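(* Fix a normalized reduced root system $R$ in $\mathbb R^N$ and a multiplicity function $k\ge 0$. Let $s>\mathbf N$ be a positive integer and $\varepsilon>0$. There is a constant $C_{s,\varepsilon}>0$ such that, for every function $F\in C^{2s}(\mathbb R^N)\cap L^1(dw)$ satisfying $$B_1=\big\|(I-\Delta)^sF(\mathbf x)\,(1+\|\mathbf x\|)^{\mathbf N/2+\varepsilon}\big\|_{L^1(dw(\mathbf x))}<\infty,$$ one has $$\sup_{\mathbf y\in\mathbb R^N}\|\tau_{\mathbf y}F\|_{L^1(dw)}\le C_{s,\varepsilon}B_1.$$ In particular, for every $1\le p<\infty$ and every $g\in L^p(dw)$, $\|g*F\|_{L^p(dw)}\le C_{s,\varepsilon}B_1\|g\|_{L^p(dw)}$.
   Context: Root system and measure. $R\subset\mathbb R^N\setminus\{0\}$ is a finite set with $\sigma_\alpha(R)=R$ for all $\alpha\in R$, where $\sigma_\alpha\mathbf x=\mathbf x-2\frac{\langle\mathbf x,\alpha\rangle}{\|\alpha\|^2}\alpha$; it is reduced ($R\cap\mathbb R\alpha=\{\pm\alpha\}$) and normalized ($\|\alpha\|^2=2$ for all $\alpha\in R$). $G$ is the finite group generated by the $\sigma_\alpha$, and $k:R\to[0,\infty)$ is $G$-invariant. $\mathbf N=N+\sum_{\alpha\in R}k(\alpha)$, $dw(\mathbf x)=\prod_{\alpha\in R}|\langle\mathbf x,\alpha\rangle|^{k(\alpha)}d\mathbf x$. Dunkl operators, Laplacian, kernel, transform. $T_\xi f(\mathbf x)=\partial_\xi f(\mathbf x)+\sum_{\alpha\in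 R}\frac{k(\alpha)}2\langle\alpha,\xi\rangle\frac{f(\mathbf x)-f(\sigma_\alpha\mathbf x)}{\langle\alpha,\mathbf x\rangle}$, $T_j=T_{e_j}$ for the canonical basis $e_1,\dots,e_N$, and $\Delta=\sum_{j=1}^NT_j^2$ (acting on $C^2$ functions) is the Dunkl Laplacian. For fixed $\mathbf y\in\mathbb R^N$, $E(\cdot,\mathbf y)$ is the unique solution of $T_\xi f=\langle\xi,\mathbf y\rangle f$ (all $\xi\in\mathbb R^N$), $f(0)=1$; $E$ extends uniquely to a holomorphic function on $\mathbb C^N\times\mathbb C^N$. With $c_k=\int_{\mathbb R^N}e^{-\|\mathbf x\|^2/2}dw(\mathbf x)$, $\mathcal Ff(\xi)=c_k^{-1}\int E(-i\xi,\mathbf x)f(\mathbf x)\,dw(\mathbf x)$. Translation and convolution. For $f$ in the Schwartz class $\mathcal S(\mathbb R^N)$ (or more generally whenever the integral converges absolutely), $\tau_{\mathbf x}f(\mathbf y)=c_k^{-1}\int E(i\xi,\mathbf x)E(i\xi,\mathbf y)\mathcal Ff(\xi)\,dw(\xi)$. For $f\in L^p(dw)$, $1\le p\le\infty$, $\tau_{\mathbf x}f$ is defined as a distribution by $\int\tau_{\mathbf x}f\,g\,dw=\int f\,\tau_{-\mathbf x}g\,dw$, $g\in\mathcal S(\mathbb R^N)$. The Dunkl convolution is $(g*F)(\mathbf x)=\int g(\mathbf y)F(\mathbf x,\mathbf y)\,dw(\mathbf y)$ with $F(\mathbf x,\mathbf y)=\tau_{\mathbf x}F(-\mathbf y)=\tau_{-\mathbf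 y}F(\mathbf x)$. *)

theory Defs
  imports "HOL-Analysis.Analysis"
begin

section \<open>Root systems and the associated measure\<close>

definition root_reflection :: "real^'n \<Rightarrow> real^'n \<Rightarrow> real^'n" where
  "root_reflection \<alpha> x = x - (2 * (x \<bullet> \<alpha>) / (norm \<alpha>)\<^sup>2) *\<^sub>R \<alpha>"

text \<open>The root system is neither required to span nor to be nonempty.\<close>

definition normalized_reduced_root_system :: "(real^'n) set \<Rightarrow> bool" where
  "normalized_reduced_root_system R \<longleftrightarrow>
     finite R \<and> 0 \<notin> R \<and>
     (\<forall>\<alpha>\<in>R. root_reflection \<alpha> ` R = R) \<and>
     (\<forall>\<alpha>\<in>R. R \<inter> span {\<alpha>} = {\<alpha>, - \<alpha>}) \<and>
     (\<forall>\<alpha>\<in>R. (norm \<alpha>)\<^sup>2 = 2)"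

inductive_set reflection_group :: "(real^'n) set \<Rightarrow> (real^'n \<Rightarrow> real^'n) set"
  for R :: "(real^'n) set" where
  "id \<in> reflection_group R"
| "\<alpha> \<in> R \<Longrightarrow> root_reflection \<alpha> \<in> reflection_group R"
| "g \<in> reflection_group R \<Longrightarrow> h \<in> reflection_group R \<Longrightarrow> g \<circ> h \<in> reflection_group R"
| "g \<in> reflection_group R \<Longrightarrow> inv g \<in> reflection_group R"

text \<open>Only the values of a multiplicity function on \<open>R\<close> are constrained and used.\<close>

definition multiplicity_function :: "(real^'n) set \<Rightarrow> (real^'n \<Rightarrow> real) \<Rightarrow> bool" where
  "multiplicity_function R k \<longleftrightarrow>
     (\<forall>\<alpha>\<in>R. 0 \<le> k \<alpha>) \<and> (\<forall>g\<in>reflection_group R. \<forall>\<alpha>\<in>R. k (g \<alpha>) = k \<alpha>)"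

definition homogeneous_dim :: "(real^'n) set \<Rightarrow> (real^'n \<Rightarrow> real) \<Rightarrow> real" where
  "homogeneous_dim R k = real CARD('n) + (\<Sum>\<alpha>\<in>R. k \<alpha>)"

text \<open>The convention \<open>0 powr 0 = 0\<close> affects the density only on the null set of points lying on
  some hyperplane orthogonal to a root, hence not the measure.\<close>

definition dunkl_measure :: "(real^'n) set \<Rightarrow> (real^'n \<Rightarrow> real) \<Rightarrow> (real^'n) measure" where
  "dunkl_measure R k = density lborel (\<lambda>x. ennreal (\<Prod>\<alpha>\<in>R. \<bar>x \<bullet> \<alpha>\<bar> powr k \<alpha>))"

section \<open>Function spaces\<close>

text \<open>Used for finite exponents \<open>p \<ge> 1\<close> only.\<close>

definition in_Lp :: "'a measure \<Rightarrow> real \<Rightarrow> ('a \<Rightarrow> complex) \<Rightarrow> bool" where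
  "in_Lp M p f \<longleftrightarrow> f \<in> borel_measurable M \<and> integrable M (\<lambda>x. norm (f x) powr p)"

definition Lp_norm :: "'a measure \<Rightarrow> real \<Rightarrow> ('a \<Rightarrow> complex) \<Rightarrow> real" where
  "Lp_norm M p f = (LINT x|M. norm (f x) powr p) powr (1 / p)"

definition partial_deriv :: "'n \<Rightarrow> (real^'n \<Rightarrow> complex) \<Rightarrow> real^'n \<Rightarrow> complex" where
  "partial_deriv i f x = frechet_derivative f (at x) (axis i 1)"

primrec C_class :: "nat \<Rightarrow> (real^'n \<Rightarrow> complex) \<Rightarrow> bool" where
  "C_class 0 f \<longleftrightarrow> continuous_on UNIV f"
| "C_class (Suc m) f \<longleftrightarrow> (\<forall>x. f differentiable (at x)) \<and> (\<forall>i. C_class m (partial_deriv i f))"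

definition schwartz :: "(real^'n \<Rightarrow> complex) \<Rightarrow> bool" where
  "schwartz f \<longleftrightarrow>
     (\<forall>m. C_class m f) \<and>
     (\<forall>is n. bounded (range (\<lambda>x. (1 + norm x) ^ n *\<^sub>R foldr partial_deriv is f x)))"

section \<open>Dunkl operators and the Dunkl Laplacian\<close>

text \<open>The quotient \<open>(f x - f (\<sigma>\<^sub>\<alpha> x)) / \<langle>\<alpha>, x\<rangle>\<close> of a \<open>C\<^sup>1\<close> function extends continuously to the
  hyperplane \<open>\<langle>\<alpha>, x\<rangle> = 0\<close>, where its value is \<open>2 / \<parallel>\<alpha>\<parallel>\<^sup>2\<close> times the derivative in direction
  \<open>\<alpha>\<close>. This extension is part of the definition of the operators; the value \<open>0\<close> coming from
  division by zero would be wrong.\<close>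

definition reflection_quotient :: "real^'n \<Rightarrow> (real^'n \<Rightarrow> complex) \<Rightarrow> real^'n \<Rightarrow> complex" where
  "reflection_quotient \<alpha> f x =
     (if \<alpha> \<bullet> x = 0 then (2 / (norm \<alpha>)\<^sup>2) *\<^sub>R frechet_derivative f (at x) \<alpha>
      else (f x - f (root_reflection \<alpha> x)) / complex_of_real (\<alpha> \<bullet> x))"

definition dunkl_op ::
    "(real^'n) set \<Rightarrow> (real^'n \<Rightarrow> real) \<Rightarrow> real^'n \<Rightarrow> (real^'n \<Rightarrow> complex) \<Rightarrow> real^'n \<Rightarrow> complex" where
  "dunkl_op R k \<xi> f x =
     frechet_derivative f (at x) \<xi> +
     (\<Sum>\<alpha>\<in>R. complex_of_real (k \<alpha> / 2 * (\<alpha> \<bullet> \<xi>)) * reflection_quotient \<alpha> f x)"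

definition dunkl_laplacian ::
    "(real^'n) set \<Rightarrow> (real^'n \<Rightarrow> real) \<Rightarrow> (real^'n \<Rightarrow> complex) \<Rightarrow> real^'n \<Rightarrow> complex" where
  "dunkl_laplacian R k f x =
     (\<Sum>j\<in>UNIV. dunkl_op R k (axis j 1) (dunkl_op R k (axis j 1) f) x)"

definition id_minus_laplacian_pow ::
    "(real^'n) set \<Rightarrow> (real^'n \<Rightarrow> real) \<Rightarrow> nat \<Rightarrow> (real^'n \<Rightarrow> complex) \<Rightarrow> real^'n \<Rightarrow> complex" where
  "id_minus_laplacian_pow R k s = (\<lambda>f x. f x - dunkl_laplacian R k f x) ^^ s"

section \<open>The Dunkl kernel and the Dunkl transform\<close>

text \<open>\<open>dunkl_kernel_real R k x y\<close> is \<open>E(x, y)\<close> for real arguments, as a function of the first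
  argument the solution of the joint eigenvalue problem with spectral parameter \<open>y\<close>.\<close>

definition dunkl_kernel_real ::
    "(real^'n) set \<Rightarrow> (real^'n \<Rightarrow> real) \<Rightarrow> real^'n \<Rightarrow> real^'n \<Rightarrow> complex" where
  "dunkl_kernel_real R k x y =
     (THE f. C_class 1 f \<and>
             (\<forall>\<xi> z. dunkl_op R k \<xi> f z = complex_of_real (\<xi> \<bullet> y) * f z) \<and> f 0 = 1) x"

definition cvec :: "real^'n \<Rightarrow> complex^'n" where
  "cvec x = (\<chi> j. complex_of_real (x $ j))"

text \<open>Holomorphy in several variables: real Frechet differentiability with complex-linear
  derivative at every point.\<close>

definition jointly_entire :: "(complex^'n \<Rightarrow> complex^'n \<Rightarrow> complex) \<Rightarrow> bool" where
  "jointly_entire E \<longleftrightarrow>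
     (\<forall>p. \<exists>D. ((\<lambda>(z, w). E z w) has_derivative D) (at p) \<and>
              (\<forall>c u v. D (c *s u, c *s v) = c * D (u, v)))"

definition dunkl_kernel ::
    "(real^'n) set \<Rightarrow> (real^'n \<Rightarrow> real) \<Rightarrow> complex^'n \<Rightarrow> complex^'n \<Rightarrow> complex" where
  "dunkl_kernel R k =
     (THE E. jointly_entire E \<and> (\<forall>x y. E (cvec x) (cvec y) = dunkl_kernel_real R k x y))"

definition dunkl_const :: "(real^'n) set \<Rightarrow> (real^'n \<Rightarrow> real) \<Rightarrow> real" where
  "dunkl_const R k = (LINT x|dunkl_measure R k. exp (- (norm x)\<^sup>2 / 2))"

definition dunkl_transform ::
    "(real^'n) set \<Rightarrow> (real^'n \<Rightarrow> real) \<Rightarrow> (real^'n \<Rightarrow> complex) \<Rightarrow> real^'n \<Rightarrow> complex" where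
  "dunkl_transform R k f \<xi> =
     inverse (complex_of_real (dunkl_const R k)) *
     (LINT x|dunkl_measure R k. dunkl_kernel R k ((- \<i>) *s cvec \<xi>) (cvec x) * f x)"

section \<open>Dunkl translation and convolution\<close>

definition translation_integrand ::
    "(real^'n) set \<Rightarrow> (real^'n \<Rightarrow> real) \<Rightarrow> real^'n \<Rightarrow> (real^'n \<Rightarrow> complex) \<Rightarrow> real^'n \<Rightarrow> real^'n \<Rightarrow> complex" where
  "translation_integrand R k x f y \<xi> =
     dunkl_kernel R k (\<i> *s cvec \<xi>) (cvec x) * dunkl_kernel R k (\<i> *s cvec \<xi>) (cvec y) *
     dunkl_transform R k f \<xi>"

text \<open>The pointwise translation \<open>\<tau>\<^sub>x f (y)\<close>, meaningful when the integral converges absolutely.\<close>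

definition dunkl_translation ::
    "(real^'n) set \<Rightarrow> (real^'n \<Rightarrow> real) \<Rightarrow> real^'n \<Rightarrow> (real^'n \<Rightarrow> complex) \<Rightarrow> real^'n \<Rightarrow> complex" where
  "dunkl_translation R k x f y =
     inverse (complex_of_real (dunkl_const R k)) *
     (LINT \<xi>|dunkl_measure R k. translation_integrand R k x f y \<xi>)"

text \<open>The distributional translation \<open>\<tau>\<^sub>x f\<close> of \<open>f \<in> L\<^sup>p(dw)\<close> is the function \<open>h\<close>. The pairing is
  bilinear, without complex conjugation.\<close>

definition represents_translation ::
    "(real^'n) set \<Rightarrow> (real^'n \<Rightarrow> real) \<Rightarrow> real^'n \<Rightarrow> (real^'n \<Rightarrow> complex) \<Rightarrow> (real^'n \<Rightarrow> complex) \<Rightarrow> bool" where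
  "represents_translation R k x f h \<longleftrightarrow>
     (\<forall>g. schwartz g \<longrightarrow>
        (LINT y|dunkl_measure R k. h y * g y) =
        (LINT y|dunkl_measure R k. f y * dunkl_translation R k (- x) g y))"

text \<open>The kernel \<open>F(x, y) = \<tau>\<^sub>x F (- y)\<close>.\<close>

definition translation_kernel ::
    "(real^'n) set \<Rightarrow> (real^'n \<Rightarrow> real) \<Rightarrow> (real^'n \<Rightarrow> complex) \<Rightarrow> real^'n \<Rightarrow> real^'n \<Rightarrow> complex" where
  "translation_kernel R k F x y = dunkl_translation R k x F (- y)"

definition dunkl_convolution ::
    "(real^'n) set \<Rightarrow> (real^'n \<Rightarrow> real) \<Rightarrow> (real^'n \<Rightarrow> complex) \<Rightarrow> (real^'n \<Rightarrow> complex) \<Rightarrow> real^'n \<Rightarrow> complex" where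
  "dunkl_convolution R k g F x =
     (LINT y|dunkl_measure R k. g y * translation_kernel R k F x y)"

section \<open>The weighted norm\<close>

definition weighted_smoothness ::
    "(real^'n) set \<Rightarrow> (real^'n \<Rightarrow> real) \<Rightarrow> nat \<Rightarrow> real \<Rightarrow> (real^'n \<Rightarrow> complex) \<Rightarrow> real^'n \<Rightarrow> complex" where
  "weighted_smoothness R k s \<epsilon> F x =
     id_minus_laplacian_pow R k s F x *
     complex_of_real ((1 + norm x) powr (homogeneous_dim R k / 2 + \<epsilon>))"

end

theory Submission
 imports Defs "HOL-Complex_Analysis.Complex_Analysis"
begin

text \<open>The Dunkl transform maps \<open>(I - \<Delta>)\<^sup>s F\<close> to \<open>(1 + \<bar>\<xi>\<bar>\<^sup>2)\<^sup>s\<close> times the transform of \<open>F\<close>, so the translation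
 of \<open>F\<close> is the integral of \<open>(I - \<Delta>)\<^sup>s F\<close> against translates of the Bessel kernel of order \<open>2 s\<close>. The theorem
 thus follows from a bound \<open>C (1 + \<bar>z\<bar>)\<^sup>N\<^sup>/\<^sup>2\<close> for the \<open>L\<^sup>1\<close> norm of these translates, and from Schur's test.
 By subordination, the bound reduces to the heat kernel, and by scaling to unit time. There the kernel
 \<open>h(x, y)\<close> is nonnegative by the maximum principle. A Harnack argument along a path into the chamber of \<open>y\<close>
 bounds \<open>h(y, y)\<close> by the inverse volume of the unit ball at \<open>y\<close>, which with the Cauchy--Schwarz inequality and a Gaussian
 moment controls \<open>h(\<cdot>, y)\<close> in \<open>L\<^sup>2\<close> with polynomial weights. An energy estimate in the translation parameter \<open>z\<close>,
 for invariant weights that vary on the scale \<open>1 + \<bar>z\<bar>\<close>, moves this to the translates \<open>\<tau>\<^sub>z h(\<cdot>, y)\<close> at the cost of a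
 constant, and Cauchy--Schwarz on the orbit of the ball of that radius gives the power \<open>N/2\<close>.\<close>

text \<open>Dunkl translations need not preserve positivity, and no bound for them on
  \<open>L^1\<close> is at hand, so everything is drawn from the eigenvalue equation of the kernel
  and from Fourier integrals. The recurring device is that along a ray the operator
  \<open>T x\<close> at \<open>x\<close> has no denominators. At a point that dominates its
  reflections the reflection terms then have a sign, and a single comparison principle yields
  uniqueness and positivity of the kernel, modulus at most 1 at imaginary arguments, and the energy
  estimate. The energy estimate works because the Fourier form treats the translation parameter
  \<open>z\<close> and the variable \<open>x\<close> alike: a derivative in \<open>z\<close> becomes
  one in \<open>x\<close>, which is integrated by parts. Its loss is
  \<open>exp (N * l * norm z)\<close> for a weight varying on the scale \<open>1 / l\<close>, which
  dictates \<open>l = 1 / (1 + norm z)\<close>. Two further obstacles shape the text. The kernel is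
  given by definite descriptions, so its existence is proved by constructing its homogeneous
  components. And only \<open>F\<close> and \<open>(I - \<Delta>)^s F\<close> are integrable, not
  the derivatives in between, so the transform of \<open>(I - \<Delta>)^s F\<close> is computed with
  oscillating test functions that receive all the derivatives.\<close>

abbreviation "nnint M f \<equiv> \<integral>\<^sup>+x. ennreal (f x) \<partial>M"
abbreviation "cor \<equiv> complex_of_real"
abbreviation "cts \<equiv> continuous_on UNIV"
abbreviation "borelm \<equiv> borel_measurable borel"
abbreviation "rquot \<equiv> reflection_quotient"
abbreviation "fderiv f x \<equiv> frechet_derivative f (at x)"

lemma fderiv_eq:
 "(f has_derivative f') (at x) ==> fderiv f x = f'"
 using frechet_derivative_at by metis

section \<open>The root system, its finite reflection group and sums over both\<close>

locale dunkl =
 fixes R :: "(real^'n) set" and k :: "real^'n => real"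
 assumes root_system: "normalized_reduced_root_system R"
  and multiplicity: "multiplicity_function R k"
begin

abbreviation G where "G \<equiv> reflection_group R"
abbreviation \<sigma> where "\<sigma> \<equiv> root_reflection"
abbreviation N where "N \<equiv> homogeneous_dim R k"
abbreviation W where "W \<equiv> dunkl_measure R k"
abbreviation T where "T \<equiv> dunkl_op R k"

text \<open>\<open>R\<close> contains both signs of each root, so this is the sum of
  \<open>k\<close> over a set of positive roots; the homogeneous dimension is
  \<open>CARD('n) + 2 * \<gamma>\<close>.\<close>

definition \<gamma> :: real where "\<gamma> = (\<Sum>a\<in>R. k a / 2)"

lemma finite_R [simp, intro]: "finite R"
 and zero_notin_R: "0 \<notin> R"
 and norm_root: "a \<in> R ==> (norm a)\<^sup>2 = 2"
 and reflection_R: "a \<in> R ==> \<sigma> a ` R = R"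
 using root_system unfolding normalized_reduced_root_system_def by auto

lemma root_nonzero: "a \<in> R ==> a \<noteq> 0"
 using zero_notin_R by auto

lemma root_inner: "a \<in> R ==> a \<bullet> a = 2"
 using norm_root by (simp add: power2_norm_eq_inner)

lemma k_nonneg: "a \<in> R ==> 0 <= k a"
 and k_invariant: "g \<in> G ==> a \<in> R ==> k (g a) = k a"
 using multiplicity unfolding multiplicity_function_def by auto

lemma \<gamma>_nonneg: "0 <= \<gamma>"
 unfolding \<gamma>_def by (intro sum_nonneg) (auto simp: k_nonneg)

lemma reflection_root: "a \<in> R ==> \<sigma> a x = x - (x \<bullet> a) *\<^sub>R a"
 by (simp add: root_reflection_def norm_root)

lemma reflection_linear [simp]: "linear (\<sigma> a)"
 unfolding root_reflection_def
 by (intro linearI) (auto simp: inner_add_left algebra_simps add_divide_distrib)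

lemma reflection_reflection: "a \<in> R ==> \<sigma> a (\<sigma> a x) = x"
 by (simp add: reflection_root inner_diff_left root_inner algebra_simps)

lemma reflection_inner: "a \<in> R ==> \<sigma> a x \<bullet> \<sigma> a y = x \<bullet> y"
 by (simp add: reflection_root inner_diff_left inner_diff_right root_inner algebra_simps inner_commute)

lemma reflection_swap: "a \<in> R ==> \<sigma> a x \<bullet> y = x \<bullet> \<sigma> a y"
 by (metis reflection_inner reflection_reflection)

lemma reflection_inner_root: "a \<in> R ==> a \<bullet> \<sigma> a x = - (a \<bullet> x)"
 by (simp add: reflection_root inner_diff_right root_inner inner_commute)

lemma reflection_orthogonal: "a \<in> R ==> orthogonal_transformation (\<sigma> a)"
 unfolding orthogonal_transformation_def by (simp add: reflection_inner)

lemma reflection_norm [simp]: "a \<in> R ==> norm (\<sigma> a x) = norm x"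
 using reflection_inner by (simp add: norm_eq_sqrt_inner)

lemma group_reflection: "a \<in> R ==> \<sigma> a \<in> G"
 by (rule reflection_group.intros)

lemma k_reflection: "a \<in> R ==> b \<in> R ==> k (\<sigma> a b) = k b"
 using k_invariant group_reflection by blast

text \<open>Subgroups generated by some of the roots are needed for the Harnack argument, which uses
  only the reflections in walls close to a given point.\<close>

lemma subgroup_orthogonal: "g \<in> reflection_group S ==> S \<subseteq> R ==> orthogonal_transformation g"
proof (induction rule: reflection_group.induct)
 case 1 show ?case by (simp add: id_def)
next
 case (2 a) then show ?case using reflection_orthogonal by blast
next
 case (3 g h) then show ?case using orthogonal_transformation_compose by blast
next
 case (4 g) then show ?case by (simp add: orthogonal_transformation_inv)
qed

lemma subgroup_mono: "g \<in> reflection_group S ==> S \<subseteq> S' ==> g \<in> reflection_group S'"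
 by (induction rule: reflection_group.induct) (auto intro: reflection_group.intros)

lemma group_orthogonal: "g \<in> G ==> orthogonal_transformation g"
 using subgroup_orthogonal by blast

lemma group_linear: "g \<in> G ==> linear g"
 using group_orthogonal orthogonal_transformation_linear by blast

lemma group_inner: "g \<in> G ==> g x \<bullet> g y = x \<bullet> y"
 using group_orthogonal by (simp add: orthogonal_transformation_def)

lemma group_norm [simp]: "g \<in> G ==> norm (g x) = norm x"
 using group_orthogonal orthogonal_transformation_norm by blast

lemma group_bij: "g \<in> G ==> bij g"
 using group_orthogonal orthogonal_transformation_bij by blast

lemma group_inv: "g \<in> G ==> inv g \<in> G"
 by (rule reflection_group.intros)

lemma group_comp: "g \<in> G ==> h \<in> G ==> g \<circ> h \<in> G"
 by (rule reflection_group.intros)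

lemma group_id: "id \<in> G"
 by (rule reflection_group.intros)

lemma group_inv_apply [simp]: "g \<in> G ==> g (inv g x) = x" "g \<in> G ==> inv g (g x) = x"
 using group_bij by (simp_all add: bij_is_surj bij_is_inj surj_f_inv_f)

lemma group_swap: "g \<in> G ==> g x \<bullet> y = x \<bullet> inv g y"
 by (metis group_inner group_inv_apply(1))

lemma group_image_R: "g \<in> G ==> g ` R = R"
proof (induction rule: reflection_group.induct)
 case 1 show ?case by simp
next
 case (2 a) then show ?case using reflection_R by blast
next
 case (3 g h) then show ?case by (metis image_comp)
next
 case (4 g)
 then show ?case by (metis bij_is_inj group_bij image_inv_f_f)
qed

lemma group_in_R: "g \<in> G ==> a \<in> R ==> g a \<in> R"
 using group_image_R by blast

lemma group_reflection_conj: "g \<in> G ==> \<sigma> (g a) (g x) = g (\<sigma> a x)"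
 using group_linear[of g]
 by (simp add: root_reflection_def group_inner linear_diff linear_scale)

lemma group_fixes_complement:
 assumes "g \<in> G" "!!a. a \<in> R ==> x \<bullet> a = 0" shows "g x = x"
 using assms(1)
proof (induction rule: reflection_group.induct)
 case (4 g) then show ?case by (metis group_inv_apply(2))
qed (use assms(2) in \<open>auto simp: root_reflection_def\<close>)

text \<open>An element is determined by how it permutes \<open>R\<close>: linearity fixes it on the
  span of \<open>R\<close>, and on the orthogonal complement, which may be nontrivial, it is the
  identity.\<close>

lemma finite_group [simp, intro]: "finite G"
proof (rule inj_on_finite)
 show "inj_on (\<lambda>g. restrict g R) G"
 proof (rule inj_onI, rule ext)
  fix g h x assume g: "g \<in> G" and h: "h \<in> G" and eq: "restrict g R = restrict h R"
  have R: "g a = h a" if "a \<in> R" for a using eq that by (metis restrict_apply')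
  obtain u v where u: "u \<in> span R" and v: "!!w. w \<in> span R ==> orthogonal v w" and x: "x = u + v"
   using orthogonal_subspace_decomp_exists[of R x] by metis
  have "g u = h u"
   using linear_eq_on_span[OF group_linear[OF g] group_linear[OF h] R u] by blast
  moreover have "v \<bullet> a = 0" if "a \<in> R" for a
   using v[of a] that by (auto simp: orthogonal_def span_base)
  hence "g v = v" "h v = v" using group_fixes_complement g h by blast+
  ultimately show "g x = h x"
   using group_linear[OF g] group_linear[OF h] by (simp add: x linear_add)
 qed
 show "(\<lambda>g. restrict g R) ` G \<subseteq> R \<rightarrow>\<^sub>E R"
  using group_in_R by auto
 show "finite (R \<rightarrow>\<^sub>E R)" by (intro finite_PiE) auto
qed

lemma sum_R_reflection:
 fixes f :: "real^'n => 'b::comm_monoid_add"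
 assumes "g \<in> G" shows "(\<Sum>a\<in>R. f (g a)) = (\<Sum>a\<in>R. f a)"
proof -
 have "inj_on g R" using group_bij[OF assms] by (meson bij_is_inj inj_on_subset subset_UNIV)
 thus ?thesis using sum.reindex[of g R f] group_image_R[OF assms] by simp
qed

lemma sum_group_left:
 fixes f :: "(real^'n => real^'n) => 'b::comm_monoid_add"
 assumes S: "S \<subseteq> R" and h: "h \<in> reflection_group S"
 shows "(\<Sum>g\<in>reflection_group S. f (h \<circ> g)) = (\<Sum>g\<in>reflection_group S. f g)"
proof (rule sum.reindex_bij_witness[where i="\<lambda>g. inv h \<circ> g" and j="\<lambda>g. h \<circ> g"])
 have b: "bij h" using subgroup_orthogonal[OF h S] orthogonal_transformation_bij by blast
 show "inv h \<circ> (h \<circ> a) = a" for a :: "real^'n => real^'n"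
  using b by (auto simp: fun_eq_iff bij_is_inj)
 show "h \<circ> (inv h \<circ> a) = a" for a :: "real^'n => real^'n"
  using b by (auto simp: fun_eq_iff bij_is_surj surj_f_inv_f)
qed (use h in \<open>auto intro: reflection_group.intros\<close>)

lemma sum_group_right:
 fixes f :: "(real^'n => real^'n) => 'b::comm_monoid_add"
 assumes h: "h \<in> G"
 shows "(\<Sum>g\<in>G. f (g \<circ> h)) = (\<Sum>g\<in>G. f g)"
proof (rule sum.reindex_bij_witness[where i="\<lambda>g. g \<circ> inv h" and j="\<lambda>g. g \<circ> h"])
 have b: "bij h" using group_bij[OF h] .
 show "a \<circ> h \<circ> inv h = a" for a :: "real^'n => real^'n" using b by (auto simp: fun_eq_iff h)
 show "a \<circ> inv h \<circ> h = a" for a :: "real^'n => real^'n" using b by (auto simp: fun_eq_iff h)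
qed (use h in \<open>auto intro: reflection_group.intros\<close>)

section \<open>Dunkl operators and the maximum principle\<close>

lemma reflection_quotient_root:
 "a \<in> R ==> rquot a f x = (if a \<bullet> x = 0 then fderiv f x a
  else (f x - f (\<sigma> a x)) / cor (a \<bullet> x))"
 by (simp add: reflection_quotient_def norm_root)

lemma reflection_wall: "a \<in> R ==> a \<bullet> x = 0 ==> \<sigma> a x = x"
 by (simp add: reflection_root inner_commute)

text \<open>The identity includes the wall, where both sides vanish; it removes the case distinction
  from later arguments.\<close>

lemma inner_reflection_quotient:
 assumes "a \<in> R"
 shows "cor (a \<bullet> x) * rquot a f x = f x - f (\<sigma> a x)"
 using assms by (simp add: reflection_quotient_root reflection_wall)

lemma reflection_quotient_add:
 assumes "a \<in> R" "f differentiable (at x)" "g differentiable (at x)"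
 shows "rquot a (\<lambda>x. f x + g x) x = rquot a f x + rquot a g x"
proof -
 have "fderiv (\<lambda>x. f x + g x) x = (\<lambda>v. fderiv f x v + fderiv g x v)"
  using assms(2,3) by (intro fderiv_eq has_derivative_add) (auto simp: frechet_derivative_works)
 thus ?thesis using assms(1) by (simp add: reflection_quotient_root add_divide_distrib[symmetric] algebra_simps)
qed

lemma reflection_quotient_mult:
 assumes "a \<in> R" "f differentiable (at x)" "g differentiable (at x)"
 shows "rquot a (\<lambda>x. f x * g x) x =
  f x * rquot a g x + rquot a f x * g (\<sigma> a x)"
proof -
 have "fderiv (\<lambda>x. f x * g x) x = (\<lambda>v. f x * fderiv g x v + fderiv f x v * g x)"
  using assms(2,3) by (intro fderiv_eq has_derivative_mult) (auto simp: frechet_derivative_works)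
 thus ?thesis using assms(1) by (simp add: reflection_quotient_root reflection_wall field_simps)
qed

lemma dunkl_op_add:
 assumes "f differentiable (at x)" "g differentiable (at x)"
 shows "T q (\<lambda>x. f x + g x) x = T q f x + T q g x"
proof -
 have "fderiv (\<lambda>x. f x + g x) x = (\<lambda>v. fderiv f x v + fderiv g x v)"
  using assms by (intro fderiv_eq has_derivative_add) (auto simp: frechet_derivative_works)
 thus ?thesis using assms
  by (simp add: dunkl_op_def reflection_quotient_add sum.distrib add_divide_distrib algebra_simps)
qed

lemma dunkl_op_mult:
 assumes "f differentiable (at x)" "g differentiable (at x)"
 shows "T q (\<lambda>x. f x * g x) x = f x * T q g x + fderiv f x q * g x +
  (\<Sum>a\<in>R. cor (k a / 2 * (a \<bullet> q)) * rquot a f x * g (\<sigma> a x))"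
proof -
 have "fderiv (\<lambda>x. f x * g x) x = (\<lambda>v. f x * fderiv g x v + fderiv f x v * g x)"
  using assms by (intro fderiv_eq has_derivative_mult) (auto simp: frechet_derivative_works)
 thus ?thesis using assms
  by (simp add: dunkl_op_def reflection_quotient_mult sum.distrib sum_distrib_left algebra_simps)
qed

lemma reflection_quotient_const [simp]: "rquot a (\<lambda>x. c) x = 0"
 by (simp add: reflection_quotient_def frechet_derivative_const)

lemma dunkl_op_const [simp]: "T q (\<lambda>x. c) x = 0"
 by (simp add: dunkl_op_def frechet_derivative_const)

lemma dunkl_op_cmult:
 assumes "f differentiable (at x)"
 shows "T q (\<lambda>x. c * f x) x = c * T q f x"
 using dunkl_op_mult[of "\<lambda>_. c" x f q] assms by simp

lemma dunkl_op_sum: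
 assumes "finite I" "!!i. i \<in> I ==> f i differentiable (at x)"
 shows "T q (\<lambda>x. \<Sum>i\<in>I. f i x) x = (\<Sum>i\<in>I. T q (f i) x)"
 using assms by (induction rule: finite_induct) (simp_all add: dunkl_op_add differentiable_sum)

lemma dunkl_op_diff:
 assumes "f differentiable (at x)" "g differentiable (at x)"
 shows "T q (\<lambda>x. f x - g x) x = T q f x - T q g x"
 using dunkl_op_add[of f x "\<lambda>x. (-1) * g x" q] assms dunkl_op_cmult[of g x q "-1"] by simp

text \<open>A group element carries direction, point and roots along together; invariance of
  \<open>k\<close> allows the sum over \<open>R\<close> to be re-indexed.\<close>

lemma dunkl_op_reflect:
 assumes f: "!!x. f differentiable (at x)" and g: "g \<in> G"
 shows "T q (\<lambda>x. f (g x)) x = T (g q) f (g x)"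
proof -
 let ?A = "\<lambda>x. f (g x)"
 have "fderiv ?A x = (\<lambda>v. fderiv f (g x) (g v))"
 proof (rule fderiv_eq)
  show "(?A has_derivative (\<lambda>v. fderiv f (g x) (g v))) (at x)"
   by (rule has_derivative_compose[OF linear_imp_has_derivative[OF group_linear[OF g]]])
    (use f in \<open>simp add: frechet_derivative_works\<close>)
 qed
 moreover have "(\<Sum>a\<in>R. cor (k a / 2 * (a \<bullet> q)) * rquot a ?A x) =
  (\<Sum>a\<in>R. cor (k (g a) / 2 * (g a \<bullet> g q)) * rquot (g a) f (g x))"
  using calculation g by (intro sum.cong refl)
   (auto simp: k_invariant group_inner reflection_quotient_def group_reflection_conj)
 moreover note sum_R_reflection[OF g, where f="\<lambda>a. cor (k a / 2 * (a \<bullet> g q)) * rquot a f (g x)"]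
 ultimately show ?thesis unfolding dunkl_op_def by simp
qed

text \<open>With direction \<open>x\<close> at the point \<open>x\<close> the coefficient of each
  quotient is its own denominator, so no singular term remains. Every use of
  \<open>max_principle\<close> starts from this.\<close>

lemma dunkl_op_ray:
 "T x f x = fderiv f x x + (\<Sum>a\<in>R. cor (k a / 2) * (f x - f (\<sigma> a x)))"
 unfolding dunkl_op_def
 by (simp add: inner_reflection_quotient[symmetric] mult.assoc)

text \<open>Dividing by \<open>exp ((\<Lambda> + \<epsilon>) * norm z)\<close> gives a function on
  the closed ball of radius \<open>norm x\<close> whose maximum, if the bound failed, would be
  positive and away from the origin. The ball is invariant under reflections, so the hypothesis
  applies at that point and makes the radial derivative strictly negative; a point slightly nearer
  to the origin then has a larger value.\<close>

lemma max_principle: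
 fixes P :: "real^'n => real"
 assumes cont: "cts P"
  and der: "!!x. x \<noteq> 0 ==> P x > 0 ==> (!!a. a \<in> R ==> P (\<sigma> a x) <= P x) ==>
    \<exists>D. ((\<lambda>t. P (t *\<^sub>R x)) has_real_derivative D) (at 1) \<and> D <= \<Lambda> * norm x * P x"
 shows "P x <= exp (\<Lambda> * norm x) * max 0 (P 0)"
proof (rule ccontr)
 let ?A = "\<lambda>\<epsilon>. \<Lambda> + \<epsilon>"
 let ?B = "\<lambda>\<epsilon>. exp (- (?A \<epsilon>) * norm x) * P x"
 let ?C = "\<lambda>D z \<epsilon>. D - \<Lambda> * norm z * P z - \<epsilon> * norm z * P z"
 assume neg: "\<not> ?thesis"
 \<comment> \<open>The strict inequality at \<open>\<epsilon> = 0\<close> survives for some positive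
   \<open>\<epsilon>\<close>, which is what makes the radial derivative strictly negative
   below.\<close>
 have lim: "(?B \<longlongrightarrow> exp (- (\<Lambda> + 0) * norm x) * P x) (at_right 0)"
 proof -
  have "isCont ?B 0" by (intro continuous_intros)
  thus ?thesis unfolding isCont_def by (rule tendsto_mono[rotated]) (simp add: at_le)
 qed
 have "max 0 (P 0) < exp (- (\<Lambda> + 0) * norm x) * P x"
 proof -
  have "exp (- \<Lambda> * norm x) * (exp (\<Lambda> * norm x) * max 0 (P 0)) < exp (- \<Lambda> * norm x) * P x"
   using neg by (intro mult_strict_left_mono) auto
  thus ?thesis by (simp add: mult.assoc[symmetric] exp_add[symmetric])
 qed
 hence "eventually (\<lambda>\<epsilon>. max 0 (P 0) < exp (- (?A \<epsilon>) * norm x) * P x) (at_right 0)"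
  using order_tendstoD(1)[OF lim] by blast
 then obtain b where b: "b > 0" "!!\<epsilon>. \<epsilon> > 0 ==> \<epsilon> < b ==> max 0 (P 0) < exp (- (?A \<epsilon>) * norm x) * P x"
  unfolding eventually_at_right_field by blast
 obtain \<epsilon> where \<epsilon>: "\<epsilon> > 0" "max 0 (P 0) < exp (- (?A \<epsilon>) * norm x) * P x"
  by (rule that[of "b/2"], use b(1) in simp, use b(2)[of "b/2"] b(1) in linarith)
 define Q where "Q z = exp (- (?A \<epsilon>) * norm z) * P z" for z
 have "continuous_on (cball 0 (norm x)) Q"
  unfolding Q_def by (intro continuous_intros continuous_on_subset[OF cont]) auto
 then obtain z where z: "z \<in> cball 0 (norm x)" "!!y. y \<in> cball 0 (norm x) ==> Q y <= Q z"
  using continuous_attains_sup[of "cball 0 (norm x)" Q] by auto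
 have Qz: "Q z > max 0 (P 0)" using \<epsilon>(2) z(2)[of x] by (simp add: Q_def)
 have "z \<noteq> 0" using Qz by (auto simp: Q_def)
 moreover have Pz: "P z > 0" using Qz by (simp add: Q_def zero_less_mult_iff)
 moreover have "P (\<sigma> a z) <= P z" if "a \<in> R" for a
  using z(2)[of "\<sigma> a z"] z(1) that by (simp add: Q_def)
 ultimately obtain D where D: "((\<lambda>t. P (t *\<^sub>R z)) has_real_derivative D) (at 1)" "D <= \<Lambda> * norm z * P z"
  using der[of z] by blast
 have "((\<lambda>t. exp (- (?A \<epsilon>) * (t * norm z)) * P (t *\<^sub>R z)) has_real_derivative
   (exp (- (?A \<epsilon>) * (1 * norm z)) * (- (?A \<epsilon>) * norm z) * P (1 *\<^sub>R z) + exp (- (?A \<epsilon>) * (1 * norm z)) * D)) (at 1)"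
  by (rule derivative_eq_intros D(1) refl | simp)+
 also have "exp (- (?A \<epsilon>) * (1 * norm z)) * (- (?A \<epsilon>) * norm z) * P (1 *\<^sub>R z) + exp (- (?A \<epsilon>) * (1 * norm z)) * D
  = exp (- (?A \<epsilon>) * norm z) * (?C D z \<epsilon>)"
  by (simp add: algebra_simps)
 finally have der: "((\<lambda>t. exp (- (?A \<epsilon>) * (t * norm z)) * P (t *\<^sub>R z)) has_real_derivative
   (exp (- (?A \<epsilon>) * norm z) * (?C D z \<epsilon>))) (at 1)" .
 have neg': "exp (- (?A \<epsilon>) * norm z) * (?C D z \<epsilon>) < 0"
 proof -
  have "\<epsilon> * norm z * P z > 0" using Pz \<epsilon>(1) \<open>z \<noteq> 0\<close> by simp
  thus ?thesis using D(2) by (intro mult_pos_neg) auto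
 qed

 obtain d where d: "d > 0"
  "!!h. h > 0 ==> h < d ==> exp (- (?A \<epsilon>) * (1 * norm z)) * P (1 *\<^sub>R z) < exp (- (?A \<epsilon>) * ((1 - h) * norm z)) * P ((1 - h) *\<^sub>R z)"
  using DERIV_neg_dec_left[OF der neg'] by blast
 define h where "h = min (d/2) (1/2)"
 have h: "h > 0" "h < d" "h < 1" using d(1) by (auto simp: h_def)
 have "Q z < Q ((1 - h) *\<^sub>R z)" using d(2)[OF h(1,2)] h by (simp add: Q_def)
 moreover have "(1 - h) *\<^sub>R z \<in> cball 0 (norm x)"
  using z(1) h mult_right_mono[of "1 - h" 1 "norm z"] by simp
 ultimately show False using z(2)[of "(1 - h) *\<^sub>R z"] by linarith
qed

lemma ray_derivative:
 assumes "f differentiable (at x)"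
 shows "((\<lambda>t. f (t *\<^sub>R x)) has_vector_derivative fderiv f x x) (at 1)"
proof -
 have "((\<lambda>t. f (t *\<^sub>R x)) has_derivative (\<lambda>h. fderiv f x (h *\<^sub>R x))) (at 1)"
 proof (rule has_derivative_compose[of "\<lambda>t. t *\<^sub>R x"])
  show "((\<lambda>t. t *\<^sub>R x) has_derivative (\<lambda>h. h *\<^sub>R x)) (at 1)"
   by (intro has_derivative_scaleR_left has_derivative_ident)
 qed (use assms in \<open>simp add: frechet_derivative_works\<close>)
 thus ?thesis by (simp add: has_vector_derivative_def linear_scale[OF linear_frechet_derivative[OF assms]])
qed

text \<open>The comparison principle is applied to the squared modulus. Where it dominates its
  reflections, Cauchy--Schwarz gives each reflection term a favourable sign. Only the real part of
  \<open>c\<close> survives in the inner product with \<open>f\<close>, so imaginary eigenvalues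
  give bounded eigenfunctions.\<close>

lemma eigenfunction_bound:
 assumes f: "!!x. f differentiable (at x)"
  and eig: "!!q z. T q f z = c * cor (q \<bullet> y) * f z"
 shows "norm (f x) <= exp (\<bar>Re c\<bar> * norm y * norm x) * norm (f 0)"
proof -
 let ?A = "\<lambda>z. \<Sum>a\<in>R. cor (k a / 2) * (f z - f (\<sigma> a z))"
 let ?B = "\<lambda>z. z \<bullet> y"
 define P where "P z = (norm (f z))\<^sup>2" for z
 have cont: "cts f"
  using f by (simp add: differentiable_imp_continuous_on differentiable_on_def differentiable_at_withinI)
 have "P x <= exp ((2 * \<bar>Re c\<bar> * norm y) * norm x) * max 0 (P 0)"
 proof (rule max_principle)
  show "cts P" unfolding P_def by (intro continuous_intros cont)
  fix z assume z: "!!a. a \<in> R ==> P (\<sigma> a z) <= P z"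
  define d where "d = fderiv f z z"
  have d: "d = c * cor (?B z) * f z - (?A z)"
   using dunkl_op_ray[of z f] eig[of z z] by (simp add: d_def algebra_simps)
  have "((\<lambda>t. f (t *\<^sub>R z) \<bullet> f (t *\<^sub>R z)) has_real_derivative (f (1 *\<^sub>R z) \<bullet> d + d \<bullet> f (1 *\<^sub>R z))) (at 1)"
   using ray_derivative[OF f, of z] unfolding d_def[symmetric]
   by (auto intro!: derivative_eq_intros simp: has_real_derivative_iff_has_vector_derivative has_vector_derivative_def inner_add_left algebra_simps)
  hence 1: "((\<lambda>t. P (t *\<^sub>R z)) has_real_derivative (2 * (f z \<bullet> d))) (at 1)"
   by (simp add: P_def power2_norm_eq_inner inner_commute)
  have "f z \<bullet> (c * cor (?B z) * f z) = Re c * (?B z) * P z"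
   unfolding P_def cmod_power2 inner_complex_def by (simp add: power2_eq_square) algebra
  moreover have "f z \<bullet> (cor (k a / 2) * (f z - f (\<sigma> a z))) >= 0" if "a \<in> R" for a
  proof -
   have "f z \<bullet> f (\<sigma> a z) <= norm (f z) * norm (f (\<sigma> a z))" by (rule norm_cauchy_schwarz)
   also have "\<dots> <= norm (f z) * norm (f z)" using z[OF that] by (intro mult_left_mono) (auto simp: P_def)
   finally have "f z \<bullet> (f z - f (\<sigma> a z)) >= 0"
    by (simp add: inner_diff_right power2_norm_eq_inner[symmetric] power2_eq_square)
   moreover have "f z \<bullet> (cor (k a / 2) * (f z - f (\<sigma> a z))) = k a / 2 * (f z \<bullet> (f z - f (\<sigma> a z)))"
    by (metis inner_scaleR_right scaleR_conv_of_real)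
   ultimately show ?thesis using k_nonneg[OF that] by (metis divide_nonneg_pos mult_nonneg_nonneg zero_less_numeral)
  qed
  hence "f z \<bullet> (?A z) >= 0"
   unfolding inner_sum_right by (rule sum_nonneg)
  ultimately have "f z \<bullet> d <= Re c * (?B z) * P z" by (simp add: d inner_diff_right)
  also have "Re c * (?B z) * P z <= \<bar>Re c\<bar> * (norm z * norm y) * P z"
  proof (rule mult_right_mono)
   have "\<bar>Re c * (?B z)\<bar> <= \<bar>Re c\<bar> * (norm z * norm y)"
    unfolding abs_mult by (intro mult_left_mono Cauchy_Schwarz_ineq2) auto
   thus "Re c * (?B z) <= \<bar>Re c\<bar> * (norm z * norm y)" by linarith
  qed (simp add: P_def)
  finally show "\<exists>D. ((\<lambda>t. P (t *\<^sub>R z)) has_real_derivative D) (at 1) \<and> D <= 2 * \<bar>Re c\<bar> * norm y * norm z * P z"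
   using 1 by (intro exI[of _ "2 * (f z \<bullet> d)"]) (simp add: algebra_simps)
 qed
 also have "\<dots> = (exp (\<bar>Re c\<bar> * norm y * norm x) * norm (f 0))\<^sup>2"
  by (simp add: P_def power_mult_distrib power2_eq_square exp_add[symmetric])
 finally show ?thesis unfolding P_def by (rule power2_le_imp_le) simp
qed

lemma eigenfunction_unique:
 assumes f: "!!x. f differentiable (at x)" and g: "!!x. g differentiable (at x)"
  and "!!q z. T q f z = c * cor (q \<bullet> y) * f z"
  and "!!q z. T q g z = c * cor (q \<bullet> y) * g z"
  and "f 0 = g 0"
 shows "f = g"
proof
 fix x
 have "norm (f x - g x) <= exp (\<bar>Re c\<bar> * norm y * norm x) * norm (f 0 - g 0)"
  using assms by (intro eigenfunction_bound[where f="\<lambda>x. f x - g x"])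
   (simp_all add: dunkl_op_diff algebra_simps)
 thus "f x = g x" using assms(5) by simp
qed

text \<open>Applied to the negative real part, the comparison principle starts from a nonpositive
  value at the origin. This takes the place of an integral representation as the source of
  positivity.\<close>

lemma eigenfunction_nonneg:
 assumes f: "!!x. f differentiable (at x)"
  and eig: "!!q z. T q f z = cor (q \<bullet> y) * f z"
  and 0: "Re (f 0) >= 0"
 shows "Re (f x) >= 0"
proof -
 let ?A = "\<lambda>P z. \<Sum>a\<in>R. k a / 2 * (P z - P (\<sigma> a z))"
 define P where "P z = - Re (f z)" for z
 have cont: "cts f"
  using f by (simp add: differentiable_imp_continuous_on differentiable_on_def differentiable_at_withinI)
 have "P x <= exp (norm y * norm x) * max 0 (P 0)"
 proof (rule max_principle)
  show "cts P" unfolding P_def by (intro continuous_intros cont)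
  fix z assume z: "!!a. a \<in> R ==> P (\<sigma> a z) <= P z" "P z > 0"
  define d where "d = fderiv f z z"
  have d: "d = cor (z \<bullet> y) * f z - (\<Sum>a\<in>R. cor (k a / 2) * (f z - f (\<sigma> a z)))"
   using dunkl_op_ray[of z f] eig[of z z] by (simp add: d_def algebra_simps)
  have 1: "((\<lambda>t. P (t *\<^sub>R z)) has_real_derivative - Re d) (at 1)"
   using ray_derivative[OF f, of z] unfolding P_def d_def[symmetric]
   by (auto intro!: derivative_eq_intros simp: has_real_derivative_iff_has_vector_derivative has_vector_derivative_def algebra_simps)
  have "(?A P z) >= 0"
   using z by (intro sum_nonneg mult_nonneg_nonneg) (auto simp: k_nonneg)
  moreover have "- Re d = (z \<bullet> y) * P z - (?A P z)"
   by (simp add: d P_def sum_negf[symmetric] right_diff_distrib del: sum_negf)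
  ultimately have "- Re d <= (z \<bullet> y) * P z" by simp
  also have "\<dots> <= (norm z * norm y) * P z"
   using norm_cauchy_schwarz z(2) by (intro mult_right_mono) auto
  finally show "\<exists>D. ((\<lambda>t. P (t *\<^sub>R z)) has_real_derivative D) (at 1) \<and> D <= norm y * norm z * P z"
   using 1 by (intro exI[of _ "- Re d"]) (simp add: algebra_simps)
 qed
 thus ?thesis using 0 by (simp add: P_def)
qed

end

section \<open>The homogeneous components of the Dunkl kernel\<close>

text \<open>The complex bilinear extension of the inner product; without conjugation it is
  holomorphic in both arguments.\<close>

definition cdot :: "complex^'n => complex^'n => complex" where
 "cdot z w = (\<Sum>j\<in>UNIV. z $ j * w $ j)"

text \<open>The complex linear extension of a real linear map, so that group elements act on the
  domain of the holomorphic kernel.\<close>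

definition cact :: "(real^'n => real^'n) => complex^'n => complex^'n" where
 "cact g z = cvec (g (\<chi> j. Re (z $ j))) + \<i> *s cvec (g (\<chi> j. Im (z $ j)))"

lemma cdot_cvec: "cdot (cvec x) (cvec y) = cor (x \<bullet> y)"
 by (simp add: cdot_def cvec_def inner_vec_def)

lemma cdot_commute: "cdot z w = cdot w z"
 by (simp add: cdot_def mult.commute)

lemma cdot_add_left: "cdot (u + v) w = cdot u w + cdot v w"
 by (simp add: cdot_def ring_distribs sum.distrib)

lemma cdot_scale_left: "cdot (a *s u) w = a * cdot u w"
 by (simp add: cdot_def sum_distrib_left mult.assoc)

lemma cdot_add_right: "cdot w (u + v) = cdot w u + cdot w v"
 by (simp add: cdot_def ring_distribs sum.distrib)

lemma cdot_scale_right: "cdot w (a *s u) = a * cdot w u"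
 by (simp add: cdot_def sum_distrib_left algebra_simps)

lemma norm_cdot: "norm (cdot z w) <= norm z * norm w"
proof -
 have "norm (cdot z w) <= (\<Sum>j\<in>UNIV. \<bar>norm (z $ j)\<bar> * \<bar>norm (w $ j)\<bar>)"
  unfolding cdot_def by (rule sum_norm_le) (simp add: norm_mult)
 also have "\<dots> <= norm z * norm w"
  unfolding norm_vec_def by (rule L2_set_mult_ineq)
 finally show ?thesis .
qed

lemma cvec_add: "cvec (x + y) = cvec x + cvec y"
 and cvec_scale: "cvec (r *\<^sub>R x) = cor r *s cvec x"
 and cvec_0 [simp]: "cvec 0 = 0"
 by (simp_all add: cvec_def vec_eq_iff)

lemma norm_cvec [simp]: "norm (cvec x) = norm x"
 by (simp add: cvec_def norm_vec_def L2_set_def)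

lemma norm_vscale [simp]: "norm (a *s (z :: complex^'n)) = norm a * norm z"
 by (simp add: norm_vec_def norm_mult L2_set_right_distrib[symmetric])

lemma scaleR_vscale: "r *\<^sub>R (z :: complex^'n) = cor r *s z"
 by (simp add: vec_eq_iff complex_eq_iff)

lemma linear_cvec: "linear cvec"
 by (rule linearI) (simp_all add: cvec_add cvec_scale scaleR_vscale)

lemma re_im_decomp: "z = cvec (\<chi> j. Re (z $ j)) + \<i> *s cvec (\<chi> j. Im (z $ j))"
 by (simp add: cvec_def vec_eq_iff complex_eq)

lemma re_part [simp]: "(\<chi> j. Re ((cvec x + \<i> *s cvec y) $ j)) = x"
 and im_part [simp]: "(\<chi> j. Im ((cvec x + \<i> *s cvec y) $ j)) = y"
 by (simp_all add: cvec_def vec_eq_iff)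

lemma cact_comp: "cact (g \<circ> h) z = cact g (cact h z)"
 unfolding cact_def by (simp only: re_part im_part comp_apply)

lemma cact_id [simp]: "cact id z = z"
 using re_im_decomp[of z] by (simp add: cact_def)

lemma cact_cvec:
 assumes "linear g" shows "cact g (cvec x) = cvec (g x)"
proof -
 have "(\<chi> j. Im (cvec x $ j)) = 0" "(\<chi> j. Re (cvec x $ j)) = x"
  by (simp_all add: cvec_def vec_eq_iff)
 thus ?thesis by (simp add: cact_def linear_0[OF assms])
qed

lemma cact_add:
 assumes "linear g" shows "cact g (z + w) = cact g z + cact g w"
proof -
 have "(\<chi> j. Re ((z + w) $ j)) = (\<chi> j. Re (z $ j)) + (\<chi> j. Re (w $ j))"
   "(\<chi> j. Im ((z + w) $ j)) = (\<chi> j. Im (z $ j)) + (\<chi> j. Im (w $ j))"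
  by (simp_all add: vec_eq_iff)
 thus ?thesis by (simp add: cact_def linear_add[OF assms] cvec_add vector_add_ldistrib)
qed

lemma cact_scale:
 assumes "linear g" shows "cact g (a *s z) = a *s cact g z"
proof -
 have "(\<chi> j. Re ((a *s z) $ j)) = Re a *\<^sub>R (\<chi> j. Re (z $ j)) + (- Im a) *\<^sub>R (\<chi> j. Im (z $ j))"
   "(\<chi> j. Im ((a *s z) $ j)) = Re a *\<^sub>R (\<chi> j. Im (z $ j)) + Im a *\<^sub>R (\<chi> j. Re (z $ j))"
  by (simp_all add: vec_eq_iff)
 thus ?thesis unfolding cact_def
  by (simp only: linear_add[OF assms] linear_scale[OF assms] cvec_add cvec_scale)
   (simp add: vec_eq_iff complex_eq_iff cvec_def algebra_simps)
qed

lemma linear_cact: "linear g ==> linear (cact g)"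
 by (rule linearI) (simp_all add: cact_add cact_scale scaleR_vscale)

lemma norm_re_im: "(norm (cvec x + \<i> *s cvec y))\<^sup>2 = (norm x)\<^sup>2 + (norm y)\<^sup>2"
 by (simp add: norm_vec_def L2_set_def sum_nonneg cvec_def cmod_power2 sum.distrib)

context dunkl begin

lemma norm_cact [simp]: "g \<in> G ==> norm (cact g z) = norm z"
proof -
 assume g: "g \<in> G"
 have "(norm (cact g z))\<^sup>2 = (norm z)\<^sup>2"
  using arg_cong[OF re_im_decomp[of z], of "\<lambda>z. (norm z)\<^sup>2"] g
  unfolding norm_re_im cact_def by simp
 thus ?thesis by simp
qed

lemma cdot_cact: "g \<in> G ==> cdot (cact g z) (cact g w) = cdot z w"
proof -
 assume g: "g \<in> G"
 have *: "cdot (cvec a + \<i> *s cvec b) (cvec c + \<i> *s cvec d) = Complex (a \<bullet> c - b \<bullet> d) (a \<bullet> d + b \<bullet> c)"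
  for a b c d :: "real^'n"
  by (simp add: cdot_add_left cdot_add_right cdot_scale_left cdot_scale_right cdot_cvec complex_eq_iff)
 have "cdot z w = cdot (cvec (\<chi> j. Re (z $ j)) + \<i> *s cvec (\<chi> j. Im (z $ j)))
    (cvec (\<chi> j. Re (w $ j)) + \<i> *s cvec (\<chi> j. Im (w $ j)))"
  using re_im_decomp[of z] re_im_decomp[of w] by argo
 thus ?thesis unfolding cact_def * using g by (simp add: group_inner)
qed

text \<open>The coefficient of \<open>g\<close> in the \<open>j\<close>-th power of the group
  algebra element \<open>\<Sum>a\<in>R. (k a / 2) \<sigma> a\<close>. Working with coefficients
  reduces the Neumann series to scalar series and leaves finite sums over \<open>G\<close> with
  nonnegative weights.\<close>

primrec word_coeff :: "nat => (real^'n => real^'n) => real" where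
 "word_coeff 0 g = (if g = id then 1 else 0)"
| "word_coeff (Suc j) g = (\<Sum>a\<in>R. k a / 2 * word_coeff j (g \<circ> \<sigma> a))"

text \<open>The coefficients of \<open>(m + \<gamma> - \<Sum>\<^sub>\<alpha> k(\<alpha>)/2 \<sigma>\<^sub>\<alpha>)\<^sup>-\<^sup>1\<close> in the group algebra, from the
 Neumann series.\<close>

definition inv_coeff :: "real => (real^'n => real^'n) => real" where
 "inv_coeff m g = (\<Sum>j. word_coeff j g / (m + \<gamma>) ^ Suc j)"

lemma word_coeff_nonneg: "0 <= word_coeff j g"
 by (induction j arbitrary: g) (auto intro!: sum_nonneg mult_nonneg_nonneg simp: k_nonneg)

lemma word_coeff_sum: "(\<Sum>g\<in>G. word_coeff j g) = \<gamma> ^ j"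
proof (induction j)
 case 0 show ?case by (simp add: group_id)
next
 case (Suc j)
 have "(\<Sum>g\<in>G. word_coeff (Suc j) g) = (\<Sum>a\<in>R. k a / 2 * (\<Sum>g\<in>G. word_coeff j (g \<circ> \<sigma> a)))"
  by (simp add: sum_distrib_left) (rule sum.swap)
 also have "\<dots> = (\<Sum>a\<in>R. k a / 2 * \<gamma> ^ j)"
  by (rule sum.cong) (simp_all only: sum_group_right group_reflection Suc)
 finally show ?case by (simp add: \<gamma>_def sum_distrib_right)
qed

lemma word_coeff_le: "g \<in> G ==> word_coeff j g <= \<gamma> ^ j"
 using member_le_sum[of g G "word_coeff j"] word_coeff_nonneg by (simp add: word_coeff_sum)

lemma word_coeff_summable:
 assumes "m > 0" "g \<in> G" shows "summable (\<lambda>j. word_coeff j g / (m + \<gamma>) ^ Suc j)"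
proof (rule summable_comparison_test')
 show "summable (\<lambda>j. (1 / (m + \<gamma>)) * (\<gamma> / (m + \<gamma>)) ^ j)"
  using assms \<gamma>_nonneg by (intro summable_mult summable_geometric) auto
 show "norm (word_coeff j g / (m + \<gamma>) ^ Suc j) <= (1 / (m + \<gamma>)) * (\<gamma> / (m + \<gamma>)) ^ j" for j
  using assms \<gamma>_nonneg word_coeff_le[OF assms(2), of j] word_coeff_nonneg[of j g]
  by (simp add: power_divide divide_right_mono abs_mult)
qed

lemma inv_coeff_nonneg: "m > 0 ==> g \<in> G ==> 0 <= inv_coeff m g"
 unfolding inv_coeff_def using \<gamma>_nonneg
 by (intro suminf_nonneg word_coeff_summable) (auto simp: word_coeff_nonneg)

text \<open>The trivial representation sends the averaging element to \<open>\<gamma>\<close>, so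
  the total is \<open>1 / (m + \<gamma> - \<gamma>)\<close>. These factors \<open>1 / n\<close>
  produce the \<open>fact n\<close> in the bound for the homogeneous components.\<close>

lemma inv_coeff_sum:
 assumes "m > 0" shows "(\<Sum>g\<in>G. inv_coeff m g) = 1 / m"
proof -
 let ?A = "m + \<gamma>"
 have "(\<Sum>g\<in>G. inv_coeff m g) = (\<Sum>j. \<Sum>g\<in>G. word_coeff j g / ?A ^ Suc j)"
  unfolding inv_coeff_def using assms by (intro suminf_sum[symmetric] word_coeff_summable)
 also have "\<dots> = (\<Sum>j. (1 / ?A) * (\<gamma> / ?A) ^ j)"
  by (simp add: sum_divide_distrib[symmetric] word_coeff_sum power_divide)
 also have "\<dots> = (1 / ?A) * (1 / (1 - \<gamma> / ?A))"
  using assms \<gamma>_nonneg by (subst suminf_mult) (auto simp: suminf_geometric summable_geometric)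
 also have "\<dots> = 1 / m" using assms \<gamma>_nonneg by (simp add: field_simps)
 finally show ?thesis .
qed

lemma inv_coeff_rec:
 assumes "m > 0" "g \<in> G"
 shows "(m + \<gamma>) * inv_coeff m g = (\<Sum>a\<in>R. k a / 2 * inv_coeff m (g \<circ> \<sigma> a)) + (if g = id then 1 else 0)"
proof -
 let ?A = "m + \<gamma>"
 let ?B = "\<lambda>j. ?A * (word_coeff j g / ?A ^ Suc j)"
 let ?C = "\<Sum>j. word_coeff (Suc j) g / ?A ^ Suc j"
 have "?A * inv_coeff m g = (\<Sum>j. ?A * (word_coeff j g / ?A ^ Suc j))"
  unfolding inv_coeff_def by (rule suminf_mult[symmetric, OF word_coeff_summable[OF assms]])
 also have "\<dots> = (\<Sum>j. word_coeff j g / ?A ^ j)"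
 proof -
  have "m + \<gamma> \<noteq> 0" using assms \<gamma>_nonneg by simp
  thus ?thesis by simp
 qed
 also have "\<dots> = ?C + (if g = id then 1 else 0)"
 proof -
  have "summable ?B"
   by (rule summable_mult[OF word_coeff_summable[OF assms]])
  also have "?B = (\<lambda>j. word_coeff j g / ?A ^ j)"
  proof -
   have "m + \<gamma> \<noteq> 0" using assms \<gamma>_nonneg by simp
   thus ?thesis by simp
  qed
  finally show ?thesis using suminf_split_head[of "\<lambda>j. word_coeff j g / ?A ^ j"] by simp
 qed
 also have "?C =
   (\<Sum>j. \<Sum>a\<in>R. k a / 2 * (word_coeff j (g \<circ> \<sigma> a) / ?A ^ Suc j))"
  by (simp add: sum_divide_distrib)
 also have "\<dots> = (\<Sum>a\<in>R. \<Sum>j. k a / 2 * (word_coeff j (g \<circ> \<sigma> a) / ?A ^ Suc j))"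
  by (rule suminf_sum) (intro summable_mult word_coeff_summable assms group_comp group_reflection)
 also have "\<dots> = (\<Sum>a\<in>R. k a / 2 * inv_coeff m (g \<circ> \<sigma> a))"
  unfolding inv_coeff_def
  by (intro sum.cong refl suminf_mult word_coeff_summable assms group_comp group_reflection)
 finally show ?thesis .
qed

text \<open>The component of degree \<open>n\<close> of the Dunkl kernel. On homogeneous functions
  of degree \<open>n\<close> the operator \<open>T x\<close> at \<open>x\<close> acts as
  \<open>n + \<gamma> - \<Sum>a\<in>R. (k a / 2) \<sigma> a\<close>, so the eigenvalue equation
  forces this operator to send the component of degree \<open>n\<close> to \<open>cdot z w\<close>
  times the preceding one; \<open>inv_coeff\<close> inverts it.\<close>

primrec kernel_term :: "nat => complex^'n => complex^'n => complex" where
 "kernel_term 0 z w = 1"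
| "kernel_term (Suc n) z w =
  (\<Sum>g\<in>G. cor (inv_coeff (real (Suc n)) g) * (cdot (cact g z) w * kernel_term n (cact g z) w))"

lemma norm_kernel_term: "norm (kernel_term n z w) <= (norm z * norm w) ^ n / fact n"
proof (induction n arbitrary: z)
 case (Suc n)
 have "norm (kernel_term (Suc n) z w) <= (\<Sum>g\<in>G. inv_coeff (real (Suc n)) g * ((norm z * norm w) * ((norm z * norm w) ^ n / fact n)))"
  unfolding kernel_term.simps
 proof (rule sum_norm_le)
  fix g assume g: "g \<in> G"
  have "norm (cdot (cact g z) w) <= norm z * norm w" using norm_cdot[of "cact g z" w] g by simp
  moreover have "norm (kernel_term n (cact g z) w) <= (norm z * norm w) ^ n / fact n" using Suc[of "cact g z"] g by simp
  ultimately show "norm (cor (inv_coeff (real (Suc n)) g) * (cdot (cact g z) w * kernel_term n (cact g z) w))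
   <= inv_coeff (real (Suc n)) g * ((norm z * norm w) * ((norm z * norm w) ^ n / fact n))"
   using inv_coeff_nonneg[OF _ g, of "real (Suc n)"] unfolding norm_mult norm_of_real
   by (intro mult_mono) auto
 qed
 also have "\<dots> = (\<Sum>g\<in>G. inv_coeff (real (Suc n)) g) * ((norm z * norm w) * ((norm z * norm w) ^ n / fact n))"
  by (rule sum_distrib_right[symmetric])
 also have "\<dots> = (norm z * norm w) ^ Suc n / fact (Suc n)"
  by (subst inv_coeff_sum) (simp_all add: field_simps)
 finally show ?case .
qed simp

lemma kernel_term_rec:
 "cor (real (Suc n) + \<gamma>) * kernel_term (Suc n) z w =
  (\<Sum>a\<in>R. cor (k a / 2) * kernel_term (Suc n) (cact (\<sigma> a) z) w) + cdot z w * kernel_term n z w"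
proof -
 let ?A = "\<lambda>m g f z. \<Sum>a\<in>R. cor (k a / 2) * (cor (inv_coeff m (g \<circ> \<sigma> a)) * f (cact g z))"
 define m where "m = real (Suc n)"
 have m: "m > 0" by (simp add: m_def)
 define f where "f z = cdot z w * kernel_term n z w" for z
 have reind: "kernel_term (Suc n) (cact (\<sigma> a) z) w = (\<Sum>g\<in>G. cor (inv_coeff m (g \<circ> \<sigma> a)) * f (cact g z))"
  if "a \<in> R" for a
 proof -
  have "g \<circ> \<sigma> a \<circ> \<sigma> a = g" for g :: "real^'n => real^'n"
   using that by (auto simp: fun_eq_iff reflection_reflection)
  hence "(\<Sum>g\<in>G. cor (inv_coeff m (g \<circ> \<sigma> a)) * f (cact g z)) =
     (\<Sum>g\<in>G. (\<lambda>g. cor (inv_coeff m g) * f (cact (g \<circ> \<sigma> a) z)) (g \<circ> \<sigma> a))" by simp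
  also have "\<dots> = (\<Sum>g\<in>G. cor (inv_coeff m g) * f (cact (g \<circ> \<sigma> a) z))"
   by (rule sum_group_right[OF group_reflection[OF that]])
  finally show ?thesis by (simp add: f_def m_def cact_comp)
 qed
 have "cor (m + \<gamma>) * kernel_term (Suc n) z w = (\<Sum>g\<in>G. cor ((m + \<gamma>) * inv_coeff m g) * f (cact g z))"
  by (simp add: m_def f_def sum_distrib_left mult.assoc)
 also have "\<dots> = (\<Sum>g\<in>G. (?A m g f z)
   + (if g = id then f (cact g z) else 0))"
 proof (rule sum.cong[OF refl])
  fix g assume g: "g \<in> G"
  show "cor ((m + \<gamma>) * inv_coeff m g) * f (cact g z) =
   (?A m g f z)
   + (if g = id then f (cact g z) else 0)"
   unfolding inv_coeff_rec[OF m g] by (simp add: ring_distribs sum_distrib_right mult.assoc)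
 qed
 also have "\<dots> = (\<Sum>a\<in>R. cor (k a / 2) * kernel_term (Suc n) (cact (\<sigma> a) z) w) + f z"
  by (simp add: sum.distrib reind sum_distrib_left sum.delta group_id del: kernel_term.simps)
   (rule sum.swap)
 finally show ?thesis by (simp add: f_def m_def)
qed

text \<open>The averaging on the right contracts the supremum over \<open>A\<close> by the factor
  \<open>\<gamma> / (m + \<gamma>) < 1\<close>. The action is left abstract because it is used both
  for orbits of points and for orbits of pairs of a direction and a point.\<close>

lemma averaging_unique:
 fixes u :: "'a => complex"
 assumes m: "m > 0" and closed: "!!a b. a \<in> A ==> b \<in> R ==> act b a \<in> A"
  and eq: "!!a. a \<in> A ==> cor (m + \<gamma>) * u a = (\<Sum>b\<in>R. cor (k b / 2) * u (act b a))"
  and bd: "!!a. a \<in> A ==> norm (u a) <= B" and a: "a \<in> A"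
 shows "u a = 0"
proof -
 let ?A = "m + \<gamma>"
 define q where "q = \<gamma> / ?A"
 have pos: "m + \<gamma> > 0" using m \<gamma>_nonneg by simp
 have q: "0 <= q" "q < 1" using m \<gamma>_nonneg by (auto simp: q_def)
 have "norm (u a) <= q ^ j * B" if "a \<in> A" for a j
  using that
 proof (induction j arbitrary: a)
  case (Suc j)
  have "?A * norm (u a) = norm (\<Sum>b\<in>R. cor (k b / 2) * u (act b a))"
   unfolding eq[OF Suc.prems, symmetric] norm_mult norm_of_real using pos by simp
  also have "\<dots> <= (\<Sum>b\<in>R. k b / 2 * (q ^ j * B))"
   using Suc k_nonneg closed unfolding sum_distrib_left[symmetric]
   by (intro sum_norm_le) (auto simp: norm_mult intro!: mult_left_mono)
  also have "\<dots> = \<gamma> * (q ^ j * B)" by (simp add: \<gamma>_def sum_distrib_right)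
  finally have "norm (u a) * ?A <= \<gamma> * (q ^ j * B)" by (simp add: mult.commute)
  hence "norm (u a) <= \<gamma> * (q ^ j * B) / ?A" using pos by (simp only: pos_le_divide_eq)
  thus ?case by (simp add: q_def)
 qed (use bd in auto)
 moreover have "(\<lambda>j. q ^ j * B) \<longlonglongrightarrow> 0 * B" using q by (intro tendsto_intros LIMSEQ_power_zero) auto
 ultimately have "norm (u a) <= 0" using a by (intro Lim_bounded2[of "\<lambda>j. q ^ j * B"]) auto
 thus ?thesis by simp
qed

lemma kernel_term_unique:
 assumes "!!z. cor (real (Suc n) + \<gamma>) * u z =
   (\<Sum>b\<in>R. cor (k b / 2) * u (cact (\<sigma> b) z)) + cdot z w * kernel_term n z w"
 shows "u z = kernel_term (Suc n) z w"
proof -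
 define v where "v z = u z - kernel_term (Suc n) z w" for z
 define A where "A = (\<lambda>g. cact g z) ` G"
 have "v z = 0"
 proof (rule averaging_unique[where m="real (Suc n)" and act="\<lambda>b. cact (\<sigma> b)" and A=A and B="Max ((\<lambda>a. norm (v a)) ` A)"])
  show "cact (\<sigma> b) a \<in> A" if "a \<in> A" "b \<in> R" for a b
   using that unfolding A_def by (auto simp: cact_comp[symmetric] intro!: imageI group_comp group_reflection)
  show "cor (real (Suc n) + \<gamma>) * v a = (\<Sum>b\<in>R. cor (k b / 2) * v (cact (\<sigma> b) a))" for a
   using assms[of a] kernel_term_rec[of n a w] unfolding v_def
   by (simp add: right_diff_distrib sum_subtractf del: kernel_term.simps)
  show "norm (v a) <= Max ((\<lambda>a. norm (v a)) ` A)" if "a \<in> A" for a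
   using that by (intro Max_ge) (auto simp: A_def)
  show "z \<in> A" unfolding A_def by (rule image_eqI[of _ _ id]) (auto simp: group_id)
 qed simp
 thus ?thesis by (simp add: v_def)
qed

lemma kernel_term_equivariant:
 assumes g: "g \<in> G" shows "kernel_term n (cact g z) (cact g w) = kernel_term n z w"
proof (induction n arbitrary: z)
 case (Suc n)
 show ?case
 proof (rule kernel_term_unique[where u="\<lambda>z. kernel_term (Suc n) (cact g z) (cact g w)"])
  fix z
  have "cact g (cact (\<sigma> a) z) = cact (\<sigma> (g a)) (cact g z)" for a
   unfolding cact_comp[symmetric] using group_reflection_conj[OF g] by (intro arg_cong2[where f=cact]) auto
  hence "(\<Sum>a\<in>R. cor (k a / 2) * kernel_term (Suc n) (cact g (cact (\<sigma> a) z)) (cact g w)) =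
    (\<Sum>a\<in>R. cor (k (g a) / 2) * kernel_term (Suc n) (cact (\<sigma> (g a)) (cact g z)) (cact g w))"
   by (simp add: k_invariant[OF g] del: kernel_term.simps)
  also have "\<dots> = (\<Sum>a\<in>R. cor (k a / 2) * kernel_term (Suc n) (cact (\<sigma> a) (cact g z)) (cact g w))"
   by (rule sum_R_reflection[OF g])
  finally show "cor (real (Suc n) + \<gamma>) * kernel_term (Suc n) (cact g z) (cact g w) =
   (\<Sum>a\<in>R. cor (k a / 2) * kernel_term (Suc n) (cact g (cact (\<sigma> a) z)) (cact g w)) + cdot z w * kernel_term n z w"
   using kernel_term_rec[of n "cact g z" "cact g w"] Suc[of z] by (simp add: cdot_cact[OF g] del: kernel_term.simps)
 qed
qed simp

text \<open>By equivariance a reflection of one argument may be moved to the other. Hence the term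
  with exchanged arguments solves the recursion in \<open>z\<close>, whose solution is
  unique.\<close>

lemma kernel_term_symmetric: "kernel_term n z w = kernel_term n w z"
proof (induction n arbitrary: z w)
 case (Suc n)
 show ?case
 proof (rule sym, rule kernel_term_unique[where u="\<lambda>z. kernel_term (Suc n) w z"])
  fix z
  have "kernel_term (Suc n) w (cact (\<sigma> a) z) = kernel_term (Suc n) (cact (\<sigma> a) w) z" if "a \<in> R" for a
  proof -
   have "\<sigma> a \<circ> \<sigma> a = id" using that by (auto simp: reflection_reflection)
   hence "cact (\<sigma> a) (cact (\<sigma> a) z) = z" by (metis cact_comp cact_id)
   thus ?thesis using kernel_term_equivariant[OF group_reflection[OF that], of "Suc n" w "cact (\<sigma> a) z"] by metis
  qed
  thus "cor (real (Suc n) + \<gamma>) * kernel_term (Suc n) w z =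
   (\<Sum>a\<in>R. cor (k a / 2) * kernel_term (Suc n) w (cact (\<sigma> a) z)) + cdot z w * kernel_term n z w"
   using kernel_term_rec[of n w z] Suc[of w z] by (simp add: cdot_commute[of w z] del: kernel_term.simps)
 qed
qed simp

lemma kernel_term_scale: "kernel_term n (a *s z) w = a ^ n * kernel_term n z w"
 by (induction n arbitrary: z)
  (auto simp: cact_scale group_linear cdot_scale_left sum_distrib_left intro!: sum.cong)

end

section \<open>Entire functions of two vector variables\<close>

lemma jointly_entireE:
 assumes "jointly_entire f"
 obtains D where "((\<lambda>(z, w). f z w) has_derivative D) (at (z, w))" "!!c u v. D (c *s u, c *s v) = c * D (u, v)"
 using assms unfolding jointly_entire_def by (metis (mono_tags, lifting))

lemma jointly_entireI:
 assumes "!!z w. \<exists>D. ((\<lambda>(z, w). f z w) has_derivative D) (at (z, w)) \<and> (\<forall>c u v. D (c *s u, c *s v) = c * D (u, v))"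
 shows "jointly_entire f"
 using assms unfolding jointly_entire_def by auto

lemma bounded_linear_vscale: "bounded_linear (\<lambda>w. w *s (u :: complex^'n))"
proof (rule bounded_linear_intro)
 show "norm (w *s u) <= norm w * norm u" for w by simp
qed (simp_all add: vec_eq_iff ring_distribs)

lemma jointly_entire_line:
 fixes f :: "complex^'n => complex^'n => complex"
 assumes "((\<lambda>(z, w). f z w) has_derivative D) (at (z + a *s u, w + a *s v))"
  and "!!c u v. D (c *s u, c *s v) = c * D (u, v)"
 shows "((\<lambda>a. f (z + a *s u) (w + a *s v)) has_field_derivative D (u, v)) (at a)"
proof -
 have "((\<lambda>a. (z + a *s u, w + a *s v)) has_derivative (\<lambda>h. (h *s u, h *s v))) (at a)"
 proof (rule has_derivative_Pair)
  show "((\<lambda>a. z + a *s u) has_derivative (\<lambda>h. h *s u)) (at a)"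
   using has_derivative_add[OF has_derivative_const bounded_linear_imp_has_derivative[OF bounded_linear_vscale]] by simp
  show "((\<lambda>a. w + a *s v) has_derivative (\<lambda>h. h *s v)) (at a)"
   using has_derivative_add[OF has_derivative_const bounded_linear_imp_has_derivative[OF bounded_linear_vscale]] by simp
 qed
 from has_derivative_compose[OF this, where g="\<lambda>(z, w). f z w"] assms(1)
 have "((\<lambda>a. f (z + a *s u) (w + a *s v)) has_derivative (\<lambda>h. D (h *s u, h *s v))) (at a)" by simp
 also have "(\<lambda>h. D (h *s u, h *s v)) = (*) (D (u, v))" by (simp add: assms(2) fun_eq_iff mult.commute)
 finally show ?thesis unfolding has_field_derivative_def .
qed

lemma jointly_entire_holomorphic_line:
 assumes "jointly_entire f"
 shows "(\<lambda>a. f (z + a *s u) (w + a *s v)) holomorphic_on S"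
proof (rule holomorphic_onI)
 fix a assume "a \<in> S"
 obtain D where "((\<lambda>(z, w). f z w) has_derivative D) (at (z + a *s u, w + a *s v))" "!!c u v. D (c *s u, c *s v) = c * D (u, v)"
  using jointly_entireE[OF assms] by metis
 from jointly_entire_line[OF this] show "(\<lambda>a. f (z + a *s u) (w + a *s v)) field_differentiable at a within S"
  by (auto simp: field_differentiable_def intro: has_field_derivative_at_within)
qed

text \<open>Cauchy's inequality for the first derivative, on the unit circle of the complex line
  through \<open>(z, w)\<close> in direction \<open>(u, v)\<close>.\<close>

lemma jointly_entire_cauchy:
 assumes "jointly_entire f" "((\<lambda>(z, w). f z w) has_derivative D) (at (z, w))" "!!c u v. D (c *s u, c *s v) = c * D (u, v)"
  and "!!a. norm a = 1 ==> norm (f (z + a *s u) (w + a *s v)) <= B"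
 shows "norm (D (u, v)) <= B"
proof -
 let ?g = "\<lambda>a. f (z + a *s u) (w + a *s v)"
 have "norm ((deriv ^^ 1) ?g 0) <= fact 1 * B / 1 ^ 1"
  using jointly_entire_holomorphic_line[OF assms(1)] assms(4)
  by (intro Cauchy_inequality holomorphic_on_imp_continuous_on) auto
 moreover have "deriv ?g 0 = D (u, v)"
  using jointly_entire_line[of f D z 0 u w v] assms by (intro DERIV_imp_deriv) auto
 ultimately show ?thesis by simp
qed

text \<open>A complex point is the value at \<open>\<i>\<close> of the affine complex line built
  from its real and imaginary parts. That line takes real parameters to real points, so the identity
  theorem in one variable suffices.\<close>

lemma jointly_entire_eq_on_reals:
 fixes f g :: "complex^'n => complex^'n => complex"
 assumes f: "jointly_entire f" and g: "jointly_entire g"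
  and eq: "!!x y. f (cvec x) (cvec y) = g (cvec x) (cvec y)"
 shows "f = g"
proof (intro ext)
 fix z w :: "complex^'n"
 define x1 x2 y1 y2 where "x1 = (\<chi> j. Re (z $ j))" "x2 = (\<chi> j. Im (z $ j))" "y1 = (\<chi> j. Re (w $ j))" "y2 = (\<chi> j. Im (w $ j))"
 define h where "h v = f (cvec x1 + v *s cvec x2) (cvec y1 + v *s cvec y2) - g (cvec x1 + v *s cvec x2) (cvec y1 + v *s cvec y2)" for v
 have "h \<i> = 0"
 proof (rule analytic_continuation[of h UNIV "range cor" 0])
  show "h holomorphic_on UNIV" unfolding h_def
   by (intro holomorphic_intros jointly_entire_holomorphic_line f g)
  show "h z = 0" if "z \<in> range cor" for z
  proof -
   from that obtain t where "z = cor t" by auto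
   thus ?thesis unfolding h_def by (simp add: cvec_scale[symmetric] cvec_add[symmetric] eq)
  qed
  show "(0::complex) islimpt range cor"
   unfolding islimpt_approachable
  proof (intro allI impI)
   fix e :: real assume "e > 0"
   thus "\<exists>x'\<in>range cor. x' \<noteq> 0 \<and> dist x' 0 < e"
    by (intro bexI[OF _ rangeI[of cor "e/2"]]) auto
  qed
 qed auto
 moreover have "cvec x1 + \<i> *s cvec x2 = z" "cvec y1 + \<i> *s cvec y2 = w"
  unfolding x1_x2_y1_y2_def by (rule re_im_decomp[symmetric])+
 ultimately show "f z w = g z w" by (simp add: h_def)
qed

lemma jointly_entire_const: "jointly_entire (\<lambda>z w. c)"
 unfolding jointly_entire_def case_prod_beta by (intro allI exI[of _ "\<lambda>_. 0"] conjI has_derivative_const) auto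

lemma jointly_entire_cdot: "jointly_entire cdot"
proof (rule jointly_entireI, intro exI conjI allI)
 fix z w :: "complex^'n"
 show "((\<lambda>(z, w). cdot z w) has_derivative (\<lambda>(u, v). cdot z v + cdot u w)) (at (z, w))"
  unfolding cdot_def case_prod_beta sum.distrib[symmetric]
  by (auto intro!: derivative_eq_intros bounded_linear.has_derivative[OF bounded_linear_vec_nth])
 fix c and u v :: "complex^'n"
 show "(\<lambda>(u, v). cdot z v + cdot u w) (c *s u, c *s v) = c * (\<lambda>(u, v). cdot z v + cdot u w) (u, v)"
  by (simp add: cdot_scale_left cdot_scale_right ring_distribs)
qed

lemma jointly_entire_mult:
 assumes "jointly_entire f" "jointly_entire g"
 shows "jointly_entire (\<lambda>z w. f z w * g z w)"
proof (rule jointly_entireI)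
 fix z w
 obtain D where D: "((\<lambda>(z, w). f z w) has_derivative D) (at (z, w))" "!!c u v. D (c *s u, c *s v) = c * D (u, v)"
  using jointly_entireE[OF assms(1)] by metis
 obtain D' where D': "((\<lambda>(z, w). g z w) has_derivative D') (at (z, w))" "!!c u v. D' (c *s u, c *s v) = c * D' (u, v)"
  using jointly_entireE[OF assms(2)] by metis
 show "\<exists>D. ((\<lambda>(z, w). f z w * g z w) has_derivative D) (at (z, w)) \<and> (\<forall>c u v. D (c *s u, c *s v) = c * D (u, v))"
 proof (intro exI conjI allI)
  show "((\<lambda>(z, w). f z w * g z w) has_derivative (\<lambda>h. f z w * D' h + D h * g z w)) (at (z, w))"
   using has_derivative_mult[OF D(1) D'(1)] by (simp add: case_prod_unfold)
  show "f z w * D' (c *s u, c *s v) + D (c *s u, c *s v) * g z w = c * (f z w * D' (u, v) + D (u, v) * g z w)" for c u v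
   by (simp only: D(2) D'(2)) (simp add: ring_distribs)
 qed
qed

lemma jointly_entire_sum:
 assumes "!!i. i \<in> I ==> jointly_entire (f i)"
 shows "jointly_entire (\<lambda>z w. \<Sum>i\<in>I. f i z w)"
proof (rule jointly_entireI)
 fix z w
 have "\<forall>i\<in>I. \<exists>D. ((\<lambda>(z, w). f i z w) has_derivative D) (at (z, w)) \<and> (\<forall>c u v. D (c *s u, c *s v) = c * D (u, v))"
  using assms jointly_entireE by metis
 then obtain D where D: "!!i. i \<in> I ==> ((\<lambda>(z, w). f i z w) has_derivative D i) (at (z, w))"
  "!!i c u v. i \<in> I ==> D i (c *s u, c *s v) = c * D i (u, v)" by metis
 have "((\<lambda>p. \<Sum>i\<in>I. (\<lambda>(z, w). f i z w) p) has_derivative (\<lambda>h. \<Sum>i\<in>I. D i h)) (at (z, w))"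
  by (intro has_derivative_sum D)
 thus "\<exists>D. ((\<lambda>(z, w). \<Sum>i\<in>I. f i z w) has_derivative D) (at (z, w)) \<and> (\<forall>c u v. D (c *s u, c *s v) = c * D (u, v))"
 proof (intro exI conjI allI)
  show "(\<Sum>i\<in>I. D i (c *s u, c *s v)) = c * (\<Sum>i\<in>I. D i (u, v))" for c u v
   by (simp add: D(2) sum_distrib_left)
 qed (simp add: case_prod_unfold)
qed

lemma jointly_entire_cact:
 assumes "jointly_entire f" "linear g"
 shows "jointly_entire (\<lambda>z w. f (cact g z) w)"
proof (rule jointly_entireI)
 let ?A = "\<lambda>p. (cact g (fst p), snd p)"
 fix z w
 obtain D where D: "((\<lambda>(z, w). f z w) has_derivative D) (at (cact g z, w))" "!!c u v. D (c *s u, c *s v) = c * D (u, v)"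
  using jointly_entireE[OF assms(1)] by metis
 have lin: "bounded_linear (cact g)" using linear_cact[OF assms(2)] linear_conv_bounded_linear by blast
 have "(?A has_derivative ?A) (at (z, w))"
  by (intro has_derivative_Pair bounded_linear.has_derivative[OF lin] bounded_linear_imp_has_derivative bounded_linear_fst bounded_linear_snd)
 from has_derivative_compose[OF this, where g="\<lambda>(z, w). f z w"] D(1)
 have "((\<lambda>(z, w). f (cact g z) w) has_derivative (\<lambda>p. D (cact g (fst p), snd p))) (at (z, w))"
  by (simp add: case_prod_unfold)
 moreover have "D (cact g (fst (c *s u, c *s v)), snd (c *s u, c *s v)) = c * D (cact g (fst (u, v)), snd (u, v))" for c u v
  by (simp add: cact_scale[OF assms(2)] D(2))
 ultimately show "\<exists>D. ((\<lambda>(z, w). f (cact g z) w) has_derivative D) (at (z, w)) \<and> (\<forall>c u v. D (c *s u, c *s v) = c * D (u, v))"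
  by (intro exI conjI allI)
qed

lemma norm_fst_snd_le: "norm (fst p) <= norm p" "norm (snd p) <= norm p"
 using norm_fst_le[of "fst p" "snd p"] norm_snd_le[of "snd p" "fst p"] by simp_all

lemma pair_scale_direction:
 fixes u v :: "complex^'n"
 assumes "r \<noteq> 0"
 shows "(u, v) = (cor r *s ((1 / cor r) *s u), cor r *s ((1 / cor r) *s v))"
 using assms by (simp add: vec_eq_iff)

text \<open>Cauchy estimates give locally uniform convergence of the derivatives.\<close>

lemma jointly_entire_suminf:
 fixes f :: "nat => complex^'n => complex^'n => complex"
 assumes f: "!!n. jointly_entire (f n)"
  and bd: "!!n z w K. norm z <= K ==> norm w <= K ==> norm (f n z w) <= M K n"
  and sm: "!!K. summable (M K)"
  and D: "!!n z w. ((\<lambda>(z, w). f n z w) has_derivative D n (z, w)) (at (z, w))"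
  and lin: "!!n z w c u v. D n (z, w) (c *s u, c *s v) = c * D n (z, w) (u, v)"
 shows "((\<lambda>(z, w). \<Sum>n. f n z w) has_derivative (\<lambda>h. \<Sum>n. D n (z, w) h)) (at (z, w))"
  and "summable (\<lambda>n. D n (z, w) h)"
  and "jointly_entire (\<lambda>z w. \<Sum>n. f n z w)"
proof -
 let ?A = "\<lambda>n D x h. (\<Sum>i<n. D i x h) - (\<Sum>i. D i x h)"
 have Dbd: "norm (D n p h) <= norm h * M (K + 1) n" if "norm p <= K" for n p h K
 proof -
  obtain z w where p: "p = (z, w)" by force
  obtain u v where h: "h = (u, v)" by force
  have K: "norm z <= K" "norm w <= K" using that norm_fst_snd_le[of p] p by auto
  show ?thesis
  proof (cases "norm h = 0")
   case True
   hence "h = (0 *s u, 0 *s v)" by (auto simp: h zero_prod_def)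
   hence "D n p h = 0" using lin[of n z w 0 u v] by (simp add: p)
   thus ?thesis using True by simp
  next
   case False
   define r where "r = norm h"
   define u' v' where "u' = (1 / cor r) *s u" "v' = (1 / cor r) *s v"
   have u'v': "norm u' <= 1" "norm v' <= 1" using norm_fst_snd_le[of h] False
    by (auto simp: u'_v'_def h r_def norm_divide divide_le_eq)
   have "norm (D n p (u', v')) <= M (K + 1) n"
    unfolding p
   proof (rule jointly_entire_cauchy[OF f D lin])
    fix a :: complex assume "norm a = 1"
    thus "norm (f n (z + a *s u') (w + a *s v')) <= M (K + 1) n"
     using u'v' K by (intro bd order_trans[OF norm_triangle_ineq] add_mono) auto
   qed
   moreover have "D n p h = cor r * D n p (u', v')"
   proof -
    have "h = (cor r *s u', cor r *s v')"
     unfolding h u'_v'_def by (rule pair_scale_direction) (use False in \<open>simp add: r_def\<close>)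
    thus ?thesis by (simp only: p lin)
   qed
   ultimately show ?thesis by (simp add: norm_mult r_def mult_left_mono)
  qed
 qed
 have Dsum: "summable (\<lambda>n. D n p h)" for p h
  by (rule summable_comparison_test'[of "\<lambda>n. norm h * M (norm p + 1) n"])
   (auto intro: summable_mult sm Dbd)
 thus "summable (\<lambda>n. D n (z, w) h)" by blast
 have main: "((\<lambda>(z, w). \<Sum>n. f n z w) has_derivative (\<lambda>h. \<Sum>n. D n p h)) (at p)" for p
 proof -
  define K where "K = norm p + 1"
  define S where "S = (ball 0 K :: ((complex^'n) \<times> (complex^'n)) set)"
  have p: "p \<in> S" by (simp add: S_def K_def)
  have fs: "summable (\<lambda>n. f n (fst q) (snd q))" for q
   using bd[of "fst q" "norm q" "snd q"] norm_fst_snd_le[of q]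
   by (intro summable_comparison_test'[OF sm[of "norm q"]]) auto
  have "\<exists>g. \<forall>x\<in>S. (\<lambda>n. (case x of (z, w) => f n z w)) sums g x \<and> (g has_derivative (\<lambda>h. \<Sum>n. D n x h)) (at x within S)"
  proof (rule has_derivative_series)
   show "convex S" unfolding S_def by simp
   show "((\<lambda>(z, w). f n z w) has_derivative D n x) (at x within S)" for n x
    using D[of n "fst x" "snd x"] by (simp add: has_derivative_at_withinI)
   show "\<forall>\<^sub>F n in sequentially. \<forall>x\<in>S. \<forall>h. norm (?A n D x h) <= e * norm h" if e: "e > 0" for e
   proof -
    have "(\<lambda>n. \<Sum>i. M (K + 1) (i + n)) \<longlonglongrightarrow> 0" by (rule suminf_exist_split2[OF sm])
    hence "\<forall>\<^sub>F n in sequentially. (\<Sum>i. M (K + 1) (i + n)) < e" using e by (rule order_tendstoD)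
    thus ?thesis
    proof (eventually_elim, intro ballI allI)
     fix n x h assume n: "(\<Sum>i. M (K + 1) (i + n)) < e" and x: "x \<in> S"
     have xK: "norm x <= K" using x by (simp add: S_def)
     have "norm (?A n D x h) = norm (\<Sum>i. D (i + n) x h)"
      using suminf_minus_initial_segment[OF Dsum[of x h], of n] by (simp add: norm_minus_commute)
     also have "\<dots> <= (\<Sum>i. norm h * M (K + 1) (i + n))"
      using Dbd[OF xK] by (intro norm_suminf_le summable_mult summable_ignore_initial_segment sm) auto
     also have "\<dots> = norm h * (\<Sum>i. M (K + 1) (i + n))"
      by (intro suminf_mult summable_ignore_initial_segment sm)
     also have "\<dots> <= norm h * e" using n by (intro mult_left_mono) auto
     finally show "norm (?A n D x h) <= e * norm h" by (simp add: mult.commute)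
    qed
   qed
   show "p \<in> S" by (rule p)
   show "(\<lambda>n. case p of (z, w) => f n z w) sums (\<Sum>n. f n (fst p) (snd p))"
    using fs[of p] by (simp add: case_prod_beta summable_sums)
  qed
  then obtain g where g: "!!x. x \<in> S ==> (\<lambda>n. (case x of (z, w) => f n z w)) sums g x"
    "!!x. x \<in> S ==> (g has_derivative (\<lambda>h. \<Sum>n. D n x h)) (at x within S)" by blast
  have "(g has_derivative (\<lambda>h. \<Sum>n. D n p h)) (at p)"
   using g(2)[OF p] at_within_open[OF p] by (simp add: S_def)
  thus ?thesis
  proof (rule has_derivative_transform_within_open[of _ _ _ _ S])
   show "g x = (case x of (z, w) => \<Sum>n. f n z w)" if "x \<in> S" for x
    using g(1)[OF that] by (simp add: case_prod_beta sums_iff)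
  qed (use p in \<open>auto simp: S_def\<close>)
 qed
 show "((\<lambda>(z, w). \<Sum>n. f n z w) has_derivative (\<lambda>h. \<Sum>n. D n (z, w) h)) (at (z, w))" by (rule main)
 show "jointly_entire (\<lambda>z w. \<Sum>n. f n z w)"
 proof (rule jointly_entireI, intro exI conjI allI)
  show "((\<lambda>(z, w). \<Sum>n. f n z w) has_derivative (\<lambda>h. \<Sum>n. D n (z, w) h)) (at (z, w))" for z w by (rule main)
  show "(\<Sum>n. D n (z, w) (c *s u, c *s v)) = c * (\<Sum>n. D n (z, w) (u, v))" for z w c u v
   unfolding lin by (rule suminf_mult[OF Dsum])
 qed
qed

lemma jointly_entire_continuous:
 assumes "jointly_entire f" shows "cts (\<lambda>(z, w). f z w)"
 unfolding continuous_on_eq_continuous_at[OF open_UNIV]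
proof
 fix p
 obtain D where "((\<lambda>(z, w). f z w) has_derivative D) (at p)"
  using assms unfolding jointly_entire_def by metis
 thus "continuous (at p) (\<lambda>(z, w). f z w)" by (rule has_derivative_continuous)
qed

text \<open>The difference of the derivatives at two base points is the derivative at 0 of the
  difference of \<open>f\<close> along two parallel complex lines. Uniform continuity on a compact
  ball makes that difference small on the unit circle, and Cauchy's inequality passes to the
  derivative.\<close>

lemma jointly_entire_derivative_continuous:
 fixes f :: "complex^'n => complex^'n => complex"
 assumes f: "jointly_entire f"
  and D: "!!p. ((\<lambda>(z, w). f z w) has_derivative D p) (at p)"
  and lin: "!!p c u v. D p (c *s u, c *s v) = c * D p (u, v)"
 shows "cts (\<lambda>p. D p (u, v))"
 unfolding continuous_on_iff
proof (intro ballI allI impI)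
 let ?A = "\<lambda>q a. q + (a *s u, a *s v)"
 fix p :: "(complex^'n) \<times> (complex^'n)" and e :: real assume e: "e > 0"
 obtain z w where p: "p = (z, w)" by force
 define K where "K = cball p (norm u + norm v + 1)"
 have "uniformly_continuous_on K (\<lambda>(z, w). f z w)"
  unfolding K_def by (intro compact_uniformly_continuous continuous_on_subset[OF jointly_entire_continuous[OF f]]) auto
 then obtain d where d: "d > 0" "!!x y. x \<in> K ==> y \<in> K ==> dist y x < d ==> dist ((\<lambda>(z, w). f z w) y) ((\<lambda>(z, w). f z w) x) < e / 2"
  unfolding uniformly_continuous_on_def using e by (meson half_gt_zero)
 show "\<exists>d>0. \<forall>x'\<in>UNIV. dist x' p < d \<longrightarrow> dist (D x' (u, v)) (D p (u, v)) < e"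
 proof (intro exI[of _ "min d 1"] conjI ballI impI)
  fix q assume q: "dist q p < min d 1"
  obtain z' w' where q': "q = (z', w')" by force
  let ?g = "\<lambda>a. f (z' + a *s u) (w' + a *s v) - f (z + a *s u) (w + a *s v)"
  have hol: "?g holomorphic_on S" for S
   by (intro holomorphic_intros jointly_entire_holomorphic_line f)
  have "norm ((deriv ^^ 1) ?g 0) <= fact 1 * (e / 2) / 1 ^ 1"
  proof (intro Cauchy_inequality holomorphic_on_imp_continuous_on hol)
   fix a :: complex assume z1: "norm (0 - a) = 1"
   have 1: "(z + a *s u, w + a *s v) = p + (a *s u, a *s v)" "(z' + a *s u, w' + a *s v) = q + (a *s u, a *s v)"
    by (auto simp: p q')
   have 2: "norm (a *s u, a *s v) <= norm u + norm v"
    using norm_Pair_le[of "a *s u" "a *s v"] z1 by simp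
   have "p + (a *s u, a *s v) \<in> K" using 2 unfolding K_def mem_cball dist_norm by (subst norm_minus_commute) simp
   moreover have "q + (a *s u, a *s v) \<in> K"
   proof -
    have "dist p (?A q a) <= dist p q + dist q (?A q a)" by (rule dist_triangle)
    also have "dist q (?A q a) <= norm u + norm v" using 2 unfolding dist_norm by (subst norm_minus_commute) simp
    also have "dist p q <= 1" using q by (simp add: dist_commute)
    finally show ?thesis by (simp add: K_def)
   qed
   moreover have "dist (?A q a) (p + (a *s u, a *s v)) < d" using q by (simp add: dist_norm)
   ultimately have "dist ((\<lambda>(z, w). f z w) (?A q a)) ((\<lambda>(z, w). f z w) (p + (a *s u, a *s v))) < e / 2"
    by (intro d(2))
   thus "norm (?g a) <= e / 2" unfolding 1[symmetric] by (simp add: dist_norm)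
  qed auto
  moreover have "deriv ?g 0 = D q (u, v) - D p (u, v)"
  proof (rule DERIV_imp_deriv, rule DERIV_diff)
   show "((\<lambda>a. f (z' + a *s u) (w' + a *s v)) has_field_derivative D q (u, v)) (at 0)"
    using D[of q] by (intro jointly_entire_line lin) (simp add: q')
   show "((\<lambda>a. f (z + a *s u) (w + a *s v)) has_field_derivative D p (u, v)) (at 0)"
    using D[of p] by (intro jointly_entire_line lin) (simp add: p)
  qed
  ultimately have "norm (D q (u, v) - D p (u, v)) <= e / 2"
   by (simp only: funpow.simps One_nat_def comp_id fact_Suc fact_0 power_one div_by_1 mult_1 of_nat_1 of_nat_Suc of_nat_0 add_0_right)
  thus "dist (D q (u, v)) (D p (u, v)) < e" using e unfolding dist_norm by linarith
 qed (use d in auto)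
qed

section \<open>The Dunkl kernel\<close>

context dunkl begin

lemma kernel_term_jointly_entire: "jointly_entire (kernel_term n)"
proof (induction n)
 case 0 show ?case using jointly_entire_const[of 1] by (simp add: fun_eq_iff cong: )
next
 case (Suc n)
 have "jointly_entire (\<lambda>z w. \<Sum>g\<in>G. cor (inv_coeff (real (Suc n)) g) * (cdot (cact g z) w * kernel_term n (cact g z) w))"
 proof (intro jointly_entire_sum jointly_entire_mult jointly_entire_const)
  fix g assume "g \<in> G"
  hence g: "linear g" by (rule group_linear)
  show "jointly_entire (\<lambda>z. cdot (cact g z))" by (rule jointly_entire_cact[OF jointly_entire_cdot g])
  show "jointly_entire (\<lambda>z. kernel_term n (cact g z))" by (rule jointly_entire_cact[OF Suc g])
 qed
 thus ?case by (simp add: kernel_term.simps(2)[abs_def])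
qed

definition kernel_term_deriv where
 "kernel_term_deriv n p = fderiv (\<lambda>(z, w). kernel_term n z w) p"

lemma kernel_term_deriv:
 "((\<lambda>(z, w). kernel_term n z w) has_derivative kernel_term_deriv n p) (at p)"
 "kernel_term_deriv n p (c *s u, c *s v) = c * kernel_term_deriv n p (u, v)"
proof -
 obtain D where D: "((\<lambda>(z, w). kernel_term n z w) has_derivative D) (at p)" "!!c u v. D (c *s u, c *s v) = c * D (u, v)"
  using jointly_entireE[OF kernel_term_jointly_entire[of n], of "fst p" "snd p"] by auto
 have "kernel_term_deriv n p = D" unfolding kernel_term_deriv_def by (rule fderiv_eq[OF D(1)])
 thus "((\<lambda>(z, w). kernel_term n z w) has_derivative kernel_term_deriv n p) (at p)"
  "kernel_term_deriv n p (c *s u, c *s v) = c * kernel_term_deriv n p (u, v)" using D by simp_all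
qed

definition kernel :: "complex^'n => complex^'n => complex" where
 "kernel z w = (\<Sum>n. kernel_term n z w)"

lemma kernel_bound_summable: "summable (\<lambda>n. (K * K) ^ n / fact n :: real)"
 using summable_exp[of "K * K"] by (simp add: field_simps)

lemma kernel_term_bound:
 assumes "norm z <= K" "norm w <= K"
 shows "norm (kernel_term n z w) <= (K * K) ^ n / fact n"
proof -
 have "norm (kernel_term n z w) <= (norm z * norm w) ^ n / fact n" by (rule norm_kernel_term)
 also have "\<dots> <= (K * K) ^ n / fact n"
  using assms order_trans[OF norm_ge_zero[of z] assms(1)]
  by (intro divide_right_mono power_mono mult_mono) auto
 finally show ?thesis .
qed

lemmas kernel_suminf = jointly_entire_suminf[OF kernel_term_jointly_entire kernel_term_bound kernel_bound_summable
  kernel_term_deriv(1) kernel_term_deriv(2), folded kernel_def]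

lemma kernel_jointly_entire: "jointly_entire kernel"
 using kernel_suminf(3) by simp

lemma kernel_term_summable: "summable (\<lambda>n. norm (kernel_term n z w))"
 by (rule summable_comparison_test'[OF kernel_bound_summable[of "max (norm z) (norm w)"]])
  (auto intro: kernel_term_bound)

lemma kernel_sums: "(\<lambda>n. kernel_term n z w) sums kernel z w"
 unfolding kernel_def by (rule summable_sums[OF summable_norm_cancel[OF kernel_term_summable]])

lemma norm_kernel: "norm (kernel z w) <= exp (norm z * norm w)"
proof -
 have "norm (kernel_term n z w) <= (norm z * norm w) ^ n /\<^sub>R fact n" for n
  using norm_kernel_term[of n z w] by (simp add: divide_inverse mult.commute)
 thus ?thesis
  unfolding kernel_def exp_def by (intro norm_suminf_le summable_exp_generic)
qed

lemma kernel_symmetric: "kernel z w = kernel w z"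
 unfolding kernel_def by (rule arg_cong[where f=suminf], rule ext, rule kernel_term_symmetric)

lemma kernel_scale: "kernel (a *s z) w = kernel z (a *s w)"
 unfolding kernel_def
 by (rule arg_cong[where f=suminf], rule ext)
  (simp only: kernel_term_symmetric[of _ z "a *s w"] kernel_term_scale kernel_term_symmetric[of _ w z])

lemma kernel_equivariant: "g \<in> G ==> kernel (cact g z) (cact g w) = kernel z w"
 unfolding kernel_def by (simp add: kernel_term_equivariant)

lemma kernel_zero [simp]: "kernel 0 w = 1"
proof -
 have "kernel_term n 0 w = (if n = 0 then 1 else 0)" for n
  using norm_kernel_term[of n 0 w] by (cases "n = 0") (simp_all del: kernel_term.simps(2) add: power_0_left)
 hence "(\<lambda>n. kernel_term n 0 w) = (\<lambda>n. if n = 0 then 1 else 0)" by blast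
 thus ?thesis unfolding kernel_def using sums_single[of 0 "\<lambda>_. 1 :: complex"] by (simp add: sums_iff)
qed

lemma kernel_zero_right [simp]: "kernel z 0 = 1"
 using kernel_symmetric[of z 0] by simp

lemma cvec_slice_derivative:
 assumes "((\<lambda>(z, w). f z w) has_derivative D) (at (cvec x, w))"
 shows "((\<lambda>x. f (cvec x) w) has_derivative (\<lambda>v. D (cvec v, 0))) (at x)"
proof -
 have "((\<lambda>x. (cvec x, w)) has_derivative (\<lambda>v. (cvec v, 0))) (at x)"
  by (intro has_derivative_Pair has_derivative_const linear_imp_has_derivative linear_cvec)
 from has_derivative_compose[OF this, where g="\<lambda>(z, w). f z w"] assms show ?thesis by simp
qed

lemma kernel_term_slice:
 "((\<lambda>x. kernel_term n (cvec x) w) has_derivative (\<lambda>v. kernel_term_deriv n (cvec x, w) (cvec v, 0))) (at x)"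
 by (rule cvec_slice_derivative[OF kernel_term_deriv(1)])

lemma kernel_term_differentiable: "(\<lambda>x. kernel_term n (cvec x) w) differentiable (at x)"
 using kernel_term_slice unfolding differentiable_def by blast

text \<open>Applying \<open>T q\<close> to the recursion for the component of degree
  \<open>Suc n\<close> and inserting the induction hypothesis shows that the defect of the claimed
  identity satisfies the homogeneous averaging equation. A Dunkl operator commutes with a reflection
  only up to rotating its direction, so the equation lives on the orbit of the pair
  \<open>(q, x)\<close>, where \<open>averaging_unique\<close> makes the defect vanish.\<close>

lemma dunkl_op_kernel_term:
 "T q (\<lambda>x. kernel_term (Suc n) (cvec x) w) x = cdot (cvec q) w * kernel_term n (cvec x) w"
proof (induction n arbitrary: q x rule: less_induct)
 case (less n)
 define u where "u n x = kernel_term n (cvec x) w" for n x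
 define ip where "ip x = cdot (cvec x) w" for x
 define r where "r = real n"
 have diff: "u n differentiable (at x)" for n x unfolding u_def by (rule kernel_term_differentiable)
 have ip_deriv: "(ip has_derivative ip) (at x)" for x
 proof -
  have "linear ip" unfolding ip_def
   by (rule linearI) (simp_all add: cvec_add cdot_add_left cvec_scale cdot_scale_left scaleR_conv_of_real[where 'a=complex])
  thus ?thesis by (rule linear_imp_has_derivative)
 qed
 have ip_diff: "ip differentiable (at x)" for x using ip_deriv differentiable_def by blast
 have ip_refl: "ip (\<sigma> b x) = ip x - cor (b \<bullet> x) * ip b" if "b \<in> R" for b x
 proof -
  have "cvec (\<sigma> b x) = cvec x + cor (- (x \<bullet> b)) *s cvec b"
   using that by (simp only: cvec_add[symmetric] cvec_scale[symmetric]) (simp add: reflection_root)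
  thus ?thesis unfolding ip_def
   by (simp only: cdot_add_left cdot_scale_left inner_commute[of x b]) simp
 qed
 have ip_quot: "rquot b ip x = ip b" if "b \<in> R" for b x
  using that fderiv_eq[OF ip_deriv] by (simp add: reflection_quotient_root ip_refl)
 have rec: "cor (real (Suc m) + \<gamma>) * u (Suc m) x = (\<Sum>b\<in>R. cor (k b / 2) * u (Suc m) (\<sigma> b x)) + ip x * u m x" for m x
  using kernel_term_rec[of m "cvec x" w] unfolding u_def ip_def by (simp only: cact_cvec[OF reflection_linear])
 \<comment> \<open>The component of degree \<open>n - 1\<close>, set to 0 for \<open>n = 0\<close>,
   so that \<open>recn\<close> below also covers the constant component, where it reads
   \<open>\<gamma> = (\<Sum>b\<in>R. k b / 2)\<close>.\<close>
 define v where "v x = (if n = 0 then 0 else u (n - 1) x)" for x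
 have Tu: "T q (u n) x = ip q * v x" for q x
 proof (cases n)
  case 0 thus ?thesis unfolding u_def v_def by simp
 next
  case (Suc m) thus ?thesis using less.IH[of m q x] by (simp only: u_def[abs_def] v_def ip_def) simp
 qed
 have recn: "cor (r + \<gamma>) * u n x = (\<Sum>b\<in>R. cor (k b / 2) * u n (\<sigma> b x)) + ip x * v x" for x
 proof (cases n)
  case 0
  have "(\<Sum>b\<in>R. cor (k b / 2)) = cor \<gamma>" unfolding \<gamma>_def by simp
  thus ?thesis using 0 by (simp add: u_def v_def r_def)
 next
  case (Suc m) thus ?thesis using rec[of m x] by (simp only: v_def r_def) simp
 qed
 define D where "D p = T (fst p) (u (Suc n)) (snd p) - ip (fst p) * u n (snd p)" for p :: "(real^'n) \<times> (real^'n)"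
 define A where "A = (\<lambda>g. (g q, g x)) ` G"
 have "D (q, x) = 0"
 proof (rule averaging_unique[where m="real (Suc n)" and A=A and act="\<lambda>b p. (\<sigma> b (fst p), \<sigma> b (snd p))" and B="Max ((\<lambda>a. norm (D a)) ` A)"])
  show "(\<sigma> b (fst a), \<sigma> b (snd a)) \<in> A" if a: "a \<in> A" and "b \<in> R" for a b
  proof -
   obtain g where g: "g \<in> G" "a = (g q, g x)" using a by (auto simp: A_def)
   have "\<sigma> b \<circ> g \<in> G" using g(1) that by (intro group_comp group_reflection)
   thus ?thesis unfolding A_def g(2) by (intro image_eqI[of _ _ "\<sigma> b \<circ> g"]) auto
  qed
  show "norm (D a) <= Max ((\<lambda>a. norm (D a)) ` A)" if "a \<in> A" for a
   using that by (intro Max_ge) (auto simp: A_def)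
  show "(q, x) \<in> A" unfolding A_def by (rule image_eqI[of _ _ id]) (auto simp: group_id)
  show "cor (real (Suc n) + \<gamma>) * D a = (\<Sum>b\<in>R. cor (k b / 2) * D (\<sigma> b (fst a), \<sigma> b (snd a)))" for a
  proof -
   obtain q x where a: "a = (q, x)" by force
   have "cor (real (Suc n) + \<gamma>) * T q (u (Suc n)) x =
     T q (\<lambda>x. cor (real (Suc n) + \<gamma>) * u (Suc n) x) x"
    by (rule dunkl_op_cmult[OF diff, symmetric])
   also have "\<dots> = T q (\<lambda>x. (\<Sum>b\<in>R. cor (k b / 2) * u (Suc n) (\<sigma> b x)) + ip x * u n x) x"
    unfolding rec ..
   also have "\<dots> = T q (\<lambda>x. \<Sum>b\<in>R. cor (k b / 2) * u (Suc n) (\<sigma> b x)) x + T q (\<lambda>x. ip x * u n x) x"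
   proof (rule dunkl_op_add)
    have 1: "(\<lambda>x. u (Suc n) (\<sigma> b x)) differentiable (at x)" for b
     by (rule differentiable_chain_at[unfolded comp_def, OF linear_imp_differentiable[OF reflection_linear] diff])
    show "(\<lambda>x. \<Sum>b\<in>R. cor (k b / 2) * u (Suc n) (\<sigma> b x)) differentiable (at x)"
     by (intro differentiable_sum differentiable_mult differentiable_const 1 finite_R ballI)
   qed (intro differentiable_mult ip_diff diff)
   also have "T q (\<lambda>x. \<Sum>b\<in>R. cor (k b / 2) * u (Suc n) (\<sigma> b x)) x =
     (\<Sum>b\<in>R. cor (k b / 2) * T (\<sigma> b q) (u (Suc n)) (\<sigma> b x))"
   proof -
    have 1: "(\<lambda>x. u (Suc n) (\<sigma> b x)) differentiable (at x)" for b
     by (rule differentiable_chain_at[unfolded comp_def, OF linear_imp_differentiable[OF reflection_linear] diff])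
    have "T q (\<lambda>x. \<Sum>b\<in>R. cor (k b / 2) * u (Suc n) (\<sigma> b x)) x = (\<Sum>b\<in>R. T q (\<lambda>x. cor (k b / 2) * u (Suc n) (\<sigma> b x)) x)"
     by (intro dunkl_op_sum finite_R differentiable_mult differentiable_const 1)
    also have "\<dots> = (\<Sum>b\<in>R. cor (k b / 2) * T (\<sigma> b q) (u (Suc n)) (\<sigma> b x))"
    proof (rule sum.cong[OF refl])
     fix b assume a: "b \<in> R"
     show "T q (\<lambda>x. cor (k b / 2) * u (Suc n) (\<sigma> b x)) x = cor (k b / 2) * T (\<sigma> b q) (u (Suc n)) (\<sigma> b x)"
      unfolding dunkl_op_cmult[OF 1] dunkl_op_reflect[OF diff group_reflection[OF a]] ..
    qed
    finally show ?thesis .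
   qed
   also have "T q (\<lambda>x. ip x * u n x) x = ip x * (ip q * v x) + ip q * u n x +
     (\<Sum>b\<in>R. cor (k b / 2 * (b \<bullet> q)) * ip b * u n (\<sigma> b x))"
    by (subst dunkl_op_mult[OF ip_diff diff]) (simp add: Tu fderiv_eq[OF ip_deriv] ip_quot)
   finally have 1: "cor (real (Suc n) + \<gamma>) * T q (u (Suc n)) x =
    (\<Sum>b\<in>R. cor (k b / 2) * T (\<sigma> b q) (u (Suc n)) (\<sigma> b x)) +
    (ip x * (ip q * v x) + ip q * u n x + (\<Sum>b\<in>R. cor (k b / 2 * (b \<bullet> q)) * ip b * u n (\<sigma> b x)))" .
   have 2: "(\<Sum>b\<in>R. cor (k b / 2) * (ip (\<sigma> b q) * u n (\<sigma> b x))) =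
    ip q * (\<Sum>b\<in>R. cor (k b / 2) * u n (\<sigma> b x)) - (\<Sum>b\<in>R. cor (k b / 2 * (b \<bullet> q)) * ip b * u n (\<sigma> b x))"
    unfolding sum_distrib_left sum_subtractf[symmetric]
    by (intro sum.cong refl) (simp add: ip_refl algebra_simps)
   have 3: "(\<Sum>b\<in>R. cor (k b / 2) * u n (\<sigma> b x)) = cor (r + \<gamma>) * u n x - ip x * v x"
    using recn[of x] by simp
   have "(\<Sum>b\<in>R. cor (k b / 2) * D (\<sigma> b q, \<sigma> b x)) =
     (\<Sum>b\<in>R. cor (k b / 2) * T (\<sigma> b q) (u (Suc n)) (\<sigma> b x)) - (\<Sum>b\<in>R. cor (k b / 2) * (ip (\<sigma> b q) * u n (\<sigma> b x)))"
    unfolding D_def by (simp add: right_diff_distrib sum_subtractf)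
   also have "\<dots> = cor (real (Suc n) + \<gamma>) * T q (u (Suc n)) x - cor (real (Suc n) + \<gamma>) * (ip q * u n x)"
    unfolding 1 2 3 r_def by (simp add: algebra_simps)
   finally show ?thesis unfolding a by (simp only: D_def fst_conv snd_conv right_diff_distrib)
  qed
 qed simp
 thus ?case by (simp only: D_def fst_conv snd_conv right_minus_eq u_def[abs_def] ip_def)
qed

definition kernel_deriv :: "(complex^'n) \<times> (complex^'n) => (complex^'n) \<times> (complex^'n) => complex" where
 "kernel_deriv p h = (\<Sum>n. kernel_term_deriv n p h)"

lemma kernel_deriv_summable: "summable (\<lambda>n. kernel_term_deriv n p h)"
 using kernel_suminf(2)[where z="fst p" and w="snd p"] by simp

lemma kernel_deriv:
 "((\<lambda>(z, w). kernel z w) has_derivative kernel_deriv p) (at p)"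
 "kernel_deriv p (c *s u, c *s v) = c * kernel_deriv p (u, v)"
proof -
 show "((\<lambda>(z, w). kernel z w) has_derivative kernel_deriv p) (at p)"
  using kernel_suminf(1)[where z="fst p" and w="snd p"] by (simp add: kernel_deriv_def[abs_def])
 show "kernel_deriv p (c *s u, c *s v) = c * kernel_deriv p (u, v)"
  unfolding kernel_deriv_def kernel_term_deriv(2) by (rule suminf_mult[OF kernel_deriv_summable])
qed

lemma kernel_slice: "((\<lambda>x. kernel (cvec x) w) has_derivative (\<lambda>v. kernel_deriv (cvec x, w) (cvec v, 0))) (at x)"
 by (rule cvec_slice_derivative[OF kernel_deriv(1)])

lemma kernel_slice_differentiable: "(\<lambda>x. kernel (cvec x) w) differentiable (at x)"
 using kernel_slice unfolding differentiable_def by blast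

text \<open>The series is treated term by term. On a wall the quotient is a directional derivative,
  so convergence of the differentiated series is needed there as well. The constant component is
  annihilated, which shifts the index by one.\<close>

lemma dunkl_op_kernel: "T q (\<lambda>x. kernel (cvec x) w) x = cdot (cvec q) w * kernel (cvec x) w"
proof -
 let ?A = "\<lambda>x. kernel (cvec x) w"
 let ?B = "\<lambda>n. \<lambda>x. kernel_term n (cvec x) w"
 have fd: "fderiv ?A x v = kernel_deriv (cvec x, w) (cvec v, 0)"
  "fderiv (?B n) x v = kernel_term_deriv n (cvec x, w) (cvec v, 0)" for v n
  using fderiv_eq[OF kernel_slice] fderiv_eq[OF kernel_term_slice] by simp_all
 have 1: "(\<lambda>n. fderiv (?B n) x v) sums fderiv ?A x v" for v
  unfolding fd kernel_deriv_def by (rule summable_sums[OF kernel_deriv_summable])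
 have 2: "(\<lambda>n. rquot a (?B n) x) sums rquot a ?A x" if "a \<in> R" for a
  unfolding reflection_quotient_root[OF that] using 1[of a] by (auto intro!: sums_divide sums_diff kernel_sums)
 have "(\<lambda>n. T q (?B n) x) sums T q ?A x"
  unfolding dunkl_op_def by (intro sums_add 1 sums_sum sums_mult 2)
 hence "(\<lambda>n. T q (\<lambda>x. kernel_term (Suc n) (cvec x) w) x) sums T q ?A x"
  by (subst sums_Suc_iff) simp
 moreover have "(\<lambda>n. cdot (cvec q) w * kernel_term n (cvec x) w) sums (cdot (cvec q) w * kernel (cvec x) w)"
  by (intro sums_mult kernel_sums)
 ultimately show ?thesis unfolding dunkl_op_kernel_term using sums_unique2 by blast
qed

lemma kernel_deriv_continuous: "cts (\<lambda>p. kernel_deriv p (u, v))"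
 by (rule jointly_entire_derivative_continuous[OF kernel_jointly_entire kernel_deriv])

lemma kernel_slice_C1: "C_class 1 (\<lambda>x. kernel (cvec x) w)"
proof -
 have cont: "cts (\<lambda>x. kernel_deriv (cvec x, w) (cvec v, 0))" for v
 proof (rule continuous_on_compose2[OF kernel_deriv_continuous])
  show "cts (\<lambda>x::real^'n. (cvec x, w))"
   by (intro continuous_on_Pair continuous_on_const linear_continuous_on linear_conv_bounded_linear[THEN iffD1, OF linear_cvec])
 qed auto
 show ?thesis
  using cont fderiv_eq[OF kernel_slice] kernel_slice_differentiable
  by (simp add: partial_deriv_def[abs_def])
qed

text \<open>The series settles existence and the comparison principle uniqueness, so the definite
  description denotes the series.\<close>

theorem dunkl_kernel_real_eq: "dunkl_kernel_real R k x y = kernel (cvec x) (cvec y)"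
 unfolding dunkl_kernel_real_def
proof (rule the1_equality[where a="\<lambda>x. kernel (cvec x) (cvec y)", THEN fun_cong])
 let ?A = "\<lambda>x. kernel (cvec x) (cvec y)"
 let ?B = "\<lambda>f. \<forall>q z. T q f z = cor (q \<bullet> y) * f z"
 show k: "C_class 1 ?A \<and> (\<forall>q z. T q ?A z =
   cor (q \<bullet> y) * kernel (cvec z) (cvec y)) \<and> kernel (cvec 0) (cvec y) = 1"
  by (simp add: kernel_slice_C1 dunkl_op_kernel cdot_cvec del: One_nat_def)
 show "\<exists>!f. C_class 1 f \<and> (?B f) \<and> f 0 = 1"
 proof (rule ex1I[where a="\<lambda>x. kernel (cvec x) (cvec y)"], rule k)
  fix f assume f: "C_class 1 f \<and> (?B f) \<and> f 0 = 1"
  show "f = ?A"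
   by (rule eigenfunction_unique[where c=1 and y=y])
    (use f in \<open>auto simp: kernel_slice_differentiable dunkl_op_kernel cdot_cvec\<close>)
 qed
qed

theorem dunkl_kernel_eq: "dunkl_kernel R k = kernel"
 unfolding dunkl_kernel_def dunkl_kernel_real_eq
 using kernel_jointly_entire jointly_entire_eq_on_reals by (intro the_equality) auto

end

section \<open>The kernel at real points, with a complex scalar\<close>

text \<open>The indicator \<open>b\<close> of the unit ball is invariant under \<open>g\<close>.
  Integrating \<open>f (g x) * b (g x + y)\<close> over both variables in the two orders reduces the
  rotation to translations and a change of sign, which preserve the measure; the common factor
  \<open>V\<close> is finite and positive and cancels.\<close>

lemma orthogonal_nn_integral:
 fixes g :: "'a::euclidean_space => 'a"
 assumes g: "orthogonal_transformation g" and f[measurable]: "f \<in> borelm"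
 shows "(\<integral>\<^sup>+x. f (g x) \<partial>lborel) = (\<integral>\<^sup>+x. f x \<partial>lborel)"
proof -
 let ?A = "\<integral>\<^sup>+y. f y \<partial>lborel"
 let ?B = "\<lambda>b y. \<integral>\<^sup>+x. f (g x) * b (g x + y) \<partial>lborel"
 let ?C = "\<lambda>y b. \<integral>\<^sup>+x. f (g x - y) * b x \<partial>lborel"
 let ?D = "\<lambda>h. \<integral>\<^sup>+x. h x \<partial>lborel"
 have shift: "(\<integral>\<^sup>+x. h (c + x) \<partial>lborel) = (?D h)"
  if [measurable]: "h \<in> borelm" for h :: "'a => ennreal" and c
  using nn_integral_distr[of "(+) c" lborel borel h] by (simp add: lborel_distr_plus)
 have flip: "(\<integral>\<^sup>+x. h (- x) \<partial>lborel) = (?D h)"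
  if [measurable]: "h \<in> borelm" for h :: "'a => ennreal"
 proof -
  have "lborel = distr lborel borel (\<lambda>x::'a. - x)"
   using lborel_affine[of "-1" "0::'a"] by (simp add: density_1)
  hence "(?D h) = (\<integral>\<^sup>+x. h x \<partial>distr lborel borel (\<lambda>x::'a. - x))" by simp
  thus ?thesis by (simp add: nn_integral_distr)
 qed
 have lin: "linear g" using g orthogonal_transformation_linear by blast
 have [measurable]: "g \<in> borelm"
  using lin linear_continuous_on[of g] linear_conv_bounded_linear[of g] borel_measurable_continuous_onI by blast
 define b where "b x = (indicator (ball 0 1) x :: ennreal)" for x :: 'a
 have [measurable]: "b \<in> borelm" unfolding b_def by (intro borel_measurable_indicator) simp
 have bg: "b (g x) = b x" for x
  using orthogonal_transformation_norm[OF g] by (simp add: b_def indicator_def)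
 define V where "V = (\<integral>\<^sup>+x. b x \<partial>lborel)"
 have V: "V = emeasure lborel (ball (0::'a) 1)" unfolding V_def b_def by simp
 have V0: "V \<noteq> 0" using V content_ball_pos[of 1 "0::'a"] by (auto simp: measure_def)
 have Vinf: "V \<noteq> \<infinity>" using V emeasure_lborel_ball_finite[of "0::'a" 1] by simp
 have "(\<integral>\<^sup>+x. f (g x) \<partial>lborel) * V = (\<integral>\<^sup>+x. (\<integral>\<^sup>+y. f (g x) * b (g x + y) \<partial>lborel) \<partial>lborel)"
  by (simp add: nn_integral_cmult shift V_def nn_integral_multc)
 also have "\<dots> = (\<integral>\<^sup>+y. (?B b y) \<partial>lborel)"
  by (rule lborel_pair.Fubini') measurable
 also have "\<dots> = (\<integral>\<^sup>+y. (?C y b) \<partial>lborel)"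
 proof (rule nn_integral_cong)
  fix y
  obtain z where z: "g z = - y" using orthogonal_transformation_surj[OF g] by (metis surjD)
  have "(?B b y) = (\<integral>\<^sup>+x. f (g (z + x)) * b (g (z + x) + y) \<partial>lborel)"
   by (rule shift[symmetric]) measurable
  also have "\<dots> = (?C y b)"
   by (simp add: linear_add[OF lin] z bg)
  finally show "(?B b y) = (?C y b)" .
 qed
 also have "\<dots> = (\<integral>\<^sup>+x. (\<integral>\<^sup>+y. f (g x - y) * b x \<partial>lborel) \<partial>lborel)"
  by (rule lborel_pair.Fubini'[symmetric]) measurable
 also have "\<dots> = (\<integral>\<^sup>+x. ?A * b x \<partial>lborel)"
 proof (rule nn_integral_cong)
  fix x
  have "(\<integral>\<^sup>+y. f (g x - y) \<partial>lborel) = (\<integral>\<^sup>+y. f (g x + y) \<partial>lborel)"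
   using flip[of "\<lambda>y. f (g x - y)"] by simp
  also have "\<dots> = ?A" by (rule shift) measurable
  finally show "(\<integral>\<^sup>+y. f (g x - y) * b x \<partial>lborel) = ?A * b x"
   by (simp add: nn_integral_multc)
 qed
 also have "\<dots> = ?A * V" by (simp add: nn_integral_cmult V_def)
 finally show ?thesis using V0 Vinf by (simp add: mult.commute[of _ V] ennreal_mult_cancel_left)
qed

context dunkl begin

text \<open>One complex scalar covers all uses: \<open>\<i>\<close> and \<open>-\<i>\<close> for the
  transform and the translation, 1 for the positive kernel behind the heat kernel. The scalar may
  sit on either argument, which makes \<open>e a\<close> symmetric in the two real vectors.\<close>

definition e :: "complex => real^'n => real^'n => complex" where
 "e a u x = kernel (a *s cvec u) (cvec x)"

lemma e_slice: "e a u x = kernel (cvec x) (a *s cvec u)"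
 unfolding e_def by (rule kernel_symmetric)

lemma e_symmetric: "e a u x = e a x u"
 unfolding e_def by (metis kernel_scale kernel_symmetric)

lemma e_scale: "e a (r *\<^sub>R u) x = e (a * cor r) u x"
 unfolding e_def by (simp add: cvec_scale)

lemma e_scale_right: "e a u (r *\<^sub>R x) = e (a * cor r) u x"
 using e_scale[of a r x u] by (simp add: e_symmetric[of _ u])

lemma e_zero [simp]: "e a 0 x = 1" "e a x 0 = 1" "e 0 u x = 1"
 unfolding e_def by simp_all

lemma e_equivariant: "g \<in> G ==> e a (g u) (g x) = e a u x"
 unfolding e_def using kernel_equivariant[of g "a *s cvec u" "cvec x"]
 by (simp add: cact_scale cact_cvec group_linear)

lemma e_minus: "e a (- u) x = e (- a) u x"
 using e_scale[of a "-1" u x] by simp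

lemma e_minus_right: "e a u (- x) = e (- a) u x"
 using e_scale_right[of a u "-1" x] by simp

lemma e_differentiable: "e a u differentiable (at x)"
 using kernel_slice_differentiable[of "a *s cvec u" x] unfolding e_slice[abs_def] .

lemma e_C1: "C_class 1 (e a u)"
 using kernel_slice_C1[of "a *s cvec u"] unfolding e_slice[abs_def] .

lemma dunkl_op_e: "T q (e a u) x = a * cor (q \<bullet> u) * e a u x"
 using dunkl_op_kernel[of q "a *s cvec u" x] unfolding e_slice[abs_def]
 by (simp add: cdot_scale_right cdot_cvec)

lemma norm_e_le: "norm (e a u x) <= exp (norm a * norm u * norm x)"
 using norm_kernel[of "a *s cvec u" "cvec x"] by (simp add: e_def)

text \<open>Unlike the estimate from the series, this sees only the real part of \<open>a\<close>.
  It gives modulus at most 1 at imaginary scalars, on which absolute convergence of the transform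
  rests.\<close>

lemma norm_e: "norm (e a u x) <= exp (\<bar>Re a\<bar> * norm u * norm x)"
 using eigenfunction_bound[of "e a u" a u x] e_differentiable dunkl_op_e by simp

lemma norm_e_i: "norm (e \<i> u x) <= 1" "norm (e (-\<i>) u x) <= 1"
 using norm_e[of \<i> u x] norm_e[of "-\<i>" u x] by simp_all

text \<open>Cauchy's inequality on the unit circle in the normalised direction; the exponential
  growth is harmless because the bound is used only under a Gaussian.\<close>

lemma e_derivative_bound: "norm (fderiv (e a u) x v) <= norm v * exp (norm a * norm u * (norm x + 1))"
proof -
 have fd: "fderiv (e a u) x v = kernel_deriv (cvec x, a *s cvec u) (cvec v, 0)" for v
  using fderiv_eq[OF kernel_slice[of "a *s cvec u" x]] unfolding e_slice[abs_def] by simp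
 have unit: "norm (fderiv (e a u) x v) <= exp (norm a * norm u * (norm x + 1))" if "norm v <= 1" for v
  unfolding fd
 proof (rule jointly_entire_cauchy[OF kernel_jointly_entire kernel_deriv])
  fix w :: complex assume z: "norm w = 1"
  have "norm (kernel (cvec x + w *s cvec v) (a *s cvec u + w *s 0)) <= exp (norm (cvec x + w *s cvec v) * norm (a *s cvec u))"
   using norm_kernel[of "cvec x + w *s cvec v" "a *s cvec u"] by simp
  also have "\<dots> <= exp ((norm x + 1) * norm (a *s cvec u))"
   using norm_triangle_ineq[of "cvec x" "w *s cvec v"] z that unfolding exp_le_cancel_iff
   by (intro mult_right_mono) auto
  finally show "norm (kernel (cvec x + w *s cvec v) (a *s cvec u + w *s 0)) <= exp (norm a * norm u * (norm x + 1))"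
   by (simp add: mult.commute)
 qed
 show ?thesis
 proof (cases "v = 0")
  case True thus ?thesis using linear_0[OF linear_frechet_derivative[OF e_differentiable]] by simp
 next
  case False
  have "fderiv (e a u) x v = norm v *\<^sub>R fderiv (e a u) x (v /\<^sub>R norm v)"
   using linear_scale[OF linear_frechet_derivative[OF e_differentiable], of a u x "norm v" "v /\<^sub>R norm v"] False by simp
  thus ?thesis using unit[of "v /\<^sub>R norm v"] False by (simp add: mult_left_mono)
 qed
qed

lemma e_continuous:
 fixes f :: "'b::topological_space => complex"
 assumes "continuous_on S f" "continuous_on S p" "continuous_on S q"
 shows "continuous_on S (\<lambda>y. e (f y) (p y) (q y))"
 unfolding e_def
proof (rule continuous_on_compose2[OF jointly_entire_continuous[OF kernel_jointly_entire],
   where f="\<lambda>y. (f y *s cvec (p y), cvec (q y))", simplified])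
 have cv: "continuous_on S (\<lambda>y. cvec (h y))" if "continuous_on S h" for h
  using continuous_on_compose2[OF linear_continuous_on[OF linear_conv_bounded_linear[THEN iffD1, OF linear_cvec]] that subset_UNIV] by simp
 show "continuous_on S (\<lambda>y. (f y *s cvec (p y), cvec (q y)))"
  using assms(1) cv[OF assms(2)] cv[OF assms(3)]
  by (intro continuous_on_Pair) (auto simp: vector_scalar_mult_def continuous_on_componentwise continuous_on_vec_lambda
    intro!: continuous_on_vec_lambda continuous_intros)
qed

lemma dunkl_op_cnj:
 assumes "f differentiable (at x)"
 shows "T q (\<lambda>x. cnj (f x)) x = cnj (T q f x)"
proof -
 have "fderiv (\<lambda>x. cnj (f x)) x = (\<lambda>v. cnj (fderiv f x v))"
  using assms by (intro fderiv_eq bounded_linear.has_derivative[OF bounded_linear_cnj])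
   (simp add: frechet_derivative_works)
 thus ?thesis by (simp add: dunkl_op_def reflection_quotient_def cong: if_cong)
  (intro sum.cong refl, auto)
qed

lemma e_cnj: "cnj (e a u x) = e (cnj a) u x"
proof -
 have "(\<lambda>x. cnj (e a u x)) = e (cnj a) u"
 proof (rule eigenfunction_unique[where c="cnj a" and y=u])
  show "(\<lambda>x. cnj (e a u x)) differentiable (at x)" for x
   using e_differentiable bounded_linear.has_derivative[OF bounded_linear_cnj] unfolding differentiable_def by blast
 qed (simp_all add: dunkl_op_cnj e_differentiable dunkl_op_e)
 thus ?thesis by metis
qed

definition er :: "real^'n => real^'n => real" where "er u x = Re (e 1 u x)"

lemma er: "e 1 u x = cor (er u x)"
 using e_cnj[of 1 u x] by (simp add: er_def complex_eq_iff)

lemma er_nonneg: "0 <= er u x"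
 unfolding er_def using eigenfunction_nonneg[of "e 1 u" u x] e_differentiable dunkl_op_e[of _ 1 u] by simp

lemma er_symmetric: "er u x = er x u"
 unfolding er_def using e_symmetric by simp

end

section \<open>The weighted measure\<close>

lemma nn_integral_inverse_square_finite: "(nnint lborel (\<lambda>x. 1 / (1 + x\<^sup>2))) < (\<infinity> :: ennreal)"
proof -
 let ?f = "\<lambda>x::real. 1 / (1 + x\<^sup>2)"
 have pos: "(\<integral>\<^sup>+x. ennreal (?f x) * indicator {0..} x \<partial>lborel) = ennreal (pi/2 - arctan 0)"
 proof (rule nn_integral_FTC_atLeast)
  show "(arctan has_real_derivative 1 / (1 + x\<^sup>2)) (at x)" for x
   using DERIV_arctan[of x] by (simp add: divide_inverse)
  show "(arctan \<longlongrightarrow> pi / 2) at_top" by (rule tendsto_arctan_at_top)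
 qed simp_all
 have neg: "(\<integral>\<^sup>+x. ennreal (?f x) * indicator {..0} x \<partial>lborel) = (\<integral>\<^sup>+x. ennreal (?f x) * indicator {0..} x \<partial>lborel)"
  by (subst nn_integral_real_affine[where c="-1" and t=0]) (auto simp: indicator_def intro!: nn_integral_cong)
 have "(nnint lborel (\<lambda>x. ?f x)) <= (\<integral>\<^sup>+x. ennreal (?f x) * indicator {..0} x + ennreal (?f x) * indicator {0..} x \<partial>lborel)"
  by (intro nn_integral_mono) (auto simp: indicator_def)
 also have "\<dots> = (\<integral>\<^sup>+x. ennreal (?f x) * indicator {..0} x \<partial>lborel) + (\<integral>\<^sup>+x. ennreal (?f x) * indicator {0..} x \<partial>lborel)"
  by (rule nn_integral_add) measurable
 also have "\<dots> < \<infinity>" unfolding neg pos by simp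
 finally show ?thesis .
qed

text \<open>With the exponent \<open>CARD('n)\<close> the power splits into one factor for each
  coordinate, and each factor is dominated by an integrable function of that coordinate
  alone.\<close>

lemma nn_integral_vec_decay_finite:
 "(nnint lborel (\<lambda>x. (1 + (norm (x :: real^'n))\<^sup>2) powr - real CARD('n))) < (\<infinity> :: ennreal)"
proof -
 have "(nnint lborel (\<lambda>x. (1 + (norm (x :: real^'n))\<^sup>2) powr - real CARD('n))) \<le>
    (\<integral>\<^sup>+x. (\<Prod>b\<in>Basis. ennreal (1 / (1 + ((x :: real^'n) \<bullet> b)\<^sup>2))) \<partial>lborel)"
 proof (rule nn_integral_mono)
  fix x :: "real^'n"
  have "(1 + (norm x)\<^sup>2) powr - real CARD('n) = (\<Prod>b\<in>(Basis :: (real^'n) set). 1 / (1 + (norm x)\<^sup>2))"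
   by (simp add: powr_minus powr_realpow add_pos_nonneg power_one_over inverse_eq_divide)
  also have "\<dots> <= (\<Prod>b\<in>Basis. 1 / (1 + (x \<bullet> b)\<^sup>2))"
  proof (intro prod_mono conjI)
   fix b :: "real^'n" assume "b \<in> Basis"
   hence "(x \<bullet> b)\<^sup>2 <= (norm x)\<^sup>2" using Basis_le_norm[of b x] by (simp add: abs_le_square_iff[symmetric])
   thus "1 / (1 + (norm x)\<^sup>2) <= 1 / (1 + (x \<bullet> b)\<^sup>2)"
    by (intro divide_left_mono mult_pos_pos add_pos_nonneg) auto
  qed simp
  finally show "ennreal ((1 + (norm x)\<^sup>2) powr - real CARD('n)) <= (\<Prod>b\<in>Basis. ennreal (1 / (1 + (x \<bullet> b)\<^sup>2)))"
   by (subst prod_ennreal) (auto simp: ennreal_leI)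
 qed
 also have "\<dots> = (\<Prod>b\<in>(Basis :: (real^'n) set). nnint lborel (\<lambda>x. 1 / (1 + x\<^sup>2)))"
  by (rule nn_integral_lborel_prod) auto
 also have "\<dots> < \<infinity>"
  using nn_integral_inverse_square_finite by (auto intro!: power_less_top_ennreal[THEN iffD2])
 finally show ?thesis .
qed

text \<open>From \<open>t <= exp t\<close> at \<open>t = y / (8 * M)\<close>. The rate 1/8 is small
  enough to be absorbed by the Gaussian in \<open>integrable_gauss\<close> and by
  \<open>exp (d / 4)\<close> in \<open>h_weighted_square\<close>.\<close>

lemma power_le_exp_bound:
 assumes "0 <= (y::real)" "0 < M" shows "y powr M <= (8 * M) powr M * exp (y / 8)"
proof -
 have "y / (8 * M) <= exp (y / (8 * M))" using exp_ge_add_one_self[of "y / (8 * M)"] by linarith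
 hence "(y / (8 * M)) powr M <= exp (y / (8 * M)) powr M" using assms by (intro powr_mono2) auto
 also have "\<dots> = exp (y / 8)" using assms by (simp add: powr_def field_simps)
 finally have "(8 * M) powr M * (y / (8 * M)) powr M <= (8 * M) powr M * exp (y / 8)"
  by (intro mult_left_mono) auto
 thus ?thesis using assms by (simp add: powr_mult[symmetric])
qed

context dunkl begin

definition weight :: "real^'n => real" where "weight x = (\<Prod>a\<in>R. \<bar>x \<bullet> a\<bar> powr k a)"
text \<open>Stands in for the measure of the unit ball at \<open>x\<close>, to which it is
  comparable: an explicit product that never vanishes and changes by at most a polynomial factor
  under translation.\<close>

definition vol :: "real^'n => real" where "vol x = (\<Prod>a\<in>R. (1 + \<bar>x \<bullet> a\<bar>) powr k a)"
definition \<kappa> :: real where "\<kappa> = (\<Sum>a\<in>R. k a)"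

lemma \<kappa>_nonneg: "0 <= \<kappa>" unfolding \<kappa>_def by (intro sum_nonneg) (auto simp: k_nonneg)

lemma N_eq: "N = real CARD('n) + \<kappa>" by (simp add: homogeneous_dim_def \<kappa>_def)

lemma N_pos: "N > 0" using \<kappa>_nonneg by (simp add: N_eq add_pos_nonneg)

lemma norm_root_le: "a \<in> R ==> norm a <= 2"
 using norm_root[of a] by (intro power2_le_imp_le[of "norm a" 2]) auto

lemma inner_root_le: "a \<in> R ==> \<bar>x \<bullet> a\<bar> <= 2 * norm x"
 using Cauchy_Schwarz_ineq2[of x a] norm_root_le[of a] mult_left_mono[of "norm a" 2 "norm x"] by simp

lemma weight_nonneg: "0 <= weight x" unfolding weight_def by (intro prod_nonneg) auto

lemma weight_measurable [measurable]: "weight \<in> borelm"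
 unfolding weight_def[abs_def] by measurable

lemma vol_continuous: "cts vol"
 unfolding vol_def[abs_def] by (intro continuous_intros) (auto simp: add_nonneg_eq_0_iff)

lemma vol_measurable [measurable]: "vol \<in> borelm"
 using vol_continuous by (rule borel_measurable_continuous_onI)

lemma vol_ge_1: "1 <= vol x"
 unfolding vol_def by (intro prod_ge_1) (auto intro: ge_one_powr_ge_zero simp: k_nonneg)

lemma vol_pos: "0 < vol x" using vol_ge_1[of x] by simp

lemma weight_le_vol: "weight x <= vol x"
 unfolding weight_def vol_def by (intro prod_mono conjI powr_mono2) (auto simp: k_nonneg)

lemma group_prod:
 assumes g: "g \<in> G"
 shows "(\<Prod>a\<in>R. f \<bar>g x \<bullet> a\<bar> powr k a) = (\<Prod>a\<in>R. f \<bar>x \<bullet> a\<bar> powr k a)"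
proof -
 have inj: "inj_on g R" using group_bij[OF g] by (meson bij_is_inj inj_on_subset subset_UNIV)
 have "(\<Prod>a\<in>R. f \<bar>g x \<bullet> a\<bar> powr k a) = (\<Prod>a\<in>R. f \<bar>g x \<bullet> g a\<bar> powr k (g a))"
  using prod.reindex[OF inj, of "\<lambda>a. f \<bar>g x \<bullet> a\<bar> powr k a"] group_image_R[OF g] by simp
 thus ?thesis using g by (simp add: group_inner k_invariant)
qed

lemma weight_invariant: "g \<in> G ==> weight (g x) = weight x"
 unfolding weight_def using group_prod[of g id x] by simp

lemma vol_invariant: "g \<in> G ==> vol (g x) = vol x"
 unfolding vol_def using group_prod[of g "\<lambda>t. 1 + t" x] by simp

lemma weight_minus: "weight (- x) = weight x" by (simp add: weight_def)
text \<open>Roots have norm at most 2, so each factor \<open>1 + \<bar>x \<bullet> b\<bar>\<close>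
  grows at most by the factor \<open>1 + 2 * norm y\<close>; the exponents of these factors add up
  to \<open>\<kappa>\<close>.\<close>

lemma vol_add_le: "vol (x + y) <= vol x * (1 + 2 * norm y) powr \<kappa>"
proof -
 let ?A = "1 + 2 * norm y"
 let ?B = "\<lambda>b. 1 + \<bar>x \<bullet> b\<bar>"
 have "vol (x + y) <= (\<Prod>b\<in>R. (?B b) powr k b * ?A powr k b)"
  unfolding vol_def
 proof (intro prod_mono conjI)
  fix b assume a: "b \<in> R"
  have "1 + \<bar>(x + y) \<bullet> b\<bar> <= 1 + \<bar>x \<bullet> b\<bar> + 2 * norm y"
   using inner_root_le[OF a, of y] by (simp add: inner_add_left)
  also have "\<dots> <= (?B b) * ?A" by (simp add: algebra_simps)
  finally have "(1 + \<bar>(x + y) \<bullet> b\<bar>) powr k b <= ((?B b) * ?A) powr k b"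
   by (intro powr_mono2) (auto simp: k_nonneg[OF a])
  thus "(1 + \<bar>(x + y) \<bullet> b\<bar>) powr k b <= (?B b) powr k b * ?A powr k b"
   by (simp add: powr_mult)
 qed simp
 also have "\<dots> = vol x * ?A powr \<kappa>"
  unfolding vol_def \<kappa>_def prod.distrib by (subst powr_sum) (auto simp: add_nonneg_eq_0_iff)
 finally show ?thesis .
qed

lemma one_plus_norm_le: "1 + 2 * norm (x :: real^'n) <= 5 * (1 + (norm x)\<^sup>2)"
proof -
 have "0 <= (norm x - 1)\<^sup>2" "0 <= (norm x)\<^sup>2" by simp_all
 moreover have "(norm x - 1)\<^sup>2 = (norm x)\<^sup>2 - 2 * norm x + 1" by (simp add: power2_diff)
 ultimately show ?thesis unfolding distrib_left by linarith
qed

lemma vol_add_le': "vol (x + y) <= vol x * (5 powr \<kappa> * (1 + (norm y)\<^sup>2) powr \<kappa>)"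
proof -
 have "(1 + 2 * norm y) powr \<kappa> <= (5 * (1 + (norm y)\<^sup>2)) powr \<kappa>"
  using one_plus_norm_le \<kappa>_nonneg by (intro powr_mono2) auto
 hence "vol x * (1 + 2 * norm y) powr \<kappa> <= vol x * (5 powr \<kappa> * (1 + (norm y)\<^sup>2) powr \<kappa>)"
  using vol_pos[of x] by (intro mult_left_mono) (simp_all add: powr_mult[symmetric] less_imp_le)
 thus ?thesis using vol_add_le[of x y] by linarith
qed

lemma vol_le: "vol x <= 5 powr \<kappa> * (1 + (norm x)\<^sup>2) powr \<kappa>"
 using vol_add_le'[of 0 x] by (simp add: vol_def[of 0])

lemma weight_scale: "t > 0 ==> weight (t *\<^sub>R x) = t powr \<kappa> * weight x"
 unfolding weight_def \<kappa>_def by (subst powr_sum) (auto simp: abs_mult powr_mult prod.distrib)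

lemma AE_regular: "AE x in lborel. \<forall>b\<in>R. x \<bullet> b \<noteq> 0"
proof (subst AE_ball_countable)
 show "\<forall>b\<in>R. AE x in lborel. x \<bullet> b \<noteq> 0"
 proof
  fix b assume a: "b \<in> R"
  have "negligible {x. b \<bullet> x = 0}" using root_nonzero[OF a] by (intro negligible_hyperplane) auto
  hence "{x. b \<bullet> x = 0} \<in> null_sets lebesgue" by (simp add: negligible_iff_null_sets)
  moreover have "{x. b \<bullet> x = 0} \<in> sets borel" by measurable
  ultimately have "{x. b \<bullet> x = 0} \<in> null_sets lborel" by (simp add: null_sets_completion_iff)
  from AE_not_in[OF this] show "AE x in lborel. x \<bullet> b \<noteq> 0"
   by eventually_elim (simp add: inner_commute)
 qed
qed (simp add: countable_finite)

lemma weight_pos: "\<forall>a\<in>R. x \<bullet> a \<noteq> 0 ==> 0 < weight x"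
 unfolding weight_def by (intro prod_pos) auto

lemma W_def': "W = density lborel (\<lambda>x. ennreal (weight x))"
 unfolding dunkl_measure_def weight_def ..

lemma sets_W [simp, measurable_cong]: "sets W = sets borel" by (simp add: W_def')
lemma space_W [simp]: "space W = UNIV" by (simp add: W_def')

lemma nn_integral_W: "f \<in> borelm ==> (\<integral>\<^sup>+x. f x \<partial>W) = (\<integral>\<^sup>+x. ennreal (weight x) * f x \<partial>lborel)"
 unfolding W_def' by (rule nn_integral_density) auto

lemma integral_W:
 fixes f :: "real^'n => 'b::{banach, second_countable_topology}"
 assumes "f \<in> borelm"
 shows "(LINT x|W. f x) = (LINT x|lborel. weight x *\<^sub>R f x)"
 unfolding W_def' by (rule integral_density) (use assms weight_nonneg in auto)

text \<open>The density vanishes only on the walls, which are Lebesgue null, so both measures have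
  the same null sets.\<close>

lemma AE_W: "(AE x in W. P x) \<longleftrightarrow> (AE x in lborel. P x)"
proof -
 have "(AE x in W. P x) \<longleftrightarrow> (AE x in lborel. 0 < ennreal (weight x) \<longrightarrow> P x)"
  unfolding W_def' by (rule AE_density) simp
 also have "\<dots> \<longleftrightarrow> (AE x in lborel. P x)"
 proof
  assume "AE x in lborel. 0 < ennreal (weight x) \<longrightarrow> P x"
  with AE_regular show "AE x in lborel. P x"
   by eventually_elim (auto dest: weight_pos)
 qed auto
 finally show ?thesis .
qed

lemma sigma_finite_W: "sigma_finite_measure W"
 unfolding W_def' by (subst sigma_finite_measure.sigma_finite_iff_density_finite[OF sigma_finite_lborel]) auto

lemma nn_integral_W_orthogonal:
 assumes "orthogonal_transformation g" "!!x. weight (g x) = weight x" "f \<in> borelm"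
 shows "(\<integral>\<^sup>+x. f (g x) \<partial>W) = (\<integral>\<^sup>+x. f x \<partial>W)"
proof -
 have [measurable]: "g \<in> borelm"
  by (rule borel_measurable_continuous_onI[OF linear_continuous_on[OF linear_conv_bounded_linear[THEN iffD1, OF orthogonal_transformation_linear[OF assms(1)]]]])
 note assms(3)[measurable]
 have "(\<integral>\<^sup>+x. f (g x) \<partial>W) = (\<integral>\<^sup>+x. ennreal (weight (g x)) * f (g x) \<partial>lborel)"
  by (subst nn_integral_W) (auto simp: assms(2))
 also have "\<dots> = (\<integral>\<^sup>+x. ennreal (weight x) * f x \<partial>lborel)"
  by (rule orthogonal_nn_integral[OF assms(1)]) measurable
 finally show ?thesis by (subst nn_integral_W[OF assms(3)])
qed

lemma distr_W:
 assumes "orthogonal_transformation g" "!!x. weight (g x) = weight x"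
 shows "distr W borel g = W"
proof (rule measure_eqI)
 have [measurable]: "g \<in> borelm"
  by (rule borel_measurable_continuous_onI[OF linear_continuous_on[OF linear_conv_bounded_linear[THEN iffD1, OF orthogonal_transformation_linear[OF assms(1)]]]])
 fix A assume "A \<in> sets (distr W borel g)"
 hence [measurable]: "A \<in> sets borel" by simp
 have "(\<integral>\<^sup>+x. indicator A (g x) \<partial>W) = (\<integral>\<^sup>+x. indicator A x \<partial>W)"
  by (rule nn_integral_W_orthogonal[OF assms]) measurable
 also have "(\<integral>\<^sup>+x. indicator A (g x) \<partial>W) = (\<integral>\<^sup>+x. indicator (g -` A) x \<partial>W)"
  by (simp add: indicator_def)
 also have "\<dots> = emeasure W (g -` A)"
  using measurable_sets[of g borel borel A] by (intro nn_integral_indicator) simp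
 finally show "emeasure (distr W borel g) A = emeasure W A" by (subst emeasure_distr) (auto simp: nn_integral_indicator)
qed simp

lemma nn_integral_W_group:
 "g \<in> G ==> f \<in> borelm ==> (\<integral>\<^sup>+x. f (g x) \<partial>W) = (\<integral>\<^sup>+x. f x \<partial>W)"
 by (rule nn_integral_W_orthogonal) (auto simp: group_orthogonal weight_invariant)

lemma orthogonal_uminus: "orthogonal_transformation (uminus :: real^'n => real^'n)"
 by (simp add: orthogonal_transformation_def linear_uminus)

lemma nn_integral_W_minus:
 "f \<in> borelm ==> (\<integral>\<^sup>+x. f (- x) \<partial>W) = (\<integral>\<^sup>+x. f x \<partial>W)"
 by (rule nn_integral_W_orthogonal) (auto simp: orthogonal_uminus weight_minus)

lemma integral_W_group:
 fixes f :: "real^'n => 'b::{banach, second_countable_topology}"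
 assumes "g \<in> G" "f \<in> borelm"
 shows "(LINT x|W. f (g x)) = (LINT x|W. f x)"
proof -
 have [measurable]: "g \<in> borelm"
  by (rule borel_measurable_continuous_onI[OF linear_continuous_on[OF linear_conv_bounded_linear[THEN iffD1, OF group_linear[OF assms(1)]]]])
 have "(LINT x|distr W borel g. f x) = (LINT x|W. f (g x))"
  by (rule integral_distr) (use assms in auto)
 thus ?thesis using distr_W[of g] assms by (simp add: group_orthogonal weight_invariant)
qed

lemma integral_W_minus:
 fixes f :: "real^'n => 'b::{banach, second_countable_topology}"
 assumes "f \<in> borelm"
 shows "(LINT x|W. f (- x)) = (LINT x|W. f x)"
proof -
 have "(LINT x|distr W borel uminus. f x) = (LINT x|W. f (- x))"
  by (rule integral_distr) (use assms in auto)
 thus ?thesis using distr_W[of uminus] assms by (simp add: orthogonal_uminus weight_minus)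
qed

lemma nn_integral_W_scale:
 assumes t: "t > 0" and f[measurable]: "f \<in> borelm"
 shows "(\<integral>\<^sup>+x. f (t *\<^sub>R x) \<partial>W) = ennreal (t powr - N) * (\<integral>\<^sup>+x. f x \<partial>W)"
proof -
 let ?A = "\<lambda>_. \<bar>t\<bar>^DIM(real^'n)"
 let ?B = "\<integral>\<^sup>+x. f x \<partial>W"
 have "lborel = density (distr lborel borel (\<lambda>x::real^'n. t *\<^sub>R x)) ?A"
  using lborel_affine[of t "0::real^'n"] t by simp
 hence "?B = (\<integral>\<^sup>+x. ennreal (weight x) * f x \<partial>density (distr lborel borel (\<lambda>x::real^'n. t *\<^sub>R x)) ?A)"
  by (simp add: nn_integral_W)
 also have "\<dots> = (\<integral>\<^sup>+x. ennreal (t ^ CARD('n)) * (ennreal (weight (t *\<^sub>R x)) * f (t *\<^sub>R x)) \<partial>lborel)"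
  using t by (simp add: nn_integral_density nn_integral_distr)
 also have "\<dots> = (\<integral>\<^sup>+x. ennreal (t powr N) * (ennreal (weight x) * f (t *\<^sub>R x)) \<partial>lborel)"
 proof -
  have tN: "t ^ CARD('n) * t powr \<kappa> = t powr N"
   using t by (simp add: N_eq powr_add powr_realpow)
  have "ennreal (t ^ CARD('n)) * (ennreal (weight (t *\<^sub>R x)) * f (t *\<^sub>R x)) = ennreal (t powr N) * (ennreal (weight x) * f (t *\<^sub>R x))" for x
   using t by (simp add: weight_scale mult.assoc[symmetric] ennreal_mult'[symmetric] weight_nonneg tN)
  thus ?thesis by simp
 qed
 also have "\<dots> = ennreal (t powr N) * (\<integral>\<^sup>+x. f (t *\<^sub>R x) \<partial>W)"
  by (simp add: nn_integral_W nn_integral_cmult)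
 finally have "ennreal (t powr - N) * ?B = ennreal (t powr - N) * ennreal (t powr N) * (\<integral>\<^sup>+x. f (t *\<^sub>R x) \<partial>W)"
  by (simp add: mult.assoc)
 also have "ennreal (t powr - N) * ennreal (t powr N) = 1"
  using t by (simp add: ennreal_mult'[symmetric] powr_add[symmetric])
 finally show ?thesis by simp
qed

text \<open>The weight grows at most like \<open>(1 + (norm x)\<^sup>2) powr \<kappa>\<close>, which
  leaves the exponent \<open>- CARD('n)\<close> for Lebesgue measure because
  \<open>N = CARD('n) + \<kappa>\<close>. The requirement that \<open>s\<close> be at least
  \<open>N\<close> enters through this bound.\<close>

lemma nn_integral_W_decay:
 assumes M: "N <= M"
 shows "(nnint lborel (\<lambda>x. (1 + (norm x)\<^sup>2) powr - M * vol x)) < \<infinity>"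
  and "(nnint W (\<lambda>x. (1 + (norm x)\<^sup>2) powr - M)) < \<infinity>"
proof -
 let ?A = "\<lambda>x. 1 + (norm x)\<^sup>2"
 let ?B = "nnint lborel (\<lambda>x. (?A x) powr - M * vol x)"
 let ?C = "nnint W (\<lambda>x. (?A x) powr - M)"
 have "?B <= (\<integral>\<^sup>+x. ennreal (5 powr \<kappa>) * ennreal ((1 + (norm (x::real^'n))\<^sup>2) powr - real CARD('n)) \<partial>lborel)"
 proof (rule nn_integral_mono)
  fix x :: "real^'n"
  have "(?A x) powr - M * vol x <= (?A x) powr - N * (5 powr \<kappa> * (?A x) powr \<kappa>)"
   using vol_le[of x] M vol_pos[of x] by (intro mult_mono powr_mono) auto
  also have "\<dots> = 5 powr \<kappa> * (?A x) powr - real CARD('n)"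
   by (simp add: N_eq powr_add[symmetric])
  finally show "ennreal ((?A x) powr - M * vol x) <= ennreal (5 powr \<kappa>) * ennreal ((?A x) powr - real CARD('n))"
   by (simp add: ennreal_mult'[symmetric] ennreal_leI)
 qed
 also have "\<dots> < \<infinity>" using nn_integral_vec_decay_finite
  by (subst nn_integral_cmult) (auto simp: ennreal_mult_less_top)
 finally show 1: "?B < \<infinity>" .
 have "?C <= ?B"
  by (subst nn_integral_W) (auto intro!: nn_integral_mono ennreal_leI mult_left_mono
    simp: ennreal_mult'[symmetric] weight_nonneg weight_le_vol mult.commute[of "weight _"])
 with 1 show "?C < \<infinity>" by (simp add: le_less_trans)
qed

lemma integrable_decay: "N <= M ==> integrable W (\<lambda>x. (1 + (norm x)\<^sup>2) powr - M)"
 using nn_integral_W_decay(2)[of M] by (intro integrableI_nonneg) auto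

text \<open>The inequality \<open>a * r <= 2 * a\<^sup>2 + r\<^sup>2 / 8\<close> and
  \<open>power_le_exp_bound\<close> together spend a quarter of \<open>r\<^sup>2\<close>, which the
  Gaussian covers.\<close>

lemma integrable_gauss: "integrable W (\<lambda>x. exp (a * norm x - (norm x)\<^sup>2 / 2))"
proof -
 let ?A = "\<lambda>r. a * r - r\<^sup>2 / 2"
 define C where "C = (8 * N) powr N * exp (1/8 + 2 * a\<^sup>2)"
 have "integrable W (\<lambda>x. C * (1 + (norm x)\<^sup>2) powr - N)"
  by (intro integrable_mult_right integrable_decay) simp
 thus ?thesis
 proof (rule Bochner_Integration.integrable_bound)
  show "AE x in W. norm (exp (a * norm x - (norm x)\<^sup>2 / 2)) <= norm (C * (1 + (norm x)\<^sup>2) powr - N)"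
  proof (rule AE_I2)
   fix x
   define r where "r = norm x"
   have pos: "1 + r\<^sup>2 > 0" by (simp add: add_pos_nonneg)
   have "0 <= (r - 4 * a)\<^sup>2 / 8" by simp
   hence ar: "a * r <= 2 * a\<^sup>2 + r\<^sup>2 / 8" by (simp add: power2_eq_square field_simps)
   have "exp (?A r) * (1 + r\<^sup>2) powr N <= exp (?A r) * ((8 * N) powr N * exp ((1 + r\<^sup>2) / 8))"
    using power_le_exp_bound[of "1 + r\<^sup>2" N] N_pos pos by (intro mult_left_mono) auto
   also have "\<dots> = (8 * N) powr N * exp ((1 + r\<^sup>2) / 8 + (?A r))"
    by (simp add: exp_add)
   also have "\<dots> <= C" unfolding C_def
   proof (rule mult_left_mono)
    show "exp ((1 + r\<^sup>2) / 8 + (?A r)) <= exp (1 / 8 + 2 * a\<^sup>2)"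
     using ar zero_le_power2[of r] unfolding exp_le_cancel_iff add_divide_distrib by linarith
   qed simp
   finally have "exp (?A r) <= C * (1 + r\<^sup>2) powr - N"
    using pos by (simp add: powr_minus field_simps)
   thus "norm (exp (a * norm x - (norm x)\<^sup>2 / 2)) <= norm (C * (1 + (norm x)\<^sup>2) powr - N)"
    by (simp add: r_def C_def)
  qed
 qed simp
qed

definition c where "c = dunkl_const R k"

lemma c_def': "c = (LINT x|W. exp (- (norm x)\<^sup>2 / 2))" by (simp add: c_def dunkl_const_def)

lemma c_pos: "c > 0"
proof -
 have int: "integrable W (\<lambda>x. exp (- (norm x)\<^sup>2 / 2))" using integrable_gauss[of 0] by simp
 have "c \<noteq> 0"
 proof
  assume "c = 0"
  hence "AE x in W. exp (- (norm x)\<^sup>2 / 2) = 0"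
   using integral_nonneg_eq_0_iff_AE[OF int] by (simp add: c_def')
  hence "AE x in (lborel :: (real^'n) measure). False" by (simp add: AE_W)
  hence "UNIV \<in> null_sets (lborel :: (real^'n) measure)" by (subst (asm) AE_iff_null) auto
  thus False using emeasure_lborel_UNIV[where 'a="real^'n"] by (simp add: null_sets_def)
 qed
 moreover have "c >= 0" unfolding c_def' by (rule Bochner_Integration.integral_nonneg) simp
 ultimately show ?thesis by simp
qed

end

section \<open>Differentiable function classes\<close>

lemma vec_axis_expansion: "(v :: real^'n) = (\<Sum>i\<in>UNIV. (v $ i) *\<^sub>R axis i 1)"
 using basis_expansion[of v] by (simp add: scalar_mult_eq_scaleR)

lemmas scaleR_complex = scaleR_conv_of_real[where 'a=complex]

lemma frechet_derivative_partials:
 assumes "f differentiable (at x)"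
 shows "fderiv f x v = (\<Sum>i\<in>UNIV. cor (v $ i) * partial_deriv i f x)"
proof -
 have lin: "linear (fderiv f x)" using assms by (rule linear_frechet_derivative)
 have "fderiv f x v = fderiv f x (\<Sum>i\<in>UNIV. (v $ i) *\<^sub>R axis i 1)"
  by (rule arg_cong[OF vec_axis_expansion])
 thus ?thesis by (simp add: linear_sum[OF lin] linear_scale[OF lin] partial_deriv_def scaleR_complex)
qed

text \<open>For a root of squared norm 2 the segment runs from \<open>x\<close> at
  \<open>t = 0\<close> to the reflection of \<open>x\<close> at \<open>t = 1\<close>. The density
  \<open>p\<close> is carried along because differentiating in \<open>x\<close> produces an
  additional factor \<open>t\<close>.\<close>

definition avg :: "(real => real) => real^'n => (real^'n => complex) => real^'n => complex" where
 "avg p a f x = integral (cbox 0 1) (\<lambda>t. cor (p t) * f (x - (t * (x \<bullet> a)) *\<^sub>R a))"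

text \<open>\<open>P\<close> is the property imposed on every derivative. Two instances are used:
  continuity, which gives \<open>C_class\<close>, and bounded continuity, which controls rapidly
  decreasing functions. Closure under \<open>avg\<close> is what keeps reflection quotients in the
  class.\<close>

locale function_space =
 fixes P :: "(real^'n => complex) => bool"
 assumes cont: "P f ==> cts f"
  and add: "P f ==> P g ==> P (\<lambda>x. f x + g x)"
  and mult: "P f ==> P g ==> P (\<lambda>x. f x * g x)"
  and const: "P (\<lambda>x. c)"
  and lin: "P f ==> linear L ==> P (\<lambda>x. f (L x))"
  and average: "P f ==> continuous_on (cbox 0 1) p ==> P (avg p \<alpha> f)"
begin

primrec smooth :: "nat => (real^'n => complex) => bool" where
 "smooth 0 f \<longleftrightarrow> P f"
| "smooth (Suc m) f \<longleftrightarrow> P f \<and> (\<forall>x. f differentiable (at x)) \<and> (\<forall>i. smooth m (partial_deriv i f))"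

lemma smooth_P: "smooth m f ==> P f" by (cases m) auto

lemma smooth_mono: "smooth (Suc m) f ==> smooth m f"
 by (induction m arbitrary: f) (auto simp: smooth_P)

lemma smooth_le: "smooth m f ==> j <= m ==> smooth j f"
 by (induction m) (auto simp: le_Suc_eq dest: smooth_mono simp del: smooth.simps)

lemma smooth_const: "smooth m (\<lambda>x. c)"
proof (induction m arbitrary: c)
 case (Suc m)
 have "partial_deriv i (\<lambda>x::real^'n. c) = (\<lambda>x. 0)" for i by (simp add: partial_deriv_def fun_eq_iff frechet_derivative_const)
 thus ?case using Suc const by simp
qed (simp add: const)

lemma partial_deriv_add:
 assumes "!!x. f differentiable (at x)" "!!x. g differentiable (at x)"
 shows "partial_deriv i (\<lambda>x. f x + g x) = (\<lambda>x. partial_deriv i f x + partial_deriv i g x)"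
proof
 fix x
 have "fderiv (\<lambda>x. f x + g x) x = (\<lambda>v. fderiv f x v + fderiv g x v)"
  using assms by (intro fderiv_eq has_derivative_add) (auto simp: frechet_derivative_works)
 thus "partial_deriv i (\<lambda>x. f x + g x) x = partial_deriv i f x + partial_deriv i g x" by (simp add: partial_deriv_def)
qed

lemma partial_deriv_mult:
 assumes "!!x. f differentiable (at x)" "!!x. g differentiable (at x)"
 shows "partial_deriv i (\<lambda>x. f x * g x) = (\<lambda>x. f x * partial_deriv i g x + partial_deriv i f x * g x)"
proof
 fix x
 have "fderiv (\<lambda>x. f x * g x) x = (\<lambda>v. f x * fderiv g x v + fderiv f x v * g x)"
  using assms by (intro fderiv_eq has_derivative_mult) (auto simp: frechet_derivative_works)
 thus "partial_deriv i (\<lambda>x. f x * g x) x = f x * partial_deriv i g x + partial_deriv i f x * g x" by (simp add: partial_deriv_def)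
qed

lemma smooth_add: "smooth m f ==> smooth m g ==> smooth m (\<lambda>x. f x + g x)"
proof (induction m arbitrary: f g)
 case (Suc m)
 have "partial_deriv i (\<lambda>x. f x + g x) = (\<lambda>x. partial_deriv i f x + partial_deriv i g x)" for i
  by (rule partial_deriv_add) (use Suc.prems in auto)
 thus ?case using Suc by (auto simp: add)
qed (simp add: add)

lemma smooth_mult: "smooth m f ==> smooth m g ==> smooth m (\<lambda>x. f x * g x)"
proof (induction m arbitrary: f g)
 case (Suc m)
 have "partial_deriv i (\<lambda>x. f x * g x) = (\<lambda>x. f x * partial_deriv i g x + partial_deriv i f x * g x)" for i
  by (rule partial_deriv_mult) (use Suc.prems in auto)
 moreover have "smooth m (\<lambda>x. f x * partial_deriv i g x + partial_deriv i f x * g x)" for i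
  using Suc.prems smooth_mono[of m f] smooth_mono[of m g] by (intro smooth_add Suc.IH) auto
 ultimately show ?case using Suc.prems by (auto simp: mult)
qed (simp add: mult)

lemma smooth_cmult: "smooth m f ==> smooth m (\<lambda>x. c * f x)"
 by (rule smooth_mult[OF smooth_const])

lemma smooth_sum: "finite I ==> (!!i. i \<in> I ==> smooth m (f i)) ==> smooth m (\<lambda>x. \<Sum>i\<in>I. f i x)"
 by (induction rule: finite_induct) (auto simp: smooth_const smooth_add)

lemma smooth_frechet: "smooth (Suc m) f ==> smooth m (\<lambda>x. fderiv f x v)"
proof -
 let ?A = "\<lambda>x. \<Sum>i\<in>UNIV. cor (v $ i) * partial_deriv i f x"
 assume f: "smooth (Suc m) f"
 have "(\<lambda>x. fderiv f x v) = ?A"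
  using f by (auto simp: frechet_derivative_partials)
 moreover have "smooth m ?A"
  using f by (intro smooth_sum smooth_cmult) auto
 ultimately show ?thesis by simp
qed

lemma smooth_lin:
 assumes L: "linear L" shows "smooth m f ==> smooth m (\<lambda>x. f (L x))"
proof (induction m arbitrary: f)
 case (Suc m)
 have d: "((\<lambda>x. f (L x)) has_derivative (\<lambda>v. fderiv f (L x) (L v))) (at x)" for x
  by (rule has_derivative_compose[OF linear_imp_has_derivative[OF L]])
   (use Suc.prems in \<open>simp add: frechet_derivative_works\<close>)
 have "partial_deriv i (\<lambda>x. f (L x)) = (\<lambda>x. \<Sum>j\<in>UNIV. cor (L (axis i 1) $ j) * partial_deriv j f (L x))" for i
  unfolding partial_deriv_def[of i] fderiv_eq[OF d]
  using Suc.prems by (auto simp: frechet_derivative_partials)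
 moreover have "smooth m (\<lambda>x. \<Sum>j\<in>UNIV. cor (L (axis i 1) $ j) * partial_deriv j f (L x))" for i
  using Suc.prems by (intro smooth_sum smooth_cmult Suc.IH) auto
 moreover have "(\<lambda>x. f (L x)) differentiable (at x)" for x using d differentiable_def by blast
 ultimately show ?case using Suc.prems by (simp add: lin[OF _ L])
qed (simp add: lin[OF _ L])

lemma avg_derivative:
 assumes f: "smooth (Suc 0) f" and p: "continuous_on (cbox 0 1) p"
 shows "(avg p a f has_derivative (\<lambda>v. integral (cbox 0 1) (\<lambda>t. cor (p t) *
   fderiv f (x - (t * (x \<bullet> a)) *\<^sub>R a) (v - (t * (v \<bullet> a)) *\<^sub>R a)))) (at x)"
proof -
 let ?A = "\<lambda>UNIV. UNIV \<times> cbox 0 1"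
 let ?B = "\<lambda>L z i f. \<Sum>j\<in>UNIV. cor (L (snd z) (axis i 1) $ j) * partial_deriv j f (L (snd z) (fst z))"
 define L where "L t x = x - (t * (x \<bullet> a)) *\<^sub>R a" for t and x :: "real^'n"
 have linL: "linear (L t)" for t unfolding L_def
  by (rule linearI) (simp_all add: inner_add_left algebra_simps)
 define c where "c i z = cor (p (snd z)) * fderiv f (L (snd z) (fst z)) (L (snd z) (axis i 1))" for i and z :: "(real^'n) \<times> real"
 \<comment> \<open>The Leibniz rule asks for a derivative that is continuous in operator norm;
   expanding over the coordinate directions reduces this to continuity of the scalar functions
   \<open>c i\<close>.\<close>
 define F where "F x t = (\<Sum>i\<in>UNIV. blinfun_scaleR_left (c i (x, t)) o\<^sub>L blinfun_inner_left (axis i 1 :: real^'n))" for x t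
 have contL: "continuous_on S (\<lambda>z :: (real^'n) \<times> real. L (snd z) (fst z))" for S
  unfolding L_def by (intro continuous_intros)
 have contL': "continuous_on S (\<lambda>z :: (real^'n) \<times> real. L (snd z) v)" for S v
  unfolding L_def by (intro continuous_intros)
 have contp: "continuous_on (?A UNIV) (\<lambda>z :: (real^'n) \<times> real. p (snd z))"
  by (rule continuous_on_compose2[OF p]) (auto intro: continuous_intros)
 have contf: "cts f" using f cont by auto
 have contc: "continuous_on (?A UNIV) (c i)" for i
 proof -
  have "c i z = cor (p (snd z)) * (?B L z i f)" for z
   unfolding c_def using f by (simp add: frechet_derivative_partials)
  moreover have "continuous_on (?A UNIV) (\<lambda>z. cor (p (snd z)) * (?B L z i f))"
  proof (intro continuous_intros contp contL')
   fix j
   have "cts (partial_deriv j f)" using f cont by auto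
   thus "continuous_on (?A UNIV) (\<lambda>z. partial_deriv j f (L (snd z) (fst z)))"
    by (rule continuous_on_compose2[OF _ contL]) auto
  qed
  ultimately show ?thesis by simp
 qed
 have Fapp: "blinfun_apply (F x t) v = cor (p t) * fderiv f (L t x) (L t v)" for x t v
 proof -
  have "linear (fderiv f (L t x) \<circ> L t)"
   using f by (intro linear_compose linL linear_frechet_derivative) auto
  from linear_sum[OF this, of "\<lambda>i. (v $ i) *\<^sub>R axis i 1" UNIV] linear_scale[OF this]
  have "fderiv f (L t x) (L t (\<Sum>i\<in>UNIV. (v $ i) *\<^sub>R axis i 1)) = (\<Sum>i\<in>UNIV. (v $ i) *\<^sub>R fderiv f (L t x) (L t (axis i 1)))"
   by simp
  hence "fderiv f (L t x) (L t v) = (\<Sum>i\<in>UNIV. (v $ i) *\<^sub>R fderiv f (L t x) (L t (axis i 1)))"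
   using vec_axis_expansion[of v] by simp
  thus ?thesis unfolding F_def c_def
   by (simp add: blinfun.sum_left inner_axis sum_distrib_left scaleR_complex algebra_simps)
 qed
 have "((\<lambda>x. integral (cbox 0 1) (\<lambda>t. cor (p t) * f (L t x))) has_derivative blinfun_apply (integral (cbox 0 1) (F x))) (at x within UNIV)"
 proof (rule leibniz_rule)
  fix x t
  have "((\<lambda>x. f (L t x)) has_derivative (\<lambda>v. fderiv f (L t x) (L t v))) (at x)"
   by (rule has_derivative_compose[OF linear_imp_has_derivative[OF linL]])
   (use f in \<open>simp add: frechet_derivative_works\<close>)
  from has_derivative_mult_right[OF this, of "cor (p t)"]
  show "((\<lambda>x. cor (p t) * f (L t x)) has_derivative blinfun_apply (F x t)) (at x within UNIV)"
   by (simp add: Fapp[abs_def])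
  show "(\<lambda>t. cor (p t) * f (L t x)) integrable_on cbox 0 1"
  proof (intro integrable_continuous continuous_intros p)
   have "continuous_on (cbox 0 1) (\<lambda>t. L t x)" unfolding L_def by (intro continuous_intros)
   thus "continuous_on (cbox 0 1) (\<lambda>t. f (L t x))" by (rule continuous_on_compose2[OF contf]) auto
  qed
 next
  have "continuous_on (?A UNIV) (\<lambda>z. \<Sum>i\<in>UNIV. blinfun_scaleR_left (c i z) o\<^sub>L blinfun_inner_left (axis i 1 :: real^'n))"
   by (intro continuous_on_sum bounded_bilinear.continuous_on[OF bounded_bilinear_blinfun_compose]
     bounded_linear.continuous_on[OF bounded_linear_blinfun_scaleR_left] contc continuous_on_const)
  thus "continuous_on (?A UNIV) (\<lambda>(x, t). F x t)"
   by (simp add: F_def case_prod_unfold)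
 qed auto
 moreover have "blinfun_apply (integral (cbox 0 1) (F x)) = (\<lambda>v. integral (cbox 0 1) (\<lambda>t. cor (p t) * fderiv f (L t x) (L t v)))"
 proof
  fix v
  have "continuous_on (cbox 0 1) (F x)"
  proof -
   have "continuous_on (cbox 0 1) (\<lambda>t. c i (x, t))" for i
    by (rule continuous_on_compose2[OF contc[of i]]) (auto intro: continuous_intros)
   thus ?thesis unfolding F_def
    by (intro continuous_on_sum bounded_bilinear.continuous_on[OF bounded_bilinear_blinfun_compose]
     bounded_linear.continuous_on[OF bounded_linear_blinfun_scaleR_left] continuous_on_const)
  qed
  hence "F x integrable_on cbox 0 1" by (rule integrable_continuous)
  from blinfun_apply_integral[OF this, of v]
  show "blinfun_apply (integral (cbox 0 1) (F x)) v = integral (cbox 0 1) (\<lambda>t. cor (p t) * fderiv f (L t x) (L t v))"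
   by (simp add: Fapp)
 qed
 ultimately show ?thesis unfolding avg_def[abs_def] L_def by simp
qed

lemma avg_integrable:
 assumes "cts f" "continuous_on (cbox 0 1) p"
 shows "(\<lambda>t. cor (p t) * f (x - (t * (x \<bullet> a)) *\<^sub>R a)) integrable_on cbox 0 1"
proof (intro integrable_continuous continuous_intros assms(2))
 have "continuous_on (cbox 0 1) (\<lambda>t. x - (t * (x \<bullet> a)) *\<^sub>R a)" by (intro continuous_intros)
 thus "continuous_on (cbox 0 1) (\<lambda>t. f (x - (t * (x \<bullet> a)) *\<^sub>R a))" by (rule continuous_on_compose2[OF assms(1)]) auto
qed

lemma smooth_avg: "smooth m f ==> continuous_on (cbox 0 1) p ==> smooth m (avg p a f)"
proof (induction m arbitrary: f p)
 case (Suc m)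
 have f1: "smooth (Suc 0) f" using smooth_le[OF Suc.prems(1), of "Suc 0"] by simp
 note d = avg_derivative[OF f1 Suc.prems(2)]
 have tp: "continuous_on (cbox 0 1) (\<lambda>t. t * p t)" by (intro continuous_intros Suc.prems)
 have sf: "smooth m (\<lambda>x. fderiv f x v)" for v by (rule smooth_frechet[OF Suc.prems(1)])
 have cf: "cts (\<lambda>x. fderiv f x v)" for v using smooth_P[OF sf] cont by blast
 have "partial_deriv i (avg p a f) = (\<lambda>x. avg p a (\<lambda>x. fderiv f x (axis i 1)) x
   + cor (- (axis i 1 \<bullet> a)) * avg (\<lambda>t. t * p t) a (\<lambda>x. fderiv f x a) x)" for i
 proof
  fix x
  have "linear (fderiv f y)" for y using Suc.prems by (intro linear_frechet_derivative) auto
  hence eq: "cor (p t) * fderiv f (x - (t * (x \<bullet> a)) *\<^sub>R a) (axis i 1 - (t * (axis i 1 \<bullet> a)) *\<^sub>R a)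
   = cor (p t) * fderiv f (x - (t * (x \<bullet> a)) *\<^sub>R a) (axis i 1) +
   cor (- (axis i 1 \<bullet> a)) * (cor (t * p t) * fderiv f (x - (t * (x \<bullet> a)) *\<^sub>R a) a)" for t
   by (simp add: linear_diff linear_scale scaleR_complex algebra_simps del: of_real_mult) (simp add: algebra_simps)
  show "partial_deriv i (avg p a f) x = avg p a (\<lambda>x. fderiv f x (axis i 1)) x
   + cor (- (axis i 1 \<bullet> a)) * avg (\<lambda>t. t * p t) a (\<lambda>x. fderiv f x a) x"
   unfolding partial_deriv_def fderiv_eq[OF d] eq avg_def
   by (subst integral_add)
    (simp_all only: integral_mult_right avg_integrable[OF cf] Suc.prems(2) tp integrable_on_mult_right)
 qed
 moreover have "smooth m (\<lambda>x. avg p a (\<lambda>x. fderiv f x (axis i 1)) x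
   + cor (- (axis i 1 \<bullet> a)) * avg (\<lambda>t. t * p t) a (\<lambda>x. fderiv f x a) x)" for i
  by (intro smooth_add smooth_cmult Suc.IH sf Suc.prems tp)
 moreover have "avg p a f differentiable (at x)" for x using d differentiable_def by blast
 moreover have "P (avg p a f)" using Suc.prems by (intro average) auto
 ultimately show ?case by simp
qed (simp add: average)

end

section \<open>Reflection quotients as averages of derivatives: the loss of regularity under Dunkl
  operators\<close>

context dunkl begin

text \<open>The fundamental theorem of calculus on the segment from \<open>x\<close> to its
  reflection. It removes the singularity at the wall: being an average of a derivative, the quotient
  costs one order of differentiability and no more.\<close>

lemma reflection_quotient_avg:
 assumes f: "!!x. f differentiable (at x)" and c: "cts (\<lambda>x. fderiv f x b)" and a: "b \<in> R"
 shows "rquot b f x = avg (\<lambda>_. 1) b (\<lambda>x. fderiv f x b) x"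
proof (cases "b \<bullet> x = 0")
 case True
 thus ?thesis using a by (simp add: reflection_quotient_root avg_def inner_commute)
next
 let ?A = "\<lambda>x t s. x - (t * s) *\<^sub>R b"
 case False
 define s where "s = x \<bullet> b"
 define h where "h t = f (?A x t s)" for t
 have lin: "linear (fderiv f y)" for y using f by (intro linear_frechet_derivative) auto
 have "(h has_vector_derivative (- s) *\<^sub>R fderiv f (?A x t s) b) (at t within S)" for t S
 proof -
  have 1: "((\<lambda>t. x - (t * s) *\<^sub>R b) has_derivative (\<lambda>u. u *\<^sub>R ((- s) *\<^sub>R b))) (at t within S)"
   by (auto intro!: derivative_eq_intros)
  have "(h has_derivative (\<lambda>u. fderiv f (?A x t s) (u *\<^sub>R ((- s) *\<^sub>R b)))) (at t within S)"
   unfolding h_def by (rule has_derivative_compose[OF 1]) (use f in \<open>simp add: frechet_derivative_works\<close>)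
  thus ?thesis unfolding has_vector_derivative_def by (simp only: linear_scale[OF lin])
 qed
 hence "((\<lambda>t. (- s) *\<^sub>R fderiv f (?A x t s) b) has_integral (h 1 - h 0)) {0..1}"
  by (intro fundamental_theorem_of_calculus) auto
 moreover have "h 1 - h 0 = - (f x - f (\<sigma> b x))" by (simp add: h_def s_def reflection_root[OF a])
 ultimately have "integral {0..1} (\<lambda>t. (- s) *\<^sub>R fderiv f (?A x t s) b) = - (f x - f (\<sigma> b x))"
  by (metis integral_unique)
 hence "s *\<^sub>R integral {0..1} (\<lambda>t. fderiv f (?A x t s) b) = f x - f (\<sigma> b x)"
  by (simp add: integral_cmul) (simp add: algebra_simps)
 hence "cor s * avg (\<lambda>_. 1) b (\<lambda>x. fderiv f x b) x = f x - f (\<sigma> b x)"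
  by (simp add: avg_def s_def cbox_interval scaleR_complex)
 thus ?thesis using False a by (simp add: reflection_quotient_root s_def inner_commute field_simps)
qed

lemma dunkl_op_smooth_in:
 assumes fs: "function_space P" and f: "function_space.smooth P (Suc m) f"
 shows "b \<in> R ==> function_space.smooth P m (rquot b f)"
  and "function_space.smooth P m (T q f)"
proof -
 interpret function_space P by (rule fs)
 have d: "f differentiable (at x)" for x using f by simp
 have 1: "smooth m (rquot b f)" if a: "b \<in> R" for b
 proof -
  have sf: "smooth m (\<lambda>x. fderiv f x b)" by (rule smooth_frechet[OF f])
  have "rquot b f = avg (\<lambda>_. 1) b (\<lambda>x. fderiv f x b)"
   using reflection_quotient_avg[OF d cont[OF smooth_P[OF sf]] a] by blast
  thus ?thesis using smooth_avg[OF sf] by simp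
 qed
 thus "b \<in> R ==> smooth m (rquot b f)" .
 show "smooth m (T q f)"
  unfolding dunkl_op_def[abs_def] using f by (intro smooth_add smooth_frechet smooth_sum smooth_cmult 1) auto
qed

end

interpretation cont_space: function_space "cts :: (real^'n => complex) => bool"
proof
 let ?A = "UNIV \<times> cbox 0 1"
 fix f :: "real^'n => complex" and p :: "real => real" and \<alpha> assume f: "cts f" and p: "continuous_on (cbox 0 1) p"
 have "continuous_on ?A (\<lambda>(x, t). cor (p t) * f (x - (t * (x \<bullet> \<alpha>)) *\<^sub>R \<alpha>))"
  unfolding case_prod_unfold
 proof (intro continuous_intros)
  show "continuous_on ?A (\<lambda>z :: (real^'n) \<times> real. p (snd z))"
   by (rule continuous_on_compose2[OF p]) (auto intro: continuous_intros)
  have "continuous_on ?A (\<lambda>z :: (real^'n) \<times> real. fst z - (snd z * (fst z \<bullet> \<alpha>)) *\<^sub>R \<alpha>)"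
   by (intro continuous_intros)
  thus "continuous_on ?A (\<lambda>z :: (real^'n) \<times> real. f (fst z - (snd z * (fst z \<bullet> \<alpha>)) *\<^sub>R \<alpha>))"
   by (rule continuous_on_compose2[OF f]) auto
 qed
 thus "cts (avg p \<alpha> f)" unfolding avg_def[abs_def] by (rule integral_continuous_on_param)
next
 fix f :: "real^'n => complex" and L :: "real^'n => real^'n" assume "cts f" "linear L"
 thus "cts (\<lambda>x. f (L x))"
  using continuous_on_compose2[OF _ linear_continuous_on[OF linear_conv_bounded_linear[THEN iffD1]], of UNIV f L UNIV] by simp
qed (auto intro: continuous_intros)

lemma C_class_smooth: "C_class m f \<longleftrightarrow> cont_space.smooth m f"
proof (induction m arbitrary: f)
 case (Suc m)
 have "cts f" if "\<forall>x. f differentiable (at x)"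
  using that by (simp add: differentiable_imp_continuous_on differentiable_on_def differentiable_at_withinI)
 thus ?case using Suc by auto
qed simp

section \<open>Integration by parts\<close>

lemma integral_lborel_shift:
 fixes f :: "'a::euclidean_space => 'b::{banach, second_countable_topology}"
 assumes [measurable]: "f \<in> borelm"
 shows "(LINT x|lborel. f (x + v)) = (LINT x|lborel. f x)"
proof -
 have "(LINT x|distr lborel borel ((+) v). f x) = (LINT x|lborel. f (v + x))"
  by (rule integral_distr) auto
 thus ?thesis by (simp add: lborel_distr_plus add.commute)
qed

text \<open>Dominated convergence with a parameter in a normed space. Neither measurability nor
  integrability of the derivative is assumed: it is a pointwise limit of difference quotients along
  a sequence and is dominated by \<open>b\<close>.\<close>

lemma has_derivative_integral:
 fixes f :: "'v::{real_normed_vector, perfect_space} => 'a => 'b::{banach, second_countable_topology}"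
 assumes \<delta>: "\<delta> > 0" and int: "!!x. x \<in> ball a \<delta> ==> integrable M (f x)"
  and der: "!!x w. x \<in> ball a \<delta> ==> ((\<lambda>x. f x w) has_derivative f' x w) (at x)"
  and bound: "!!x w v. x \<in> ball a \<delta> ==> norm (f' x w v) <= b w * norm v" and b: "integrable M b"
 shows "((\<lambda>x. LINT w|M. f x w) has_derivative (\<lambda>v. LINT w|M. f' a w v)) (at a)"
  and "integrable M (\<lambda>w. f' a w v)"
proof -
 let ?A = "\<lambda>M h D. (LINT w|M. f (a + h) w) - (LINT w|M. f a w) - D h"
 let ?B = "\<lambda>v. v /\<^sub>R norm v"
 have lin: "linear (f' a w)" for w using has_derivative_linear[OF der] \<delta> by simp
 have diff: "norm (f (a + h) w - f a w) <= b w * norm h" if "norm h < \<delta>" for h w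
 proof -
  have "norm (f (a + h) w - f a w) <= b w * norm ((a + h) - a)"
  proof (rule differentiable_bound[where S="ball a \<delta>" and f="\<lambda>x. f x w" and f'="\<lambda>x. f' x w"])
   fix x assume x: "x \<in> ball a \<delta>"
   show "((\<lambda>x. f x w) has_derivative f' x w) (at x within ball a \<delta>)" by (rule has_derivative_at_withinI[OF der[OF x]])
   show "onorm (f' x w) <= b w" by (rule onorm_le) (rule bound[OF x])
  qed (use that \<delta> in \<open>auto simp: dist_norm\<close>)
  thus ?thesis by simp
 qed
 define q where "q h w = (f (a + h) w - f a w - f' a w h) /\<^sub>R norm h" for h w
 have q0: "(\<lambda>n. q (s n) w) \<longlonglongrightarrow> 0" if "\<forall>n. s n \<noteq> 0" "s \<longlonglongrightarrow> 0" for s w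
 proof (rule tendsto_norm_zero_cancel)
  have "((\<lambda>h. norm (f (a + h) w - f a w - f' a w h) / norm h) \<longlongrightarrow> 0) (at 0)"
   using der[of a w] \<delta> unfolding has_derivative_at by simp
  thus "(\<lambda>n. norm (q (s n) w)) \<longlonglongrightarrow> 0"
   using that unfolding tendsto_at_iff_sequentially comp_def q_def norm_scaleR by (simp add: divide_real_def mult.commute)
 qed
 show di: "integrable M (\<lambda>w. f' a w v)" for v
 proof (cases "v = 0")
  case True thus ?thesis using linear_0[OF lin] by simp
 next
  case False
  \<comment> \<open>The factor \<open>\<delta> / 2 / norm v\<close> keeps \<open>a + s n\<close>
    inside the ball on which the hypotheses hold.\<close>
  define \<tau> where "\<tau> n = \<delta> / 2 / norm v * (1 / real (Suc n))" for n
  define s where "s n = \<tau> n *\<^sub>R v" for n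
  have \<tau>: "\<tau> n > 0" for n using \<delta> False by (simp add: \<tau>_def)
  have s: "\<forall>n. s n \<noteq> 0" using \<tau> False by (simp add: s_def less_imp_neq[THEN not_sym])
  have sn: "norm (s n) = \<tau> n * norm v" for n using \<tau>[of n] by (simp add: s_def)
  have "\<tau> \<longlonglongrightarrow> \<delta> / 2 / norm v * 0"
   unfolding \<tau>_def by (intro tendsto_mult tendsto_const LIMSEQ_inverse_real_of_nat[unfolded inverse_eq_divide])
  hence s0: "s \<longlonglongrightarrow> 0" unfolding s_def by (intro tendsto_eq_intros) auto
  have sb: "a + s n \<in> ball a \<delta>" for n
  proof -
   have "norm (s n) = \<delta> / 2 * (1 / real (Suc n))" unfolding sn \<tau>_def using False by simp
   also have "\<dots> <= \<delta> / 2 * 1" using \<delta> by (intro mult_left_mono) auto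
   finally show ?thesis using \<delta> by (simp add: dist_norm)
  qed
  define d where "d n w = (f (a + s n) w - f a w) /\<^sub>R norm (s n)" for n w
  have "(\<lambda>n. d n w) \<longlonglongrightarrow> f' a w (?B v)" for w
  proof -
   have "f' a w (s n) /\<^sub>R norm (s n) = f' a w (?B v)" for n
    using \<tau>[of n] unfolding sn by (simp add: s_def linear_scale[OF lin])
   hence "d n w = q (s n) w + f' a w (?B v)" for n
    unfolding q_def scaleR_diff_right d_def by simp
   thus ?thesis using tendsto_add[OF q0[OF s s0, of w] tendsto_const] by simp
  qed
  moreover have "d n \<in> borel_measurable M" for n
   unfolding d_def using int[OF sb] int[of a] \<delta> by simp
  ultimately have "(\<lambda>w. f' a w (?B v)) \<in> borel_measurable M" by (rule borel_measurable_LIMSEQ_metric[rotated])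
  hence "(\<lambda>w. norm v *\<^sub>R f' a w (?B v)) \<in> borel_measurable M" by simp
  hence "(\<lambda>w. f' a w v) \<in> borel_measurable M"
   using False unfolding linear_scale[OF lin, symmetric] by simp
  moreover have "norm (f' a w v) <= norm (b w * norm v)" for w
   unfolding real_norm_def using \<delta> by (intro order_trans[OF bound abs_ge_self]) simp
  ultimately show ?thesis
   by (rule_tac Bochner_Integration.integrable_bound[of M "\<lambda>w. b w * norm v"]) (use b in auto)
 qed
 define D where "D v = (LINT w|M. f' a w v)" for v
 have "((\<lambda>h. norm (?A M h D) / norm h) \<longlongrightarrow> 0) (at 0)"
  unfolding tendsto_at_iff_sequentially comp_def
 proof (intro allI impI)
  fix s :: "nat => 'v" assume s: "\<forall>i. s i \<in> UNIV - {0}" "s \<longlonglongrightarrow> 0"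
  have "\<forall>\<^sub>F n in sequentially. norm (s n) < \<delta>" using s(2) \<delta> by (auto simp: tendsto_iff)
  then obtain n0 where "\<forall>n\<ge>n0. norm (s n) < \<delta>" by (auto simp: eventually_sequentially)
  hence n0: "norm (s (n + n0)) < \<delta>" for n by simp
  have fi: "integrable M (f (a + s (n + n0)))" "integrable M (f a)" for n using int n0 \<delta> by (auto simp: dist_norm)
  have "(\<lambda>n. LINT w|M. q (s (n + n0)) w) \<longlonglongrightarrow> (LINT w|M. 0)"
  proof (rule integral_dominated_convergence[where w="\<lambda>w. 2 * b w"])
   show "AE w in M. (\<lambda>n. q (s (n + n0)) w) \<longlonglongrightarrow> 0"
    using s by (intro AE_I2 q0 LIMSEQ_ignore_initial_segment) auto
   show "AE w in M. norm (q (s (n + n0)) w) <= 2 * b w" for n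
   proof (rule AE_I2)
    fix w
    have "norm (f (a + s (n + n0)) w - f a w - f' a w (s (n + n0))) <= b w * norm (s (n + n0)) + b w * norm (s (n + n0))"
     by (rule order_trans[OF norm_triangle_ineq4 add_mono[OF diff[OF n0] bound]]) (use \<delta> in simp)
    thus "norm (q (s (n + n0)) w) <= 2 * b w"
     using s(1) unfolding q_def norm_scaleR by (simp add: field_simps)
   qed
   show "(\<lambda>w. q (s (n + n0)) w) \<in> borel_measurable M" for n
    unfolding q_def using fi(1)[of n] fi(2) di by simp
  qed (use b in auto)
  moreover have "norm (?A M h D) / norm h = norm (LINT w|M. q h w)" if "norm h < \<delta>" for h
  proof -
   have "(LINT w|M. q h w) = (?A M h D) /\<^sub>R norm h"
    unfolding q_def D_def using int[of "a + h"] int[of a] di \<delta> that by (simp add: dist_norm)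
   thus ?thesis by (simp only: norm_scaleR) (simp add: divide_real_def)
  qed
  ultimately have "(\<lambda>n. norm ((LINT w|M. f (a + s (n + n0)) w) - (LINT w|M. f a w) - D (s (n + n0))) / norm (s (n + n0))) \<longlonglongrightarrow> 0"
   using n0 by (simp add: tendsto_norm_zero)
  thus "(\<lambda>n. norm ((LINT w|M. f (a + s n) w) - (LINT w|M. f a w) - D (s n)) / norm (s n)) \<longlonglongrightarrow> 0" by (rule LIMSEQ_offset)
 qed
 moreover have "bounded_linear D"
 proof (rule bounded_linear_intro[where K="LINT w|M. b w"])
  show "D (u + v) = D u + D v" for u v using di by (simp add: D_def linear_add[OF lin])
  show "D (r *\<^sub>R v) = r *\<^sub>R D v" for r v by (simp add: D_def linear_scale[OF lin])
  show "norm (D v) <= norm v * (LINT w|M. b w)" for v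
  proof -
   have "norm (D v) <= (LINT w|M. b w * norm v)"
    unfolding D_def using bound[of a] \<delta> b di
    by (intro order_trans[OF integral_norm_bound] integral_mono integrable_norm) auto
   thus ?thesis by (simp add: mult.commute)
  qed
 qed
 ultimately show "((\<lambda>x. LINT w|M. f x w) has_derivative (\<lambda>v. LINT w|M. f' a w v)) (at a)"
  unfolding has_derivative_at D_def[abs_def] by blast
qed

lemma frechet_derivative_outside_support:
 fixes f :: "real^'n => complex"
 assumes "!!x. norm x > r ==> f x = 0" "norm x > r"
 shows "fderiv f x v = 0"
proof -
 have "((\<lambda>x. 0) has_derivative (\<lambda>_. 0)) (at x)" by simp
 hence "(f has_derivative (\<lambda>_. 0)) (at x)"
 proof (rule has_derivative_transform_within_open)
  show "open (- cball 0 r :: (real^'n) set)" by (simp add: open_Compl)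
 qed (use assms in auto)
 from fderiv_eq[OF this] show ?thesis by simp
qed

lemma compact_support_bounded:
 fixes f :: "real^'n => complex"
 assumes "cts f" "!!x. norm x > r ==> f x = 0"
 obtains B where "B >= 0" "!!x. norm (f x) <= B"
proof -
 have "bounded (f ` cball 0 r)"
  by (intro compact_imp_bounded compact_continuous_image continuous_on_subset[OF assms(1)]) auto
 then obtain B where B: "!!x. norm x <= r ==> norm (f x) <= B" unfolding bounded_iff by force
 show ?thesis
 proof (rule that[of "max B 0"])
  show "norm (f x) <= max B 0" for x using B[of x] assms(2)[of x] by (cases "norm x <= r") auto
 qed simp
qed

lemma integrable_lborel_compact_support:
 fixes f :: "real^'n => complex"
 assumes "cts f" "!!x. norm x > r ==> f x = 0"
 shows "integrable lborel f"
proof -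
 let ?A = "\<lambda>x. indicator (cball 0 r) x *\<^sub>R f x"
 have "integrable lborel ?A"
  by (rule borel_integrable_compact) (auto intro: continuous_on_subset[OF assms(1)])
 also have "?A = f"
  using assms(2) by (auto simp: fun_eq_iff indicator_def)
 finally show ?thesis .
qed

text \<open>By translation invariance the integral of \<open>f (x + t *\<^sub>R w)\<close> does not
  depend on \<open>t\<close>; its derivative at \<open>t = 0\<close> is taken under the
  integral.\<close>

lemma integral_derivative_zero:
 fixes f :: "real^'n => complex"
 assumes f: "!!x. f differentiable (at x)" and c: "cts (\<lambda>x. fderiv f x w)"
  and supp: "!!x. norm x > r ==> f x = 0"
 shows "(LINT x|lborel. fderiv f x w) = 0"
proof -
 let ?A = "\<lambda>x t. x + t *\<^sub>R w"
 have cf: "cts f"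
  using f by (simp add: differentiable_imp_continuous_on differentiable_on_def differentiable_at_withinI)
 obtain B where B: "B >= 0" "!!x. norm (fderiv f x w) <= B"
  by (rule compact_support_bounded[OF c frechet_derivative_outside_support[OF supp]]) (assumption | rule that)+
 define b where "b x = B * indicator (cball 0 (r + norm w)) x" for x :: "real^'n"
 have b: "integrable lborel b"
  unfolding b_def by (intro integrable_mult_right integrable_real_indicator emeasure_bounded_finite) auto
 have int: "integrable lborel (\<lambda>x. f (x + v))" for v
 proof (rule integrable_lborel_compact_support[where r="r + norm v"])
  show "cts (\<lambda>x. f (x + v))"
   by (rule continuous_on_compose2[OF cf]) (auto intro!: continuous_intros)
  show "f (x + v) = 0" if "norm x > r + norm v" for x
   using that norm_triangle_ineq4[of "x + v" v] by (intro supp) simp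
 qed
 have "((\<lambda>t. LINT x|lborel. f (?A x t)) has_derivative (\<lambda>s. LINT x|lborel. s *\<^sub>R fderiv f (x + 0 *\<^sub>R w) w)) (at 0)"
 proof (rule has_derivative_integral(1)[where \<delta>=1 and b=b])
  fix t :: real and x assume t: "t \<in> ball 0 1"
  have "((\<lambda>t. f (?A x t)) has_derivative (\<lambda>s. fderiv f (?A x t) (s *\<^sub>R w))) (at t)"
  proof (rule has_derivative_compose[where g=f])
   show "((\<lambda>t. x + t *\<^sub>R w) has_derivative (\<lambda>s. s *\<^sub>R w)) (at t)" by (auto intro!: derivative_eq_intros)
  qed (use f in \<open>simp add: frechet_derivative_works\<close>)
  thus "((\<lambda>t. f (?A x t)) has_derivative (\<lambda>s. s *\<^sub>R fderiv f (?A x t) w)) (at t)"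
   by (simp only: linear_scale[OF linear_frechet_derivative[OF f]])
  have "norm (fderiv f (?A x t) w) <= b x"
  proof (cases "norm x <= r + norm w")
   case False
   have "norm (t *\<^sub>R w) <= norm w" using t by (simp add: mult_left_le_one_le)
   hence "norm (?A x t) > r" using False norm_triangle_ineq4[of "x + t *\<^sub>R w" "t *\<^sub>R w"] by simp
   thus ?thesis using False frechet_derivative_outside_support[of r f] supp by (simp add: b_def)
  qed (simp add: b_def B)
  thus "norm (s *\<^sub>R fderiv f (?A x t) w) <= b x * norm s" for s
   by (simp add: mult.commute[of "b x"] mult_left_mono)
 qed (use int b in auto)
 moreover have "(LINT x|lborel. f (x + v)) = (LINT x|lborel. f x)" for v
  using borel_measurable_integrable[OF int[of 0]] by (intro integral_lborel_shift) simp
 ultimately have "((\<lambda>t :: real. LINT x|lborel. f x) has_derivative (\<lambda>s. LINT x|lborel. s *\<^sub>R fderiv f x w)) (at 0)" by simp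
 from has_derivative_unique[OF this has_derivative_const] show ?thesis by (auto dest: fun_cong[of _ _ 1])
qed

section \<open>Regularised weights and the vanishing integral of a Dunkl derivative\<close>

context dunkl begin

text \<open>A smooth invariant approximation of \<open>weight\<close>, tending to it off the walls
  as \<open>\<delta>\<close> tends to 0. The weight itself need not be differentiable at a wall when
  its exponent is small.\<close>

definition reg_weight :: "real => real^'n => real" where
 "reg_weight \<delta> x = exp (\<Sum>a\<in>R. k a / 2 * ln ((a \<bullet> x)\<^sup>2 + \<delta>\<^sup>2))"

lemma reg_weight_derivative:
 assumes "\<delta> \<noteq> 0"
 shows "(reg_weight \<delta> has_derivative (\<lambda>v. reg_weight \<delta> x * (\<Sum>a\<in>R. k a * (a \<bullet> v) * ((a \<bullet> x) / ((a \<bullet> x)\<^sup>2 + \<delta>\<^sup>2))))) (at x)"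
proof -
 let ?A = "\<lambda>a x. (a \<bullet> x)\<^sup>2 + \<delta>\<^sup>2"
 let ?B = "\<lambda>a x. \<lambda>v. k a / 2 * ((2 * (a \<bullet> x) * (a \<bullet> v)) * inverse (?A a x))"
 let ?C = "\<lambda>a x. \<lambda>v. k a * (a \<bullet> v) * ((a \<bullet> x) / (?A a x))"
 have pos: "(a \<bullet> x)\<^sup>2 + \<delta>\<^sup>2 > 0" for a using assms by (simp add: add_nonneg_pos)
 have "((\<lambda>x. k a / 2 * ln (?A a x)) has_derivative (?C a x)) (at x)" for a
 proof -
  have "((\<lambda>x. (a \<bullet> x)\<^sup>2 + \<delta>\<^sup>2) has_derivative (\<lambda>v. 2 * (a \<bullet> x) * (a \<bullet> v))) (at x)"
   by (auto intro!: derivative_eq_intros)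
  hence "((\<lambda>x. ln (?A a x)) has_derivative (\<lambda>v. (2 * (a \<bullet> x) * (a \<bullet> v)) * inverse (?A a x))) (at x)"
   by (rule DERIV_compose_FDERIV[where f=ln and g="\<lambda>x. (a \<bullet> x)\<^sup>2 + \<delta>\<^sup>2" and x=x, OF DERIV_ln[OF pos[of a]]])
  hence "((\<lambda>x. k a / 2 * ln (?A a x)) has_derivative (?B a x)) (at x)"
   by (rule has_derivative_mult_right)
  thus ?thesis
  proof (rule has_derivative_eq_rhs)
   show "(?B a x) = (?C a x)"
    by (rule ext) (simp only: divide_inverse mult_ac, simp)
  qed
 qed
 hence "((\<lambda>x. \<Sum>a\<in>R. k a / 2 * ln (?A a x)) has_derivative (\<lambda>v. \<Sum>a\<in>R. k a * (a \<bullet> v) * ((a \<bullet> x) / (?A a x)))) (at x)"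
  by (rule has_derivative_sum)
 from has_derivative_exp[OF this]
 show ?thesis unfolding reg_weight_def[abs_def] by (simp only: mult.commute)
qed

lemma reg_weight_invariant: "a \<in> R ==> reg_weight \<delta> (\<sigma> a x) = reg_weight \<delta> x"
 unfolding reg_weight_def
 using sum_R_reflection[OF group_reflection, of a "\<lambda>b. k b / 2 * ln ((b \<bullet> x)\<^sup>2 + \<delta>\<^sup>2)"]
 by (simp add: k_reflection reflection_swap)

lemma reg_weight_continuous:
 assumes "\<delta> \<noteq> 0" shows "continuous_on S (reg_weight \<delta>)"
proof -
 have "(a \<bullet> x)\<^sup>2 + \<delta>\<^sup>2 \<noteq> 0" for a x :: "real^'n" using assms by (simp add: add_nonneg_eq_0_iff)
 thus ?thesis unfolding reg_weight_def by (intro continuous_intros) auto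
qed

lemma reg_weight_bound:
 assumes "0 < \<delta>" "\<delta> <= 1" "norm x <= r"
 shows "0 <= reg_weight \<delta> x" "reg_weight \<delta> x <= exp (\<Sum>b\<in>R. k b / 2 * ln ((2 * r)\<^sup>2 + 1))"
proof -
 show "reg_weight \<delta> x <= exp (\<Sum>b\<in>R. k b / 2 * ln ((2 * r)\<^sup>2 + 1))"
  unfolding reg_weight_def exp_le_cancel_iff
 proof (intro sum_mono mult_left_mono)
  fix b assume a: "b \<in> R"
  have "\<bar>b \<bullet> x\<bar> <= 2 * r" using inner_root_le[OF a, of x] assms(3) by (simp add: inner_commute)
  hence "(b \<bullet> x)\<^sup>2 <= (2 * r)\<^sup>2" unfolding abs_le_square_iff[symmetric] by linarith
  moreover have "\<delta>\<^sup>2 <= 1" using assms by (simp add: power_le_one)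
  moreover have "0 < (b \<bullet> x)\<^sup>2 + \<delta>\<^sup>2" using assms by (simp add: add_nonneg_pos)
  ultimately show "ln ((b \<bullet> x)\<^sup>2 + \<delta>\<^sup>2) <= ln ((2 * r)\<^sup>2 + 1)" by (subst ln_le_cancel_iff) auto
 qed (use k_nonneg in auto)
qed (simp add: reg_weight_def)

lemma reg_weight_tendsto:
 assumes x: "\<forall>a\<in>R. x \<bullet> a \<noteq> 0" and t: "t \<longlonglongrightarrow> (0::real)"
 shows "(\<lambda>n. reg_weight (t n) x) \<longlonglongrightarrow> weight x"
proof -
 let ?A = "\<Sum>a\<in>R. k a / 2 * ln ((a \<bullet> x)\<^sup>2 + 0\<^sup>2)"
 have "(\<lambda>n. reg_weight (t n) x) \<longlonglongrightarrow> exp ?A"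
  unfolding reg_weight_def
  using x by (intro tendsto_exp tendsto_sum tendsto_mult tendsto_const tendsto_ln tendsto_add tendsto_power t) (auto simp: inner_commute)
 also have "exp ?A = weight x"
  unfolding weight_def exp_sum[OF finite_R]
 proof (rule prod.cong[OF refl])
  fix a assume "a \<in> R"
  hence ne: "\<bar>x \<bullet> a\<bar> > 0" using x by auto
  have "ln ((a \<bullet> x)\<^sup>2 + 0\<^sup>2) = 2 * ln \<bar>x \<bullet> a\<bar>"
   using ln_realpow[of "\<bar>x \<bullet> a\<bar>" 2] by (simp add: inner_commute)
  thus "exp (k a / 2 * ln ((a \<bullet> x)\<^sup>2 + 0\<^sup>2)) = \<bar>x \<bullet> a\<bar> powr k a"
   using ne by (simp add: powr_def)
 qed
 finally show ?thesis .
qed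

lemma C1_D:
 assumes "C_class 1 f"
 shows "f differentiable (at x)" "cts f" "cts (\<lambda>x. fderiv f x v)"
  "a \<in> R ==> cts (rquot a f)" "cts (T q f)"
proof -
 have s: "cont_space.smooth (Suc 0) f" using assms C_class_smooth[of "Suc 0" f] by simp
 show "f differentiable (at x)" "cts f" using s by simp_all
 show "cts (\<lambda>x. fderiv f x v)" using cont_space.smooth_frechet[OF s] by simp
 show "a \<in> R ==> cts (rquot a f)" "cts (T q f)"
  using dunkl_op_smooth_in[OF cont_space.function_space_axioms s] by simp_all
qed

lemma supported_dunkl:
 assumes supp: "!!x. norm x > r ==> f x = 0" and x: "norm x > r"
 shows "a \<in> R ==> rquot a f x = 0" "T q f x = 0"
proof -
 have fd: "fderiv f x v = 0" for v using frechet_derivative_outside_support[of r f] supp x by blast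
 show 1: "rquot a f x = 0" if "a \<in> R" for a
  using that fd supp[of x] supp[of "\<sigma> a x"] x by (simp add: reflection_quotient_root)
 show "T q f x = 0" unfolding dunkl_op_def using 1 fd by simp
qed

lemma integral_lborel_reflection:
 fixes f :: "real^'n => complex"
 assumes "a \<in> R" and [measurable]: "f \<in> borelm"
 shows "(LINT x|lborel. f (\<sigma> a x)) = (LINT x|lborel. f x)"
proof -
 let ?A = "\<lambda>A. \<integral>\<^sup>+x. indicator A (\<sigma> a x) \<partial>lborel"
 let ?B = "distr lborel borel (\<sigma> a)"
 have [measurable]: "\<sigma> a \<in> borelm"
  by (rule borel_measurable_continuous_onI[OF linear_continuous_on[OF linear_conv_bounded_linear[THEN iffD1, OF reflection_linear]]])
 have "distr lborel borel (\<sigma> a) = (lborel :: (real^'n) measure)"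
 proof (rule measure_eqI)
  fix A assume "A \<in> sets ?B"
  hence [measurable]: "A \<in> sets borel" by simp
  have "(?A A) = (\<integral>\<^sup>+x. indicator A x \<partial>lborel)"
   by (rule orthogonal_nn_integral[OF reflection_orthogonal[OF assms(1)]]) measurable
  also have "(?A A) = (\<integral>\<^sup>+x. indicator (\<sigma> a -` A) x \<partial>lborel)"
   by (simp add: indicator_def)
  also have "\<dots> = emeasure lborel (\<sigma> a -` A)"
   using measurable_sets[of "\<sigma> a" borel borel A] by (intro nn_integral_indicator) simp
  finally show "emeasure ?B A = emeasure lborel A" by (subst emeasure_distr) (auto simp: nn_integral_indicator)
 qed simp
 thus ?thesis using integral_distr[of "\<sigma> a" lborel borel f] by simp
qed

text \<open>For the regularised weight an exact identity holds before the limit. The logarithmic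
  derivative of that weight involves \<open>\<theta> \<delta> p x\<close>, which is odd under the
  reflection in \<open>p\<close>, and so matches quotient terms carrying the factor
  \<open>\<theta> \<delta> p x * (p \<bullet> x)\<close>. That factor is at most 1 and tends to 1
  off the walls, so dominated convergence gives the claim.\<close>

lemma integral_dunkl_op_zero:
 assumes F: "C_class 1 F" and supp: "!!x. norm x > r ==> F x = 0"
 shows "(LINT x|W. T g F x) = 0"
proof -
 let ?A = "\<lambda>p. k p / 2 * (p \<bullet> g)"
 let ?B = "\<lambda>x. norm (fderiv F x g) + (\<Sum>p\<in>R. \<bar>k p / 2 * (p \<bullet> g)\<bar> * norm (rquot p F x))"
 let ?C = "\<lambda>lborel B. \<Sum>p\<in>R. cor (k p * (p \<bullet> g)) * (LINT x|lborel. B p x)"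
 let ?D = "\<lambda>p x. p \<bullet> x"
 note C1 = C1_D[OF F]
 define \<theta> where "\<theta> \<delta> p x = (?D p x) / ((?D p x)\<^sup>2 + \<delta>\<^sup>2)" for \<delta> and p x :: "real^'n"
 have \<theta>c: "continuous_on S (\<lambda>x. \<theta> \<delta> p x)" if "\<delta> > 0" for \<delta> p S
  unfolding \<theta>_def using that by (intro continuous_intros) (auto simp: add_nonneg_eq_0_iff)
 have wc: "continuous_on S (reg_weight \<delta>)" if "\<delta> > 0" for \<delta> S using reg_weight_continuous that by simp
 define Z where "Z \<delta> x = cor (reg_weight \<delta> x) * (fderiv F x g +
   (\<Sum>p\<in>R. cor (?A p) * (cor (\<theta> \<delta> p x * (?D p x)) * rquot p F x)))" for \<delta> x
 have zero: "(LINT x|lborel. Z \<delta> x) = 0" if d: "\<delta> > 0" for \<delta>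
 proof -
  define A where "A x = cor (reg_weight \<delta> x) * fderiv F x g" for x
  define B where "B p x = F x * cor (reg_weight \<delta> x * \<theta> \<delta> p x)" for p x
  define C where "C p x = cor (reg_weight \<delta> x) * (cor (\<theta> \<delta> p x * (?D p x)) * rquot p F x)" for p x
  have Ac: "cts A" unfolding A_def by (intro continuous_intros C1 wc d)
  have Bc: "cts (B p)" for p unfolding B_def by (intro continuous_intros C1 wc \<theta>c d)
  have Cc: "cts (C p)" if "p \<in> R" for p unfolding C_def by (intro continuous_intros C1 wc \<theta>c d that)
  have Ai: "integrable lborel A" using frechet_derivative_outside_support[of r F] supp
   by (intro integrable_lborel_compact_support[OF Ac, of r]) (auto simp: A_def)
  have Bi: "integrable lborel (B p)" for p using supp
   by (intro integrable_lborel_compact_support[OF Bc, of r]) (auto simp: B_def)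
  have Ci: "integrable lborel (C p)" if "p \<in> R" for p using supported_dunkl(1)[of r F] supp that
   by (intro integrable_lborel_compact_support[OF Cc[OF that], of r]) (auto simp: C_def)
  \<comment> \<open>The 2 arises by splitting \<open>F x - F (\<sigma> p x)\<close> and reflecting
    the second half; it turns the coefficient \<open>k p / 2\<close> of the quotient into the
    \<open>k p\<close> of the derivative of the weight.\<close>
  have BC: "(LINT x|lborel. C p x) = 2 * (LINT x|lborel. B p x)" if a: "p \<in> R" for p
  proof -
   have m: "B p \<in> borelm" using Bc by (rule borel_measurable_continuous_onI)
   have "C p x = B p x + B p (\<sigma> p x)" for x
   proof -
    have "C p x = cor (reg_weight \<delta> x) * (cor (\<theta> \<delta> p x) * (F x - F (\<sigma> p x)))"
     using inner_reflection_quotient[OF a, of x F] by (simp add: C_def mult.assoc)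
    moreover have "\<theta> \<delta> p (\<sigma> p x) = - \<theta> \<delta> p x" by (simp add: \<theta>_def reflection_inner_root[OF a])
    ultimately show ?thesis by (simp add: B_def reg_weight_invariant[OF a] algebra_simps)
   qed
   hence "(LINT x|lborel. C p x) = (LINT x|lborel. B p x + B p (\<sigma> p x))" by simp
   also have "\<dots> = (LINT x|lborel. B p x) + (LINT x|lborel. B p (\<sigma> p x))"
   proof (rule Bochner_Integration.integral_add[OF Bi])
    show "integrable lborel (\<lambda>x. B p (\<sigma> p x))"
    proof (rule integrable_lborel_compact_support[where r=r])
     show "cts (\<lambda>x. B p (\<sigma> p x))"
      by (rule continuous_on_compose2[OF Bc linear_continuous_on[OF linear_conv_bounded_linear[THEN iffD1, OF reflection_linear]]]) auto
    qed (use supp a in \<open>simp add: B_def\<close>)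
   qed
   finally show ?thesis by (simp add: integral_lborel_reflection[OF a m])
  qed
  define f where "f x = F x * cor (reg_weight \<delta> x)" for x
  have fD: "(f has_derivative (\<lambda>v. F x * cor (reg_weight \<delta> x * (\<Sum>p\<in>R. k p * (p \<bullet> v) * \<theta> \<delta> p x)) +
    fderiv F x v * cor (reg_weight \<delta> x))) (at x)" for x
   unfolding f_def \<theta>_def using C1(1)[of x] d
   by (intro has_derivative_mult has_derivative_of_real reg_weight_derivative) (auto simp: frechet_derivative_works)
  have fD': "fderiv f x g = A x + (\<Sum>p\<in>R. cor (k p * (p \<bullet> g)) * B p x)" for x
   unfolding fderiv_eq[OF fD] A_def B_def
   by (simp add: sum_distrib_left algebra_simps)
  have "(LINT x|lborel. fderiv f x g) = 0"
  proof (rule integral_derivative_zero)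
   show "f differentiable (at x)" for x using fD differentiable_def by blast
   show "cts (\<lambda>x. fderiv f x g)"
    unfolding fD' by (intro continuous_intros Ac Bc)
   show "f x = 0" if "norm x > r" for x using supp[OF that] by (simp add: f_def)
  qed
  hence "(LINT x|lborel. A x) + (?C lborel B) = 0"
   unfolding fD' using Ai Bi by (subst (asm) Bochner_Integration.integral_add) auto
  moreover have "(LINT x|lborel. Z \<delta> x) = (LINT x|lborel. A x) + (\<Sum>p\<in>R. cor (?A p) * (LINT x|lborel. C p x))"
  proof -
   have "Z \<delta> x = A x + (\<Sum>p\<in>R. cor (?A p) * C p x)" for x
    unfolding Z_def A_def C_def by (simp add: distrib_left sum_distrib_left mult.left_commute)
   thus ?thesis using Ai Ci by (simp del: of_real_mult of_real_divide)
  qed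
  moreover have "(\<Sum>p\<in>R. cor (?A p) * (LINT x|lborel. C p x)) = (?C lborel B)"
   by (intro sum.cong refl) (simp add: BC)
  ultimately show ?thesis by simp
 qed
 define t where "t n = 1 / real (Suc n)" for n
 have t: "t n > 0" "t n <= 1" for n by (auto simp: t_def)
 have t0: "t \<longlonglongrightarrow> 0" unfolding t_def by (rule LIMSEQ_inverse_real_of_nat[unfolded inverse_eq_divide])
 define wb where "wb = exp (\<Sum>p\<in>R. k p / 2 * ln ((2 * r)\<^sup>2 + 1))"
 define b where "b x = wb * (?B x)" for x
 have [measurable]: "(\<lambda>x. fderiv F x g) \<in> borelm" "T g F \<in> borelm"
  using C1 by (auto intro: borel_measurable_continuous_onI)
 have Zm: "Z \<delta> \<in> borelm" if d: "\<delta> > 0" for \<delta>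
  unfolding Z_def by (intro borel_measurable_continuous_onI continuous_intros C1 wc \<theta>c d)
 have "(\<lambda>n. LINT x|lborel. Z (t n) x) \<longlonglongrightarrow> (LINT x|lborel. weight x *\<^sub>R T g F x)"
 proof (rule integral_dominated_convergence[where w=b])
  show "(\<lambda>x. weight x *\<^sub>R T g F x) \<in> borel_measurable lborel" by measurable
  show "Z (t n) \<in> borel_measurable lborel" for n using Zm t by simp
  have "integrable lborel (\<lambda>x. cor (b x))"
  proof (rule integrable_lborel_compact_support[where r=r])
   show "cts (\<lambda>x. cor (b x))" unfolding b_def by (intro continuous_intros C1)
   show "cor (b x) = 0" if "norm x > r" for x
    using frechet_derivative_outside_support[of r F x g] supported_dunkl(1)[of r F x] supp that by (simp add: b_def)
  qed
  thus "integrable lborel b" by (simp add: complex_of_real_integrable_eq)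
  show "AE x in lborel. (\<lambda>n. Z (t n) x) \<longlonglongrightarrow> weight x *\<^sub>R T g F x"
   using AE_regular
  proof eventually_elim
   case (elim x)
   have "(\<lambda>n. \<theta> (t n) p x * (?D p x)) \<longlonglongrightarrow> (?D p x) / ((?D p x)\<^sup>2 + 0\<^sup>2) * (?D p x)" if "p \<in> R" for p
    unfolding \<theta>_def using elim that
    by (intro tendsto_mult tendsto_divide tendsto_const tendsto_add tendsto_power t0) (auto simp: inner_commute)
   hence 1: "(\<lambda>n. \<theta> (t n) p x * (?D p x)) \<longlonglongrightarrow> 1" if "p \<in> R" for p
    using elim that by (simp add: inner_commute power2_eq_square)
   have "(\<lambda>n. Z (t n) x) \<longlonglongrightarrow> cor (weight x) * (fderiv F x g +
     (\<Sum>p\<in>R. cor (?A p) * (cor 1 * rquot p F x)))"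
    unfolding Z_def by (intro tendsto_mult tendsto_add tendsto_sum tendsto_const tendsto_of_real reg_weight_tendsto elim t0 1)
   thus ?case by (simp add: dunkl_op_def scaleR_complex)
  qed
  show "AE x in lborel. norm (Z (t n) x) <= b x" for n
  proof (rule AE_I2)
   fix x
   show "norm (Z (t n) x) <= b x"
   proof (cases "norm x <= r")
    case False
    thus ?thesis using frechet_derivative_outside_support[of r F x g] supported_dunkl(1)[of r F x] supp by (simp add: Z_def b_def)
   next
    case True
    have th: "\<bar>\<theta> (t n) p x * (?D p x)\<bar> <= 1" for p
     using t[of n] by (simp add: \<theta>_def divide_le_eq power2_eq_square add_nonneg_pos abs_mult)
    have "norm (Z (t n) x) <= reg_weight (t n) x * (?B x)"
     unfolding Z_def norm_mult norm_of_real abs_of_nonneg[OF reg_weight_bound(1)[OF t True]]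
    proof (intro mult_left_mono reg_weight_bound(1)[OF t True] order_trans[OF norm_triangle_ineq] add_left_mono sum_norm_le)
     fix p
     show "norm (cor (?A p) * (cor (\<theta> (t n) p x * (?D p x)) * rquot p F x))
      <= \<bar>k p / 2 * (p \<bullet> g)\<bar> * norm (rquot p F x)"
      unfolding norm_mult[where 'a=complex] norm_of_real
      using th[of p] by (intro mult_left_mono mult_left_le_one_le) auto
    qed
    also have "\<dots> <= b x" unfolding b_def wb_def
     by (intro mult_right_mono reg_weight_bound(2)[OF t True] add_nonneg_nonneg sum_nonneg) auto
    finally show ?thesis .
   qed
  qed
 qed
 hence "(LINT x|lborel. weight x *\<^sub>R T g F x) = 0" by (simp only: zero[OF t(1)] LIMSEQ_const_iff)
 thus ?thesis by (subst integral_W) auto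
qed

end

section \<open>Bumps and radial cutoffs of finite smoothness\<close>

lemma DERIV_max_power:
 assumes "m >= 1"
 shows "((\<lambda>u::real. max 0 u ^ Suc m) has_real_derivative (real (Suc m) * max 0 u ^ m)) (at u)"
proof -
 let ?A = "\<lambda>h. max 0 h ^ Suc m - max 0 0 ^ Suc m"
 consider "u > 0" | "u < 0" | "u = 0" by linarith
 thus ?thesis
 proof cases
  case 1
  have "((\<lambda>u::real. u ^ Suc m) has_real_derivative (real (Suc m) * u ^ m)) (at u)"
   using DERIV_pow[of "Suc m" u] by simp
  hence "((\<lambda>u::real. max 0 u ^ Suc m) has_real_derivative (real (Suc m) * u ^ m)) (at u)"
   by (rule has_field_derivative_transform_within_open[where S="{0<..}"]) (use 1 in auto)
  thus ?thesis using 1 by simp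
 next
  case 2
  have "((\<lambda>u::real. 0) has_real_derivative 0) (at u)" by simp
  hence "((\<lambda>u::real. max 0 u ^ Suc m) has_real_derivative 0) (at u)"
   by (rule has_field_derivative_transform_within_open[where S="{..<0}"]) (use 2 in auto)
  moreover have "real (Suc m) * max 0 u ^ m = 0" using 2 assms by simp
  ultimately show ?thesis by (simp only:)
 next
  case 3
  have "((\<lambda>h::real. (?A h) / (h - 0)) \<longlongrightarrow> 0) (at 0)"
  proof (rule Lim_null_comparison)
   have "norm ((?A h) / (h - 0)) <= \<bar>h\<bar> ^ m" for h :: real
    by (cases "h > 0") auto
   thus "\<forall>\<^sub>F h::real in at 0. norm ((?A h) / (h - 0)) <= \<bar>h\<bar> ^ m"
    by (simp add: always_eventually)
   have "isCont (\<lambda>h::real. \<bar>h\<bar> ^ m) 0" by (intro continuous_intros)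
   moreover have "\<bar>0::real\<bar> ^ m = 0" using assms by simp
   ultimately show "((\<lambda>h::real. \<bar>h\<bar> ^ m) \<longlongrightarrow> 0) (at 0)" unfolding isCont_def by (simp only:)
  qed
  moreover have "real (Suc m) * max 0 u ^ m = 0" using 3 assms by simp
  ultimately show ?thesis unfolding has_field_derivative_iff using 3 by (simp only:)
 qed
qed

text \<open>Truncated powers are smooth only to an order below the exponent. This suffices because
  finitely many integrations by parts are made, and the exponent is chosen to match.\<close>

definition bump :: "nat => real^'n => complex" where
 "bump m x = cor (max 0 (1 - (norm x)\<^sup>2) ^ m)"

lemma bump_derivative:
 fixes x :: "real^'n"
 assumes "m >= 1"
 shows "(bump (Suc m) has_derivative (\<lambda>v. cor (- 2 * real (Suc m) * (x \<bullet> v)) * bump m x)) (at x)"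
proof -
 have 1: "((\<lambda>x :: real^'n. 1 - (norm x)\<^sup>2) has_derivative (\<lambda>v. - 2 * (x \<bullet> v))) (at x)"
  unfolding power2_norm_eq_inner by (auto intro!: derivative_eq_intros simp: inner_commute)
 have 2: "((\<lambda>x :: real^'n. max 0 (1 - (norm x)\<^sup>2) ^ Suc m) has_derivative (\<lambda>v. - 2 * (x \<bullet> v) * (real (Suc m) * max 0 (1 - (norm x)\<^sup>2) ^ m))) (at x)"
  by (rule DERIV_compose_FDERIV[where f="\<lambda>u. max 0 u ^ Suc m" and g="\<lambda>x :: real^'n. 1 - (norm x)\<^sup>2" and x=x, OF DERIV_max_power[OF assms] 1])
 show ?thesis unfolding bump_def[abs_def]
  by (rule has_derivative_eq_rhs[OF has_derivative_of_real[OF 2]]) (simp only: mult_ac of_real_mult)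
qed

lemma smooth_coordinate: "cont_space.smooth m (\<lambda>x :: real^'n. cor (x \<bullet> v))"
proof (cases m)
 case (Suc j)
 have d: "((\<lambda>x :: real^'n. cor (x \<bullet> v)) has_derivative (\<lambda>u. cor (u \<bullet> v))) (at x)" for x
  by (intro has_derivative_of_real bounded_linear_imp_has_derivative bounded_linear_inner_left)
 have "partial_deriv i (\<lambda>x :: real^'n. cor (x \<bullet> v)) = (\<lambda>x. cor (axis i 1 \<bullet> v))" for i
  unfolding partial_deriv_def[abs_def] fderiv_eq[OF d] ..
 moreover have "(\<lambda>x :: real^'n. cor (x \<bullet> v)) differentiable (at x)" for x using d differentiable_def by blast
 ultimately show ?thesis unfolding Suc by (auto simp: cont_space.smooth_const intro!: continuous_intros)
qed (auto intro!: continuous_intros)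

lemma bump_smooth: "cont_space.smooth m (bump (Suc m) :: real^'n => complex)"
proof (induction m)
 case 0 show ?case unfolding bump_def[abs_def] by (auto intro!: continuous_intros)
next
 case (Suc m)
 have d: "(bump (Suc (Suc m)) has_derivative (\<lambda>v. cor (- 2 * real (Suc (Suc m)) * (x \<bullet> v)) * bump (Suc m) x)) (at x)" for x :: "real^'n"
  by (rule bump_derivative) simp
 have "partial_deriv i (bump (Suc (Suc m))) = (\<lambda>x :: real^'n. cor (- 2 * real (Suc (Suc m))) * (cor (x \<bullet> axis i 1) * bump (Suc m) x))" for i
  unfolding partial_deriv_def[abs_def] fderiv_eq[OF d] by (simp only: of_real_mult mult.assoc)
 moreover have "cont_space.smooth m (\<lambda>x :: real^'n. cor (- 2 * real (Suc (Suc m))) * (cor (x \<bullet> axis i 1) * bump (Suc m) x))" for i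
  by (intro cont_space.smooth_cmult cont_space.smooth_mult smooth_coordinate Suc)
 moreover have "bump (Suc (Suc m)) differentiable (at x)" for x :: "real^'n" using d differentiable_def by blast
 moreover have "cts (bump (Suc (Suc m)) :: real^'n => complex)"
  unfolding bump_def[abs_def] by (auto intro!: continuous_intros)
 ultimately show ?case by simp
qed

lemma bump_le: "norm (bump m x) <= 1"
 unfolding bump_def norm_of_real by (simp add: power_le_one)

lemma bump_support: "m >= 1 ==> norm x >= 1 ==> bump m x = 0"
proof -
 assume "m >= 1" "norm x >= 1"
 moreover from \<open>norm x \<ge> 1\<close> have "1 <= (norm x)\<^sup>2" by (rule one_le_power)
 ultimately show ?thesis by (simp add: bump_def max_absorb1)
qed

lemma C_class_mult: "C_class m f ==> C_class m g ==> C_class m (\<lambda>x. f x * g x)"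
 unfolding C_class_smooth by (rule cont_space.smooth_mult)

definition cutoff :: "nat => real^'n => complex" where
 "cutoff n x = bump 2 ((1 / real (Suc n)) *\<^sub>R x)"

lemma linear_scaling: "linear (\<lambda>x :: 'a::real_vector. r *\<^sub>R x)"
 by (rule linearI) (simp_all add: scaleR_add_right)

lemma cutoff_C1: "C_class 1 (cutoff n)"
 unfolding C_class_smooth cutoff_def[abs_def] One_nat_def numeral_2_eq_2
 by (rule cont_space.smooth_lin[OF linear_scaling bump_smooth])

lemma cutoff_support: "norm x > real (Suc n) ==> cutoff n x = 0"
 unfolding cutoff_def by (rule bump_support) (simp_all add: field_simps)

lemma cutoff_le: "norm (cutoff n x) <= 1"
 unfolding cutoff_def by (rule bump_le)

lemma cutoff_tendsto: "(\<lambda>n. cutoff n x) \<longlonglongrightarrow> 1"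
proof -
 have "(\<lambda>n. (1 / real (Suc n)) *\<^sub>R x) \<longlonglongrightarrow> 0 *\<^sub>R x"
  by (intro tendsto_scaleR tendsto_const LIMSEQ_inverse_real_of_nat[unfolded inverse_eq_divide])
 hence "(\<lambda>n. cor (max 0 (1 - (norm ((1 / real (Suc n)) *\<^sub>R x))\<^sup>2) ^ 2)) \<longlonglongrightarrow> cor (max 0 (1 - (norm (0 *\<^sub>R x))\<^sup>2) ^ 2)"
  by (intro tendsto_of_real tendsto_power tendsto_max tendsto_diff tendsto_const tendsto_norm)
 thus ?thesis by (simp add: cutoff_def bump_def)
qed

lemma cutoff_derivative:
 fixes x v :: "real^'n"
 shows "norm (fderiv (cutoff n) x v) <= 4 * norm v / real (Suc n)"
proof -
 let ?A = "1 / real (Suc n)"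
 define y where "y = ?A *\<^sub>R x"
 have 1: "((\<lambda>x :: real^'n. ?A *\<^sub>R x) has_derivative (\<lambda>v. ?A *\<^sub>R v)) (at x)"
  by (rule linear_imp_has_derivative[OF linear_scaling])
 have b: "(bump 2 has_derivative (\<lambda>v. cor (- 2 * real (Suc (Suc 0)) * (y \<bullet> v)) * bump (Suc 0) y)) (at y)"
  using bump_derivative[of "Suc 0" y] by (simp add: numeral_2_eq_2)
 have "(cutoff n has_derivative (\<lambda>v. cor (- 2 * real (Suc (Suc 0)) * (y \<bullet> (?A *\<^sub>R v))) * bump (Suc 0) y)) (at x)"
  unfolding cutoff_def[abs_def] by (rule has_derivative_compose[OF 1, where g="bump 2"]) (use b in \<open>simp add: y_def\<close>)
 hence eq: "fderiv (cutoff n) x v = cor (- 4 * (y \<bullet> v) / real (Suc n)) * bump (Suc 0) y"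
  by (subst fderiv_eq) (assumption, simp)
 show ?thesis
 proof (cases "norm y >= 1")
  case True
  thus ?thesis unfolding eq by (simp add: bump_support)
 next
  case False
  have "\<bar>y \<bullet> v\<bar> <= norm y * norm v" by (rule Cauchy_Schwarz_ineq2)
  also have "\<dots> <= norm v" using False by (simp add: mult_left_le_one_le)
  finally have "\<bar>- 4 * (y \<bullet> v) / real (Suc n)\<bar> <= 4 * norm v / real (Suc n)"
   by (simp add: abs_mult divide_right_mono)
  thus ?thesis unfolding eq norm_mult norm_of_real
   using mult_mono[of "\<bar>- 4 * (y \<bullet> v) / real (Suc n)\<bar>" "4 * norm v / real (Suc n)" "norm (bump (Suc 0) y)" 1] bump_le[of "Suc 0" y] by simp
 qed
qed

section \<open>Antisymmetry of Dunkl operators\<close>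

context dunkl begin

text \<open>On the wall the reflection fixes the point and reverses \<open>a\<close>, so invariance
  makes the derivative in direction \<open>a\<close> equal to its own negative.\<close>

lemma reflection_quotient_invariant:
 assumes "!!x. f differentiable (at x)" "!!x. f (\<sigma> a x) = f x" "a \<in> R"
 shows "rquot a f x = 0"
proof (cases "a \<bullet> x = 0")
 case True
 have s: "\<sigma> a x = x" "\<sigma> a a = - a"
  using reflection_wall[OF assms(3) True] root_inner[OF assms(3)] by (simp_all add: reflection_root[OF assms(3)] scaleR_2)
 have "((\<lambda>x. f (\<sigma> a x)) has_derivative (\<lambda>v. fderiv f (\<sigma> a x) (\<sigma> a v))) (at x)"
  by (rule has_derivative_compose[OF linear_imp_has_derivative[OF reflection_linear]])
   (use assms(1) in \<open>simp add: frechet_derivative_works\<close>)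
 hence "fderiv f x = (\<lambda>v. fderiv f x (\<sigma> a v))"
  unfolding assms(2) s(1) by (rule fderiv_eq)
 from fun_cong[OF this, of a] have "fderiv f x a = - fderiv f x a"
  using linear_neg[OF linear_frechet_derivative[OF assms(1)]] by (simp add: s(2))
 thus ?thesis using True assms(3) by (simp add: reflection_quotient_root)
next
 case False thus ?thesis using assms(2,3) by (simp add: reflection_quotient_root)
qed

lemma dunkl_op_invariant_mult:
 assumes "!!x. f differentiable (at x)" "!!a x. a \<in> R ==> f (\<sigma> a x) = f x" "g differentiable (at x)"
 shows "T q (\<lambda>x. f x * g x) x = f x * T q g x + fderiv f x q * g x"
 using dunkl_op_mult[OF assms(1,3), of q] reflection_quotient_invariant[OF assms(1,2)] by simp

lemma measurable_W: "f \<in> borelm ==> f \<in> borel_measurable W"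
 using measurable_cong_sets[OF sets_W refl] by blast

lemma continuous_measurable_W: "cts f ==> f \<in> borel_measurable W"
 by (intro measurable_W borel_measurable_continuous_onI)

lemma integrable_W_compact_support:
 fixes f :: "real^'n => complex"
 assumes c: "cts f" and supp: "!!x. norm x > r ==> f x = 0"
 shows "integrable W f"
proof -
 let ?A = "1 + r\<^sup>2"
 let ?B = "\<lambda>x. 1 + (norm x)\<^sup>2"
 obtain B where B: "B >= 0" "!!x. norm (f x) <= B" by (rule compact_support_bounded[OF c supp]) (assumption | rule that)+
 have "integrable W (\<lambda>x. B * ?A powr N * (?B x) powr - N)"
  by (intro integrable_mult_right integrable_decay) simp
 thus ?thesis
 proof (rule Bochner_Integration.integrable_bound)
  show "f \<in> borel_measurable W" by (rule continuous_measurable_W[OF c])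
  show "AE x in W. norm (f x) <= norm (B * ?A powr N * (?B x) powr - N)"
  proof (rule AE_I2)
   fix x
   show "norm (f x) <= norm (B * ?A powr N * (?B x) powr - N)"
   proof (cases "norm x <= r")
    case True
    have "(norm x)\<^sup>2 <= r\<^sup>2" using True by (intro power_mono) auto
    hence "(?B x) powr N <= ?A powr N" using N_pos by (intro powr_mono2) auto
    hence "1 <= ?A powr N * (?B x) powr - N"
     using powr_gt_zero[of "1 + (norm x)\<^sup>2" N] by (simp add: powr_minus divide_inverse[symmetric] add_nonneg_eq_0_iff)
    hence "B * 1 <= B * (?A powr N * (?B x) powr - N)" using B(1) by (intro mult_left_mono)
    thus ?thesis using B(2)[of x] B(1) by (simp add: mult.assoc abs_mult)
   qed (use supp in auto)
  qed
 qed
qed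

lemma reflection_quotient_reflect:
 assumes a: "b \<in> R" shows "rquot b f (\<sigma> b x) = rquot b f x"
proof (cases "b \<bullet> x = 0")
 case True thus ?thesis by (simp add: reflection_wall[OF a])
next
 case False
 thus ?thesis using a by (simp add: reflection_quotient_root reflection_inner_root reflection_reflection field_simps)
qed

text \<open>Besides the two wanted terms the product rule leaves the functions \<open>q b\<close>,
  which are odd under the reflection in \<open>b\<close> and hence integrate to 0. The rest is
  \<open>integral_dunkl_op_zero\<close> for the product.\<close>

lemma by_parts_compact:
 assumes f: "C_class 1 f" and g: "C_class 1 g" and supp: "!!x. norm x > r ==> g x = 0"
 shows "(LINT x|W. T v f x * g x) = - (LINT x|W. f x * T v g x)"
proof -
 note F = C1_D[OF f] note Gg = C1_D[OF g]
 have Tg0: "T v g x = 0" if "norm x > r" for x by (rule supported_dunkl(2)[OF supp that])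
 have i1: "integrable W (\<lambda>x. f x * T v g x)"
  by (rule integrable_W_compact_support[where r=r]) (auto intro!: continuous_intros F Gg simp: Tg0)
 have i2: "integrable W (\<lambda>x. T v f x * g x)"
  by (rule integrable_W_compact_support[where r=r]) (auto intro!: continuous_intros F Gg simp: supp)
 have cs: "cts (\<lambda>x. g (\<sigma> b x))" for b
  by (rule continuous_on_compose2[OF Gg(2) linear_continuous_on[OF linear_conv_bounded_linear[THEN iffD1, OF reflection_linear]]]) auto
 define q where "q b x = rquot b f x * (g (\<sigma> b x) - g x)" for b x
 have qc: "cts (q b)" if "b \<in> R" for b
  unfolding q_def by (intro continuous_intros F Gg cs that)
 have qi: "integrable W (q b)" if "b \<in> R" for b
  by (rule integrable_W_compact_support[OF qc[OF that], where r=r]) (use that supp in \<open>simp add: q_def\<close>)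
 have q0: "(LINT x|W. q b x) = 0" if a: "b \<in> R" for b
 proof -
  have "(LINT x|W. q b x) = (LINT x|W. q b (\<sigma> b x))"
   by (rule integral_W_group[OF group_reflection[OF a], symmetric]) (rule borel_measurable_continuous_onI[OF qc[OF a]])
  also have "\<dots> = (LINT x|W. - q b x)"
   by (simp add: q_def reflection_quotient_reflect[OF a] reflection_reflection[OF a] algebra_simps)
  finally show ?thesis by simp
 qed
 have "(LINT x|W. T v (\<lambda>x. f x * g x) x) = 0"
  by (rule integral_dunkl_op_zero[where r=r]) (use C_class_mult[OF f g] supp in auto)
 moreover have "T v (\<lambda>x. f x * g x) x = (f x * T v g x + T v f x * g x) + (\<Sum>b\<in>R. cor (k b / 2 * (b \<bullet> v)) * q b x)" for x
  unfolding dunkl_op_mult[OF F(1) Gg(1)] unfolding dunkl_op_def[of R k v f]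
  by (simp add: q_def distrib_right right_diff_distrib sum_subtractf sum_distrib_right mult.assoc)
 ultimately have "(LINT x|W. f x * T v g x) + (LINT x|W. T v f x * g x) = 0"
  using i1 i2 qi q0 by (simp del: of_real_mult of_real_divide)
 thus ?thesis by (simp add: add_eq_0_iff2)
qed

text \<open>The cutoffs are radial, hence invariant, and obey the ordinary product rule. Their
  gradient is of order \<open>1 / n\<close>, so integrability of \<open>f * g\<close> disposes of
  the error term.\<close>

lemma by_parts:
 assumes f: "C_class 1 f" and g: "C_class 1 g"
  and i0: "integrable W (\<lambda>x. f x * g x)" and i1: "integrable W (\<lambda>x. T v f x * g x)" and i2: "integrable W (\<lambda>x. f x * T v g x)"
 shows "(LINT x|W. T v f x * g x) = - (LINT x|W. f x * T v g x)"
proof -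
 let ?A = "\<lambda>n x. cutoff n x * T v g x + fderiv (cutoff n) x v * g x"
 let ?B = "\<lambda>n. (4 * norm v) * (1 / real (Suc n))"
 let ?C = "\<lambda>x. f x * T v g x"
 let ?D = "\<lambda>n x. fderiv (cutoff n) x v"
 note F = C1_D[OF f] note Gg = C1_D[OF g]
 note C = C1_D[OF cutoff_C1]
 have inv: "cutoff n (\<sigma> a x) = cutoff n x" if "a \<in> R" for n a x
  using that by (simp add: cutoff_def bump_def)
 have Tc: "T v (\<lambda>x. cutoff n x * g x) x = cutoff n x * T v g x + fderiv (cutoff n) x v * g x" for n x
  by (rule dunkl_op_invariant_mult[OF C(1) inv Gg(1)])
 have [measurable]: "f \<in> borelm" "g \<in> borelm" "T v f \<in> borelm" "T v g \<in> borelm"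
  "(cutoff n :: real^'n => complex) \<in> borelm" "(\<lambda>x. fderiv (cutoff n) x v) \<in> borelm" for n :: nat
  by (rule borel_measurable_continuous_onI, rule F Gg C)+
 have eq: "(LINT x|W. T v f x * (cutoff n x * g x)) = - (LINT x|W. f x * (?A n x))" for n
  unfolding Tc[symmetric]
  by (rule by_parts_compact[OF f C_class_mult[OF cutoff_C1 g], of "real (Suc n)"]) (simp add: cutoff_support)
 have "(\<lambda>n. LINT x|W. T v f x * (cutoff n x * g x)) \<longlonglongrightarrow> (LINT x|W. T v f x * (1 * g x))"
 proof (rule integral_dominated_convergence[where w="\<lambda>x. norm (T v f x * g x)"])
  show "integrable W (\<lambda>x. norm (T v f x * g x))" using i1 by (rule integrable_norm)
  show "AE x in W. (\<lambda>n. T v f x * (cutoff n x * g x)) \<longlonglongrightarrow> T v f x * (1 * g x)"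
   by (intro AE_I2 tendsto_mult tendsto_const cutoff_tendsto)
  show "AE x in W. norm (T v f x * (cutoff n x * g x)) <= norm (T v f x * g x)" for n
  proof (rule AE_I2)
   fix x
   have "norm (cutoff n x) * (norm (T v f x) * norm (g x)) <= 1 * (norm (T v f x) * norm (g x))"
    by (intro mult_right_mono cutoff_le) auto
   thus "norm (T v f x * (cutoff n x * g x)) <= norm (T v f x * g x)" by (simp add: norm_mult mult_ac)
  qed
 qed simp_all
 moreover have "(\<lambda>n. - (LINT x|W. f x * (?A n x))) \<longlonglongrightarrow> - (LINT x|W. f x * (1 * T v g x + 0 * g x))"
 proof (rule tendsto_minus, rule integral_dominated_convergence[where w="\<lambda>x. norm (?C x) + 4 * norm v * norm (f x * g x)"])
  show "integrable W (\<lambda>x. norm (?C x) + 4 * norm v * norm (f x * g x))"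
   using i0 i2 by (intro Bochner_Integration.integrable_add integrable_mult_right integrable_norm)
  have d0: "(\<lambda>n. fderiv (cutoff n) x v) \<longlonglongrightarrow> 0" for x :: "real^'n"
  proof (rule Lim_null_comparison)
   show "\<forall>\<^sub>F n in sequentially. norm (?D n x) <= (4 * norm v) * (1 / real (Suc n))"
    using cutoff_derivative[of _ x v] by simp
   have "?B \<longlonglongrightarrow> (4 * norm v) * 0"
    by (intro tendsto_mult tendsto_const LIMSEQ_inverse_real_of_nat[unfolded inverse_eq_divide])
   thus "?B \<longlonglongrightarrow> 0" by simp
  qed
  show "AE x in W. (\<lambda>n. f x * (?A n x)) \<longlonglongrightarrow> f x * (1 * T v g x + 0 * g x)"
   by (intro AE_I2 tendsto_mult tendsto_add tendsto_const cutoff_tendsto d0)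
  show "AE x in W. norm (f x * (?A n x)) <= norm (?C x) + 4 * norm v * norm (f x * g x)" for n
  proof (rule AE_I2)
   fix x
   have "norm (?D n x) <= 4 * norm v / real (Suc n)" by (rule cutoff_derivative)
   also have "\<dots> <= 4 * norm v" using mult_left_mono[of 1 "real (Suc n)" "4 * norm v"] by (simp add: divide_le_eq)
   finally have d: "norm (?D n x) <= 4 * norm v" .
   have "norm (?A n x) <= norm (cutoff n x) * norm (T v g x) + norm (?D n x) * norm (g x)"
    using norm_triangle_ineq[of "cutoff n x * T v g x" "fderiv (cutoff n) x v * g x"] by (simp add: norm_mult)
   also have "\<dots> <= 1 * norm (T v g x) + 4 * norm v * norm (g x)"
    by (intro add_mono mult_right_mono cutoff_le d) auto
   finally have "norm (f x) * norm (?A n x) <= norm (f x) * (1 * norm (T v g x) + 4 * norm v * norm (g x))"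
    by (intro mult_left_mono) auto
   also have "\<dots> = norm (?C x) + 4 * norm v * norm (f x * g x)"
    by (simp add: norm_mult algebra_simps)
   finally show "norm (f x * (?A n x)) <= norm (?C x) + 4 * norm v * norm (f x * g x)"
    unfolding norm_mult .
  qed
 qed simp_all
 ultimately show ?thesis unfolding eq using LIMSEQ_unique by fastforce
qed

section \<open>Gaussian integrals of the kernel\<close>

definition gauss :: "real^'n => complex" where "gauss x = cor (exp (- (norm x)\<^sup>2 / 2))"

text \<open>Allowing an arbitrary linear term in the exponent makes the class stable under
  multiplication by \<open>e a u\<close> and by linear functions, so that Gaussian transforms may be
  differentiated and integrated by parts freely.\<close>

definition gauss_bounded :: "(real^'n => complex) => bool" where
 "gauss_bounded f \<longleftrightarrow> cts f \<and> (\<exists>C a. 0 <= C \<and> (\<forall>x. norm (f x) <= C * exp (a * norm x - (norm x)\<^sup>2 / 2)))"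

lemma gauss_boundedE:
 assumes "gauss_bounded f"
 obtains C a where "0 <= C" "!!x. norm (f x) <= C * exp (a * norm x - (norm x)\<^sup>2 / 2)"
 using assms unfolding gauss_bounded_def by metis

lemma gauss_bounded_continuous: "gauss_bounded f ==> cts f"
 by (simp add: gauss_bounded_def)

lemma gauss_bounded_gauss: "gauss_bounded gauss"
 unfolding gauss_bounded_def
proof (intro conjI exI[of _ "1::real"] exI[of _ "0::real"] allI)
 show "cts gauss" unfolding gauss_def[abs_def] by (intro continuous_intros) auto
qed (simp_all add: gauss_def)

lemma gauss_bounded_mult_exp:
 assumes f: "gauss_bounded f" and c: "cts g" and b: "0 <= B" "!!x. norm (g x) <= B * exp (b * norm x)"
 shows "gauss_bounded (\<lambda>x. g x * f x)"
proof -
 let ?A = "\<lambda>a x. a * norm x - (norm x)\<^sup>2 / 2"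
 obtain C a where C: "0 <= C" "!!x. norm (f x) <= C * exp (?A a x)" using gauss_boundedE[OF f] by metis
 show ?thesis unfolding gauss_bounded_def
 proof (rule conjI, rule_tac [2] exI[of _ "B * C"], rule_tac [2] exI[of _ "b + a"], rule_tac [2] conjI, rule_tac [3] allI)
  show "cts (\<lambda>x. g x * f x)" by (intro continuous_intros c gauss_bounded_continuous f)
  show "0 <= B * C" using b(1) C(1) by simp
  fix x :: "real^'n"
  have "norm (g x * f x) <= (B * exp (b * norm x)) * (C * exp (?A a x))"
   unfolding norm_mult using b C by (intro mult_mono) auto
  also have "\<dots> = B * C * (exp (b * norm x) * exp (?A a x))" by simp
  also have "exp (b * norm x) * exp (?A a x) = exp ((b + a) * norm x - (norm x)\<^sup>2 / 2)"
   by (simp add: exp_add[symmetric] algebra_simps)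
  finally show "norm (g x * f x) <= B * C * exp ((b + a) * norm x - (norm x)\<^sup>2 / 2)" .
 qed
qed

lemma e_continuous1: "continuous_on S (e a u)"
 using C1_D(2)[OF e_C1] by (rule continuous_on_subset) simp

lemma gauss_bounded_e: "gauss_bounded f ==> gauss_bounded (\<lambda>x. e a u x * f x)"
 by (rule gauss_bounded_mult_exp[where B=1 and b="norm a * norm u"]) (simp_all add: e_continuous1 norm_e_le)

lemma gauss_bounded_inner: "gauss_bounded f ==> gauss_bounded (\<lambda>x. cor (v \<bullet> x) * f x)"
proof (rule gauss_bounded_mult_exp[where B="norm v" and b=1])
 fix x :: "real^'n"
 have "norm x <= exp (norm x)" using exp_ge_add_one_self[of "norm x"] by linarith
 hence "norm v * norm x <= norm v * exp (norm x)" by (intro mult_left_mono) auto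
 thus "norm (cor (v \<bullet> x)) <= norm v * exp (1 * norm x)"
  using Cauchy_Schwarz_ineq2[of v x] by simp
qed (auto intro!: continuous_intros)

lemma gauss_bounded_cmult: "gauss_bounded f ==> gauss_bounded (\<lambda>x. z * f x)"
 by (rule gauss_bounded_mult_exp[where B="norm z" and b=0]) simp_all

lemma gauss_bounded_integrable:
 assumes "gauss_bounded f" shows "integrable W f"
proof -
 obtain C a where C: "0 <= C" "!!x. norm (f x) <= C * exp (a * norm x - (norm x)\<^sup>2 / 2)" using gauss_boundedE[OF assms] by metis
 have "integrable W (\<lambda>x. C * exp (a * norm x - (norm x)\<^sup>2 / 2))" by (intro integrable_mult_right integrable_gauss)
 thus ?thesis
  by (rule Bochner_Integration.integrable_bound)
   (use C in \<open>auto intro: continuous_measurable_W gauss_bounded_continuous assms\<close>)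
qed

section \<open>Differentiating Gaussian transforms under the integral\<close>

lemma e_deriv_continuous:
 fixes p q :: "'b::topological_space => real^'n"
 assumes "continuous_on S p" "continuous_on S q"
 shows "continuous_on S (\<lambda>y. fderiv (e a (p y)) (q y) v)"
proof -
 have fd: "fderiv (e a u) x v = kernel_deriv (cvec x, a *s cvec u) (cvec v, 0)" for u x
  using fderiv_eq[OF kernel_slice[of "a *s cvec u" x]] unfolding e_slice[abs_def] by simp
 have cv: "continuous_on S (\<lambda>y. cvec (h y))" if "continuous_on S h" for h :: "'b => real^'n"
  using continuous_on_compose2[OF linear_continuous_on[OF linear_conv_bounded_linear[THEN iffD1, OF linear_cvec]] that subset_UNIV] by simp
 show ?thesis unfolding fd
 proof (rule continuous_on_compose2[OF kernel_deriv_continuous, where f="\<lambda>y. (cvec (q y), a *s cvec (p y))"])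
  show "continuous_on S (\<lambda>y. (cvec (q y), a *s cvec (p y)))"
   using cv[OF assms(1)] cv[OF assms(2)] by (intro continuous_on_Pair)
    (auto simp: vector_scalar_mult_def intro!: continuous_on_vec_lambda continuous_intros)
 qed auto
qed

lemma integral_param_continuous:
 fixes f :: "real^'n => real^'n => complex"
 assumes m: "!!x. f x \<in> borelm" and c: "!!q. cts (\<lambda>x. f x q)"
  and b: "!!r x q. norm x <= r ==> norm (f x q) <= b r q" and i: "!!r. integrable W (b r)"
 shows "cts (\<lambda>x. LINT q|W. f x q)"
 unfolding continuous_on_sequentially
proof (intro allI ballI impI, elim conjE)
 fix s :: "nat => real^'n" and x assume s: "s \<longlonglongrightarrow> x"
 obtain r where r: "!!n. norm (s n) <= r" using convergent_imp_bounded[OF s] by (auto simp: bounded_iff)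
 show "((\<lambda>x. LINT q|W. f x q) \<circ> s) \<longlonglongrightarrow> (LINT q|W. f x q)"
  unfolding comp_def
 proof (rule integral_dominated_convergence[where w="b r"])
  show "AE q in W. (\<lambda>n. f (s n) q) \<longlonglongrightarrow> f x q"
  proof (rule AE_I2)
   fix q
   show "(\<lambda>n. f (s n) q) \<longlonglongrightarrow> f x q"
    by (rule continuous_on_tendsto_compose[OF c s]) auto
  qed
  show "AE q in W. norm (f (s n) q) <= b r q" for n using b[OF r] by simp
 qed (use m measurable_W i in auto)
qed

definition transf :: "complex => (real^'n => complex) => real^'n => complex" where
 "transf a f x = (LINT q|W. e a q x * f q)"

lemma transf_integrable: "gauss_bounded f ==> integrable W (\<lambda>q. e a q x * f q)"
 using gauss_bounded_integrable[OF gauss_bounded_e, of f a x] by (simp add: e_symmetric[of a x])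

context
 fixes \<phi> assumes \<phi>: "gauss_bounded \<phi>"
begin

lemma transf_deriv_bound:
 obtains b where "!!r. integrable W (b r)" "!!r x q v. norm x <= r ==> norm (fderiv (e a q) x v * \<phi> q) <= norm v * b r q"
  "!!r q. 0 <= b r q"
proof -
 let ?A = "\<lambda>r q. norm a * (r + 1) * norm q"
 let ?B = "\<lambda>c q. c * norm q - (norm q)\<^sup>2 / 2"
 obtain C c where C: "0 <= C" "!!x. norm (\<phi> x) <= C * exp (c * norm x - (norm x)\<^sup>2 / 2)" using gauss_boundedE[OF \<phi>] by metis
 define b where "b r q = C * exp ((norm a * (r + 1) + c) * norm q - (norm q)\<^sup>2 / 2)" for r and q :: "real^'n"
 show ?thesis
 proof (rule that[of b])
  show "integrable W (b r)" for r unfolding b_def by (intro integrable_mult_right integrable_gauss)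
  show "0 <= b r q" for r q using C(1) by (simp add: b_def)
  fix r x q v :: "real^'n" assume "norm (x :: real^'n) <= r" for r :: real
 next
  fix r and x q v :: "real^'n" assume x: "norm x <= r"
  have "norm (fderiv (e a q) x v) <= norm v * exp (norm a * norm q * (norm x + 1))" by (rule e_derivative_bound)
  also have "\<dots> <= norm v * exp (?A r q)"
  proof (rule mult_left_mono)
   have "norm a * norm q * (norm x + 1) <= norm a * norm q * (r + 1)" using x by (intro mult_left_mono) auto
   thus "exp (norm a * norm q * (norm x + 1)) <= exp (?A r q)" by (simp add: mult_ac)
  qed simp
  finally have "norm (fderiv (e a q) x v * \<phi> q) <= (norm v * exp (?A r q)) * (C * exp (?B c q))"
   unfolding norm_mult by (intro mult_mono C) auto
  also have "\<dots> = norm v * (C * (exp (?A r q) * exp (?B c q)))" by simp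
  also have "exp (?A r q) * exp (?B c q) = exp ((norm a * (r + 1) + c) * norm q - (norm q)\<^sup>2 / 2)"
   by (simp add: exp_add[symmetric] algebra_simps)
  finally show "norm (fderiv (e a q) x v * \<phi> q) <= norm v * b r q" by (simp only: b_def)
 qed
qed

lemma transf_deriv_measurable [measurable]: "(\<lambda>q. fderiv (e a q) x v * \<phi> q) \<in> borelm"
 by (intro borel_measurable_continuous_onI continuous_intros e_deriv_continuous gauss_bounded_continuous \<phi>)

lemma transf_has_derivative: "(transf a \<phi> has_derivative (\<lambda>v. LINT q|W. fderiv (e a q) x v * \<phi> q)) (at x)"
 and transf_deriv_integrable: "integrable W (\<lambda>q. fderiv (e a q) x v * \<phi> q)"
proof -
 obtain b where b: "!!r. integrable W (b r)" "!!r x q v. norm x <= r ==> norm (fderiv (e a q) x v * \<phi> q) <= norm v * b r q"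
  using transf_deriv_bound[of a] by metis
 note D = has_derivative_integral[where \<delta>=1 and a=x and M=W and b="b (norm x + 1)"
   and f="\<lambda>x q. e a q x * \<phi> q" and f'="\<lambda>x q v. fderiv (e a q) x v * \<phi> q", OF zero_less_one transf_integrable[OF \<phi>]]
 have der: "((\<lambda>x. e a q x * \<phi> q) has_derivative (\<lambda>v. fderiv (e a q) x v * \<phi> q)) (at x)" for x q
  by (rule has_derivative_mult_left) (use e_differentiable in \<open>simp add: frechet_derivative_works\<close>)
 have bound: "norm (fderiv (e a q) z v * \<phi> q) <= b (norm x + 1) q * norm v" if "z \<in> ball x 1" for z q v
 proof -
  have "norm z <= norm x + 1" using that norm_triangle_ineq2[of z x] by (simp add: dist_norm norm_minus_commute)
  thus ?thesis using b(2)[of z "norm x + 1" q v] by (simp add: mult.commute)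
 qed
 show "(transf a \<phi> has_derivative (\<lambda>v. LINT q|W. fderiv (e a q) x v * \<phi> q)) (at x)"
  unfolding transf_def[abs_def] by (rule D(1)[OF der bound b(1)])
 show "integrable W (\<lambda>q. fderiv (e a q) x v * \<phi> q)" by (rule D(2)[OF der bound b(1)])
qed

lemma transf_differentiable: "transf a \<phi> differentiable (at x)"
 unfolding differentiable_def by (rule exI, rule transf_has_derivative)

lemma transf_frechet: "fderiv (transf a \<phi>) x v = (LINT q|W. fderiv (e a q) x v * \<phi> q)"
 using fderiv_eq[OF transf_has_derivative] by simp

lemma transf_C1: "C_class 1 (transf a \<phi>)"
proof -
 obtain b where b: "!!r. integrable W (b r)" "!!r x q v. norm x <= r ==> norm (fderiv (e a q) x v * \<phi> q) <= norm v * b r q"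
  "!!r q. 0 <= b r q" using transf_deriv_bound[of a] by metis
 have "cts (\<lambda>x. LINT q|W. fderiv (e a q) x v * \<phi> q)" for v
 proof (rule integral_param_continuous[where b="\<lambda>r q. norm v * b r q"])
  show "cts (\<lambda>x. fderiv (e a q) x v * \<phi> q)" for q
   by (intro continuous_intros e_deriv_continuous)
  show "integrable W (\<lambda>q. norm v * b r q)" for r by (intro integrable_mult_right b)
 qed (use b(2) in auto)
 thus ?thesis by (simp add: transf_differentiable partial_deriv_def[abs_def] transf_frechet)
qed

lemma dunkl_op_transf: "T v (transf a \<phi>) x = (LINT p|W. a * cor (v \<bullet> p) * (e a p x * \<phi> p))"
proof -
 let ?A = "\<lambda>b a. \<lambda>p. rquot b (e a p) x * \<phi> p"
 let ?B = "\<lambda>b a. LINT p|W. rquot b (e a p) x * \<phi> p"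
 have q: "rquot b (transf a \<phi>) x = (?B b a)"
  and qi: "integrable W (?A b a)" if a: "b \<in> R" for b
 proof -
  have "rquot b (transf a \<phi>) x = (?B b a) \<and> integrable W (?A b a)"
  proof (cases "b \<bullet> x = 0")
   case True thus ?thesis using a by (simp add: reflection_quotient_root transf_frechet transf_deriv_integrable)
  next
   case False
   have eq: "rquot b (e a p) x * \<phi> p = (e a p x * \<phi> p - e a p (\<sigma> b x) * \<phi> p) / cor (b \<bullet> x)" for p
    using False a by (simp add: reflection_quotient_root left_diff_distrib diff_divide_distrib)
   have i: "integrable W (\<lambda>p. e a p x * \<phi> p - e a p (\<sigma> b x) * \<phi> p)"
    by (intro Bochner_Integration.integrable_diff transf_integrable \<phi>)
   show ?thesis unfolding eq using False a i
    by (simp add: reflection_quotient_root transf_def transf_integrable[OF \<phi>])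
  qed
  thus "rquot b (transf a \<phi>) x = (?B b a)"
  "integrable W (?A b a)" by blast+
 qed
 have "T v (transf a \<phi>) x = (LINT p|W. fderiv (e a p) x v * \<phi> p) +
   (\<Sum>b\<in>R. LINT p|W. cor (k b / 2 * (b \<bullet> v)) * (rquot b (e a p) x * \<phi> p))"
  unfolding dunkl_op_def transf_frechet by (simp add: q)
 also have "\<dots> = (LINT p|W. fderiv (e a p) x v * \<phi> p + (\<Sum>b\<in>R. cor (k b / 2 * (b \<bullet> v)) * (rquot b (e a p) x * \<phi> p)))"
  using transf_deriv_integrable qi by (simp del: of_real_mult of_real_divide)
 also have "\<dots> = (LINT p|W. T v (e a p) x * \<phi> p)"
  unfolding dunkl_op_def by (simp add: distrib_right sum_distrib_right mult.assoc)
 finally show ?thesis unfolding dunkl_op_e by (simp add: mult.assoc)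
qed

end

lemma gauss_C1: "C_class 1 gauss" and gauss_derivative: "fderiv gauss x v = - cor (x \<bullet> v) * gauss x"
 and gauss_diff: "gauss differentiable (at x)"
proof -
 have d: "(gauss has_derivative (\<lambda>v. - cor (x \<bullet> v) * gauss x)) (at x)" for x
 proof -
  have "((\<lambda>x :: real^'n. - (norm x)\<^sup>2 / 2) has_derivative (\<lambda>v. - (x \<bullet> v))) (at x)"
   unfolding power2_norm_eq_inner by (auto intro!: derivative_eq_intros simp: inner_commute)
  from has_derivative_of_real[OF has_derivative_exp[OF this]]
  show ?thesis unfolding gauss_def[abs_def] by (rule has_derivative_eq_rhs) simp
 qed
 show 1: "fderiv gauss x v = - cor (x \<bullet> v) * gauss x" for x v
  using fderiv_eq[OF d] by simp
 show 2: "gauss differentiable (at x)" for x using d differentiable_def by blast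
 have "cts (\<lambda>x. - cor (x \<bullet> v) * gauss x)" for v
  by (intro continuous_intros gauss_bounded_continuous gauss_bounded_gauss)
 thus "C_class 1 gauss" by (simp add: 2 partial_deriv_def[abs_def] 1)
qed

text \<open>Integration by parts expresses the moment of \<open>d \<bullet> x\<close> through the
  integral itself, so \<open>T d \<Psi> u\<close> is \<open>\<Psi> u\<close> times a coefficient
  with one part linear in \<open>u\<close> and one in \<open>v\<close>. The radial factor
  \<open>E\<close> removes the first part; the product then solves the eigenvalue equation of
  \<open>e (a * b) v\<close>, and uniqueness identifies it.\<close>

lemma gauss_transf_eigen:
 "transf a (\<lambda>x. e b v x * gauss x) u = exp (a\<^sup>2 * cor ((norm u)\<^sup>2 / 2)) * transf a (\<lambda>x. e b v x * gauss x) 0 * e (a * b) v u"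
proof -
 let ?A = "\<lambda>u. a\<^sup>2 * cor ((norm u)\<^sup>2 / 2)"
 let ?B = "\<lambda>d u \<phi>. LINT x|W. cor (d \<bullet> x) * (e a u x * \<phi> x)"
 define \<phi> where "\<phi> x = e b v x * gauss x" for x
 have \<phi>: "gauss_bounded \<phi>" unfolding \<phi>_def by (intro gauss_bounded_e gauss_bounded_gauss)
 have \<phi>': "\<phi> = (\<lambda>x. gauss x * e b v x)" by (simp add: \<phi>_def fun_eq_iff)
 have g_inv: "gauss (\<sigma> r x) = gauss x" if "r \<in> R" for r x using that by (simp add: gauss_def)
 have T\<phi>: "T d \<phi> x = cor (d \<bullet> v) * b * \<phi> x - cor (d \<bullet> x) * \<phi> x" for d x
 proof -
  have "T d \<phi> x = gauss x * T d (e b v) x + fderiv gauss x d * e b v x"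
   unfolding \<phi>' by (rule dunkl_op_invariant_mult[OF gauss_diff g_inv e_differentiable])
  thus ?thesis unfolding dunkl_op_e gauss_derivative \<phi>_def by (simp add: inner_commute algebra_simps)
 qed
 have C\<phi>: "C_class 1 \<phi>" unfolding \<phi>' by (intro C_class_mult gauss_C1 e_C1)
 define \<Psi> where "\<Psi> = transf a \<phi>"
 have T\<Psi>: "T d \<Psi> u = (a\<^sup>2 * cor (d \<bullet> u) + a * b * cor (d \<bullet> v)) * \<Psi> u" for d u
 proof -
  have ib: "integrable W (\<lambda>x. e a u x * \<phi> x)" by (rule gauss_bounded_integrable[OF gauss_bounded_e[OF \<phi>]])
  have ii: "integrable W (\<lambda>x. cor (d \<bullet> x) * (e a u x * \<phi> x))"
   by (rule gauss_bounded_integrable[OF gauss_bounded_inner[OF gauss_bounded_e[OF \<phi>]]])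
  have Tf: "T d (e a u) x * \<phi> x = a * cor (d \<bullet> u) * (e a u x * \<phi> x)" for x by (simp add: dunkl_op_e mult.assoc)
  have Tg: "e a u x * T d \<phi> x = cor (d \<bullet> v) * b * (e a u x * \<phi> x) - cor (d \<bullet> x) * (e a u x * \<phi> x)" for x
   by (simp add: T\<phi> algebra_simps)
  have "integrable W (\<lambda>x. T d (e a u) x * \<phi> x)" unfolding Tf using ib by simp
  moreover have "integrable W (\<lambda>x. e a u x * T d \<phi> x)" unfolding Tg using ib ii by simp
  ultimately have "(LINT x|W. T d (e a u) x * \<phi> x) = - (LINT x|W. e a u x * T d \<phi> x)"
   by (rule by_parts[OF e_C1 C\<phi> ib])
  hence "a * cor (d \<bullet> u) * (LINT x|W. e a u x * \<phi> x) =
    - (cor (d \<bullet> v) * b * (LINT x|W. e a u x * \<phi> x) - (?B d u \<phi>))"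
   unfolding Tf Tg using ib ii by simp
  hence 1: "(?B d u \<phi>) = (a * cor (d \<bullet> u) + cor (d \<bullet> v) * b) * (LINT x|W. e a u x * \<phi> x)"
   by (simp add: algebra_simps)
  have "T d \<Psi> u = a * (?B d u \<phi>)"
   unfolding \<Psi>_def dunkl_op_transf[OF \<phi>] by (simp add: mult.assoc e_symmetric[of a u])
  moreover have "\<Psi> u = (LINT x|W. e a u x * \<phi> x)" unfolding \<Psi>_def transf_def by (simp add: e_symmetric[of a u])
  ultimately show ?thesis using 1 by (simp add: power2_eq_square algebra_simps)
 qed
 define E where "E u = exp (- (?A u))" for u :: "real^'n"
 have Ed: "(E has_derivative (\<lambda>w. - (a\<^sup>2 * cor (u \<bullet> w)) * E u)) (at u)" for u
 proof -
  have "((\<lambda>x :: real^'n. (norm x)\<^sup>2 / 2) has_derivative (\<lambda>w. u \<bullet> w)) (at u)"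
   unfolding power2_norm_eq_inner by (auto intro!: derivative_eq_intros simp: inner_commute)
  from has_derivative_minus[OF has_derivative_mult_right[OF has_derivative_of_real[OF this], of "a\<^sup>2"]]
  have 1: "((\<lambda>x :: real^'n. - (a\<^sup>2 * cor ((norm x)\<^sup>2 / 2))) has_derivative (\<lambda>w. - (a\<^sup>2 * cor (u \<bullet> w)))) (at u)" .
  have "(E has_derivative (\<lambda>w. - (a\<^sup>2 * cor (u \<bullet> w)) * exp (- (?A u)))) (at u)"
   unfolding E_def[abs_def]
   by (rule has_derivative_eq_rhs[OF has_derivative_compose[OF 1, where g=exp, OF has_field_derivative_imp_has_derivative[OF DERIV_exp]]]) (simp add: mult.commute)
  thus ?thesis by (simp add: E_def)
 qed
 have Ediff: "E differentiable (at u)" for u using Ed differentiable_def by blast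
 have \<Psi>diff: "\<Psi> differentiable (at u)" for u unfolding \<Psi>_def by (rule transf_differentiable[OF \<phi>])
 have "(\<lambda>u. E u * \<Psi> u) = (\<lambda>u. \<Psi> 0 * e (a * b) v u)"
 proof (rule eigenfunction_unique[where c="a * b" and y=v])
  show "(\<lambda>u. E u * \<Psi> u) differentiable (at x)" for x by (intro differentiable_mult Ediff \<Psi>diff)
  show "(\<lambda>u. \<Psi> 0 * e (a * b) v u) differentiable (at x)" for x by (intro differentiable_mult e_differentiable differentiable_const)
  show "T q (\<lambda>u. E u * \<Psi> u) z = a * b * cor (q \<bullet> v) * (E z * \<Psi> z)" for q z
  proof -
   have "E (\<sigma> r x) = E x" if "r \<in> R" for r x using that by (simp add: E_def)
   from dunkl_op_invariant_mult[OF Ediff this \<Psi>diff]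
   have "T q (\<lambda>u. E u * \<Psi> u) z = E z * T q \<Psi> z + fderiv E z q * \<Psi> z" .
   also have "fderiv E z q = - (a\<^sup>2 * cor (z \<bullet> q)) * E z"
    using fderiv_eq[OF Ed] by simp
   finally show ?thesis unfolding T\<Psi> by (simp add: inner_commute algebra_simps)
  qed
  show "T q (\<lambda>u. \<Psi> 0 * e (a * b) v u) z = a * b * cor (q \<bullet> v) * (\<Psi> 0 * e (a * b) v z)" for q z
   by (simp add: dunkl_op_cmult[OF e_differentiable] dunkl_op_e)
 qed (simp add: E_def)
 from fun_cong[OF this, of u] have "exp (?A u) * (E u * \<Psi> u) = exp (?A u) * (\<Psi> 0 * e (a * b) v u)"
  by simp
 moreover have "exp (?A u) * E u = 1"
  unfolding E_def by (simp add: exp_minus_inverse)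
 ultimately have "\<Psi> u = exp (?A u) * (\<Psi> 0 * e (a * b) v u)"
  by (metis mult.assoc mult_1)
 thus ?thesis by (simp add: \<Psi>_def \<phi>_def[abs_def] mult.assoc)
qed

text \<open>The eigenfunction formula is used twice, the second time with a vanishing vector in the
  inner kernel, which reduces the remaining constant to \<open>c\<close>. The scalars
  \<open>\<i>, -\<i>\<close> give the Fourier form of the heat kernel and the scalars 1, 0 its total
  mass.\<close>

theorem gauss_kernel_integral:
 "(LINT x|W. e a u x * e b v x * gauss x) =
  cor c * exp (a\<^sup>2 * cor ((norm u)\<^sup>2 / 2) + b\<^sup>2 * cor ((norm v)\<^sup>2 / 2)) * e (a * b) v u"
proof -
 have 0: "transf b gauss 0 = cor c"
  unfolding transf_def gauss_def c_def' by simp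
 have 1: "transf b gauss v = exp (b\<^sup>2 * cor ((norm v)\<^sup>2 / 2)) * cor c"
  using gauss_transf_eigen[of b b 0 v] by (simp add: 0)
 have 2: "transf a (\<lambda>x. e b v x * gauss x) 0 = transf b gauss v"
  unfolding transf_def by (simp add: e_symmetric[of b v])
 have "(LINT x|W. e a u x * e b v x * gauss x) = transf a (\<lambda>x. e b v x * gauss x) u"
  unfolding transf_def by (simp add: e_symmetric[of a u] mult.assoc)
 thus ?thesis unfolding gauss_transf_eigen[of a b v u] 2 1 exp_add by (simp add: mult_ac)
qed

section \<open>The heat kernel at unit time and its diagonal\<close>

text \<open>The heat kernel of half the Dunkl Laplacian at time 1, with the normalising constant
  left out: its integral in \<open>x\<close> is \<open>c\<close>, not 1.\<close>

definition h :: "real^'n => real^'n => real" where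
 "h x y = exp (- ((norm x)\<^sup>2 + (norm y)\<^sup>2) / 2) * er x y"

lemma h_nonneg: "0 <= h x y" unfolding h_def by (simp add: er_nonneg)

lemma er_continuous:
 assumes "continuous_on S p" "continuous_on S q" shows "continuous_on S (\<lambda>y. er (p y) (q y))"
 unfolding er_def by (intro continuous_intros e_continuous assms)

lemma h_continuous:
 assumes "continuous_on S p" "continuous_on S q" shows "continuous_on S (\<lambda>y. h (p y) (q y))"
 unfolding h_def by (intro continuous_intros er_continuous assms) auto

lemma er_equivariant: "g \<in> G ==> er (g x) (g y) = er x y"
 unfolding er_def by (simp add: e_equivariant)

lemma h_equivariant: "g \<in> G ==> h (g x) (g y) = h x y"
 unfolding h_def by (simp add: er_equivariant)

lemma h_fourier: "cor (c * h x y) = (LINT q|W. e \<i> x q * e (-\<i>) y q * gauss q)"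
proof -
 let ?A = "- ((norm x)\<^sup>2 + (norm y)\<^sup>2) / 2"
 have "(LINT q|W. e \<i> x q * e (-\<i>) y q * gauss q) = cor c * exp (cor ?A) * e 1 y x"
 proof -
  have arg: "\<i>\<^sup>2 * cor ((norm x)\<^sup>2 / 2) + (-\<i>)\<^sup>2 * cor ((norm y)\<^sup>2 / 2) = cor ?A"
   by (simp add: field_simps)
  show ?thesis unfolding gauss_kernel_integral[of \<i> x "-\<i>" y] arg by simp
 qed
 also have "\<dots> = cor (c * h x y)"
  by (simp add: h_def er er_symmetric[of y x] exp_of_real[symmetric])
 finally show ?thesis by simp
qed

lemma h_mass: "(nnint W (\<lambda>x. h x y)) = ennreal c"
proof -
 let ?A = "- (norm y)\<^sup>2 / 2"
 have gb: "gauss_bounded (\<lambda>x. e 1 y x * gauss x)" by (rule gauss_bounded_e[OF gauss_bounded_gauss])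
 have eq: "cor (h x y) = cor (exp ?A) * (e 1 y x * gauss x)" for x
 proof -
  have "h x y = exp ?A * (er y x * exp (- (norm x)\<^sup>2 / 2))"
   unfolding h_def er_symmetric[of x y] by (simp add: exp_add[symmetric] diff_divide_distrib add_divide_distrib)
  thus ?thesis unfolding er gauss_def by (simp only: of_real_mult)
 qed
 have int: "integrable W (\<lambda>x. cor (h x y))"
  unfolding eq by (intro integrable_mult_right gauss_bounded_integrable gb)
 have "(LINT x|W. cor (h x y)) = cor (exp ?A) * (LINT x|W. e 1 y x * e 0 0 x * gauss x)"
  unfolding eq by simp
 also have "\<dots> = cor (exp ?A * exp ((norm y)\<^sup>2 / 2) * c)"
  unfolding gauss_kernel_integral by (simp add: exp_of_real[symmetric])
 also have "exp ?A * exp ((norm y)\<^sup>2 / 2) = 1" by (simp add: exp_add[symmetric])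
 finally have "cor (LINT x|W. h x y) = cor c" by simp
 hence "(LINT x|W. h x y) = c" by (simp only: of_real_eq_iff)
 moreover have "integrable W (\<lambda>x. h x y)" using int by (simp only: complex_of_real_integrable_eq)
 ultimately show ?thesis using nn_integral_eq_integral[of W "\<lambda>x. h x y"] h_nonneg by simp
qed

text \<open>By the Fourier form the kernel is positive definite: the Gaussian integral of the
  squared modulus of \<open>e \<i> x q - t * e \<i> y q\<close> is a nonnegative quadratic in
  \<open>t\<close>, and its discriminant is the claim.\<close>

lemma h_cauchy_schwarz: "(h x y)\<^sup>2 <= h x x * h y y"
proof -
 let ?A = "\<lambda>t. LINT q|W. (norm (e \<i> x q - cor t * e \<i> y q))\<^sup>2 * exp (- (norm q)\<^sup>2 / 2)"
 let ?B = "\<lambda>q t. (norm (e \<i> x q - cor t * e \<i> y q))\<^sup>2 * exp (- (norm q)\<^sup>2 / 2)"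
 have quad: "0 <= h x x - 2 * t * h x y + t\<^sup>2 * h y y" for t
 proof -
  have i: "integrable W (\<lambda>q. e \<i> u q * e (-\<i>) v q * gauss q)" for u v
   using gauss_bounded_integrable[OF gauss_bounded_e[OF gauss_bounded_e[OF gauss_bounded_gauss]]] by (simp add: mult.assoc)
  have "cor (?B q t) =
   e \<i> x q * e (-\<i>) x q * gauss q - cor t * (e \<i> x q * e (-\<i>) y q * gauss q)
   - cor t * (e \<i> y q * e (-\<i>) x q * gauss q) + cor (t\<^sup>2) * (e \<i> y q * e (-\<i>) y q * gauss q)" for q
  proof -
   have cn: "cnj (e \<i> u q) = e (-\<i>) u q" for u by (simp add: e_cnj)
   show ?thesis unfolding of_real_mult complex_norm_square gauss_def
    by (simp add: cn) (simp add: power2_eq_square algebra_simps)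
  qed
  hence "(LINT q|W. cor (?B q t)) =
   cor (c * h x x) - cor t * cor (c * h x y) - cor t * cor (c * h y x) + cor (t\<^sup>2) * cor (c * h y y)"
   unfolding h_fourier using i by simp
  hence "cor (?A t) =
   cor (c * (h x x - 2 * t * h x y + t\<^sup>2 * h y y))"
   by (simp only: integral_complex_of_real) (simp add: h_def er_symmetric[of y x] algebra_simps)
  hence "(?A t) = c * (h x x - 2 * t * h x y + t\<^sup>2 * h y y)"
   by (simp only: of_real_eq_iff)
  moreover have "0 <= (?A t)"
   by (rule Bochner_Integration.integral_nonneg) simp
  ultimately show ?thesis using c_pos by (simp add: zero_le_mult_iff)
 qed
 show ?thesis
 proof (cases "h y y = 0")
  case True
  have "h x y = 0"
  proof (rule ccontr)
   assume "h x y \<noteq> 0"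
   \<comment> \<open>With \<open>h y y = 0\<close> the quadratic is affine in \<open>t\<close>; at
     this value of \<open>t\<close> it equals -1.\<close>
   thus False using quad[of "(h x x + 1) / (2 * h x y)"] True by (simp add: field_simps)
  qed
  thus ?thesis using True by simp
 next
  case False
  hence pos: "h y y > 0" using h_nonneg[of y y] by simp
  have "0 <= h y y * (h x x - 2 * (h x y / h y y) * h x y + (h x y / h y y)\<^sup>2 * h y y)"
   using quad[of "h x y / h y y"] pos by (intro mult_nonneg_nonneg) auto
  also have "\<dots> = h x x * h y y - (h x y)\<^sup>2"
   using pos by (simp add: field_simps power2_eq_square)
  finally show ?thesis by simp
 qed
qed

section \<open>The bound on the diagonal: geometry of chambers and a Harnack inequality\<close>

lemma er_line_derivative:
 "((\<lambda>s. er (p + s *\<^sub>R q) y) has_real_derivative Re (fderiv (e 1 y) (p + s *\<^sub>R q) q)) (at s)"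
proof -
 let ?A = "\<lambda>s. p + s *\<^sub>R q"
 have "((\<lambda>s. e 1 y (?A s)) has_derivative (\<lambda>u. fderiv (e 1 y) (?A s) (u *\<^sub>R q))) (at s)"
 proof (rule has_derivative_compose[where g="e 1 y"])
  show "((\<lambda>s. p + s *\<^sub>R q) has_derivative (\<lambda>u. u *\<^sub>R q)) (at s)" by (auto intro!: derivative_eq_intros)
  show "(e 1 y has_derivative fderiv (e 1 y) (?A s)) (at (?A s))"
   using e_differentiable by (simp add: frechet_derivative_works)
 qed
 hence "((\<lambda>s. Re (e 1 y (?A s))) has_derivative (\<lambda>u. Re (fderiv (e 1 y) (?A s) (u *\<^sub>R q)))) (at s)"
  by (rule bounded_linear.has_derivative[OF bounded_linear_Re])
 moreover have "(\<lambda>s. Re (e 1 y (?A s))) = (\<lambda>s. er (?A s) y)"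
  by (simp add: er_def e_symmetric[of 1 y])
 ultimately show ?thesis
  by (simp add: has_field_derivative_def linear_scale[OF linear_frechet_derivative[OF e_differentiable]] mult.commute[of _ "Re _"] fun_eq_iff)
qed

lemma er_direction:
 "Re (fderiv (e 1 y) x v) = (v \<bullet> y) * er x y - (\<Sum>a\<in>R. k a / 2 * (a \<bullet> v) * Re (rquot a (e 1 y) x))"
proof -
 have "fderiv (e 1 y) x v = cor (v \<bullet> y) * e 1 y x - (\<Sum>a\<in>R. cor (k a / 2 * (a \<bullet> v)) * rquot a (e 1 y) x)"
  using dunkl_op_e[of v 1 y x] unfolding dunkl_op_def by (simp add: algebra_simps)
 thus ?thesis by (simp add: er er_symmetric[of y x])
qed

text \<open>A single reflection in a root of \<open>S\<close> moves such a point by at most 2, and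
  orthogonality lets displacements add along products. The bound \<open>K\<close> is chosen before
  \<open>y\<close>.\<close>

lemma subgroup_displacement:
 assumes "g \<in> reflection_group S" "S \<subseteq> R"
 shows "\<exists>K\<ge>0. \<forall>y. (\<forall>b\<in>S. \<bar>y \<bullet> b\<bar> <= 1) \<longrightarrow> norm (y - g y) <= K"
 using assms(1)
proof (induction rule: reflection_group.induct)
 case 1 show ?case by (intro exI[of _ 0]) simp
next
 case (2 b)
 show ?case
 proof (intro exI[of _ 2] conjI allI impI)
  fix y assume y: "\<forall>b\<in>S. \<bar>y \<bullet> b\<bar> <= 1"
  have a: "b \<in> R" using 2 assms(2) by blast
  have "\<bar>y \<bullet> b\<bar> * norm b <= 1 * 2" using y 2 norm_root_le[OF a] by (intro mult_mono) auto
  thus "norm (y - \<sigma> b y) <= 2" by (simp add: reflection_root[OF a])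
 qed simp
next
 case (3 g h)
 then obtain K K' where K: "K >= 0" "!!y. (\<forall>b\<in>S. \<bar>y \<bullet> b\<bar> <= 1) ==> norm (y - g y) <= K"
  and K': "K' >= 0" "!!y. (\<forall>b\<in>S. \<bar>y \<bullet> b\<bar> <= 1) ==> norm (y - h y) <= K'" by blast
 have og: "orthogonal_transformation g" using subgroup_orthogonal[OF 3(1) assms(2)] .
 show ?case
 proof (intro exI[of _ "K + K'"] conjI allI impI)
  fix y assume y: "\<forall>b\<in>S. \<bar>y \<bullet> b\<bar> <= 1"
  have "norm (g y - g (h y)) = norm (y - h y)"
   using orthogonal_transformation_norm[OF og, of "y - h y"] linear_diff[OF orthogonal_transformation_linear[OF og]] by simp
  hence "norm ((y - g y) + (g y - g (h y))) <= K + K'"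
   using K(2)[OF y] K'(2)[OF y] by (intro order_trans[OF norm_triangle_ineq] add_mono) auto
  thus "norm (y - (g \<circ> h) y) <= K + K'" by simp
 qed (use K K' in simp)
next
 case (4 g)
 then obtain K where K: "K >= 0" "!!y. (\<forall>b\<in>S. \<bar>y \<bullet> b\<bar> <= 1) ==> norm (y - g y) <= K" by blast
 have g: "g \<in> G" using subgroup_mono[OF 4(1) assms(2)] .
 show ?case
 proof (intro exI[of _ K] conjI allI impI)
  fix y assume y: "\<forall>b\<in>S. \<bar>y \<bullet> b\<bar> <= 1"
  have "norm (y - inv g y) = norm (g (y - inv g y))" using g by simp
  also have "\<dots> = norm (g y - y)" using g linear_diff[OF group_linear[OF g]] by simp
  finally show "norm (y - inv g y) <= K" using K(2)[OF y] by (simp add: norm_minus_commute)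
 qed (use K in simp)
qed

text \<open>There are only finitely many pairs of a subset of \<open>R\<close> and an element of the
  group it generates, so the bounds may be summed.\<close>

lemma uniform_displacement:
 obtains K where "K >= 0" "!!S g y. S \<subseteq> R ==> g \<in> reflection_group S ==> (\<forall>b\<in>S. \<bar>y \<bullet> b\<bar> <= 1) ==> norm (y - g y) <= K"
proof -
 define I where "I = {(S, g). S \<subseteq> R \<and> g \<in> reflection_group S}"
 have "I \<subseteq> Pow R \<times> G" using subgroup_mono by (auto simp: I_def)
 hence fin: "finite I" by (rule finite_subset) auto
 have "\<forall>i\<in>I. \<exists>K\<ge>0. \<forall>y. (\<forall>b\<in>fst i. \<bar>y \<bullet> b\<bar> <= 1) \<longrightarrow> norm (y - snd i y) <= K"
  using subgroup_displacement by (auto simp: I_def)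
 then obtain K where K: "!!i. i \<in> I ==> K i >= 0" "!!i y. i \<in> I ==> (\<forall>b\<in>fst i. \<bar>y \<bullet> b\<bar> <= 1) ==> norm (y - snd i y) <= K i"
  by metis
 show ?thesis
 proof (rule that[of "sum K I"])
  show "sum K I >= 0" by (intro sum_nonneg K)
  fix S g y assume a: "S \<subseteq> R" "g \<in> reflection_group S" "\<forall>b\<in>S. \<bar>y \<bullet> b\<bar> <= 1"
  hence i: "(S, g) \<in> I" by (simp add: I_def)
  have "norm (y - g y) <= K (S, g)" using K(2)[OF i, of y] a(3) by simp
  also have "\<dots> <= sum K I" using fin K(1) i by (intro member_le_sum) auto
  finally show "norm (y - g y) <= sum K I" .
 qed
qed

text \<open>Almost every point avoids the finitely many walls. The margin
  \<open>4 * \<delta>\<close> leaves \<open>2 * \<delta>\<close> on the whole ball of radius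
  \<open>\<delta>\<close> about \<open>r\<close>, because roots have norm at most 2.\<close>

lemma regular_vector:
 obtains r \<delta> where "0 < \<delta>" "\<delta> <= 1" "!!a. a \<in> R ==> 4 * \<delta> <= \<bar>r \<bullet> a\<bar>"
proof -
 obtain r where r: "\<forall>a\<in>R. r \<bullet> a \<noteq> 0"
 proof -
  have "\<exists>x. \<forall>a\<in>R. x \<bullet> a \<noteq> 0"
  proof (rule ccontr)
   assume "\<not> (\<exists>x. \<forall>a\<in>R. x \<bullet> a \<noteq> 0)"
   hence "AE x in (lborel :: (real^'n) measure). False" using AE_regular by (auto elim: eventually_mono)
   hence "UNIV \<in> null_sets (lborel :: (real^'n) measure)" by (subst (asm) AE_iff_null) auto
   thus False using emeasure_lborel_UNIV[where 'a="real^'n"] by (simp add: null_sets_def)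
  qed
  thus ?thesis using that by blast
 qed
 define \<delta> where "\<delta> = Min (insert 1 ((\<lambda>a. \<bar>r \<bullet> a\<bar> / 4) ` R))"
 show ?thesis
 proof (rule that[of \<delta> r])
  show "0 < \<delta>" unfolding \<delta>_def using r by (subst Min_gr_iff) auto
  show "\<delta> <= 1" unfolding \<delta>_def by (rule Min_le) auto
  show "4 * \<delta> <= \<bar>r \<bullet> a\<bar>" if "a \<in> R" for a
  proof -
   have "\<delta> <= \<bar>r \<bullet> a\<bar> / 4" unfolding \<delta>_def using that by (intro Min_le) auto
   thus ?thesis by simp
  qed
 qed
qed

text \<open>Moving away from the walls along a direction \<open>\<eta>\<close> of the chamber of \<open>y\<close>, the coefficients
 \<open>\<langle>p, g \<eta>\<rangle> / \<langle>p, g x\<rangle>\<close> of the reflection terms are nonnegative. Summing over the group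
 generated by the reflections in the walls close to \<open>y\<close> cancels the unbounded coefficients.\<close>

lemma chamber_harnack:
 assumes K: "K >= 0" "!!S g y. S \<subseteq> R ==> g \<in> reflection_group S ==> (\<forall>p\<in>S. \<bar>y \<bullet> p\<bar> <= 1) ==> norm (y - g y) <= K"
  and L: "norm \<eta> <= L" and sgn: "!!p. p \<in> R ==> 0 <= (y \<bullet> p) * (\<eta> \<bullet> p)" and reg: "!!p. p \<in> R ==> \<eta> \<bullet> p \<noteq> 0"
 shows "exp (- (L * K + \<gamma> * (2 * L))) * er y y <= exp (- (\<eta> \<bullet> y)) * (\<Sum>g\<in>G. er (g (y + \<eta>)) y)"
proof -
 \<comment> \<open>The roots whose walls are close to \<open>y\<close>. Their reflections generate
   the group \<open>H\<close>, which displaces \<open>y\<close> by at most \<open>K\<close>.\<close>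
 define S where "S = {p\<in>R. \<bar>y \<bullet> p\<bar> < 1}"
 define H where "H = reflection_group S"
 have S: "S \<subseteq> R" by (auto simp: S_def)
 have HG: "H \<subseteq> G" unfolding H_def using subgroup_mono[OF _ S] by blast
 have finH: "finite H" by (rule finite_subset[OF HG]) simp
 have L0: "L >= 0" using L norm_ge_zero order_trans by blast
 define C where "C = L * K + \<gamma> * (2 * L)"
 define x where "x s = y + s *\<^sub>R \<eta>" for s
 \<comment> \<open>The exponential cancels the main growth and leaves the drift \<open>(g \<eta> -
   \<eta>) \<bullet> y = \<eta> \<bullet> (inv g y - y)\<close>, which is bounded for
   \<open>g\<close> in \<open>H\<close>.\<close>
 define V where "V g s = exp (- (s * (\<eta> \<bullet> y))) * er (g (x s)) y" for g s
 define r where "r g p s = (p \<bullet> g \<eta>) / (p \<bullet> g (x s))" for g :: "real^'n => real^'n" and p s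
 have V0: "0 <= V g s" for g s unfolding V_def by (simp add: er_nonneg)
 have sw: "p \<bullet> g z = inv g p \<bullet> z" if "g \<in> G" for p g z
  using group_swap[OF that, of z p] by (simp add: inner_commute)
 have xin: "l \<bullet> x s = l \<bullet> y + s * (l \<bullet> \<eta>)" for l s by (simp add: x_def inner_add_right)
 have ne: "l \<bullet> x s \<noteq> 0" if "l \<in> R" "s > 0" for l s
 proof
  assume "l \<bullet> x s = 0"
  hence "(l \<bullet> \<eta>) * (l \<bullet> y + s * (l \<bullet> \<eta>)) = 0" by (simp add: xin)
  hence "(y \<bullet> l) * (\<eta> \<bullet> l) + s * (\<eta> \<bullet> l)\<^sup>2 = 0" by (simp add: algebra_simps inner_commute power2_eq_square)
  moreover have "s * (\<eta> \<bullet> l)\<^sup>2 > 0" using reg that by simp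
  ultimately show False using sgn[OF that(1)] by linarith
 qed
 have r0: "0 <= r g p s" if "g \<in> G" "p \<in> R" "s > 0" for g p s
 proof -
  define l where "l = inv g p"
  have b: "l \<in> R" unfolding l_def by (rule group_in_R[OF group_inv[OF that(1)] that(2)])
  have "0 <= (l \<bullet> \<eta>) * (l \<bullet> x s)"
   using sgn[OF b] that(3) by (simp add: xin algebra_simps inner_commute)
  thus ?thesis unfolding r_def sw[OF that(1)] l_def[symmetric] by (simp add: zero_le_divide_iff zero_le_mult_iff)
 qed
 \<comment> \<open>If the reflection in \<open>p\<close> is not in \<open>H\<close>, neither is its
   conjugate by \<open>g\<close>, so \<open>inv g p\<close> belongs to a wall far from
   \<open>y\<close>. Moving along \<open>\<eta>\<close> only increases that distance, and the
   coefficient stays bounded.\<close>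
 have r1: "r g p s <= 2 * L" if "g \<in> H" "p \<in> R" "\<sigma> p \<notin> H" "s > 0" for g p s
 proof -
  have g: "g \<in> G" using that(1) HG by blast
  define l where "l = inv g p"
  have b: "l \<in> R" unfolding l_def by (rule group_in_R[OF group_inv[OF g] that(2)])
  have "l \<notin> S"
  proof
   assume "l \<in> S"
   hence "\<sigma> l \<in> H" unfolding H_def by (rule reflection_group.intros)
   hence "g \<circ> \<sigma> l \<circ> inv g \<in> H" using that(1) unfolding H_def by (intro reflection_group.intros(3,4))
   moreover have "g \<circ> \<sigma> l \<circ> inv g = \<sigma> p"
   proof
    fix z show "(g \<circ> \<sigma> l \<circ> inv g) z = \<sigma> p z"
     using group_reflection_conj[OF g, of l "inv g z"] g by (simp add: l_def)
   qed
   ultimately show False using that(3) by simp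
  qed
  hence by1: "1 <= \<bar>l \<bullet> y\<bar>" using b by (auto simp: S_def inner_commute)
  have same: "0 <= (l \<bullet> y) * (l \<bullet> \<eta>)" using sgn[OF b] by (simp add: inner_commute)
  have "\<bar>l \<bullet> x s\<bar> = \<bar>l \<bullet> y\<bar> + s * \<bar>l \<bullet> \<eta>\<bar>"
  proof -
   have "0 <= (l \<bullet> y) * (s * (l \<bullet> \<eta>))" using same that(4) by (simp add: mult.left_commute)
   moreover have "\<bar>a + b\<bar> = \<bar>a\<bar> + \<bar>b\<bar>" if "0 <= a * b" for a b :: real
    using that by (auto simp: zero_le_mult_iff)
   ultimately have "\<bar>l \<bullet> y + s * (l \<bullet> \<eta>)\<bar> = \<bar>l \<bullet> y\<bar> + \<bar>s * (l \<bullet> \<eta>)\<bar>" by blast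
   thus ?thesis using that(4) by (simp add: xin abs_mult)
  qed
  hence bx: "1 <= \<bar>l \<bullet> x s\<bar>" using by1 that(4) by (simp add: add_increasing2)
  have "r g p s <= \<bar>l \<bullet> \<eta>\<bar> / \<bar>l \<bullet> x s\<bar>"
   unfolding r_def sw[OF g] l_def[symmetric] abs_divide[symmetric] by (rule abs_ge_self)
  also have "\<dots> <= \<bar>l \<bullet> \<eta>\<bar>" using bx by (simp add: divide_le_eq mult_left_le mult_le_cancel_left1)
  also have "\<dots> <= 2 * L" using inner_root_le[OF b, of \<eta>] L by (simp add: inner_commute)
  finally show ?thesis .
 qed
 define V' where "V' g s = (g \<eta> \<bullet> y - \<eta> \<bullet> y) * V g s - (\<Sum>p\<in>R. k p / 2 * r g p s * (V g s - V (\<sigma> p \<circ> g) s))" for g s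
 have der: "(V g has_real_derivative V' g s) (at s)" if g: "g \<in> G" and s: "s > 0" for g s
 proof -
  have gx: "g (x s) = g y + s *\<^sub>R g \<eta>" for s
   unfolding x_def using group_linear[OF g] by (simp add: linear_add linear_scale)
  have "Re (fderiv (e 1 y) (g (x s)) (g \<eta>)) = (g \<eta> \<bullet> y) * er (g (x s)) y - (\<Sum>p\<in>R. k p / 2 * r g p s * (er (g (x s)) y - er (\<sigma> p (g (x s))) y))"
  proof -
   have "k p / 2 * (p \<bullet> g \<eta>) * Re (rquot p (e 1 y) (g (x s))) = k p / 2 * r g p s * (er (g (x s)) y - er (\<sigma> p (g (x s))) y)"
    if a: "p \<in> R" for p
   proof -
    have n0: "p \<bullet> g (x s) \<noteq> 0"
     unfolding sw[OF g] using ne[OF _ s] group_in_R[OF group_inv[OF g] a] by blast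
    have "Re (rquot p (e 1 y) (g (x s))) = (er (g (x s)) y - er (\<sigma> p (g (x s))) y) / (p \<bullet> g (x s))"
     unfolding reflection_quotient_root[OF a] er er_symmetric[of y] using n0
     by (simp add: Re_divide_of_real flip: of_real_diff)
    thus ?thesis by (simp add: r_def)
   qed
   hence "(\<Sum>p\<in>R. k p / 2 * (p \<bullet> g \<eta>) * Re (rquot p (e 1 y) (g (x s)))) = (\<Sum>p\<in>R. k p / 2 * r g p s * (er (g (x s)) y - er (\<sigma> p (g (x s))) y))"
    by (rule sum.cong[OF refl])
   thus ?thesis unfolding er_direction by (simp only:)
  qed
  moreover have "((\<lambda>s. er (g (x s)) y) has_real_derivative Re (fderiv (e 1 y) (g (x s)) (g \<eta>))) (at s)"
   unfolding gx by (rule er_line_derivative)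
  ultimately have d1: "((\<lambda>s. er (g (x s)) y) has_real_derivative ((g \<eta> \<bullet> y) * er (g (x s)) y - (\<Sum>p\<in>R. k p / 2 * r g p s * (er (g (x s)) y - er (\<sigma> p (g (x s))) y)))) (at s)" by simp
  have d2: "((\<lambda>s. exp (- (s * (\<eta> \<bullet> y)))) has_real_derivative (exp (- (s * (\<eta> \<bullet> y))) * (- (\<eta> \<bullet> y)))) (at s)"
   by (auto intro!: derivative_eq_intros)
  have "V' g s = exp (- (s * (\<eta> \<bullet> y))) * (- (\<eta> \<bullet> y)) * er (g (x s)) y + ((g \<eta> \<bullet> y) * er (g (x s)) y - (\<Sum>p\<in>R. k p / 2 * r g p s * (er (g (x s)) y - er (\<sigma> p (g (x s))) y))) * exp (- (s * (\<eta> \<bullet> y)))"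
   unfolding V'_def V_def by (simp add: algebra_simps sum_distrib_left)
  thus ?thesis using DERIV_mult[OF d2 d1] unfolding V_def[abs_def] by simp
 qed
 have lower: "- C * (\<Sum>g\<in>H. V g s) <= (\<Sum>g\<in>H. V' g s)" if s: "s > 0" for s
 proof -
  define q where "q p = (\<Sum>g\<in>H. k p / 2 * r g p s * (V g s - V (\<sigma> p \<circ> g) s))" for p
  have q: "q p <= k p / 2 * (2 * L) * (\<Sum>g\<in>H. V g s)" if a: "p \<in> R" for p
  proof (cases "\<sigma> p \<in> H")
   \<comment> \<open>The coefficient is unchanged when \<open>g\<close> is replaced by
     \<open>\<sigma> p \<circ> g\<close>, numerator and denominator both changing sign. The two
     halves therefore cancel in the sum over \<open>H\<close>, however large they are.\<close>
   case True
   have rr: "r (\<sigma> p \<circ> g) p s = r g p s" for g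
    unfolding r_def by (simp add: reflection_inner_root[OF a])
   have ss: "\<sigma> p \<circ> (\<sigma> p \<circ> g) = g" for g :: "real^'n => real^'n"
    using a by (auto simp: fun_eq_iff reflection_reflection)
   have "(\<Sum>g\<in>H. k p / 2 * r g p s * V (\<sigma> p \<circ> g) s) = (\<Sum>g\<in>H. (\<lambda>g. k p / 2 * r g p s * V g s) (\<sigma> p \<circ> g))"
    by (simp add: rr)
   also have "\<dots> = (\<Sum>g\<in>H. k p / 2 * r g p s * V g s)"
    unfolding H_def by (rule sum_group_left[OF S]) (use True in \<open>simp add: H_def\<close>)
   finally have "q p = 0" unfolding q_def by (simp add: right_diff_distrib sum_subtractf)
   moreover have "0 <= k p / 2 * (2 * L) * (\<Sum>g\<in>H. V g s)"
    using k_nonneg[OF a] L0 by (intro mult_nonneg_nonneg sum_nonneg V0) auto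
   ultimately show ?thesis by simp
  next
   case False
   show ?thesis unfolding q_def sum_distrib_left
   proof (rule sum_mono)
    fix g assume g: "g \<in> H"
    have gG: "g \<in> G" using g HG by blast
    \<comment> \<open>Since the coefficient is nonnegative, the reflected value may be
      dropped.\<close>
    have "r g p s * (V g s - V (\<sigma> p \<circ> g) s) <= r g p s * V g s"
     using V0 r0[OF gG a s] by (intro mult_left_mono) auto
    also have "\<dots> <= 2 * L * V g s" using V0 r1[OF g a False s] by (intro mult_right_mono) auto
    finally have "k p / 2 * (r g p s * (V g s - V (\<sigma> p \<circ> g) s)) <= k p / 2 * (2 * L * V g s)"
     using k_nonneg[OF a] by (intro mult_left_mono) auto
    thus "k p / 2 * r g p s * (V g s - V (\<sigma> p \<circ> g) s) <= k p / 2 * (2 * L) * V g s" by (simp only: mult.assoc)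
   qed
  qed
  have "(\<Sum>g\<in>H. V' g s) = (\<Sum>g\<in>H. (g \<eta> \<bullet> y - \<eta> \<bullet> y) * V g s) - (\<Sum>p\<in>R. q p)"
   unfolding V'_def q_def sum_subtractf by (simp add: sum.swap[of _ R H])
  moreover have "(\<Sum>p\<in>R. q p) <= \<gamma> * (2 * L) * (\<Sum>g\<in>H. V g s)"
   using sum_mono[of R q "\<lambda>p. k p / 2 * (2 * L) * (\<Sum>g\<in>H. V g s)"] q by (simp add: \<gamma>_def sum_distrib_right)
  moreover have "- (L * K) * (\<Sum>g\<in>H. V g s) <= (\<Sum>g\<in>H. (g \<eta> \<bullet> y - \<eta> \<bullet> y) * V g s)"
   unfolding sum_distrib_left
  proof (rule sum_mono, rule mult_right_mono[OF _ V0])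
   fix g assume g: "g \<in> H"
   have gG: "g \<in> G" using g HG by blast
   have "g \<eta> \<bullet> y - \<eta> \<bullet> y = \<eta> \<bullet> (inv g y - y)" using group_swap[OF gG, of \<eta> y] by (simp add: inner_diff_right)
   moreover have "\<bar>\<eta> \<bullet> (inv g y - y)\<bar> <= L * K"
   proof -
    have "norm (y - inv g y) <= K"
     by (rule K(2)[OF S]) (use g in \<open>auto simp: S_def H_def intro: reflection_group.intros\<close>)
    hence "norm \<eta> * norm (inv g y - y) <= L * K" using L L0 by (intro mult_mono) (auto simp: norm_minus_commute)
    thus ?thesis using Cauchy_Schwarz_ineq2[of \<eta> "inv g y - y"] by linarith
   qed
   ultimately show "- (L * K) <= g \<eta> \<bullet> y - \<eta> \<bullet> y" by linarith
  qed
  ultimately show ?thesis unfolding C_def by (simp add: algebra_simps)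
 qed
 define F where "F s = exp (C * s) * (\<Sum>g\<in>H. V g s)" for s
 \<comment> \<open>The derivative formula holds only for \<open>s > 0\<close>, because
   \<open>y\<close> itself may lie on a wall; continuity covers the endpoint.\<close>
 have "F 0 <= F 1"
 proof (rule DERIV_nonneg_imp_increasing_open[where f=F])
  fix s :: real assume s: "0 < s" "s < 1"
  have "(F has_real_derivative (exp (C * s) * C * (\<Sum>g\<in>H. V g s) + (\<Sum>g\<in>H. V' g s) * exp (C * s))) (at s)"
   unfolding F_def[abs_def]
  proof (rule DERIV_mult)
   show "((\<lambda>s. exp (C * s)) has_real_derivative exp (C * s) * C) (at s)" by (auto intro!: derivative_eq_intros)
   show "((\<lambda>s. \<Sum>g\<in>H. V g s) has_real_derivative (\<Sum>g\<in>H. V' g s)) (at s)"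
    using HG s by (intro DERIV_sum der) auto
  qed
  moreover have "0 <= exp (C * s) * ((\<Sum>g\<in>H. V' g s) - (- C * (\<Sum>g\<in>H. V g s)))"
   using lower[OF s(1)] by (intro mult_nonneg_nonneg) auto
  hence "0 <= exp (C * s) * C * (\<Sum>g\<in>H. V g s) + (\<Sum>g\<in>H. V' g s) * exp (C * s)" by (simp add: algebra_simps)
  ultimately show "\<exists>D. (F has_real_derivative D) (at s) \<and> 0 <= D" by blast
 next
  have "continuous_on {0..1} (\<lambda>s. V g s)" if "g \<in> H" for g
  proof -
   have lg: "continuous_on S g" for S
    by (rule linear_continuous_on[OF linear_conv_bounded_linear[THEN iffD1, OF group_linear]]) (use that HG in blast)
   have "continuous_on {0..1} (\<lambda>s. g (x s))"
    by (rule continuous_on_compose2[OF lg[of UNIV]]) (auto simp: x_def intro!: continuous_intros)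
   thus ?thesis unfolding V_def by (intro continuous_intros er_continuous)
  qed
  thus "continuous_on {0..1} F" unfolding F_def by (intro continuous_intros) auto
 qed simp
 moreover have "er y y <= F 0"
 proof -
  have "id \<in> H" unfolding H_def by (rule reflection_group.intros)
  hence "V id 0 <= (\<Sum>g\<in>H. V g 0)" using member_le_sum[of id H "\<lambda>g. V g 0"] finH V0 by blast
  thus ?thesis by (simp add: F_def V_def x_def)
 qed
 moreover have "(\<Sum>g\<in>H. V g 1) <= (\<Sum>g\<in>G. V g 1)" using HG V0 by (intro sum_mono2) auto
 hence "F 1 <= exp C * (\<Sum>g\<in>G. V g 1)" unfolding F_def by simp
 ultimately have "exp (- C) * er y y <= exp (- C) * (exp C * (\<Sum>g\<in>G. V g 1))"
  by (intro mult_left_mono) auto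
 also have "\<dots> = (\<Sum>g\<in>G. V g 1)" by (simp add: mult.assoc[symmetric] exp_add[symmetric])
 also have "\<dots> = exp (- (\<eta> \<bullet> y)) * (\<Sum>g\<in>G. er (g (y + \<eta>)) y)"
  by (simp add: V_def x_def sum_distrib_left)
 finally show ?thesis by (simp add: C_def)
qed

text \<open>The orbit point with the largest inner product with \<open>r\<close> works: if a root
  separated it from \<open>r\<close>, reflecting in that root would increase the product.\<close>

lemma chamber_representative:
 obtains g where "g \<in> G" "!!b. b \<in> R ==> 0 <= (g y \<bullet> b) * (r \<bullet> b)"
proof -
 let ?A = "\<lambda>g. g y \<bullet> r"
 have "finite (?A ` G)" "?A ` G \<noteq> {}" using group_id by auto
 from Max_in[OF this] obtain g where g: "g \<in> G" "g y \<bullet> r = Max (?A ` G)" by auto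
 show ?thesis
 proof (rule that[OF g(1)])
  fix b assume a: "b \<in> R"
  have "\<sigma> b \<circ> g \<in> G" by (intro group_comp group_reflection a g)
  hence "(\<sigma> b \<circ> g) y \<bullet> r <= g y \<bullet> r" unfolding g(2) by (intro Max_ge image_eqI[of _ _ "\<sigma> b \<circ> g"]) auto
  thus "0 <= (g y \<bullet> b) * (r \<bullet> b)" by (simp add: reflection_root[OF a] inner_diff_left inner_commute[of b r])
 qed
qed

text \<open>For \<open>y\<close> in the closed chamber of \<open>r\<close> the Harnack bound holds
  for every displacement \<open>\<eta>\<close> in the ball about \<open>r\<close>. Integrated
  against the weight at \<open>y + \<eta>\<close>, which is at least a multiple of
  \<open>vol y\<close>, its right side becomes a sum over \<open>G\<close> of total masses of
  \<open>h\<close>. Invariance reduces every point to this case.\<close>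

theorem h_diagonal: obtains C where "C > 0" "!!y. h y y * vol y <= C"
proof -
 obtain K where K: "K >= 0" "!!S g y. S \<subseteq> R ==> g \<in> reflection_group S ==> (\<forall>b\<in>S. \<bar>y \<bullet> b\<bar> <= 1) ==> norm (y - g y) <= K"
  using uniform_displacement by metis
 obtain r \<delta> where \<delta>: "0 < \<delta>" "\<delta> <= 1" "!!b. b \<in> R ==> 4 * \<delta> <= \<bar>r \<bullet> b\<bar>" using regular_vector by metis
 define L where "L = norm r + 1"
 \<comment> \<open>The first exponent pays for the Gaussian in \<open>\<eta>\<close>, the second is
   the Harnack loss. The mixed term in the square of \<open>norm (y + \<eta>)\<close> is supplied by
   the factor \<open>exp (- (\<eta> \<bullet> y))\<close> of the Harnack bound.\<close>
 define c0 where "c0 = exp (- (L\<^sup>2 / 2) - (L * K + \<gamma> * (2 * L)))"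
 define V where "V = measure lborel (ball r \<delta>)"
 have Vpos: "V > 0" unfolding V_def using \<delta>(1) by (rule content_ball_pos)
 have c0pos: "c0 > 0" by (simp add: c0_def)
 define C where "C = real (card G) * c / (c0 * \<delta> powr \<kappa> * V)"
 have "card G > 0" using group_id by (auto simp: card_gt_0_iff)
 hence Cpos: "C > 0" unfolding C_def using c_pos c0pos Vpos \<delta>(1) by simp
 have chamber: "h y y * vol y <= C" if sg: "!!b. b \<in> R ==> 0 <= (y \<bullet> b) * (r \<bullet> b)" for y
 proof -
  have \<eta>: "norm \<eta> <= L" "!!b. b \<in> R ==> 0 <= (y \<bullet> b) * (\<eta> \<bullet> b)" "!!b. b \<in> R ==> 2 * \<delta> <= \<bar>\<eta> \<bullet> b\<bar>" if "\<eta> \<in> ball r \<delta>" for \<eta>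
  proof -
   have d: "norm (\<eta> - r) < \<delta>" using that by (simp add: dist_norm norm_minus_commute)
   have "norm \<eta> <= norm r + norm (\<eta> - r)" using norm_triangle_ineq[of r "\<eta> - r"] by simp
   thus "norm \<eta> <= L" using d \<delta>(2) by (simp add: L_def)
   fix b assume a: "b \<in> R"
   have "\<bar>(\<eta> - r) \<bullet> b\<bar> <= 2 * \<delta>" using inner_root_le[OF a, of "\<eta> - r"] d by linarith
   hence diff: "\<bar>\<eta> \<bullet> b - r \<bullet> b\<bar> <= 2 * \<delta>" by (simp add: inner_diff_left)
   note big = \<delta>(3)[OF a]
   show "2 * \<delta> <= \<bar>\<eta> \<bullet> b\<bar>" using diff big by linarith
   show "0 <= (y \<bullet> b) * (\<eta> \<bullet> b)"
   proof (cases "r \<bullet> b > 0")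
    case True
    hence "y \<bullet> b >= 0" using sg[OF a] by (simp add: zero_le_mult_iff)
    moreover have "\<eta> \<bullet> b >= 0" using diff big True \<delta>(1) by linarith
    ultimately show ?thesis by simp
   next
    case False
    hence neg: "r \<bullet> b < 0" using big \<delta>(1) by linarith
    hence "y \<bullet> b <= 0" using sg[OF a] by (simp add: zero_le_mult_iff)
    moreover have "\<eta> \<bullet> b <= 0" using diff big neg \<delta>(1) by linarith
    ultimately show ?thesis by (simp add: mult_nonpos_nonpos)
   qed
  qed
  have harnack: "c0 * h y y <= (\<Sum>g\<in>G. h (g (y + \<eta>)) y)" if e: "\<eta> \<in> ball r \<delta>" for \<eta>
  proof -
   have reg: "\<eta> \<bullet> b \<noteq> 0" if "b \<in> R" for b using \<eta>(3)[OF e that] \<delta>(1) by auto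
   have 1: "exp (- (L * K + \<gamma> * (2 * L))) * er y y <= exp (- (\<eta> \<bullet> y)) * (\<Sum>g\<in>G. er (g (y + \<eta>)) y)"
   proof (rule chamber_harnack[where L=L and K=K and y=y and \<eta>=\<eta>])
    show "norm \<eta> <= L" by (rule \<eta>(1)[OF e])
    show "0 <= (y \<bullet> b) * (\<eta> \<bullet> b)" "\<eta> \<bullet> b \<noteq> 0" if "b \<in> R" for b using \<eta>(2)[OF e that] reg[OF that] by auto
   qed (use K in auto)
   have "(norm \<eta>)\<^sup>2 <= L\<^sup>2" using \<eta>(1)[OF e] by (intro power_mono) auto
   hence "c0 * h y y <= exp (- ((norm \<eta>)\<^sup>2 / 2) - (L * K + \<gamma> * (2 * L))) * h y y"
    unfolding c0_def using h_nonneg by (intro mult_right_mono) auto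
   also have "\<dots> = (exp (- ((norm \<eta>)\<^sup>2 / 2)) * exp (- (norm y)\<^sup>2)) * (exp (- (L * K + \<gamma> * (2 * L))) * er y y)"
    by (simp add: h_def exp_add[symmetric] algebra_simps)
   also have "\<dots> <= (exp (- ((norm \<eta>)\<^sup>2 / 2)) * exp (- (norm y)\<^sup>2)) * (exp (- (\<eta> \<bullet> y)) * (\<Sum>g\<in>G. er (g (y + \<eta>)) y))"
    using 1 by (intro mult_left_mono) auto
   also have "\<dots> = (\<Sum>g\<in>G. h (g (y + \<eta>)) y)"
   proof -
    have nn: "(norm (y + \<eta>))\<^sup>2 = (norm y)\<^sup>2 + 2 * (\<eta> \<bullet> y) + (norm \<eta>)\<^sup>2"
     by (simp add: power2_norm_eq_inner inner_add_left inner_add_right inner_commute)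
    have "exp (- ((norm \<eta>)\<^sup>2 / 2)) * exp (- (norm y)\<^sup>2) * exp (- (\<eta> \<bullet> y)) = exp (- ((norm (y + \<eta>))\<^sup>2 + (norm y)\<^sup>2) / 2)"
     unfolding exp_add[symmetric] nn by (simp add: field_simps)
    thus ?thesis unfolding h_def by (simp add: sum_distrib_left mult.assoc[symmetric])
   qed
   finally show ?thesis .
  qed
  have wlow: "\<delta> powr \<kappa> * vol y <= weight (y + \<eta>)" if e: "\<eta> \<in> ball r \<delta>" for \<eta>
  proof -
   have "\<delta> powr \<kappa> * vol y = (\<Prod>b\<in>R. \<delta> powr k b * (1 + \<bar>y \<bullet> b\<bar>) powr k b)"
    unfolding vol_def \<kappa>_def prod.distrib using \<delta>(1) by (subst powr_sum) auto
   also have "\<dots> <= weight (y + \<eta>)"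
    unfolding weight_def
   proof (intro prod_mono conjI)
    fix b assume a: "b \<in> R"
    have "\<delta> * (1 + \<bar>y \<bullet> b\<bar>) <= \<bar>y \<bullet> b\<bar> + 2 * \<delta>"
     using \<delta> mult_right_mono[of \<delta> 1 "\<bar>y \<bullet> b\<bar>"] by (simp add: algebra_simps)
    also have "\<dots> <= \<bar>y \<bullet> b\<bar> + \<bar>\<eta> \<bullet> b\<bar>" using \<eta>(3)[OF e a] by simp
    \<comment> \<open>\<open>y\<close> and \<open>\<eta>\<close> lie on the same side of every wall,
      so absolute values add.\<close>
    also have "\<dots> = \<bar>(y + \<eta>) \<bullet> b\<bar>"
     using \<eta>(2)[OF e a] by (auto simp: inner_add_left zero_le_mult_iff abs_if split: if_splits)
    finally have "(\<delta> * (1 + \<bar>y \<bullet> b\<bar>)) powr k b <= \<bar>(y + \<eta>) \<bullet> b\<bar> powr k b"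
     using \<delta>(1) k_nonneg[OF a] by (intro powr_mono2) auto
    thus "\<delta> powr k b * (1 + \<bar>y \<bullet> b\<bar>) powr k b <= \<bar>(y + \<eta>) \<bullet> b\<bar> powr k b"
     using \<delta>(1) by (simp add: powr_mult)
   qed simp
   finally show ?thesis .
  qed
  have hm: "(\<lambda>x. ennreal (h x y)) \<in> borelm"
   by (intro measurable_compose[OF _ measurable_ennreal] borel_measurable_continuous_onI h_continuous continuous_intros)
  have gm: "g \<in> borelm" if "g \<in> G" for g
   by (rule borel_measurable_continuous_onI[OF linear_continuous_on[OF linear_conv_bounded_linear[THEN iffD1, OF group_linear[OF that]]]])
  have hgm: "(\<lambda>x. ennreal (h (g x) y)) \<in> borelm" if "g \<in> G" for g
   by (rule measurable_compose[OF gm[OF that] hm])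
  define B where "B x = (indicator (ball r \<delta>) (x - y) :: ennreal)" for x
  have "ennreal (c0 * h y y * (\<delta> powr \<kappa> * vol y)) * emeasure lborel (ball r \<delta>) = (\<integral>\<^sup>+\<eta>. ennreal (c0 * h y y * (\<delta> powr \<kappa> * vol y)) * indicator (ball r \<delta>) \<eta> \<partial>lborel)"
   by (simp add: nn_integral_cmult_indicator)
  also have "\<dots> <= (\<integral>\<^sup>+\<eta>. ennreal (weight (y + \<eta>)) * (\<Sum>g\<in>G. ennreal (h (g (y + \<eta>)) y)) \<partial>lborel)"
  proof (rule nn_integral_mono)
   fix \<eta>
   show "ennreal (c0 * h y y * (\<delta> powr \<kappa> * vol y)) * indicator (ball r \<delta>) \<eta> <= ennreal (weight (y + \<eta>)) * (\<Sum>g\<in>G. ennreal (h (g (y + \<eta>)) y))"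
   proof (cases "\<eta> \<in> ball r \<delta>")
    case True
    have "c0 * h y y * (\<delta> powr \<kappa> * vol y) <= (\<Sum>g\<in>G. h (g (y + \<eta>)) y) * weight (y + \<eta>)"
     using harnack[OF True] wlow[OF True] c0pos h_nonneg vol_pos[of y] by (intro mult_mono sum_nonneg) auto
    hence "ennreal (c0 * h y y * (\<delta> powr \<kappa> * vol y)) <= ennreal (weight (y + \<eta>) * (\<Sum>g\<in>G. h (g (y + \<eta>)) y))"
     by (intro ennreal_leI) (simp add: mult.commute)
    thus ?thesis using True h_nonneg weight_nonneg by (simp add: ennreal_mult' sum_ennreal)
   qed simp
  qed
  also have "\<dots> = (\<integral>\<^sup>+x. ennreal (weight x) * (\<Sum>g\<in>G. ennreal (h (g x) y)) \<partial>lborel)"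
  proof -
   have m: "(\<lambda>x. ennreal (weight x) * (\<Sum>g\<in>G. ennreal (h (g x) y))) \<in> borelm"
    by (intro borel_measurable_times_ennreal borel_measurable_sum hgm) auto
   show ?thesis using nn_integral_distr[of "(+) y" lborel borel "\<lambda>x. ennreal (weight x) * (\<Sum>g\<in>G. ennreal (h (g x) y))"] m by (simp add: lborel_distr_plus)
  qed
  also have "\<dots> = (\<integral>\<^sup>+x. (\<Sum>g\<in>G. ennreal (h (g x) y)) \<partial>W)"
   by (rule nn_integral_W[symmetric]) (intro borel_measurable_sum hgm)
  also have "\<dots> = (\<Sum>g\<in>G. nnint W (\<lambda>x. h (g x) y))"
   by (rule nn_integral_sum) (intro measurable_W hgm)
  also have "\<dots> = (\<Sum>g\<in>G. ennreal c)"
   by (intro sum.cong refl) (simp add: nn_integral_W_group[OF _ hm] h_mass)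
  also have "\<dots> = ennreal (real (card G) * c)" using c_pos by (simp add: ennreal_mult' ennreal_of_nat_eq_real_of_nat)
  finally have "ennreal (c0 * h y y * (\<delta> powr \<kappa> * vol y)) * ennreal V <= ennreal (real (card G) * c)"
   unfolding V_def using emeasure_eq_ennreal_measure[of lborel "ball r \<delta>"] emeasure_lborel_ball_finite[of r \<delta>] by simp
  hence "ennreal (c0 * h y y * (\<delta> powr \<kappa> * vol y) * V) <= ennreal (real (card G) * c)"
   using Vpos by (simp add: ennreal_mult'')
  hence "c0 * h y y * (\<delta> powr \<kappa> * vol y) * V <= real (card G) * c"
   using c_pos by (subst (asm) ennreal_le_iff) auto
  moreover have "c0 * \<delta> powr \<kappa> * V > 0" using c0pos \<delta>(1) Vpos by simp
  ultimately show ?thesis unfolding C_def by (simp add: pos_le_divide_eq mult_ac)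
 qed
 show ?thesis
 proof (rule that[OF Cpos])
  fix y
  obtain g where g: "g \<in> G" "!!b. b \<in> R ==> 0 <= (g y \<bullet> b) * (r \<bullet> b)" using chamber_representative[of y r] by metis
  show "h y y * vol y <= C" using chamber[OF g(2)] by (simp add: h_equivariant[OF g(1)] vol_invariant[OF g(1)])
 qed
qed

section \<open>Off-diagonal decay of the heat kernel in the mean\<close>

text \<open>\<open>(norm x)\<^sup>2 + (norm y)\<^sup>2 - 2 * gmax x y\<close> is the squared
  distance between the orbits of \<open>x\<close> and \<open>y\<close>, the distance in which the
  heat kernel decays.\<close>

definition gmax :: "real^'n => real^'n => real" where
 "gmax x y = Max ((\<lambda>g. g x \<bullet> y) ` G)"

lemma gmax_ge: "g \<in> G ==> g x \<bullet> y <= gmax x y"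
 unfolding gmax_def by (rule Max_ge) auto

lemma gmax_attained: obtains g where "g \<in> G" "gmax x y = g x \<bullet> y"
proof -
 have "gmax x y \<in> (\<lambda>g. g x \<bullet> y) ` G" unfolding gmax_def using group_id by (intro Max_in) auto
 thus ?thesis using that by auto
qed

lemma group_continuous: "g \<in> G ==> continuous_on S g"
 by (rule linear_continuous_on[OF linear_conv_bounded_linear[THEN iffD1, OF group_linear]])

lemma group_measurable: "g \<in> G ==> g \<in> borelm"
 by (rule borel_measurable_continuous_onI[OF group_continuous])

lemma gmax_measurable: "(\<lambda>x. gmax x y) \<in> borelm"
 unfolding gmax_def
 by (rule borel_measurable_Max) (auto intro!: borel_measurable_inner[OF group_measurable borel_measurable_const])

lemma gmax_invariant: "g \<in> G ==> gmax (g x) y = gmax x y"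
proof (rule antisym)
 show le: "gmax (g x) y <= gmax x y" if g: "g \<in> G" for g x
 proof -
  obtain g' where g': "g' \<in> G" "gmax (g x) y = g' (g x) \<bullet> y" using gmax_attained by blast
  thus ?thesis using gmax_ge[OF group_comp[OF g'(1) g], of x y] by simp
 qed
 show "gmax x y <= gmax (g x) y" if g: "g \<in> G"
  using le[OF group_inv[OF g], of "g x"] g by simp
qed

lemma er_scale: "er (r *\<^sub>R u) x = er u (r *\<^sub>R x)"
 unfolding er_def by (simp add: e_scale e_scale_right)

text \<open>Summed over \<open>G\<close>, the reflection terms of the radial derivative cancel, and
  the logarithmic derivative of the sum is at most \<open>gmax x y\<close>. The scales
  \<open>t = 1\<close> and \<open>t = 1 / 2\<close> are compared.\<close>

lemma group_sum_decreasing: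
 "(\<Sum>g\<in>G. er (g x) y) * exp (- gmax x y / 2) <= (\<Sum>g\<in>G. er ((1 / 2) *\<^sub>R g x) y)"
proof -
 let ?A = "\<lambda>t g. t *\<^sub>R g x"
 let ?B = "\<lambda>t g y b. er (?A t g) y - er (t *\<^sub>R \<sigma> b (g x)) y"
 let ?C = "\<lambda>t y. \<Sum>g\<in>G. er (?A t g) y"
 define m where "m = gmax x y"
 define F where "F t = exp (- (t * m)) * (?C t y)" for t
 have "F (1 / 2) >= F 1"
 proof (rule DERIV_nonpos_imp_decreasing_open[where f=F])
  fix t :: real assume t: "1 / 2 < t" "t < 1"
  define D where "D g = (g x \<bullet> y) * er (?A t g) y - (\<Sum>b\<in>R. k b / (2 * t) * (?B t g y b))" for g
  have der: "((\<lambda>t. er (?A t g) y) has_real_derivative D g) (at t)" for g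
  proof -
   have "(\<Sum>b\<in>R. k b / 2 * (b \<bullet> g x) * Re (rquot b (e 1 y) (?A t g))) = (\<Sum>b\<in>R. k b / (2 * t) * (?B t g y b))"
   proof (rule sum.cong[OF refl])
    fix b assume a: "b \<in> R"
    have "cor (b \<bullet> t *\<^sub>R g x) * rquot b (e 1 y) (?A t g) = e 1 y (?A t g) - e 1 y (\<sigma> b (?A t g))"
     by (rule inner_reflection_quotient[OF a])
    hence "Re (cor (b \<bullet> t *\<^sub>R g x) * rquot b (e 1 y) (?A t g)) = er y (?A t g) - er y (\<sigma> b (?A t g))"
     by (simp add: er)
    hence "t * (b \<bullet> g x) * Re (rquot b (e 1 y) (?A t g)) = er (?A t g) y - er (t *\<^sub>R \<sigma> b (g x)) y"
     by (simp add: linear_scale[OF reflection_linear] er_symmetric[of y])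
    hence "k b / (2 * t) * (t * (b \<bullet> g x) * Re (rquot b (e 1 y) (?A t g))) = k b / (2 * t) * (?B t g y b)"
     by (rule arg_cong)
    thus "k b / 2 * (b \<bullet> g x) * Re (rquot b (e 1 y) (?A t g)) = k b / (2 * t) * (?B t g y b)"
     using t by simp
   qed
   thus ?thesis using er_line_derivative[of 0 "g x" y t] er_direction[of y "t *\<^sub>R g x" "g x"] by (simp add: D_def)
  qed
  have "(\<Sum>g\<in>G. D g) = (\<Sum>g\<in>G. (g x \<bullet> y) * er (?A t g) y)"
  proof -
   have "(\<Sum>g\<in>G. er (t *\<^sub>R \<sigma> b (g x)) y) = (?C t y)" if "b \<in> R" for b
    using sum_group_left[OF subset_refl group_reflection[OF that], of "\<lambda>g. er (?A t g) y"] by simp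
   hence "(\<Sum>b\<in>R. \<Sum>g\<in>G. k b / (2 * t) * (?B t g y b)) = 0"
    unfolding sum_distrib_left[symmetric] sum_subtractf by (intro sum.neutral ballI) simp
   thus ?thesis unfolding D_def sum_subtractf by (simp add: sum.swap[of _ R G])
  qed
  also have "\<dots> <= (\<Sum>g\<in>G. m * er (?A t g) y)"
   unfolding m_def by (intro sum_mono mult_right_mono gmax_ge er_nonneg)
  finally have "exp (- (t * m)) * ((\<Sum>g\<in>G. D g) - m * (?C t y)) <= 0"
   by (intro mult_nonneg_nonpos) (auto simp: sum_distrib_left)
  moreover have "(F has_real_derivative (exp (- (t * m)) * (- m) * (?C t y) + (\<Sum>g\<in>G. D g) * exp (- (t * m)))) (at t)"
   unfolding F_def[abs_def]
  proof (rule DERIV_mult)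
   show "((\<lambda>t. exp (- (t * m))) has_real_derivative exp (- (t * m)) * (- m)) (at t)" by (auto intro!: derivative_eq_intros)
   show "((\<lambda>t. \<Sum>g\<in>G. er (?A t g) y) has_real_derivative (\<Sum>g\<in>G. D g)) (at t)" by (intro DERIV_sum der)
  qed
  ultimately show "\<exists>y. (F has_real_derivative y) (at t) \<and> y <= 0" by (intro exI conjI) (auto simp: algebra_simps)
 next
  show "continuous_on {1 / 2..1} F" unfolding F_def by (intro continuous_intros er_continuous)
 qed simp
 hence "exp (m / 2) * (exp (- m) * (\<Sum>g\<in>G. er (g x) y)) <= exp (m / 2) * (exp (- (m / 2)) * (\<Sum>g\<in>G. er ((1 / 2) *\<^sub>R g x) y))"
  unfolding F_def by (intro mult_left_mono) auto
 thus ?thesis by (simp add: mult.assoc[symmetric] exp_add[symmetric] m_def mult.commute)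
qed

lemma h_measurable: "(\<lambda>x. h x y) \<in> borelm"
 by (rule borel_measurable_continuous_onI[OF h_continuous]) (intro continuous_intros)+

text \<open>After averaging over \<open>G\<close>, halving the argument of the kernel pays for the
  exponential of a quarter of the squared orbit distance. What results is again a heat kernel, at
  points scaled by \<open>1 / sqrt 2\<close>, and its mass is known from scaling.\<close>

lemma h_exponential_moment:
 "(nnint W (\<lambda>x. h x y * exp (((norm x)\<^sup>2 + (norm y)\<^sup>2 - 2 * gmax x y) / 4))) <= ennreal (2 powr (N / 2) * c)"
  (is "(\<integral>\<^sup>+x. ?f x \<partial>W) <= _")
proof -
 let ?A = "\<lambda>s. s *\<^sub>R y"
 let ?B = "\<lambda>g x. ((norm (g x))\<^sup>2 + (norm y)\<^sup>2 - 2 * gmax (g x) y) / 4"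
 define s where "s = 1 / sqrt 2"
 have s: "s > 0" "s * s = 1 / 2" "s\<^sup>2 = 1 / 2" unfolding s_def by (auto simp: power_divide)
 have fm[measurable]: "?f \<in> borelm"
  using h_measurable gmax_measurable by measurable
 have fgm: "(\<lambda>x. ?f (g x)) \<in> borel_measurable W" if "g \<in> G" for g
  by (rule measurable_W[OF measurable_compose[OF group_measurable[OF that] fm]])
 have hm: "(\<lambda>x. ennreal (h x (?A s))) \<in> borelm" using h_measurable by measurable
 have hgm: "(\<lambda>x. ennreal (h (s *\<^sub>R g x) (?A s))) \<in> borel_measurable W" if "g \<in> G" for g
  by (intro measurable_W measurable_compose[OF _ hm] borel_measurable_scaleR group_measurable that) auto
 have scm: "(\<lambda>x. ennreal (h (s *\<^sub>R x) (?A s))) \<in> borelm"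
  by (rule measurable_compose[OF _ hm]) auto
 have "of_nat (card G) * (\<integral>\<^sup>+x. ?f x \<partial>W) = (\<Sum>g\<in>G. \<integral>\<^sup>+x. ?f (g x) \<partial>W)"
 proof -
  have "(\<Sum>g\<in>G. \<integral>\<^sup>+x. ?f (g x) \<partial>W) = (\<Sum>g\<in>G. \<integral>\<^sup>+x. ?f x \<partial>W)"
   by (intro sum.cong refl nn_integral_W_group fm)
  thus ?thesis by (simp only: sum_constant)
 qed
 also have "\<dots> = (\<integral>\<^sup>+x. (\<Sum>g\<in>G. ?f (g x)) \<partial>W)"
  by (rule nn_integral_sum[symmetric]) (rule fgm)
 also have "\<dots> <= (\<integral>\<^sup>+x. (\<Sum>g\<in>G. ennreal (h (s *\<^sub>R g x) (?A s))) \<partial>W)"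
 proof (rule nn_integral_mono)
  fix x :: "real^'n"
  define E where "E = exp (- ((norm x)\<^sup>2 + (norm y)\<^sup>2) / 4)"
  have "(\<Sum>g\<in>G. h (g x) y * exp (?B g x)) = E * ((\<Sum>g\<in>G. er (g x) y) * exp (- gmax x y / 2))"
   unfolding sum_distrib_left sum_distrib_right
  proof (rule sum.cong[OF refl])
   fix g assume g: "g \<in> G"
   have "exp (- ((norm x)\<^sup>2 + (norm y)\<^sup>2) / 2) * exp (((norm x)\<^sup>2 + (norm y)\<^sup>2 - 2 * gmax x y) / 4) = E * exp (- gmax x y / 2)"
    unfolding E_def exp_add[symmetric] by (simp add: field_simps)
   thus "h (g x) y * exp (?B g x) = E * (er (g x) y * exp (- gmax x y / 2))"
    using g by (simp add: h_def gmax_invariant)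
  qed
  also have "\<dots> <= E * (\<Sum>g\<in>G. er ((1 / 2) *\<^sub>R g x) y)"
   by (rule mult_left_mono[OF group_sum_decreasing]) (simp add: E_def)
  also have "\<dots> = (\<Sum>g\<in>G. h (s *\<^sub>R g x) (?A s))"
  proof -
   have "E * er ((1 / 2) *\<^sub>R g x) y = h (s *\<^sub>R g x) (?A s)" if "g \<in> G" for g
   proof -
    have "er (s *\<^sub>R g x) (?A s) = er ((1 / 2) *\<^sub>R g x) y"
     by (simp add: er_scale[symmetric] s(2))
    moreover have "exp (- ((norm (s *\<^sub>R g x))\<^sup>2 + (norm (?A s))\<^sup>2) / 2) = E"
     using that by (simp add: E_def power_mult_distrib s(3))
    ultimately show ?thesis by (simp add: h_def)
   qed
   thus ?thesis unfolding sum_distrib_left by (intro sum.cong) auto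
  qed
  finally show "(\<Sum>g\<in>G. ?f (g x)) <= (\<Sum>g\<in>G. ennreal (h (s *\<^sub>R g x) (?A s)))"
   using h_nonneg by (simp add: sum_ennreal ennreal_leI)
 qed
 also have "\<dots> = (\<Sum>g\<in>G. nnint W (\<lambda>x. h (s *\<^sub>R g x) (?A s)))"
  by (rule nn_integral_sum) (rule hgm)
 also have "\<dots> = (\<Sum>g\<in>G. ennreal (s powr - N) * ennreal c)"
 proof (rule sum.cong[OF refl])
  fix g assume g: "g \<in> G"
  show "(nnint W (\<lambda>x. h (s *\<^sub>R g x) (?A s))) = ennreal (s powr - N) * ennreal c"
   using nn_integral_W_group[OF g scm] nn_integral_W_scale[OF s(1) hm] h_mass by simp
 qed
 also have "\<dots> = of_nat (card G) * (ennreal (s powr - N) * ennreal c)" by simp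
 finally have "of_nat (card G) * (\<integral>\<^sup>+x. ?f x \<partial>W) <= of_nat (card G) * (ennreal (s powr - N) * ennreal c)" .
 moreover have "card G \<noteq> 0" using group_id by auto
 ultimately have "(\<integral>\<^sup>+x. ?f x \<partial>W) <= ennreal (s powr - N) * ennreal c"
  by (subst (asm) ennreal_mult_le_mult_iff) auto
 moreover have "s powr - N = 2 powr (N / 2)"
  by (simp add: s_def powr_divide powr_minus powr_half_sqrt[symmetric] powr_powr field_simps)
 ultimately show ?thesis by (simp add: ennreal_mult'' c_pos less_imp_le)
qed

text \<open>One factor of the square is bounded pointwise by Cauchy--Schwarz and the diagonal bound
  at both points; exchanging \<open>vol x\<close> for \<open>vol y\<close> costs a power of the
  orbit distance. That power and \<open>\<Phi>\<close> are absorbed by the exponential moment of the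
  other factor.\<close>

lemma h_weighted_square:
 assumes "M >= 0"
 obtains C where "C > 0"
  "!!y \<Phi>. \<Phi> \<in> borelm ==> (!!x. 0 <= \<Phi> x) ==> (!!x g. g \<in> G ==> \<Phi> x <= (1 + (norm (x - g y))\<^sup>2) powr M) ==>
   (nnint W (\<lambda>x. (h x y)\<^sup>2 * \<Phi> x)) <= ennreal (C / vol y)"
proof -
 let ?A = "\<lambda>x y. ((norm x)\<^sup>2 + (norm y)\<^sup>2 - 2 * gmax x y) / 4"
 let ?B = "\<lambda>A d. A * (1 + d) powr \<kappa>"
 obtain C0 where C0: "C0 > 0" "!!y. h y y * vol y <= C0" using h_diagonal by blast
 define A where "A = (5::real) powr \<kappa>"
 have A: "A >= 1" unfolding A_def using \<kappa>_nonneg by (intro ge_one_powr_ge_zero) auto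
 \<comment> \<open>The total power to absorb: \<open>\<kappa>\<close> from the exchange of volumes,
   \<open>M\<close> from \<open>\<Phi>\<close>, and 1 to make the exponent positive.\<close>
 define M' where "M' = \<kappa> + M + 1"
 have M': "M' > 0" unfolding M'_def using \<kappa>_nonneg assms by simp
 define B where "B = C0 * A * ((8 * M') powr M' * exp (1 / 8))"
 have B: "B > 0" using C0 A M' by (simp add: B_def)
 define C where "C = B * (2 powr (N / 2) * c)"
 have "C > 0" using B c_pos by (simp add: C_def)
 moreover have "(nnint W (\<lambda>x. (h x y)\<^sup>2 * \<Phi> x)) <= ennreal (C / vol y)"
  if m: "\<Phi> \<in> borelm" and nn: "!!x. 0 <= \<Phi> x" and le: "!!x g. g \<in> G ==> \<Phi> x <= (1 + (norm (x - g y))\<^sup>2) powr M" for y \<Phi>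
 proof -
  have pw: "(h x y)\<^sup>2 * \<Phi> x <= B / vol y * (h x y * exp (?A x y))" for x
  proof -
   obtain g where g: "g \<in> G" "gmax x y = g x \<bullet> y" using gmax_attained by blast
   define d where "d = (norm (y - g x))\<^sup>2"
   have d0: "d >= 0" by (simp add: d_def)
   have d: "d = (norm x)\<^sup>2 + (norm y)\<^sup>2 - 2 * gmax x y"
    unfolding d_def g(2) using group_norm[OF g(1), of x] by (simp add: power2_norm_eq_inner inner_diff_left inner_diff_right inner_commute group_inner[OF g(1)])
   have d': "(norm (x - inv g y))\<^sup>2 = d"
   proof -
    have "norm (x - inv g y) = norm (g (x - inv g y))" using g by simp
    also have "g (x - inv g y) = g x - y" using g linear_diff[OF group_linear[OF g(1)]] by simp
    finally show ?thesis by (simp add: d_def norm_minus_commute)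
   qed
   have vy: "vol y <= vol x * (?B A d)"
    using vol_add_le'[of "g x" "y - g x"] by (simp add: vol_invariant[OF g(1)] d_def A_def)
   have pow1: "1 <= (1 + d) powr \<kappa>" using d0 \<kappa>_nonneg by (intro ge_one_powr_ge_zero) auto
   have Q1: "1 <= A * (1 + d) powr \<kappa>" using mult_mono[OF A pow1] A by simp
   have "(h x y)\<^sup>2 * (vol y * vol y) <= (h x x * h y y) * (vol y * vol y)"
    using h_cauchy_schwarz by (rule mult_right_mono) (use vol_pos[of y] in simp)
   also have "\<dots> = (h x x * vol y) * (h y y * vol y)" by (simp only: mult_ac)
   also have "\<dots> <= (C0 * (?B A d)) * C0"
   proof (rule mult_mono)
    have "h x x * vol y <= h x x * (vol x * (?B A d))" by (rule mult_left_mono[OF vy h_nonneg])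
    also have "\<dots> = (h x x * vol x) * (?B A d)" by (simp only: mult_ac)
    also have "\<dots> <= C0 * (?B A d)" using C0(2)[of x] Q1 by (intro mult_right_mono) auto
    finally show "h x x * vol y <= C0 * (?B A d)" .
    show "h y y * vol y <= C0" by (rule C0)
   qed (use C0(1) Q1 h_nonneg vol_pos[of y] in auto)
   \<comment> \<open>Enlarged to a perfect square so that the root can be taken.\<close>
   also have "\<dots> <= (C0 * (?B A d)) * (C0 * (?B A d))"
    using C0(1) Q1 by (intro mult_left_mono) auto
   finally have "(h x y * vol y)\<^sup>2 <= (C0 * (?B A d))\<^sup>2" by (simp add: power2_eq_square mult_ac)
   hence hv: "h x y * vol y <= C0 * (?B A d)" by (rule power2_le_imp_le) (use C0(1) Q1 in simp)
   have "(h x y * vol y) * \<Phi> x <= (C0 * (?B A d)) * (1 + d) powr M"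
    by (rule mult_mono[OF hv]) (use le[OF group_inv[OF g(1)], of x] nn C0(1) Q1 in \<open>simp_all add: d'\<close>)
   also have "\<dots> = C0 * A * (1 + d) powr (\<kappa> + M)" by (simp add: powr_add)
   also have "\<dots> <= C0 * A * (1 + d) powr M'" using C0(1) A d0 unfolding M'_def by (intro mult_left_mono powr_mono) auto
   also have "\<dots> <= C0 * A * ((8 * M') powr M' * exp ((1 + d) / 8))"
    using C0(1) A d0 M' by (intro mult_left_mono power_le_exp_bound) auto
   also have "\<dots> <= C0 * A * ((8 * M') powr M' * (exp (1 / 8) * exp (d / 4)))"
    using C0(1) A d0 M' by (intro mult_left_mono) (auto simp: exp_add[symmetric] add_divide_distrib)
   finally have "(h x y * vol y) * \<Phi> x <= B * exp (d / 4)" by (simp add: B_def mult_ac)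
   hence "h x y * ((h x y * vol y) * \<Phi> x) <= h x y * (B * exp (d / 4))" by (rule mult_left_mono[OF _ h_nonneg])
   thus ?thesis using vol_pos[of y] unfolding d[symmetric] by (simp add: pos_le_divide_eq power2_eq_square mult_ac)
  qed
  have "(nnint W (\<lambda>x. (h x y)\<^sup>2 * \<Phi> x)) <= (\<integral>\<^sup>+x. ennreal (B / vol y) * ennreal (h x y * exp (?A x y)) \<partial>W)"
  proof (rule nn_integral_mono)
   fix x
   show "ennreal ((h x y)\<^sup>2 * \<Phi> x) <= ennreal (B / vol y) * ennreal (h x y * exp (?A x y))"
    using ennreal_leI[OF pw[of x]] B vol_pos[of y] by (subst ennreal_mult''[symmetric]) (auto simp: h_nonneg)
  qed
  also have "\<dots> = ennreal (B / vol y) * (nnint W (\<lambda>x. h x y * exp (?A x y)))"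
  proof (rule nn_integral_cmult, rule measurable_W)
   show "(\<lambda>x. ennreal (h x y * exp (?A x y))) \<in> borelm"
    using h_measurable gmax_measurable by measurable
  qed
  also have "\<dots> <= ennreal (B / vol y) * ennreal (2 powr (N / 2) * c)"
   by (rule mult_left_mono[OF h_exponential_moment]) simp
  also have "\<dots> = ennreal (C / vol y)"
   using c_pos by (subst ennreal_mult''[symmetric]) (auto simp: C_def)
  finally show ?thesis .
 qed
 ultimately show ?thesis by (rule that)
qed

end

section \<open>Translates of the heat kernel\<close>

lemma DERIV_integral:
 fixes f f' :: "real => 'a => real"
 assumes \<delta>: "\<delta> > 0" and int: "!!t. \<bar>t - t0\<bar> < \<delta> ==> integrable M (f t)"
  and der: "!!t x. \<bar>t - t0\<bar> < \<delta> ==> ((\<lambda>t. f t x) has_real_derivative f' t x) (at t)"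
  and bound: "!!t x. \<bar>t - t0\<bar> < \<delta> ==> \<bar>f' t x\<bar> <= b x" and b: "integrable M b"
 shows "((\<lambda>t. LINT x|M. f t x) has_real_derivative (LINT x|M. f' t0 x)) (at t0)"
proof -
 have ball: "\<bar>t - t0\<bar> < \<delta>" if "t \<in> ball t0 \<delta>" for t using that by (simp add: dist_real_def abs_minus_commute)
 have "((\<lambda>t. LINT x|M. f t x) has_derivative (\<lambda>v. LINT x|M. f' t0 x * v)) (at t0)"
  by (rule has_derivative_integral(1)[where \<delta>=\<delta> and b=b and f'="\<lambda>t x v. f' t x * v"])
   (use \<delta> int der b ball bound in \<open>auto simp: has_field_derivative_def abs_mult intro!: mult_right_mono\<close>)
 thus ?thesis by (simp add: has_field_derivative_def)
qed

lemma C_class_cnj: assumes "C_class 1 f" shows "C_class 1 (\<lambda>x. cnj (f x))"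
proof -
 let ?A = "\<lambda>x. cnj (f x)"
 have d: "f differentiable (at x)" for x using assms by simp
 have fd: "(?A has_derivative (\<lambda>v. cnj (fderiv f x v))) (at x)" for x
  by (rule bounded_linear.has_derivative[OF bounded_linear_cnj]) (use d in \<open>simp add: frechet_derivative_works\<close>)
 have "?A differentiable (at x)" for x unfolding differentiable_def by (rule exI, rule fd)
 moreover have "partial_deriv i ?A = (\<lambda>x. cnj (partial_deriv i f x))" for i
  unfolding partial_deriv_def[abs_def] fderiv_eq[OF fd] ..
 ultimately show ?thesis using assms by (auto intro!: continuous_intros)
qed

context dunkl begin

text \<open>Up to the factor \<open>c\<close>, the translate by \<open>z\<close> of the heat kernel
  with second argument \<open>y\<close>, in Fourier form; \<open>x\<close> and \<open>z\<close>
  enter alike, and at \<open>z = 0\<close> it is \<open>c * h x y\<close>.\<close>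

definition htr :: "real^'n => real^'n => real^'n => complex" where
 "htr y z = transf \<i> (\<lambda>q. e (-\<i>) y q * (e \<i> z q * gauss q))"

lemma htr_gauss_bounded: "gauss_bounded (\<lambda>q. e (-\<i>) y q * (e \<i> z q * gauss q))"
 by (intro gauss_bounded_e gauss_bounded_gauss)

lemma Re_of_real_times: "Re (cor a * w) = a * Re w"
 by simp

lemma htr_eq: "htr y z x = (LINT q|W. e \<i> x q * (e (-\<i>) y q * (e \<i> z q * gauss q)))"
 unfolding htr_def transf_def by (simp add: e_symmetric[of _ x])

lemma htr_symmetric: "htr y z x = htr y x z"
 unfolding htr_eq by (simp only: mult.left_commute)

lemma htr_C1: "C_class 1 (htr y z)"
 unfolding htr_def by (rule transf_C1[OF htr_gauss_bounded])

lemma htr_zero: "htr y 0 x = cor (c * h x y)"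
 unfolding htr_eq h_fourier by (simp add: mult.assoc)

lemma htr_integrand_le: "norm (e \<i> x q * (e (-\<i>) y q * (e \<i> z q * u))) <= norm u"
proof -
 have "norm (e \<i> x q * (e (-\<i>) y q * (e \<i> z q * u))) <= 1 * (1 * (1 * norm u))"
  unfolding norm_mult by (intro mult_mono norm_e_i) auto
 thus ?thesis by simp
qed

lemma htr_dunkl: "T v (htr y z) x = (LINT q|W. e \<i> x q * (e (-\<i>) y q * (e \<i> z q * (\<i> * cor (v \<bullet> q) * gauss q))))"
 unfolding htr_def dunkl_op_transf[OF htr_gauss_bounded] by (simp add: e_symmetric[of _ x] mult_ac)

text \<open>The Dunkl operators in \<open>x\<close> and in \<open>z\<close> both multiply the
  Fourier integrand by \<open>\<i> * cor (v \<bullet> q)\<close>. A derivative in the translation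
  parameter can thus be replaced by one in \<open>x\<close>, where it can be integrated by
  parts.\<close>

lemma htr_dunkl_symmetric: "T v (htr y z) x = T v (htr y x) z"
 unfolding htr_dunkl by (simp only: mult.left_commute)

lemma integrable_gauss_moment: "integrable W (\<lambda>q. norm (\<i> * cor (v \<bullet> q) * gauss q))"
 using gauss_bounded_integrable[OF gauss_bounded_cmult[OF gauss_bounded_inner[OF gauss_bounded_gauss]], of \<i> v] by (simp add: mult.assoc)

lemma integral_e_bound:
 assumes "integrable W (\<lambda>q. norm (u q))" "u \<in> borel_measurable W"
 shows "norm (LINT q|W. e \<i> x q * (e (-\<i>) y q * (e \<i> z q * u q))) <= (LINT q|W. norm (u q))"
proof -
 let ?A = "\<lambda>q. e (-\<i>) y q * (e \<i> z q * u q)"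
 let ?B = "\<lambda>q. e \<i> x q * (?A q)"
 have m: "?B \<in> borel_measurable W"
  by (intro borel_measurable_times assms continuous_measurable_W e_continuous1)
 have "integrable W ?B"
  by (rule Bochner_Integration.integrable_bound[OF assms(1) m]) (use htr_integrand_le in auto)
 hence "integrable W (\<lambda>q. norm (e \<i> x q * (?A q)))" by (rule integrable_norm)
 hence "(LINT q|W. norm (e \<i> x q * (?A q))) <= (LINT q|W. norm (u q))"
  by (intro integral_mono assms htr_integrand_le)
 thus ?thesis by (rule order_trans[OF integral_norm_bound])
qed

lemma htr_le: "norm (htr y z x) <= c"
proof -
 have "norm (htr y z x) <= (LINT q|W. norm (gauss q))"
  unfolding htr_eq
  by (rule integral_e_bound) (use gauss_bounded_integrable[OF gauss_bounded_gauss] in auto)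
 thus ?thesis by (simp add: c_def' gauss_def)
qed

lemma htr_dunkl_bound: obtains B where "B >= 0" "!!y z x. norm (T v (htr y z) x) <= B"
proof (rule that)
 let ?A = "LINT q|W. norm (\<i> * cor (v \<bullet> q) * gauss q)"
 show "0 <= ?A" by (rule Bochner_Integration.integral_nonneg) simp
 show "norm (T v (htr y z) x) <= ?A" for y z x
  unfolding htr_dunkl
  by (rule integral_e_bound[OF integrable_gauss_moment])
   (use gauss_bounded_integrable[OF gauss_bounded_cmult[OF gauss_bounded_inner[OF gauss_bounded_gauss]], of \<i> v] in \<open>simp add: mult.assoc\<close>)
qed

lemma integrable_W_compact_support_real:
 fixes f :: "real^'n => real"
 assumes "cts f" "!!x. norm x > r ==> f x = 0"
 shows "integrable W f"
 using integrable_W_compact_support[of "\<lambda>x. cor (f x)" r] assms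
 by (simp add: complex_of_real_integrable_eq continuous_on_of_real)

end

section \<open>Weighted energy of the translates as a function of the translation parameter\<close>

locale energy = dunkl R k for R :: "(real^'n) set" and k :: "real^'n => real" +
 fixes \<Phi> :: "real^'n => real" and \<Phi>' :: "real^'n => real^'n => real" and \<Lambda> :: real and y :: "real^'n"
 assumes \<Phi>_der: "(\<Phi> has_derivative \<Phi>' x) (at x)" and \<Phi>'_cont: "cts (\<lambda>x. \<Phi>' x v)"
  and \<Phi>_pos: "0 < \<Phi> x" and \<Phi>_inv: "\<alpha> \<in> R ==> \<Phi> (root_reflection \<alpha> x) = \<Phi> x"
  and \<Phi>_log: "\<bar>\<Phi>' x v\<bar> <= \<Lambda> * norm v * \<Phi> x"
begin

lemma \<Phi>_cont: "continuous_on S \<Phi>"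
 using \<Phi>_der by (intro has_derivative_continuous_on[of _ _ \<Phi>']) (blast intro: has_derivative_at_withinI)

text \<open>A cone-shaped cutoff. With \<open>r = norm z\<close> its support in \<open>x\<close> is
  compact and retreats at unit speed as \<open>z\<close> moves outwards, while its gradient in
  \<open>x\<close> has norm at most 1, \<open>sqrt (1 + (norm x)\<^sup>2)\<close> being a smooth
  substitute for the norm. It keeps all integrals finite before square integrability of the
  translate is known.\<close>

definition u where "u l r x = max 0 (l - r - sqrt (1 + (norm (x :: real^'n))\<^sup>2))"

lemma u_support: "0 <= r ==> norm x > l ==> u l r x = 0"
proof -
 assume "0 <= r" "norm x > l"
 moreover have "norm x <= sqrt (1 + (norm x)\<^sup>2)" by (rule real_le_rsqrt) simp
 ultimately show ?thesis by (simp add: u_def)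
qed

lemma u_cont: "cts f ==> cts g ==> cts (\<lambda>x. u r (f x) (g x))"
 unfolding u_def by (intro continuous_intros)

lemma u_le: "0 <= r ==> 0 <= l ==> u l r x <= l" and u_nonneg: "0 <= u l r x"
proof -
 have "0 <= sqrt (1 + (norm x)\<^sup>2)" by simp
 thus "0 <= r ==> 0 <= l ==> u l r x <= l" unfolding u_def by linarith
qed (simp add: u_def)

definition P where "P r z = (LINT x|W. (norm (htr y z x))\<^sup>2 * (\<Phi> x * (u r (norm z) x)\<^sup>2))"

definition \<Psi> where "\<Psi> l r x = cor (\<Phi> x * (u l r x)\<^sup>2)"

lemma u_square_deriv:
 "((\<lambda>x. (u l r x)\<^sup>2) has_derivative (\<lambda>v. - ((x \<bullet> v) / sqrt (1 + (norm x)\<^sup>2)) * (2 * u l r x))) (at x)"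
proof -
 have pos: "1 + (norm x)\<^sup>2 > 0" by (simp add: add_pos_nonneg)
 have 1: "((\<lambda>x :: real^'n. l - r - sqrt (1 + (norm x)\<^sup>2)) has_derivative (\<lambda>v. - ((x \<bullet> v) / sqrt (1 + (norm x)\<^sup>2)))) (at x)"
  using pos unfolding power2_norm_eq_inner
  by (auto intro!: derivative_eq_intros simp: inner_commute field_simps)
 show ?thesis
  using DERIV_compose_FDERIV[where f="\<lambda>u. max 0 u ^ Suc 1" and g="\<lambda>x :: real^'n. l - r - sqrt (1 + (norm x)\<^sup>2)" and x=x, OF DERIV_max_power[OF order_refl] 1]
  by (simp add: u_def power2_eq_square)
qed

lemma \<Psi>_der:
 "(\<Psi> l r has_derivative (\<lambda>v. cor (\<Phi>' x v * (u l r x)\<^sup>2 - \<Phi> x * (x \<bullet> v) / sqrt (1 + (norm x)\<^sup>2) * (2 * u l r x)))) (at x)"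
proof -
 have "((\<lambda>x. \<Phi> x * (u l r x)\<^sup>2) has_derivative (\<lambda>v. \<Phi> x * (- ((x \<bullet> v) / sqrt (1 + (norm x)\<^sup>2)) * (2 * u l r x)) + \<Phi>' x v * (u l r x)\<^sup>2)) (at x)"
  by (rule has_derivative_mult[OF \<Phi>_der u_square_deriv])
 from has_derivative_of_real[OF this] show ?thesis
  unfolding \<Psi>_def[abs_def] by (rule has_derivative_eq_rhs) (simp add: fun_eq_iff)
qed

lemma \<Psi>_C1: "C_class 1 (\<Psi> l r)"
proof -
 have "\<Psi> l r differentiable (at x)" for x unfolding differentiable_def by (rule exI, rule \<Psi>_der)
 moreover have "cts (partial_deriv i (\<Psi> l r))" for i
  unfolding partial_deriv_def[abs_def] fderiv_eq[OF \<Psi>_der]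
  by (intro continuous_intros u_cont \<Phi>_cont \<Phi>'_cont) (auto simp: add_nonneg_eq_0_iff)
 ultimately show ?thesis by simp
qed

lemma \<Psi>_inv: "a \<in> R ==> \<Psi> l r (root_reflection a x) = \<Psi> l r x"
 by (simp add: \<Psi>_def \<Phi>_inv u_def)

lemma htr_cont: "cts (htr y z)" by (rule C1_D(2)[OF htr_C1])

lemma P_int:
 assumes "0 <= r" "cts f"
 shows "integrable W (\<lambda>x. f x * (\<Phi> x * (u l r x)\<^sup>2))" "integrable W (\<lambda>x. f x * (\<Phi> x * u l r x))"
 using assms
 by (intro integrable_W_compact_support_real[where r=l] continuous_intros u_cont \<Phi>_cont; simp add: u_support)+

text \<open>Since \<open>\<Psi>\<close> is invariant, the antisymmetry of the Dunkl operator turns the first order term into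
 a derivative of the weight.\<close>

lemma energy_by_parts:
 assumes r: "0 <= r"
 shows "(LINT x|W. 2 * Re (T v (htr y z) x * cnj (htr y z x)) * (\<Phi> x * (u l r x)\<^sup>2)) =
  - (LINT x|W. (norm (htr y z x))\<^sup>2 * (\<Phi>' x v * (u l r x)\<^sup>2 - \<Phi> x * (x \<bullet> v) / sqrt (1 + (norm x)\<^sup>2) * (2 * u l r x)))"
proof -
 let ?H = "htr y z"
 note H = C1_D[OF htr_C1[of y z]]
 define g where "g x = \<Psi> l r x * cnj (?H x)" for x
 define D where "D x = \<Phi>' x v * (u l r x)\<^sup>2 - \<Phi> x * (x \<bullet> v) / sqrt (1 + (norm x)\<^sup>2) * (2 * u l r x)" for x
 have gC: "C_class 1 g" unfolding g_def[abs_def] by (intro C_class_mult \<Psi>_C1 C_class_cnj htr_C1)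
 have g0: "g x = 0" if "norm x > l" for x using u_support[OF r that] by (simp add: g_def \<Psi>_def)
 have Dc: "cts D" unfolding D_def
  by (intro continuous_intros u_cont \<Phi>_cont \<Phi>'_cont) (auto simp: add_nonneg_eq_0_iff)
 have D0: "D x = 0" if "norm x > l" for x using u_support[OF r that] by (simp add: D_def)
 have Tg: "T v g x = \<Psi> l r x * cnj (T v ?H x) + cor (D x) * cnj (?H x)" for x
 proof -
  have "T v g x = \<Psi> l r x * T v (\<lambda>x. cnj (?H x)) x + fderiv (\<Psi> l r) x v * cnj (?H x)"
   unfolding g_def[abs_def]
   by (rule dunkl_op_invariant_mult[OF C1_D(1)[OF \<Psi>_C1] \<Psi>_inv C1_D(1)[OF C_class_cnj[OF htr_C1]]])
  thus ?thesis unfolding fderiv_eq[OF \<Psi>_der] dunkl_op_cnj[OF H(1)] by (simp add: D_def)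
 qed
 have \<Psi>c: "cts (\<Psi> l r)" by (rule C1_D(2)[OF \<Psi>_C1])
 have gc: "cts g" by (rule C1_D(2)[OF gC])
 have iA: "integrable W (\<lambda>x. T v ?H x * g x)"
  by (rule integrable_W_compact_support[where r=l]) (auto intro!: continuous_intros H gc simp: g0)
 have iD: "integrable W (\<lambda>x. cor ((norm (?H x))\<^sup>2 * D x))"
  by (rule integrable_W_compact_support[where r=l]) (auto intro!: continuous_intros H Dc simp: D0)
 define A where "A = (LINT x|W. T v ?H x * g x)"
 have iA': "integrable W (\<lambda>x. cnj (T v ?H x * g x))" using iA by (simp only: integrable_cnj)
 have "A = - (LINT x|W. ?H x * T v g x)" unfolding A_def by (rule by_parts_compact[OF htr_C1 gC g0])
 also have "(\<lambda>x. ?H x * T v g x) = (\<lambda>x. cnj (T v ?H x * g x) + cor ((norm (?H x))\<^sup>2 * D x))"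
  unfolding Tg of_real_mult complex_norm_square by (simp add: fun_eq_iff g_def \<Psi>_def algebra_simps)
 also have "(LINT x|W. cnj (T v ?H x * g x) + cor ((norm (?H x))\<^sup>2 * D x)) = cnj A + cor (LINT x|W. (norm (?H x))\<^sup>2 * D x)"
  unfolding Bochner_Integration.integral_add[OF iA' iD] A_def integral_complex_of_real by (simp only: Bochner_Integration.integral_cnj)
 finally have "Re A = Re (- (cnj A + cor (LINT x|W. (norm (?H x))\<^sup>2 * D x)))" by (rule arg_cong)
 hence "2 * Re A = - (LINT x|W. (norm (?H x))\<^sup>2 * D x)" by simp
 moreover have "2 * Re A = (LINT x|W. 2 * Re (T v ?H x * g x))"
  unfolding A_def integral_Re[OF iA, symmetric] by (rule Bochner_Integration.integral_mult_right_zero[symmetric])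
 moreover have "2 * Re (T v ?H x * g x) = 2 * Re (T v ?H x * cnj (?H x)) * (\<Phi> x * (u l r x)\<^sup>2)" for x
 proof -
  have "T v ?H x * g x = cor (\<Phi> x * (u l r x)\<^sup>2) * (T v ?H x * cnj (?H x))"
   by (simp only: g_def \<Psi>_def mult_ac)
  thus ?thesis by (simp only: Re_of_real_times) (simp only: mult_ac)
 qed
 ultimately show ?thesis unfolding D_def by (simp only:)
qed

lemma P_continuous: assumes "0 <= l" shows "cts (P l)"
proof -
 let ?A = "\<lambda>z x. (norm (htr y z x))\<^sup>2 * (\<Phi> x * (u l (norm z) x)\<^sup>2)"
 \<comment> \<open>The last factor is at least 1 where the cutoff lives and makes the majorant
   continuous with compact support.\<close>
 define B where "B x = c\<^sup>2 * l\<^sup>2 * \<Phi> x * max 0 (l + 1 - norm x)" for x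
 have Bi: "integrable W B"
  unfolding B_def by (rule integrable_W_compact_support_real[where r="l + 1"]) (auto intro!: continuous_intros \<Phi>_cont)
 have "cts (\<lambda>z. LINT x|W. cor (?A z x))"
 proof (rule integral_param_continuous[where b="\<lambda>r. B"])
  show "(\<lambda>x. cor (?A z x)) \<in> borelm" for z
   by (intro borel_measurable_continuous_onI continuous_intros htr_cont u_cont \<Phi>_cont)
  show "cts (\<lambda>z. cor (?A z x))" for x
   unfolding htr_symmetric[of y _ x] by (intro continuous_intros htr_cont u_cont)
  fix z x :: "real^'n"
  have "(norm (htr y z x))\<^sup>2 * (\<Phi> x * (u l (norm z) x)\<^sup>2) <= B x"
  proof (cases "norm x <= l")
   case True
   have "(norm (htr y z x))\<^sup>2 * (\<Phi> x * (u l (norm z) x)\<^sup>2) <= c\<^sup>2 * (\<Phi> x * l\<^sup>2)"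
    using htr_le u_le[of "norm z" l x] u_nonneg assms \<Phi>_pos[of x] by (intro mult_mono power_mono) auto
   also have "\<dots> <= c\<^sup>2 * (\<Phi> x * l\<^sup>2) * max 0 (l + 1 - norm x)"
    using True \<Phi>_pos[of x] using mult_left_mono[of 1 "max 0 (l + 1 - norm x)" "c\<^sup>2 * (\<Phi> x * l\<^sup>2)"] by simp
   finally show ?thesis by (simp add: B_def mult_ac)
  next
   case False thus ?thesis using u_support[of "norm z" l x] \<Phi>_pos[of x] by (simp add: B_def)
  qed
  thus "norm (cor (?A z x)) <= B x"
   using \<Phi>_pos[of x] by (simp add: norm_mult norm_power)
 qed (rule Bi)
 from continuous_on_Re[OF this] show ?thesis
  unfolding P_def integral_complex_of_real by simp
qed

lemma P_derivative:
 assumes z: "z \<noteq> 0" and m: "0 <= m"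
 defines "d \<equiv> \<lambda>x. fderiv (htr y x) z z"
 shows "((\<lambda>t. P m (t *\<^sub>R z)) has_real_derivative
  (LINT x|W. 2 * Re (d x * cnj (htr y z x)) * (\<Phi> x * (u m (norm z) x)\<^sup>2) - (norm (htr y z x))\<^sup>2 * (\<Phi> x * (2 * norm z * u m (norm z) x)))) (at 1)"
proof -
 let ?A = "\<lambda>t. t *\<^sub>R z"
 let ?B = "\<lambda>p y x t. cor (p \<bullet> z) * rquot p (htr y x) (?A t)"
 let ?C = "\<lambda>y x t. \<Sum>p\<in>R. cor (k p / 2 * (p \<bullet> z)) * rquot p (htr y x) (?A t)"
 let ?D = "\<lambda>y x t. fderiv (htr y x) (?A t) z * cnj (htr y x (?A t))"
 let ?E = "\<lambda>K. 2 * K * c * m\<^sup>2 + c\<^sup>2 * (2 * norm z * m)"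
 let ?F = "\<lambda>x t. \<Phi> x * (u m (t * norm z) x)\<^sup>2"
 define f where "f t x = (norm (htr y (?A t) x))\<^sup>2 * (?F x t)" for t x
 define f' where "f' t x = 2 * Re (?D y x t) * (?F x t)
  - (norm (htr y (?A t) x))\<^sup>2 * (\<Phi> x * (2 * norm z * u m (t * norm z) x))" for t x
 obtain B where B: "B >= 0" "!!y w x. norm (T z (htr y w) x) <= B" using htr_dunkl_bound[of z] by metis
 \<comment> \<open>The ordinary derivative is the Dunkl derivative minus the reflection terms. For
   \<open>t > 1 / 2\<close> the factor \<open>1 / t\<close> in those terms is at most 2, and each
   difference of values of \<open>htr\<close> is at most \<open>2 * c\<close>.\<close>
 define K where "K = B + 4 * \<gamma> * c"
 define b where "b x = (?E K) * \<Phi> x * max 0 (m + 1 - norm x)" for x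
 have K0: "K >= 0" using B(1) \<gamma>_nonneg c_pos by (simp add: K_def)
 have fd: "norm (fderiv (htr y x) (?A t) z) <= K" if t: "t > 1 / 2" for t x
 proof -
  have lin: "linear (fderiv (htr y x) (?A t))" by (rule linear_frechet_derivative[OF C1_D(1)[OF htr_C1]])
  have "T z (htr y x) (?A t) = fderiv (htr y x) (?A t) z + (?C y x t)"
   by (simp add: dunkl_op_def)
  moreover have "norm (cor (k p / 2 * (p \<bullet> z)) * rquot p (htr y x) (?A t)) <= k p / 2 * (4 * c)" if a: "p \<in> R" for p
  proof -
   have "t * norm (?B p y x t) = norm (cor (p \<bullet> t *\<^sub>R z) * rquot p (htr y x) (?A t))"
    using t by (simp add: norm_mult)
   also have "\<dots> <= norm (htr y x (?A t)) + norm (htr y x (\<sigma> p (?A t)))"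
    unfolding inner_reflection_quotient[OF a] by (rule norm_triangle_ineq4)
   also have "\<dots> <= 2 * c" using htr_le[of y x "t *\<^sub>R z"] htr_le[of y x "\<sigma> p (?A t)"] by linarith
   finally have "t * norm (?B p y x t) <= 2 * c" .
   moreover have "1 / 2 * norm (?B p y x t) <= t * norm (?B p y x t)"
    using t by (intro mult_right_mono) auto
   ultimately have "norm (?B p y x t) <= 4 * c" by linarith
   hence "k p / 2 * norm (?B p y x t) <= k p / 2 * (4 * c)"
    using k_nonneg[OF a] by (intro mult_left_mono) auto
   thus ?thesis using k_nonneg[OF a] by (simp add: norm_mult mult_ac)
  qed
  hence "norm (?C y x t) <= (\<Sum>p\<in>R. k p / 2 * (4 * c))"
   by (intro sum_norm_le)
  hence "norm (?C y x t) <= \<gamma> * (4 * c)"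
   by (simp only: \<gamma>_def sum_distrib_right)
  ultimately show ?thesis using B(2)[of y x "t *\<^sub>R z"] norm_triangle_ineq4[of "T z (htr y x) (?A t)" "\<Sum>p\<in>R. cor (k p / 2 * (p \<bullet> z)) * rquot p (htr y x) (?A t)"]
   unfolding K_def by (simp add: algebra_simps)
 qed
 have "((\<lambda>t. LINT x|W. f t x) has_real_derivative (LINT x|W. f' 1 x)) (at 1)"
 proof (rule DERIV_integral[where \<delta>="1 / 2" and b=b])
  fix t :: real assume "\<bar>t - 1\<bar> < 1 / 2"
  hence t: "t > 1 / 2" by linarith
  show "integrable W (f t)" unfolding f_def using t by (intro P_int continuous_intros htr_cont) auto
  fix x
  have 1: "((\<lambda>t. htr y x (?A t)) has_derivative (\<lambda>h. fderiv (htr y x) (?A t) (h *\<^sub>R z))) (at t)"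
  proof (rule has_derivative_compose[where g="htr y x"])
   show "((\<lambda>t. t *\<^sub>R z) has_derivative (\<lambda>h. h *\<^sub>R z)) (at t)" by (auto intro!: derivative_eq_intros)
   show "(htr y x has_derivative fderiv (htr y x) (?A t)) (at (?A t))"
    using C1_D(1)[OF htr_C1] by (simp add: frechet_derivative_works)
  qed
  have 2: "((\<lambda>t. (norm (htr y (?A t) x))\<^sup>2) has_real_derivative 2 * Re (?D y x t)) (at t)"
  proof -
   have "((\<lambda>t. htr y x (?A t) \<bullet> htr y x (?A t)) has_derivative (\<lambda>h. htr y x (?A t) \<bullet> fderiv (htr y x) (?A t) (h *\<^sub>R z) + fderiv (htr y x) (?A t) (h *\<^sub>R z) \<bullet> htr y x (?A t))) (at t)"
    by (rule has_derivative_inner[OF 1 1])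
   thus ?thesis unfolding power2_norm_eq_inner htr_symmetric[of y _ x] has_field_derivative_def
    by (rule has_derivative_eq_rhs)
     (simp add: fun_eq_iff linear_scale[OF linear_frechet_derivative[OF C1_D(1)[OF htr_C1]]] inner_complex_def algebra_simps)
  qed
  have 3: "((\<lambda>t. (u m (t * norm z) x)\<^sup>2) has_real_derivative 2 * u m (t * norm z) x * (- norm z)) (at t)"
  proof -
   have "((\<lambda>t. m - t * norm z - sqrt (1 + (norm x)\<^sup>2)) has_real_derivative - norm z) (at t)"
    by (auto intro!: derivative_eq_intros)
   from DERIV_chain2[OF DERIV_max_power[OF order_refl] this]
   show ?thesis by (simp add: u_def power2_eq_square)
  qed
  show "((\<lambda>t. f t x) has_real_derivative f' t x) (at t)"
   unfolding f_def f'_def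
   by (rule DERIV_cong[OF DERIV_mult[OF 2 DERIV_cmult[OF 3]]]) (simp add: algebra_simps)
  show "\<bar>f' t x\<bar> <= b x"
  proof (cases "norm x <= m")
   case True
   have uu: "u m (t * norm z) x <= m" "0 <= u m (t * norm z) x" using u_le[of "t * norm z" m x] u_nonneg m t by auto
   have "\<bar>Re (?D y x t)\<bar> <= norm (?D y x t)"
    by (rule abs_Re_le_cmod)
   also have "\<dots> <= K * c" unfolding norm_mult using fd[OF t] K0 htr_le by (intro mult_mono) auto
   finally have "\<bar>2 * Re (?D y x t) * (?F x t)\<bar> <= 2 * (K * c) * (\<Phi> x * m\<^sup>2)"
    unfolding abs_mult using uu \<Phi>_pos[of x] K0 c_pos by (intro mult_mono power_mono) auto
   moreover have "\<bar>(norm (htr y (?A t) x))\<^sup>2 * (\<Phi> x * (2 * norm z * u m (t * norm z) x))\<bar> <= c\<^sup>2 * (\<Phi> x * (2 * norm z * m))"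
    unfolding abs_mult abs_power2 abs_norm_cancel using uu \<Phi>_pos[of x] htr_le m by (intro mult_mono power_mono) auto
   ultimately have "\<bar>f' t x\<bar> <= (?E K) * \<Phi> x"
    unfolding f'_def by (simp add: algebra_simps)
   also have "\<dots> <= b x" unfolding b_def
    using mult_left_mono[of 1 "max 0 (m + 1 - norm x)" "(?E K) * \<Phi> x"] True \<Phi>_pos[of x] K0 c_pos m by simp
   finally show ?thesis .
  next
   case False
   thus ?thesis using u_support[of "t * norm z" m x] \<Phi>_pos[of x] K0 c_pos m t by (simp add: b_def f'_def)
  qed
 next
  show "integrable W b"
   unfolding b_def by (rule integrable_W_compact_support_real[where r="m + 1"]) (auto intro!: continuous_intros \<Phi>_cont)
 qed simp
 moreover have "((\<lambda>t. LINT x|W. f t x) has_real_derivative l) (at 1) ==> ((\<lambda>t. P m (?A t)) has_real_derivative l) (at 1)" for l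
 proof (erule has_field_derivative_transform_within_open[where S="{0<..}"])
  show "(LINT x|W. f t x) = P m (?A t)" if "t \<in> {0<..}" for t using that by (simp add: P_def f_def)
 qed auto
 ultimately show ?thesis unfolding f'_def d_def by (simp add: htr_symmetric[of y _ z])
qed

text \<open>The comparison principle is applied to \<open>P l\<close>. The radial derivative of the
  translate is a Dunkl derivative, moved to \<open>x\<close> and integrated by parts, minus
  reflection terms; integrated, the latter contribute differences
  \<open>P l z - P l (\<sigma> b z)\<close>, nonnegative where the principle asks. The retreat of
  the cutoff outweighs its gradient in \<open>x\<close>, so only the logarithmic derivative of
  \<open>\<Phi>\<close> remains.\<close>

lemma P_bound:
 assumes l: "0 <= l" shows "P l z <= exp (\<Lambda> * norm z) * P l 0"
proof -
 let ?A = "\<lambda>z x H. T z (htr y z) x * cnj (H x)"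
 let ?B = "\<lambda>H x z. \<Sum>b\<in>R. cor (k b / 2) * (H x - htr y (\<sigma> b z) x)"
 let ?C = "\<lambda>b z x. norm (htr y (\<sigma> b z) x)"
 let ?D = "\<lambda>H V. LINT x|W. (norm (H x))\<^sup>2 * V x"
 let ?E = "\<lambda>H D. LINT x|W. (norm (H x))\<^sup>2 * D x"
 have P0: "0 <= P l z" for z
  unfolding P_def using \<Phi>_pos by (intro Bochner_Integration.integral_nonneg mult_nonneg_nonneg) (auto intro: less_imp_le)
 have "P l z <= exp (\<Lambda> * norm z) * max 0 (P l 0)"
 proof (rule max_principle[OF P_continuous[OF l]])
  fix z assume z: "z \<noteq> 0" and le: "!!b. b \<in> R ==> P l (\<sigma> b z) <= P l z"
  define H where "H x = htr y z x" for x
  define r where "r = norm z"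
  have r0: "0 <= r" by (simp add: r_def)
  define U where "U x = \<Phi> x * (u l r x)\<^sup>2" for x
  define V where "V x = \<Phi> x * (2 * r * u l r x)" for x
  define d where "d x = fderiv (htr y x) z z" for x
  define D where "D x = \<Phi>' x z * (u l r x)\<^sup>2 - \<Phi> x * (x \<bullet> z) / sqrt (1 + (norm x)\<^sup>2) * (2 * u l r x)" for x
  note Hc = C1_D[OF htr_C1[of y z], folded H_def]
  have Hc': "cts H" unfolding H_def[abs_def] by (rule htr_cont)
  have U0: "0 <= U x" for x using \<Phi>_pos[of x] by (simp add: U_def)
  have IU: "integrable W (\<lambda>x. f x * U x)" if "cts f" for f unfolding U_def by (rule P_int(1)[OF r0 that])
  \<comment> \<open>The identity along rays in the variable \<open>z\<close>, with the Dunkl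
    operator in \<open>z\<close> exchanged for the one in \<open>x\<close>.\<close>
  have d: "d x = T z (htr y z) x - (?B H x z)" for x
   using dunkl_op_ray[of z "htr y x"] unfolding d_def H_def by (simp add: htr_dunkl_symmetric htr_symmetric[of y _ x])
  have dc: "cts d"
   unfolding d[abs_def] by (intro continuous_intros C1_D(5)[OF htr_C1] Hc' htr_cont)
  have Dc: "cts D" unfolding D_def
   by (intro continuous_intros u_cont \<Phi>_cont \<Phi>'_cont) (auto simp: add_nonneg_eq_0_iff)
  define J where "J = (LINT x|W. 2 * Re (d x * cnj (H x)) * U x - (norm (H x))\<^sup>2 * V x)"
  have J: "((\<lambda>t. P l (t *\<^sub>R z)) has_real_derivative J) (at 1)"
   unfolding J_def d_def H_def U_def V_def r_def by (rule P_derivative[OF z l])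
  have Vs: "(\<lambda>x. (norm (H x))\<^sup>2 * V x) = (\<lambda>x. (2 * r * (norm (H x))\<^sup>2) * (\<Phi> x * u l r x))"
   by (simp add: V_def mult_ac fun_eq_iff)
  have IV: "integrable W (\<lambda>x. (norm (H x))\<^sup>2 * V x)"
   unfolding Vs by (intro P_int(2)[OF r0] continuous_intros Hc')
  have ID: "integrable W (\<lambda>x. (norm (H x))\<^sup>2 * D x)"
  proof (rule integrable_W_compact_support_real[where r=l])
   show "cts (\<lambda>x. (cmod (H x))\<^sup>2 * D x)" by (intro continuous_intros Hc' Dc)
   show "(cmod (H x))\<^sup>2 * D x = 0" if "norm x > l" for x using u_support[OF r0 that] by (simp add: D_def)
  qed
  define S where "S x = (\<Sum>b\<in>R. k b / 2 * ((norm (H x))\<^sup>2 - (?C b z x)\<^sup>2))" for x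
  have Sc: "cts S" unfolding S_def by (intro continuous_intros Hc' htr_cont)
  \<comment> \<open>Expanding the square of \<open>norm (H x - K)\<close>, with \<open>K\<close> the
    reflected translate, bounds each reflection term below by a difference of squared
    moduli.\<close>
  have pw: "2 * Re (d x * cnj (H x)) <= 2 * Re (?A z x H) - S x" for x
  proof -
   have q: "k b / 2 * ((norm (H x))\<^sup>2 - (?C b z x)\<^sup>2) <= 2 * Re (cor (k b / 2) * (H x - htr y (\<sigma> b z) x) * cnj (H x))" if a: "b \<in> R" for b
   proof -
    let ?K = "htr y (\<sigma> b z) x"
    have "0 <= (norm (H x - ?K))\<^sup>2" by simp
    hence "(norm (H x))\<^sup>2 - (norm ?K)\<^sup>2 <= 2 * Re ((H x - ?K) * cnj (H x))"
     unfolding cmod_power2 by (simp add: power2_eq_square algebra_simps)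
    hence "k b / 2 * ((norm (H x))\<^sup>2 - (norm ?K)\<^sup>2) <= k b / 2 * (2 * Re ((H x - ?K) * cnj (H x)))"
     using k_nonneg[OF a] by (intro mult_left_mono) auto
    thus ?thesis unfolding mult.assoc Re_of_real_times by (simp only: mult_ac)
   qed
   have "S x <= (\<Sum>b\<in>R. 2 * Re (cor (k b / 2) * (H x - htr y (\<sigma> b z) x) * cnj (H x)))"
    unfolding S_def by (intro sum_mono q)
   also have "\<dots> = 2 * Re ((?B H x z) * cnj (H x))"
    by (simp only: sum_distrib_left[symmetric] Re_sum[symmetric] sum_distrib_right[symmetric])
   finally show ?thesis unfolding d left_diff_distrib by simp
  qed
  have IS: "(LINT x|W. S x * U x) >= 0"
  proof -
   have "(LINT x|W. S x * U x) = (LINT x|W. (\<Sum>b\<in>R. k b / 2 * ((norm (H x))\<^sup>2 * U x - (?C b z x)\<^sup>2 * U x)))"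
    unfolding S_def sum_distrib_right by (simp only: mult.assoc left_diff_distrib)
   also have "\<dots> = (\<Sum>b\<in>R. k b / 2 * (P l z - P l (\<sigma> b z)))"
   proof -
    have i: "integrable W (\<lambda>x. (norm (htr y w x))\<^sup>2 * U x)" for w by (intro IU continuous_intros htr_cont)
    have "(LINT x|W. k b / 2 * ((norm (H x))\<^sup>2 * U x - (?C b z x)\<^sup>2 * U x)) = k b / 2 * (P l z - P l (\<sigma> b z))" if "b \<in> R" for b
     using i that unfolding P_def U_def H_def r_def by simp
    moreover have "integrable W (\<lambda>x. k b / 2 * ((norm (H x))\<^sup>2 * U x - (?C b z x)\<^sup>2 * U x))" for b
     unfolding H_def by (intro integrable_mult_right Bochner_Integration.integrable_diff i)
    ultimately show ?thesis by (simp only: Bochner_Integration.integral_sum cong: sum.cong)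
   qed
   also have "\<dots> >= 0" using le by (intro sum_nonneg mult_nonneg_nonneg) (auto simp: k_nonneg)
   finally show ?thesis .
  qed
  have "J <= (LINT x|W. 2 * Re (?A z x H) * U x - S x * U x - (norm (H x))\<^sup>2 * V x)"
   unfolding J_def
  proof (rule integral_mono)
   show "integrable W (\<lambda>x. 2 * Re (d x * cnj (H x)) * U x - (norm (H x))\<^sup>2 * V x)"
    by (intro Bochner_Integration.integrable_diff IU IV continuous_intros dc Hc')
   show "integrable W (\<lambda>x. 2 * Re (?A z x H) * U x - S x * U x - (norm (H x))\<^sup>2 * V x)"
    by (intro Bochner_Integration.integrable_diff IU IV continuous_intros C1_D(5)[OF htr_C1] Hc' Sc)
   show "2 * Re (d x * cnj (H x)) * U x - (norm (H x))\<^sup>2 * V x <= 2 * Re (?A z x H) * U x - S x * U x - (norm (H x))\<^sup>2 * V x" for x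
    using mult_right_mono[OF pw U0] by (simp add: left_diff_distrib)
  qed
  also have "\<dots> = (LINT x|W. 2 * Re (?A z x H) * U x) - (LINT x|W. S x * U x) - (?D H V)"
   by (subst Bochner_Integration.integral_diff;
     (intro Bochner_Integration.integrable_diff IU IV continuous_intros C1_D(5)[OF htr_C1] Hc' Sc)?)+ simp
  also have "(LINT x|W. 2 * Re (?A z x H) * U x) = - (?E H D)"
   unfolding H_def U_def D_def by (rule energy_by_parts[OF r0])
  also have "- (?E H D) - (LINT x|W. S x * U x) - (?D H V) <= - (?E H D) - (?D H V)"
   using IS by simp
  also have "\<dots> = (LINT x|W. - ((norm (H x))\<^sup>2 * D x) - (norm (H x))\<^sup>2 * V x)"
   using ID IV by simp
  also have "\<dots> <= (LINT x|W. (\<Lambda> * norm z) * ((norm (H x))\<^sup>2 * U x))"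
  proof (rule integral_mono)
   show "integrable W (\<lambda>x. - ((norm (H x))\<^sup>2 * D x) - (norm (H x))\<^sup>2 * V x)" using ID IV by simp
   show "integrable W (\<lambda>x. (\<Lambda> * norm z) * ((norm (H x))\<^sup>2 * U x))" by (intro integrable_mult_right IU continuous_intros Hc')
   fix x :: "real^'n"
   define s where "s = sqrt (1 + (norm x)\<^sup>2)"
   have s: "norm x <= s" "s > 0" unfolding s_def by (auto intro: real_le_rsqrt simp: add_pos_nonneg)
   have "x \<bullet> z <= norm x * norm z" by (rule norm_cauchy_schwarz)
   also have "\<dots> <= s * r" unfolding r_def using s by (intro mult_right_mono) auto
   \<comment> \<open>Here the unit speed of the cone is matched with its unit slope.\<close>
   finally have "(x \<bullet> z) / s <= r" using s by (simp add: divide_le_eq mult.commute)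
   hence "\<Phi> x * (2 * u l r x) * ((x \<bullet> z) / s) <= \<Phi> x * (2 * u l r x) * r"
    using \<Phi>_pos[of x] u_nonneg[of l r x] by (intro mult_left_mono) auto
   moreover have "- (\<Phi>' x z) * (u l r x)\<^sup>2 <= (\<Lambda> * norm z * \<Phi> x) * (u l r x)\<^sup>2"
    using \<Phi>_log[of x z] by (intro mult_right_mono) auto
   ultimately have "- D x - V x <= \<Lambda> * norm z * U x"
    unfolding D_def V_def U_def s_def[symmetric] by (simp add: algebra_simps)
   hence "(norm (H x))\<^sup>2 * (- D x - V x) <= (norm (H x))\<^sup>2 * (\<Lambda> * norm z * U x)" by (rule mult_left_mono) simp
   thus "- ((norm (H x))\<^sup>2 * D x) - (norm (H x))\<^sup>2 * V x <= (\<Lambda> * norm z) * ((norm (H x))\<^sup>2 * U x)" by (simp add: algebra_simps)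
  qed
  also have "\<dots> = \<Lambda> * norm z * P l z" by (simp add: P_def H_def U_def r_def)
  finally show "\<exists>D. ((\<lambda>t. P l (t *\<^sub>R z)) has_real_derivative D) (at 1) \<and> D <= \<Lambda> * norm z * P l z"
   using J by blast
 qed
 thus ?thesis using P0[of 0] by simp
qed

text \<open>With \<open>l = n + 1\<close> the cutoff divided by \<open>l\<close> is at most 1 and
  tends to 1 pointwise, so Fatou's lemma removes it from the truncated estimate.\<close>

theorem energy_estimate:
 "(nnint W (\<lambda>x. (norm (htr y z x))\<^sup>2 * \<Phi> x)) <= ennreal (exp (\<Lambda> * norm z) * c\<^sup>2) * (nnint W (\<lambda>x. (h x y)\<^sup>2 * \<Phi> x))"
proof -
 let ?A = "nnint W (\<lambda>x. (h x y)\<^sup>2 * \<Phi> x)"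
 let ?B = "\<integral>\<^sup>+x. ennreal (c\<^sup>2) * ennreal ((h x y)\<^sup>2 * \<Phi> x) \<partial>W"
 let ?C = "\<Lambda> * norm z"
 let ?D = "\<lambda>w r. \<lambda>x. (norm (htr y w x))\<^sup>2 * (\<Phi> x * (u r (norm w) x)\<^sup>2) / r\<^sup>2"
 let ?E = "\<lambda>x. norm (htr y z x)"
 let ?F = "\<lambda>x n. \<Phi> x * (u (real (Suc n)) (norm z) x / real (Suc n))\<^sup>2"
 define f where "f n x = ennreal ((?E x)\<^sup>2 * (\<Phi> x * (u (real (Suc n)) (norm z) x)\<^sup>2) / (real (Suc n))\<^sup>2)" for n x
 have fm: "f n \<in> borel_measurable W" for n
  unfolding f_def[abs_def]
  by (intro measurable_compose[OF _ measurable_ennreal] continuous_measurable_W continuous_intros htr_cont u_cont \<Phi>_cont) auto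
 have lim: "(\<lambda>n. f n x) \<longlonglongrightarrow> ennreal ((?E x)\<^sup>2 * \<Phi> x)" for x
 proof -
  define a where "a = norm z + sqrt (1 + (norm x)\<^sup>2)"
  have "(\<lambda>n. a * (1 / real (Suc n))) \<longlonglongrightarrow> a * 0"
   by (intro tendsto_mult tendsto_const LIMSEQ_inverse_real_of_nat[unfolded inverse_eq_divide])
  hence "(\<lambda>n. max 0 (1 - a * (1 / real (Suc n)))) \<longlonglongrightarrow> max 0 (1 - a * 0)" by (intro tendsto_max tendsto_diff tendsto_const)
  moreover have "max 0 (1 - a * (1 / real (Suc n))) = u (real (Suc n)) (norm z) x / real (Suc n)" for n
  proof -
   have "1 - a * (1 / real (Suc n)) = (real (Suc n) - norm z - sqrt (1 + (norm x)\<^sup>2)) / real (Suc n)"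
    by (simp add: a_def field_simps)
   thus ?thesis by (simp only: u_def max_divide_distrib_right) simp
  qed
  ultimately have "(\<lambda>n. u (real (Suc n)) (norm z) x / real (Suc n)) \<longlonglongrightarrow> 1" by simp
  hence "(\<lambda>n. (?E x)\<^sup>2 * (?F x n)) \<longlonglongrightarrow> (?E x)\<^sup>2 * (\<Phi> x * 1\<^sup>2)"
   by (intro tendsto_mult tendsto_const tendsto_power)
  hence "(\<lambda>n. ennreal ((?E x)\<^sup>2 * (?F x n))) \<longlonglongrightarrow> ennreal ((?E x)\<^sup>2 * (\<Phi> x * 1\<^sup>2))"
   by (rule tendsto_ennrealI)
  thus ?thesis by (simp add: f_def power_divide)
 qed
 have bound: "(\<integral>\<^sup>+x. f n x \<partial>W) <= ennreal (exp ?C * c\<^sup>2) * ?A" for n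
 proof -
  define r where "r = real (Suc n)"
  have r: "r > 0" by (simp add: r_def)
  have PW: "(nnint W (?D w r)) = ennreal (P r w / r\<^sup>2)" for w
  proof -
   have i: "integrable W (?D w r)"
    by (intro integrable_divide P_int(1) continuous_intros htr_cont) auto
   show ?thesis using nn_integral_eq_integral[OF i] \<Phi>_pos by (simp add: P_def less_imp_le)
  qed
  have "(\<integral>\<^sup>+x. f n x \<partial>W) = ennreal (P r z / r\<^sup>2)" unfolding f_def r_def[symmetric] by (rule PW)
  also have "\<dots> <= ennreal (exp ?C * (P r 0 / r\<^sup>2))"
   using P_bound[of r z] r by (intro ennreal_leI) (simp add: divide_right_mono)
  also have "\<dots> = ennreal (exp ?C) * (nnint W (\<lambda>x. (norm (htr y 0 x))\<^sup>2 * (\<Phi> x * (u r (norm (0 :: real^'n)) x)\<^sup>2) / r\<^sup>2))"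
   unfolding PW by (rule ennreal_mult') simp
  also have "\<dots> <= ennreal (exp ?C) * ?B"
  proof (intro mult_left_mono nn_integral_mono)
   fix x
   have "(u r 0 x)\<^sup>2 <= r\<^sup>2" using u_le[of 0 r x] u_nonneg r by (intro power_mono) auto
   hence "(u r 0 x)\<^sup>2 / r\<^sup>2 <= 1" using r by simp
   hence "((norm (htr y 0 x))\<^sup>2 * \<Phi> x) * ((u r 0 x)\<^sup>2 / r\<^sup>2) <= ((norm (htr y 0 x))\<^sup>2 * \<Phi> x) * 1"
    using \<Phi>_pos[of x] by (intro mult_left_mono) auto
   also have "\<dots> = c\<^sup>2 * ((h x y)\<^sup>2 * \<Phi> x)"
    unfolding htr_zero norm_of_real by (simp add: power_mult_distrib)
   finally have "(norm (htr y 0 x))\<^sup>2 * (\<Phi> x * (u r (norm (0 :: real^'n)) x)\<^sup>2) / r\<^sup>2 <= c\<^sup>2 * ((h x y)\<^sup>2 * \<Phi> x)"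
    by (simp add: mult_ac)
   thus "ennreal ((norm (htr y 0 x))\<^sup>2 * (\<Phi> x * (u r (norm (0 :: real^'n)) x)\<^sup>2) / r\<^sup>2) <= ennreal (c\<^sup>2) * ennreal ((h x y)\<^sup>2 * \<Phi> x)"
    by (subst ennreal_mult'[symmetric]) (auto intro: ennreal_leI)
  qed simp
  also have "?B = ennreal (c\<^sup>2) * ?A"
   by (intro nn_integral_cmult measurable_compose[OF _ measurable_ennreal] continuous_measurable_W continuous_intros \<Phi>_cont h_continuous)
  finally show ?thesis by (simp add: ennreal_mult' mult.assoc)
 qed
 have "(nnint W (\<lambda>x. (?E x)\<^sup>2 * \<Phi> x)) = (\<integral>\<^sup>+x. liminf (\<lambda>n. f n x) \<partial>W)"
  by (simp only: lim_imp_Liminf[OF sequentially_bot lim])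
 also have "\<dots> <= liminf (\<lambda>n. \<integral>\<^sup>+x. f n x \<partial>W)" by (rule nn_integral_liminf[OF fm])
 also have "\<dots> <= ennreal (exp ?C * c\<^sup>2) * ?A"
  by (rule Liminf_le) (use bound in auto)
 finally show ?thesis .
qed

end

section \<open>Translates of the heat kernel in the mean\<close>

context dunkl begin

lemma nn_integral_shifted_decay:
 obtains C where "C > 0" "!!a. (nnint W (\<lambda>x. (1 + (norm (x - a))\<^sup>2) powr - N)) <= ennreal (C * vol a)"
proof -
 let ?A = "\<lambda>x a. 1 + (norm (x - a))\<^sup>2"
 let ?B = "\<lambda>v. 1 + (norm v)\<^sup>2"
 define I where "I = (nnint lborel (\<lambda>v. (1 + (norm (v :: real^'n))\<^sup>2) powr - real CARD('n)))"
 have "I < \<infinity>" unfolding I_def by (rule nn_integral_vec_decay_finite)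
 then obtain i where i: "i >= 0" "I = ennreal i" by (cases I) auto
 define C where "C = 5 powr \<kappa> * i + 1"
 have "C > 0" using i by (simp add: C_def add_nonneg_pos)
 moreover have "(nnint W (\<lambda>x. (?A x a) powr - N)) <= ennreal (C * vol a)" for a
 proof -
  have m: "(\<lambda>x. ennreal (vol x) * ennreal ((?A x a) powr - N)) \<in> borelm" by measurable
  have "(nnint W (\<lambda>x. (?A x a) powr - N)) = (\<integral>\<^sup>+x. ennreal (weight x) * ennreal ((?A x a) powr - N) \<partial>lborel)"
   by (rule nn_integral_W) measurable
  also have "\<dots> <= (\<integral>\<^sup>+x. ennreal (vol x) * ennreal ((?A x a) powr - N) \<partial>lborel)"
   by (intro nn_integral_mono mult_right_mono ennreal_leI weight_le_vol) simp
  also have "\<dots> = (\<integral>\<^sup>+v. ennreal (vol (a + v)) * ennreal ((?B v) powr - N) \<partial>lborel)"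
   using nn_integral_distr[of "(+) a" lborel borel "\<lambda>x. ennreal (vol x) * ennreal ((?A x a) powr - N)"] m
   by (simp add: lborel_distr_plus)
  also have "\<dots> <= (\<integral>\<^sup>+v. ennreal (vol a * 5 powr \<kappa>) * ennreal ((1 + (norm (v :: real^'n))\<^sup>2) powr - real CARD('n)) \<partial>lborel)"
  proof (rule nn_integral_mono)
   fix v :: "real^'n"
   have "vol (a + v) * (?B v) powr - N <= vol a * (5 powr \<kappa> * (?B v) powr \<kappa>) * (?B v) powr - N"
    by (intro mult_right_mono vol_add_le') auto
   also have "\<dots> = vol a * 5 powr \<kappa> * (?B v) powr - real CARD('n)"
    by (simp add: N_eq powr_add[symmetric] mult.assoc)
   finally show "ennreal (vol (a + v)) * ennreal ((?B v) powr - N) <= ennreal (vol a * 5 powr \<kappa>) * ennreal ((?B v) powr - real CARD('n))"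
    using vol_pos[of a] by (simp add: ennreal_mult''[symmetric] ennreal_leI)
  qed
  also have "\<dots> = ennreal (vol a * 5 powr \<kappa>) * ennreal i"
   unfolding i(2)[symmetric] I_def by (rule nn_integral_cmult) measurable
  also have "\<dots> <= ennreal (C * vol a)"
   using i(1) vol_pos[of a] by (subst ennreal_mult''[symmetric]) (auto intro!: ennreal_leI simp: C_def algebra_simps)
  finally show ?thesis .
 qed
 ultimately show ?thesis by (rule that)
qed

text \<open>A bump of width \<open>1 / l\<close> around the orbit of \<open>y\<close>, summed over
  \<open>G\<close> to be invariant. Its inverse is the weight in the energy estimate, and its
  integral plays the part of the volume of the orbit of a ball of that radius.\<close>

definition \<Omega> :: "real => real^'n => real^'n => real" where
 "\<Omega> l y x = (\<Sum>g\<in>G. (1 + l\<^sup>2 * (norm (x - g y))\<^sup>2) powr - N)"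

definition \<Omega>' :: "real => real^'n => real^'n => real^'n => real" where
 "\<Omega>' l y x v = (\<Sum>g\<in>G. - N * (1 + l\<^sup>2 * (norm (x - g y))\<^sup>2) powr (- N - 1) * (l\<^sup>2 * (2 * ((x - g y) \<bullet> v))))"

lemma one_plus_pos: "1 + l\<^sup>2 * (norm x)\<^sup>2 > (0 :: real)"
 by (intro add_pos_nonneg) auto

lemma one_plus_nonzero: "1 + l\<^sup>2 * (norm x)\<^sup>2 \<noteq> (0 :: real)"
 using one_plus_pos[of l x] by linarith

lemma \<Omega>_der: "(\<Omega> l y has_derivative \<Omega>' l y x) (at x)"
 unfolding \<Omega>_def[abs_def] \<Omega>'_def[abs_def]
proof (rule has_derivative_sum)
 let ?A = "\<lambda>x g. 1 + l\<^sup>2 * (norm (x - g y))\<^sup>2"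
 fix g
 have 1: "((\<lambda>x. 1 + l\<^sup>2 * (norm (x - g y))\<^sup>2) has_derivative (\<lambda>v. l\<^sup>2 * (2 * ((x - g y) \<bullet> v)))) (at x)"
  unfolding power2_norm_eq_inner by (auto intro!: derivative_eq_intros simp: inner_commute)
 have 2: "((\<lambda>r. r powr - N) has_real_derivative - N * (?A x g) powr (- N - 1)) (at (?A x g))"
  using one_plus_pos by (rule has_real_derivative_powr)
 show "((\<lambda>x. (?A x g) powr - N) has_derivative (\<lambda>v. - N * (?A x g) powr (- N - 1) * (l\<^sup>2 * (2 * ((x - g y) \<bullet> v))))) (at x)"
  by (rule has_derivative_eq_rhs[OF DERIV_compose_FDERIV[OF 2 1]]) (simp only: mult.commute)
qed

lemma \<Omega>_pos: "\<Omega> l y x > 0"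
 unfolding \<Omega>_def using group_id by (intro sum_pos) (auto simp: one_plus_nonzero)

lemma \<Omega>_invariant: assumes "g' \<in> G" shows "\<Omega> l y (g' x) = \<Omega> l y x"
proof -
 have eq: "norm (g' x - (g' \<circ> g) y) = norm (x - g y)" if "g \<in> G" for g
  using group_norm[OF assms, of "x - g y"] linear_diff[OF group_linear[OF assms]] by simp
 have "\<Omega> l y (g' x) = (\<Sum>g\<in>G. (1 + l\<^sup>2 * (norm (g' x - (g' \<circ> g) y))\<^sup>2) powr - N)"
  unfolding \<Omega>_def using sum_group_left[OF subset_refl assms, of "\<lambda>g. (1 + l\<^sup>2 * (norm (g' x - g y))\<^sup>2) powr - N"] by simp
 also have "\<dots> = \<Omega> l y x" unfolding \<Omega>_def by (intro sum.cong refl) (simp only: eq)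
 finally show ?thesis .
qed

text \<open>From \<open>2 * (l * norm w) <= 1 + l\<^sup>2 * (norm w)\<^sup>2\<close> for each
  summand. The logarithmic derivative is of size \<open>N * l\<close>, so over a distance of order
  \<open>1 / l\<close> the energy grows by a bounded factor.\<close>

lemma \<Omega>'_bound: assumes l: "l >= 0" shows "\<bar>\<Omega>' l y x v\<bar> <= N * l * norm v * \<Omega> l y x"
proof -
 have "\<bar>- N * (1 + l\<^sup>2 * (norm w)\<^sup>2) powr (- N - 1) * (l\<^sup>2 * (2 * (w \<bullet> v)))\<bar> <= N * l * norm v * (1 + l\<^sup>2 * (norm w)\<^sup>2) powr - N" for w
 proof -
  define q where "q = 1 + l\<^sup>2 * (norm w)\<^sup>2"
  have q: "q > 0" unfolding q_def by (rule one_plus_pos)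
  have "2 * (l * norm w) <= q" using sum_squares_bound[of 1 "l * norm w"] by (simp add: q_def power_mult_distrib)
  hence "(l * norm v) * (2 * (l * norm w)) <= (l * norm v) * q" using l by (intro mult_left_mono) auto
  moreover have "\<bar>l\<^sup>2 * (2 * (w \<bullet> v))\<bar> <= l\<^sup>2 * (2 * (norm w * norm v))"
   using Cauchy_Schwarz_ineq2[of w v] by (simp add: abs_mult mult_left_mono)
  ultimately have "\<bar>l\<^sup>2 * (2 * (w \<bullet> v))\<bar> <= l * norm v * q" by (simp add: power2_eq_square mult_ac)
  hence "N * q powr (- N - 1) * \<bar>l\<^sup>2 * (2 * (w \<bullet> v))\<bar> <= N * q powr (- N - 1) * (l * norm v * q)"
   using N_pos by (intro mult_left_mono) auto
  also have "\<dots> = N * l * norm v * q powr - N" using q powr_add[of q "- N - 1" 1] by simp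
  finally show ?thesis unfolding q_def[symmetric] abs_mult using N_pos by simp
 qed
 thus ?thesis unfolding \<Omega>'_def \<Omega>_def sum_distrib_left real_norm_def[symmetric] by (intro sum_norm_le)
qed

lemma \<Omega>_continuous: "cts (\<Omega> l y)"
 unfolding \<Omega>_def[abs_def] by (intro continuous_intros) (auto simp: one_plus_nonzero)

lemma energy_\<Omega>:
 assumes "l >= 0"
 shows "energy R k (\<lambda>x. inverse (\<Omega> l y x)) (\<lambda>x v. - (inverse (\<Omega> l y x) * \<Omega>' l y x v * inverse (\<Omega> l y x))) (N * l)"
proof unfold_locales
 let ?A = "\<lambda>\<Omega> x v. inverse (\<Omega> l y x) * \<Omega>' l y x v * inverse (\<Omega> l y x)"
 have ne: "\<Omega> l y x \<noteq> 0" for x using \<Omega>_pos[of l y x] by simp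
 show "((\<lambda>x. inverse (\<Omega> l y x)) has_derivative (\<lambda>v. - (?A \<Omega> x v))) (at x)" for x
  by (rule Deriv.has_derivative_inverse[OF ne \<Omega>_der])
 have "cts (\<lambda>x. \<Omega>' l y x v)" for v
  unfolding \<Omega>'_def by (intro continuous_intros) (auto simp: one_plus_nonzero)
 thus "cts (\<lambda>x. - (?A \<Omega> x v))" for v
  using ne by (intro continuous_intros \<Omega>_continuous) auto
 show "0 < inverse (\<Omega> l y x)" for x using \<Omega>_pos by simp
 show "inverse (\<Omega> l y (\<sigma> a x)) = inverse (\<Omega> l y x)" if "a \<in> R" for a x
  using \<Omega>_invariant[OF group_reflection[OF that]] by simp
 show "\<bar>- (?A \<Omega> x v)\<bar> <= N * l * norm v * inverse (\<Omega> l y x)" for x v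
  using \<Omega>'_bound[OF assms, of y x v] \<Omega>_pos[of l y x] by (simp add: abs_mult field_simps)
qed

text \<open>Scaling by \<open>l\<close> brings the width to 1 and produces
  \<open>l powr - N\<close>; since \<open>l <= 1\<close>, scaling the centre does not increase its
  volume.\<close>

lemma \<Omega>_integral:
 assumes C: "!!a. (nnint W (\<lambda>x. (1 + (norm (x - a))\<^sup>2) powr - N)) <= ennreal (C * vol a)" and C0: "C > 0"
  and l: "0 < l" "l <= 1"
 shows "(nnint W (\<lambda>x. \<Omega> l y x)) <= ennreal (real (card G) * (l powr - N * (C * vol y)))"
proof -
 let ?A = "\<lambda>l x g. 1 + l\<^sup>2 * (norm (x - g y))\<^sup>2"
 let ?B = "\<lambda>l. l powr - N * (C * vol y)"
 have each: "(nnint W (\<lambda>x. (?A l x g) powr - N)) <= ennreal (?B l)" if g: "g \<in> G" for g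
 proof -
  have "(?A l x g) = (1 + (norm (l *\<^sub>R x - l *\<^sub>R g y))\<^sup>2)" for x
   using l by (simp add: scaleR_diff_right[symmetric] power_mult_distrib)
  hence "(nnint W (\<lambda>x. (?A l x g) powr - N)) = (nnint W (\<lambda>x. (1 + (norm (l *\<^sub>R x - l *\<^sub>R g y))\<^sup>2) powr - N))" by simp
  also have "\<dots> = ennreal (l powr - N) * (nnint W (\<lambda>x. (1 + (norm (x - l *\<^sub>R g y))\<^sup>2) powr - N))"
   by (rule nn_integral_W_scale[OF l(1), of "\<lambda>x. ennreal ((1 + (norm (x - l *\<^sub>R g y))\<^sup>2) powr - N)"]) measurable
  also have "\<dots> <= ennreal (l powr - N) * ennreal (C * vol (l *\<^sub>R g y))" by (intro mult_left_mono C) simp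
  also have "\<dots> = ennreal (l powr - N * (C * vol (l *\<^sub>R g y)))" using C0 vol_pos by (simp add: ennreal_mult'' less_imp_le)
  also have "\<dots> <= ennreal (?B l)"
  proof -
   have "vol (l *\<^sub>R g y) <= vol (g y)" unfolding vol_def
    using l by (intro prod_mono conjI powr_mono2) (auto simp: k_nonneg abs_mult mult_left_le_one_le)
   thus ?thesis unfolding vol_invariant[OF g] using C0 by (intro ennreal_leI mult_left_mono) auto
  qed
  finally show ?thesis .
 qed
 have "(nnint W (\<lambda>x. \<Omega> l y x)) = (\<integral>\<^sup>+x. (\<Sum>g\<in>G. ennreal ((?A l x g) powr - N)) \<partial>W)"
  unfolding \<Omega>_def by (simp add: sum_ennreal)
 also have "\<dots> = (\<Sum>g\<in>G. nnint W (\<lambda>x. (?A l x g) powr - N))"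
  by (rule nn_integral_sum) (rule measurable_W, measurable)
 also have "\<dots> <= (\<Sum>g\<in>G. ennreal (?B l))" by (intro sum_mono each)
 also have "\<dots> = ennreal (real (card G) * (?B l))"
  using C0 vol_pos[of y] by (simp add: ennreal_of_nat_eq_real_of_nat ennreal_mult'')
 finally show ?thesis .
qed

lemma ennreal_power2_le: assumes "(X :: ennreal)\<^sup>2 <= ennreal q" "q >= 0" shows "X <= ennreal (sqrt q)"
proof (cases X)
 case (real x)
 hence "x\<^sup>2 <= q" using assms by (simp add: ennreal_power)
 thus ?thesis using real by (simp add: ennreal_leI real_le_rsqrt)
next
 case top
 thus ?thesis using assms by (simp add: power2_eq_square ennreal_top_mult top_unique)
qed

text \<open>Cauchy--Schwarz with the factors \<open>sqrt (\<Phi> x)\<close> and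
  \<open>sqrt (\<Omega> l y x)\<close>, whose product is 1. The weighted square contributes
  \<open>1 / vol y\<close> and the integral of \<open>\<Omega>\<close> contributes
  \<open>(1 + norm z) powr N * vol y\<close>; so \<open>y\<close> drops out and the square root
  leaves the exponent \<open>N / 2\<close>.\<close>

theorem htr_mass:
 obtains C where "C > 0" "!!y z. (nnint W (\<lambda>x. norm (htr y z x))) <= ennreal (C * (1 + norm z) powr (N / 2))"
proof -
 let ?A = "\<lambda>C1 C2 z. (exp N * c\<^sup>2 * C1 * (real (card G) * C2)) * (1 + norm z) powr N"
 let ?B = "\<lambda>y \<Phi>. nnint W (\<lambda>x. (h x y)\<^sup>2 * \<Phi> x)"
 let ?C = "\<lambda>y z \<Phi>. nnint W (\<lambda>x. (norm (htr y z x))\<^sup>2 * \<Phi> x)"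
 let ?D = "\<lambda>x g y. 1 + (norm (x - g y))\<^sup>2"
 let ?E = "\<lambda>y z. nnint W (\<lambda>x. norm (htr y z x))"
 obtain C1 where C1: "C1 > 0" "!!y \<Phi>. \<Phi> \<in> borelm ==> (!!x. 0 <= \<Phi> x) ==> (!!x g. g \<in> G ==> \<Phi> x <= (?D x g y) powr N) ==>
   (?B y \<Phi>) <= ennreal (C1 / vol y)"
 proof -
  assume *: "!!C1. C1 > 0 ==> (!!y \<Phi>. \<Phi> \<in> borelm ==> (!!x. 0 <= \<Phi> x) ==> (!!x g. g \<in> G ==> \<Phi> x <= (?D x g y) powr N) ==>
   (?B y \<Phi>) <= ennreal (C1 / vol y)) ==> thesis"
  show thesis
  proof (rule h_weighted_square[OF less_imp_le[OF N_pos]], goal_cases)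
   case 1 thus thesis by (rule *)
  qed
 qed
 obtain C2 where C2: "C2 > 0" "!!a. (nnint W (\<lambda>x. (1 + (norm (x - a))\<^sup>2) powr - N)) <= ennreal (C2 * vol a)"
  using nn_integral_shifted_decay by metis
 define C where "C = sqrt (exp N * c\<^sup>2 * C1 * (real (card G) * C2))"
 have G0: "card G > 0" using group_id by (auto simp: card_gt_0_iff)
 have "C > 0" unfolding C_def using C1 C2 c_pos G0 by simp
 moreover have "(?E y z) <= ennreal (C * (1 + norm z) powr (N / 2))" for y z
 proof -
  \<comment> \<open>With this choice \<open>l * norm z <= 1\<close>, and the energy estimate loses
    only \<open>exp N\<close>.\<close>
  define l where "l = 1 / (1 + norm z)"
  have l: "0 < l" "l <= 1" "l * norm z <= 1" unfolding l_def by (auto simp: add_pos_nonneg)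
  have lN: "l powr - N = (1 + norm z) powr N" unfolding l_def by (simp add: powr_divide powr_minus inverse_eq_divide)
  define \<Phi> where "\<Phi> x = inverse (\<Omega> l y x)" for x
  have ne: "\<Omega> l y x \<noteq> 0" for x using \<Omega>_pos[of l y x] by simp
  have \<Phi>c: "cts \<Phi>" unfolding \<Phi>_def using ne by (intro continuous_intros \<Omega>_continuous) auto
  have \<Phi>0: "0 <= \<Phi> x" for x using \<Omega>_pos[of l y x] by (simp add: \<Phi>_def)
  \<comment> \<open>Since \<open>l <= 1\<close>, the weight satisfies the growth condition of
    \<open>h_weighted_square\<close> uniformly in \<open>l\<close>.\<close>
  have \<Phi>le: "\<Phi> x <= (?D x g y) powr N" if g: "g \<in> G" for g x
  proof -
   have "l\<^sup>2 * (norm (x - g y))\<^sup>2 <= 1 * (norm (x - g y))\<^sup>2"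
    using l by (intro mult_right_mono power_le_one) auto
   hence "(?D x g y) powr - N <= (1 + l\<^sup>2 * (norm (x - g y))\<^sup>2) powr - N"
    using N_pos one_plus_pos by (intro powr_mono2') auto
   also have "\<dots> <= \<Omega> l y x" unfolding \<Omega>_def
    using member_le_sum[of g G "\<lambda>g. (1 + l\<^sup>2 * (norm (x - g y))\<^sup>2) powr - N"] g by auto
   finally have "\<Phi> x <= inverse ((?D x g y) powr - N)"
    unfolding \<Phi>_def by (intro le_imp_inverse_le) (auto simp: add_pos_nonneg less_imp_neq[THEN not_sym] add_nonneg_eq_0_iff)
   thus ?thesis by (simp add: powr_minus)
  qed
  have cH: "cts (\<lambda>x. htr y z x)" using C1_D(2)[OF htr_C1[of y z]] by simp
  have e1: "(?C y z \<Phi>) <= ennreal (exp N * c\<^sup>2 * (C1 / vol y))"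
  proof -
   have "(?C y z \<Phi>) <= ennreal (exp (N * l * norm z) * c\<^sup>2) * (?B y \<Phi>)"
    unfolding \<Phi>_def by (rule energy.energy_estimate[OF energy_\<Omega>]) (use l in simp)
   also have "\<dots> <= ennreal (exp N * c\<^sup>2) * ennreal (C1 / vol y)"
   proof (rule mult_mono)
    have "N * (l * norm z) <= N * 1" using l N_pos by (intro mult_left_mono) auto
    thus "ennreal (exp (N * l * norm z) * c\<^sup>2) <= ennreal (exp N * c\<^sup>2)"
     by (intro ennreal_leI mult_right_mono) (auto simp: mult.assoc)
    show "(?B y \<Phi>) <= ennreal (C1 / vol y)"
     by (rule C1(2)[OF borel_measurable_continuous_onI[OF \<Phi>c] \<Phi>0 \<Phi>le])
   qed auto
   also have "\<dots> = ennreal (exp N * c\<^sup>2 * (C1 / vol y))"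
    using C1(1) vol_pos[of y] by (intro ennreal_mult''[symmetric]) auto
   finally show ?thesis .
  qed
  have e2: "(nnint W (\<lambda>x. \<Omega> l y x)) <= ennreal (real (card G) * ((1 + norm z) powr N * (C2 * vol y)))"
   using \<Omega>_integral[OF C2(2,1) l(1,2), of y] by (simp add: lN)
  have "(?E y z)\<^sup>2 = (\<integral>\<^sup>+x. ennreal (norm (htr y z x) * sqrt (\<Phi> x)) * ennreal (sqrt (\<Omega> l y x)) \<partial>W)\<^sup>2"
  proof -
   have "sqrt (\<Phi> x) * sqrt (\<Omega> l y x) = 1" for x
    using ne[of x] by (simp add: real_sqrt_mult[symmetric] \<Phi>_def)
   hence "norm (htr y z x) = norm (htr y z x) * sqrt (\<Phi> x) * sqrt (\<Omega> l y x)" for x by (simp only: mult.assoc mult_1_right)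
   hence "ennreal (norm (htr y z x)) = ennreal (norm (htr y z x) * sqrt (\<Phi> x)) * ennreal (sqrt (\<Omega> l y x))" for x
    using \<Phi>0 by (subst ennreal_mult''[symmetric]) (auto simp: \<Omega>_pos less_imp_le)
   thus ?thesis by (simp only:)
  qed
  also have "\<dots> <= (\<integral>\<^sup>+x. (ennreal (norm (htr y z x) * sqrt (\<Phi> x)))\<^sup>2 \<partial>W) * (\<integral>\<^sup>+x. (ennreal (sqrt (\<Omega> l y x)))\<^sup>2 \<partial>W)"
   by (rule Cauchy_Schwarz_nn_integral)
    (intro measurable_compose[OF _ measurable_ennreal] continuous_measurable_W continuous_intros cH \<Phi>c \<Omega>_continuous)+
  also have "(\<lambda>x. (ennreal (norm (htr y z x) * sqrt (\<Phi> x)))\<^sup>2) = (\<lambda>x. ennreal ((norm (htr y z x))\<^sup>2 * \<Phi> x))"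
   using \<Phi>0 by (simp add: fun_eq_iff ennreal_power power_mult_distrib)
  also have "(\<lambda>x. (ennreal (sqrt (\<Omega> l y x)))\<^sup>2) = (\<lambda>x. ennreal (\<Omega> l y x))"
   using \<Omega>_pos by (simp add: fun_eq_iff ennreal_power less_imp_le)
  also have "(?C y z \<Phi>) * (nnint W (\<lambda>x. \<Omega> l y x)) \<le>
    ennreal (exp N * c\<^sup>2 * (C1 / vol y)) * ennreal (real (card G) * ((1 + norm z) powr N * (C2 * vol y)))"
   by (intro mult_mono e1 e2) auto
  also have "\<dots> = ennreal (?A C1 C2 z)"
   using C1(1) C2(1) vol_pos[of y] by (subst ennreal_mult''[symmetric]) (auto simp: field_simps)
  finally have "(?E y z) <= ennreal (sqrt (?A C1 C2 z))"
   by (rule ennreal_power2_le) (use C1(1) C2(1) in simp)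
  also have "sqrt (?A C1 C2 z) = C * (1 + norm z) powr (N / 2)"
   unfolding real_sqrt_mult C_def by (simp add: powr_half_sqrt[symmetric] powr_powr add_nonneg_nonneg)
  finally show ?thesis .
 qed
 ultimately show ?thesis by (rule that)
qed

end

section \<open>The Bessel kernel\<close>

text \<open>Without integrability the left side is 0 by convention.\<close>

lemma norm_integral_le_nn_integral:
 fixes f :: "'a => 'b::{banach, second_countable_topology}"
 shows "ennreal (norm (LINT x|M. f x)) <= (nnint M (\<lambda>x. norm (f x)))"
 by (cases "integrable M f") (auto intro: integral_norm_bound_ennreal simp: not_integrable_integral_eq)

definition gamma_density :: "real => real => real" where
 "gamma_density s t = indicator {0..} t * t powr (s - 1) / exp t / Gamma s"

lemma gamma_density_nonneg: "s > 0 ==> 0 <= gamma_density s t"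
 by (simp add: gamma_density_def Gamma_real_pos less_imp_le)

lemma gamma_density_measurable [measurable]: "gamma_density s \<in> borelm"
 unfolding gamma_density_def[abs_def] by measurable

text \<open>The substitution of \<open>t / (1 + r)\<close> for \<open>t\<close> in the Gamma
  integral. It subordinates the symbol \<open>(1 + r) powr - s\<close> to the heat
  semigroup.\<close>

lemma gamma_density_laplace:
 assumes s: "s > 0" and r: "r >= 0"
 shows "(nnint lborel (\<lambda>t. gamma_density s t * exp (- t * r))) = ennreal ((1 + r) powr - s)"
proof -
 define a where "a = 1 / (1 + r)"
 have a: "a > 0" "1 + r > 0" using r by (auto simp: a_def)
 have "(nnint lborel (\<lambda>t. gamma_density s t * exp (- t * r))) = ennreal \<bar>a\<bar> * (nnint lborel (\<lambda>t. gamma_density s (0 + a * t) * exp (- (0 + a * t) * r)))"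
  by (rule nn_integral_real_affine) (use a in auto)
 also have "\<dots> = ennreal a * (\<integral>\<^sup>+t. ennreal (a powr (s - 1) / Gamma s) * ennreal (indicator {0..} t * t powr (s - 1) / exp t) \<partial>lborel)"
 proof -
  have "gamma_density s (0 + a * t) * exp (- (0 + a * t) * r) = a powr (s - 1) / Gamma s * (indicator {0..} t * t powr (s - 1) / exp t)" for t
  proof (cases "t >= 0")
   case True
   have "a * (1 + r) * t = t" using a(2) by (simp add: a_def)
   hence "a * t + a * t * r = t" by (simp add: algebra_simps)
   hence "exp (a * t) * exp (a * t * r) = exp t" by (simp add: exp_add[symmetric])
   thus ?thesis using True a by (simp add: gamma_density_def powr_mult exp_minus field_simps)
  next
   case False
   thus ?thesis using a by (simp add: gamma_density_def mult_le_0_iff zero_le_mult_iff)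
  qed
  thus ?thesis using a s by (simp add: ennreal_mult''[symmetric] Gamma_real_pos less_imp_le)
 qed
 also have "\<dots> = ennreal a * (ennreal (a powr (s - 1) / Gamma s) * ennreal (Gamma s))"
  by (subst nn_integral_cmult) (auto simp: Gamma_conv_nn_integral_real[OF s])
 also have "\<dots> = ennreal (a * a powr (s - 1))"
  using a Gamma_real_pos[OF s] by (simp add: ennreal_mult'[symmetric])
 also have "a * a powr (s - 1) = (1 + r) powr - s"
 proof -
  have "a * a powr (s - 1) = a powr s" using a powr_add[of a 1 "s - 1"] by simp
  thus ?thesis using a(2) by (simp add: a_def powr_divide powr_minus inverse_eq_divide)
 qed
 finally show ?thesis .
qed

text \<open>The factor is at most \<open>2 powr M * (1 + t powr - (M / 2))\<close>, and the negative
  power shifts the Gamma parameter from \<open>s\<close> to \<open>s - M / 2\<close>, which must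
  stay positive. The bound for heat translates is singular in this way as \<open>t\<close> tends to
  0.\<close>

lemma gamma_density_moment:
 assumes s: "s > 0" and M: "0 <= M" "M / 2 < s"
 obtains B where "B > 0" "(nnint lborel (\<lambda>t. gamma_density s t * (1 + 1 / sqrt t) powr M)) <= ennreal B"
proof -
 let ?A = "\<lambda>s t s'. ennreal (gamma_density s t) + ennreal (Gamma s' / Gamma s) * ennreal (gamma_density s' t)"
 define s' where "s' = s - M / 2"
 have s': "s' > 0" using M by (simp add: s'_def)
 define B where "B = 2 powr M * (1 + Gamma s' / Gamma s)"
 have B: "B > 0" using Gamma_real_pos[OF s] Gamma_real_pos[OF s'] by (simp add: B_def add_pos_pos)
 have pw: "gamma_density s t * (1 + 1 / sqrt t) powr M <= 2 powr M * (gamma_density s t + Gamma s' / Gamma s * gamma_density s' t)" for t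
 proof (cases "t > 0")
  case True
  have "(1 + 1 / sqrt t) powr M <= (2 * max 1 (1 / sqrt t)) powr M"
   using M(1) True by (intro powr_mono2) (auto intro: add_nonneg_nonneg)
  also have "\<dots> = 2 powr M * (max 1 (1 / sqrt t)) powr M" using True by (simp add: powr_mult)
  also have "\<dots> <= 2 powr M * (1 + t powr - (M / 2))"
  proof (rule mult_left_mono)
   have "(1 / sqrt t) powr M = t powr - (M / 2)"
    using True by (simp add: powr_half_sqrt[symmetric] powr_divide powr_powr powr_minus inverse_eq_divide)
   thus "(max 1 (1 / sqrt t)) powr M <= 1 + t powr - (M / 2)" by (auto simp: max_def)
  qed simp
  finally have "gamma_density s t * (1 + 1 / sqrt t) powr M <= gamma_density s t * (2 powr M * (1 + t powr - (M / 2)))"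
   by (rule mult_left_mono) (rule gamma_density_nonneg[OF s])
  moreover have "gamma_density s t * t powr - (M / 2) = Gamma s' / Gamma s * gamma_density s' t"
  proof -
   have "t powr (s - 1) * t powr - (M / 2) = t powr (s' - 1)" by (simp add: powr_add[symmetric] s'_def algebra_simps)
   hence "t powr (s - 1) / exp t / Gamma s * t powr - (M / 2) = t powr (s' - 1) / exp t / Gamma s" by (simp only: times_divide_eq_left)
   moreover have "gamma_density s t = t powr (s - 1) / exp t / Gamma s" "gamma_density s' t = t powr (s' - 1) / exp t / Gamma s'"
    using True by (simp_all add: gamma_density_def)
   moreover have "Gamma s' / Gamma s * (t powr (s' - 1) / exp t / Gamma s') = t powr (s' - 1) / exp t / Gamma s"
    using Gamma_real_pos[OF s'] by simp
   ultimately show ?thesis by (simp only:)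
  qed
  moreover have "gamma_density s t * (2 powr M * (1 + t powr - (M / 2))) = 2 powr M * (gamma_density s t + gamma_density s t * t powr - (M / 2))"
   by (simp add: algebra_simps)
  ultimately show ?thesis by (simp only:)
 next
  case False
  hence "t = 0 \<or> t < 0" by auto
  thus ?thesis by (auto simp: gamma_density_def)
 qed
 have one: "(nnint lborel (\<lambda>t. gamma_density s t)) = 1" if "s > 0" for s
  using gamma_density_laplace[OF that, of 0] by simp
 have "(nnint lborel (\<lambda>t. gamma_density s t * (1 + 1 / sqrt t) powr M)) \<le>
   (\<integral>\<^sup>+t. ennreal (2 powr M) * (?A s t s') \<partial>lborel)"
 proof (rule nn_integral_mono)
  fix t
  have "ennreal (2 powr M) * (?A s t s') = ennreal (2 powr M * (gamma_density s t + Gamma s' / Gamma s * gamma_density s' t))"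
  proof -
   have "0 <= Gamma s' / Gamma s" using Gamma_real_pos[OF s] Gamma_real_pos[OF s'] by simp
   thus ?thesis using gamma_density_nonneg[OF s, of t] gamma_density_nonneg[OF s', of t]
    by (simp only: ennreal_mult ennreal_plus mult_nonneg_nonneg add_nonneg_nonneg powr_ge_zero)
  qed
  thus "ennreal (gamma_density s t * (1 + 1 / sqrt t) powr M) <= ennreal (2 powr M) * (?A s t s')"
   using ennreal_leI[OF pw[of t]] by simp
 qed
 also have "\<dots> = ennreal (2 powr M) * (1 + ennreal (Gamma s' / Gamma s))"
  by (simp add: nn_integral_cmult nn_integral_add one s s')
 also have "\<dots> = ennreal B"
  using Gamma_real_pos[OF s] Gamma_real_pos[OF s'] unfolding B_def
  by (simp add: ennreal_mult' ennreal_1[symmetric] ennreal_plus[symmetric] del: ennreal_plus ennreal_1)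
 finally show ?thesis using B that by blast
qed

context dunkl begin

lemma e_measurable2 [measurable (raw)]:
 assumes "f \<in> borel_measurable M" "g \<in> borel_measurable M"
 shows "(\<lambda>w. e a (f w) (g w)) \<in> borel_measurable M"
 using assms by (rule borel_measurable_continuous_Pair) (intro e_continuous continuous_intros)

lemma integral_W_scale:
 fixes f :: "real^'n => complex"
 assumes t: "t > 0" and f[measurable]: "f \<in> borelm"
 shows "(LINT x|W. f (t *\<^sub>R x)) = cor (t powr - N) * (LINT x|W. f x)"
proof -
 let ?A = "\<lambda>x. t *\<^sub>R x"
 let ?B = "\<lambda>_. ennreal (t powr - N)"
 have "distr W borel ?A = density W ?B"
 proof (rule measure_eqI)
  fix A assume "A \<in> sets (distr W borel ?A)"
  hence A[measurable]: "A \<in> sets borel" by simp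
  have "emeasure (distr W borel ?A) A = (\<integral>\<^sup>+x. indicator A x \<partial>distr W borel ?A)" by simp
  also have "\<dots> = (\<integral>\<^sup>+x. indicator A (t *\<^sub>R x) \<partial>W)" by (rule nn_integral_distr) (auto intro: measurable_W)
  also have "\<dots> = ennreal (t powr - N) * (\<integral>\<^sup>+x. indicator A x \<partial>W)" by (rule nn_integral_W_scale[OF t]) measurable
  also have "\<dots> = (\<integral>\<^sup>+x. ennreal (t powr - N) * indicator A x \<partial>W)"
   by (rule nn_integral_cmult[symmetric]) (rule measurable_W, measurable)
  also have "\<dots> = emeasure (density W ?B) A"
   by (rule emeasure_density[symmetric]) auto
  finally show "emeasure (distr W borel ?A) A = emeasure (density W ?B) A" .
 qed simp
 moreover have "(LINT x|distr W borel ?A. f x) = (LINT x|W. f (t *\<^sub>R x))"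
  by (rule integral_distr) (auto intro: measurable_W)
 moreover have "(LINT x|density W ?B. f x) = (LINT x|W. t powr - N *\<^sub>R f x)"
  by (rule integral_density) (auto intro: measurable_W)
 ultimately show ?thesis by (simp add: scaleR_complex)
qed

definition gtr :: "real => real^'n => real^'n => real^'n => complex" where
 "gtr t y z x = (LINT q|W. e \<i> x q * (e (-\<i>) y q * (e \<i> z q * cor (exp (- t * (norm q)\<^sup>2)))))"

text \<open>The substitution of \<open>r *\<^sub>R q\<close> for \<open>q\<close> with
  \<open>t * r\<^sup>2 = 1 / 2\<close> brings the Gaussian to unit time.\<close>

lemma gtr_scale:
 assumes t: "t > 0"
 defines "r \<equiv> 1 / sqrt (2 * t)"
 shows "gtr t y z x = cor (r powr N) * htr (r *\<^sub>R y) (r *\<^sub>R z) (r *\<^sub>R x)"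
proof -
 have r: "r > 0" "t * r\<^sup>2 = 1 / 2" using t by (auto simp: r_def power_divide)
 define f where "f q = e \<i> x q * (e (-\<i>) y q * (e \<i> z q * cor (exp (- t * (norm q)\<^sup>2))))" for q
 have fm: "f \<in> borelm" unfolding f_def[abs_def] by measurable
 have "htr (r *\<^sub>R y) (r *\<^sub>R z) (r *\<^sub>R x) = (LINT q|W. f (r *\<^sub>R q))"
 proof -
  have "- t * (norm (r *\<^sub>R q))\<^sup>2 = - (norm q)\<^sup>2 / 2" for q :: "real^'n"
   using r(2) by (simp add: power_mult_distrib mult.assoc[symmetric])
  hence "gauss q = cor (exp (- t * (norm (r *\<^sub>R q))\<^sup>2))" for q unfolding gauss_def by simp
  thus ?thesis unfolding htr_eq f_def by (simp only: e_scale e_scale_right)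
 qed
 also have "\<dots> = cor (r powr - N) * gtr t y z x"
  unfolding integral_W_scale[OF r(1) fm] by (simp only: f_def[abs_def] gtr_def)
 finally have "cor (r powr N) * htr (r *\<^sub>R y) (r *\<^sub>R z) (r *\<^sub>R x) = cor (r powr N * r powr - N) * gtr t y z x"
  by simp
 thus ?thesis using r(1) by (simp add: powr_add[symmetric])
qed

text \<open>The factor \<open>r powr N\<close> is cancelled by the change of variables, so scaling
  changes only the size of the translation parameter;
  \<open>1 + norm z / sqrt t <= (1 + norm z) * (1 + 1 / sqrt t)\<close> separates the two
  dependences.\<close>

lemma gtr_mass:
 assumes C: "!!y z. (nnint W (\<lambda>x. norm (htr y z x))) <= ennreal (C * (1 + norm z) powr (N / 2))" "C > 0"
  and t: "t > 0"
 shows "(nnint W (\<lambda>x. norm (gtr t y z x))) <= ennreal (C * (1 + norm z) powr (N / 2) * (1 + 1 / sqrt t) powr (N / 2))"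
proof -
 let ?A = "\<lambda>r. r *\<^sub>R z"
 let ?B = "1 + 1 / sqrt t"
 let ?C = "\<lambda>r. nnint W (\<lambda>x. norm (htr (r *\<^sub>R y) (?A r) x))"
 define r where "r = 1 / sqrt (2 * t)"
 have r: "r > 0" "r <= 1 / sqrt t" using t by (auto simp: r_def real_sqrt_mult field_simps)
 have m: "(\<lambda>x. ennreal (norm (htr (r *\<^sub>R y) (?A r) x))) \<in> borelm"
  using borel_measurable_continuous_onI[OF C1_D(2)[OF htr_C1]] by measurable
 have "(nnint W (\<lambda>x. norm (gtr t y z x))) = (\<integral>\<^sup>+x. ennreal (r powr N) * ennreal (norm (htr (r *\<^sub>R y) (?A r) (r *\<^sub>R x))) \<partial>W)"
  unfolding gtr_scale[OF t] r_def[symmetric] by (simp add: norm_mult ennreal_mult')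
 also have "\<dots> = ennreal (r powr N) * (nnint W (\<lambda>x. norm (htr (r *\<^sub>R y) (?A r) (r *\<^sub>R x))))"
  by (intro nn_integral_cmult measurable_W measurable_compose[OF _ m]) auto
 also have "\<dots> = ennreal (r powr N) * (ennreal (r powr - N) * (?C r))"
  unfolding nn_integral_W_scale[OF r(1) m] ..
 also have "\<dots> = (?C r)"
  using r(1) by (simp add: mult.assoc[symmetric] ennreal_mult'[symmetric] powr_add[symmetric])
 also have "\<dots> <= ennreal (C * (1 + norm (?A r)) powr (N / 2))" by (rule C)
 also have "\<dots> <= ennreal (C * (1 + norm z) powr (N / 2) * ?B powr (N / 2))"
 proof (rule ennreal_leI)
  have "1 + norm (?A r) <= 1 + (1 / sqrt t) * norm z" using r mult_right_mono[OF r(2), of "norm z"] by simp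
  also have "\<dots> <= (1 + norm z) * ?B"
  proof -
   have "0 <= norm z" "0 <= 1 / sqrt t" using t by auto
   thus ?thesis by (simp only: distrib_left distrib_right mult_1_left mult_1_right mult.commute)
  qed
  finally have "(1 + norm (?A r)) powr (N / 2) <= ((1 + norm z) * ?B) powr (N / 2)"
   using N_pos by (intro powr_mono2) auto
  also have "\<dots> = (1 + norm z) powr (N / 2) * ?B powr (N / 2)"
   by (rule powr_mult)
  finally show "C * (1 + norm (?A r)) powr (N / 2) <= C * (1 + norm z) powr (N / 2) * ?B powr (N / 2)"
   using C(2) by (simp add: mult.assoc)
 qed
 finally show ?thesis .
qed

definition bes :: "real => real^'n => real^'n => real^'n => complex" where
 "bes s y z x = (LINT q|W. e \<i> x q * (e (-\<i>) y q * (e \<i> z q * cor ((1 + (norm q)\<^sup>2) powr - s))))"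

lemma gtr_measurable: "(\<lambda>p. gtr (fst p) y z (snd p)) \<in> borel_measurable (lborel \<Otimes>\<^sub>M W)"
proof -
 interpret sigma_finite_measure W by (rule sigma_finite_W)
 show ?thesis unfolding gtr_def by measurable
qed

text \<open>Fubini in the subordination formula. The kernels at imaginary scalars have modulus at
  most 1, so \<open>s >= N\<close> makes the double integral absolutely convergent.\<close>

lemma bes_subordination:
 assumes s: "s >= N"
 shows "bes s y z x = (LINT t|lborel. cor (gamma_density s t) * gtr t y z x)"
proof -
 let ?A = "lborel \<Otimes>\<^sub>M W"
 let ?B = "\<lambda>t a. - t * (norm a)\<^sup>2"
 let ?C = "\<lambda>t a f. \<integral>\<^sup>+p. ennreal (norm (case p of (t, a) => f t a)) \<partial>?A"
 let ?D = "\<lambda>a. 1 + (norm a)\<^sup>2"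
 interpret W: sigma_finite_measure W by (rule sigma_finite_W)
 interpret P: pair_sigma_finite lborel W ..
 have s0: "s > 0" using N_pos s by simp
 note gd0 = gamma_density_nonneg[OF s0]
 define q where "q a = e \<i> x a * (e (-\<i>) y a * e \<i> z a)" for a
 have qm[measurable]: "q \<in> borelm" unfolding q_def[abs_def] by measurable
 have q1: "norm (q a) <= 1" for a using htr_integrand_le[of x a y z 1] by (simp add: q_def)
 define f where "f t a = q a * cor (gamma_density s t * exp (?B t a))" for t a
 have fm: "(\<lambda>(t, a). f t a) \<in> borel_measurable ?A" unfolding f_def by measurable
 have L: "(nnint lborel (\<lambda>t. gamma_density s t * exp (?B t a))) = ennreal ((?D a) powr - s)" for a :: "real^'n"
  by (rule gamma_density_laplace[OF s0]) simp
 have int: "integrable ?A (\<lambda>(t, a). f t a)"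
 proof (rule integrableI_bounded[OF fm])
  have "(?C t a f) = (\<integral>\<^sup>+a. nnint lborel (\<lambda>t. norm (f t a)) \<partial>W)"
   using P.nn_integral_snd[of "\<lambda>p. ennreal (norm (case p of (t, a) => f t a))"] fm by simp
  also have "\<dots> <= (nnint W (\<lambda>a. (?D a) powr - s))"
  proof (rule nn_integral_mono)
   fix a :: "real^'n"
   have "norm (f t a) <= gamma_density s t * exp (?B t a)" for t
    using mult_right_mono[OF q1[of a], of "gamma_density s t * exp (?B t a)"] gd0[of t]
    by (simp add: f_def norm_mult)
   thus "(nnint lborel (\<lambda>t. norm (f t a))) <= ennreal ((?D a) powr - s)"
    unfolding L[symmetric] by (intro nn_integral_mono ennreal_leI)
  qed
  also have "\<dots> < \<infinity>" using integrable_decay[OF s] by (simp add: integrable_iff_bounded)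
  finally show "(?C t a f) < \<infinity>" .
 qed
 have "(LINT a|W. (LINT t|lborel. f t a)) = (LINT t|lborel. (LINT a|W. f t a))"
  by (rule P.Fubini_integral[OF int])
 moreover have "(LINT t|lborel. f t a) = e \<i> x a * (e (-\<i>) y a * (e \<i> z a * cor ((?D a) powr - s)))" for a
 proof -
  have "(LINT t|lborel. gamma_density s t * exp (?B t a)) = (?D a) powr - s"
   using gd0 by (subst integral_eq_nn_integral) (auto simp: L[simplified])
  thus ?thesis unfolding f_def by (simp only: Bochner_Integration.integral_mult_right_zero integral_complex_of_real q_def mult.assoc)
 qed
 moreover have "(LINT a|W. f t a) = cor (gamma_density s t) * gtr t y z x" for t
 proof -
  have "(\<lambda>a. f t a) = (\<lambda>a. cor (gamma_density s t) * (e \<i> x a * (e (-\<i>) y a * (e \<i> z a * cor (exp (?B t a))))))"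
   unfolding f_def q_def of_real_mult by (simp add: fun_eq_iff mult_ac)
  thus ?thesis unfolding gtr_def by (simp only: Bochner_Integration.integral_mult_right_zero)
 qed
 ultimately show ?thesis unfolding bes_def by simp
qed

text \<open>The bounds for the heat translates are integrated against the Gamma density;
  \<open>N / 4 < s\<close> controls the singular factor at \<open>t = 0\<close>.\<close>

theorem bes_mass:
 assumes s: "s >= N"
 obtains C where "C > 0" "!!y z. (nnint W (\<lambda>x. norm (bes s y z x))) <= ennreal (C * (1 + norm z) powr (N / 2))"
proof -
 let ?A = "nnint lborel (\<lambda>t. gamma_density s t * (1 + 1 / sqrt t) powr (N / 2))"
 let ?B = "\<lambda>t. gamma_density s t * (1 + 1 / sqrt t) powr (N / 2)"
 let ?C = "\<lambda>t y z. \<lambda>x. norm (cor (gamma_density s t) * gtr t y z x)"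
 interpret W: sigma_finite_measure W by (rule sigma_finite_W)
 interpret P: pair_sigma_finite lborel W ..
 have s0: "s > 0" using N_pos s by simp
 note gd0 = gamma_density_nonneg[OF s0]
 obtain C where C: "C > 0" "!!y z. (nnint W (\<lambda>x. norm (htr y z x))) <= ennreal (C * (1 + norm z) powr (N / 2))"
  using htr_mass by metis
 obtain B where B: "B > 0" "?A <= ennreal B"
  using gamma_density_moment[OF s0, of "N / 2"] N_pos s by auto
 have "C * B > 0" using C B by simp
 moreover have "(nnint W (\<lambda>x. norm (bes s y z x))) <= ennreal (C * B * (1 + norm z) powr (N / 2))" for y z
 proof -
  define D where "D = C * (1 + norm z) powr (N / 2)"
  have D0: "D >= 0" using C by (simp add: D_def)
  have gm[measurable]: "(\<lambda>p. ennreal (norm (cor (gamma_density s (fst p)) * gtr (fst p) y z (snd p)))) \<in> borel_measurable (lborel \<Otimes>\<^sub>M W)"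
   using gtr_measurable[of y z] by measurable
  have "(nnint W (\<lambda>x. norm (bes s y z x))) <= (\<integral>\<^sup>+x. nnint lborel (\<lambda>t. norm (cor (gamma_density s t) * gtr t y z x)) \<partial>W)"
   unfolding bes_subordination[OF s] by (intro nn_integral_mono norm_integral_le_nn_integral)
  also have "\<dots> = (\<integral>\<^sup>+t. nnint W (?C t y z) \<partial>lborel)"
   using P.Fubini[OF gm] by simp
  also have "\<dots> <= (\<integral>\<^sup>+t. ennreal D * ennreal (?B t) \<partial>lborel)"
  proof (rule nn_integral_mono)
   fix t :: real
   have mt: "(\<lambda>x. ennreal (norm (gtr t y z x))) \<in> borel_measurable W"
    using measurable_compose[OF measurable_Pair1'[of t lborel W] gtr_measurable[of y z]] by simp
   have "(nnint W (?C t y z)) = ennreal (gamma_density s t) * (nnint W (\<lambda>x. norm (gtr t y z x)))"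
    using gd0[of t] by (simp add: norm_mult ennreal_mult' nn_integral_cmult[OF mt])
   also have "\<dots> <= ennreal (gamma_density s t) * ennreal (D * (1 + 1 / sqrt t) powr (N / 2))"
   proof (cases "t > 0")
    case True
    thus ?thesis using gtr_mass[OF C(2,1) True] by (intro mult_left_mono) (auto simp: D_def)
   next
    case False
    hence "t = 0 \<or> t < 0" by auto
    hence "gamma_density s t = 0" by (auto simp: gamma_density_def)
    thus ?thesis by simp
   qed
   also have "\<dots> = ennreal D * ennreal (?B t)"
    using D0 gd0[of t] by (simp add: ennreal_mult'[symmetric] mult_ac)
   finally show "(nnint W (?C t y z)) <= ennreal D * ennreal (?B t)" .
  qed
  also have "\<dots> = ennreal D * ?A"
   by (rule nn_integral_cmult) measurable
  also have "\<dots> <= ennreal D * ennreal B" by (rule mult_left_mono[OF B(2)]) simp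
  also have "\<dots> = ennreal (C * B * (1 + norm z) powr (N / 2))"
   using D0 B(1) by (simp add: ennreal_mult''[symmetric] D_def mult_ac)
  finally show ?thesis .
 qed
 ultimately show ?thesis by (rule that)
qed

section \<open>The transform of the Dunkl Laplacian\<close>

definition idl :: "(real^'n => complex) => real^'n => complex" where
 "idl f x = f x - (\<Sum>j\<in>UNIV. T (axis j 1) (T (axis j 1) f) x)"

lemma id_minus_laplacian_pow_eq: "id_minus_laplacian_pow R k s = idl ^^ s"
proof -
 have "(\<lambda>f x. f x - dunkl_laplacian R k f x) = idl" by (simp add: fun_eq_iff idl_def dunkl_laplacian_def)
 thus ?thesis by (simp add: id_minus_laplacian_pow_def)
qed

lemma smooth_idl:
 assumes fs: "function_space P" and f: "function_space.smooth P (Suc (Suc m)) f"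
 shows "function_space.smooth P m (idl f)"
proof -
 interpret function_space P by (rule fs)
 have "idl f = (\<lambda>x. f x + (-1) * (\<Sum>j\<in>UNIV. T (axis j 1) (T (axis j 1) f) x))" by (simp add: idl_def fun_eq_iff)
 moreover have "smooth m f" using smooth_le[OF f] by simp
 moreover have "smooth m (\<lambda>x. \<Sum>j\<in>UNIV. T (axis j 1) (T (axis j 1) f) x)"
  by (intro smooth_sum dunkl_op_smooth_in(2)[OF fs] f) simp
 ultimately show ?thesis by (simp only:) (intro smooth_add smooth_cmult)
qed

lemma smooth_idl_pow:
 assumes fs: "function_space P" shows "function_space.smooth P (2 * s + m) f ==> function_space.smooth P m ((idl ^^ s) f)"
proof (induction s arbitrary: m)
 case (Suc s)
 have "function_space.smooth P (Suc (Suc m)) ((idl ^^ s) f)" by (rule Suc.IH) (use Suc.prems in simp)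
 thus ?case using smooth_idl[OF fs] by simp
qed simp

text \<open>Sequences of test functions that oscillate with fixed frequencies under amplitudes that
 spread out linearly: Dunkl operators act on them, to leading order, by multiplication.\<close>

definition wave :: "(real^'n => complex) => real^'n => nat => real^'n => complex" where
 "wave g w n x = g ((1 / real (Suc n)) *\<^sub>R x) * e (-\<i>) w x"

text \<open>\<open>m\<close> counts the derivatives still available to the amplitudes. Several
  frequencies may occur in one sum because reflection terms change the frequency, and the
  coefficients depend on \<open>n\<close> so that factors \<open>1 / (n + 1)\<close> stay in the
  class.\<close>

inductive asym :: "nat => (nat => real^'n => complex) => bool" for m where
 wave: "bounded (range q) ==> cont_space.smooth m g ==> (!!x. norm x > 1 ==> g x = 0) ==> asym m (\<lambda>n x. q n * wave g w n x)"
| add: "asym m u ==> asym m v ==> asym m (\<lambda>n x. u n x + v n x)"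

lemma asym_cmult:
 assumes "asym m u" "bounded (range q)" shows "asym m (\<lambda>n x. q n * u n x)"
 using assms(1)
proof (induction rule: asym.induct)
 case (wave q' g w)
 obtain A B where AB: "!!n. norm (q n) <= A" "!!n. norm (q' n) <= B"
  using assms(2) wave(1) unfolding bounded_iff by blast
 have "bounded (range (\<lambda>n. q n * q' n))"
  unfolding bounded_iff using AB by (auto simp: norm_mult intro!: exI[of _ "A * B"] mult_mono')
 from asym.wave[OF this wave(2,3)] show ?case by (simp add: mult.assoc)
next
 case (add u v)
 thus ?case using asym.add by (simp add: distrib_left)
qed

lemma asym_wave: "cont_space.smooth m g ==> (!!x. norm x > 1 ==> g x = 0) ==> asym m (wave g w)"
 using asym.wave[of "\<lambda>_. 1" m g w] by simp

lemma asym_zero: "asym m (\<lambda>n x. 0)"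
 using asym.wave[of "\<lambda>_. 0" m "\<lambda>_. 0" 0] by (simp add: cont_space.smooth_const)

lemma asym_sum: "finite I ==> (!!i. i \<in> I ==> asym m (u i)) ==> asym m (\<lambda>n x. \<Sum>i\<in>I. u i n x)"
 by (induction rule: finite_induct) (auto simp: asym_zero intro: asym.add)

lemma asym_mono: "asym (Suc m) u ==> asym m u"
 by (induction rule: asym.induct) (auto intro: asym.intros cont_space.smooth_mono simp del: cont_space.smooth.simps)

lemma asym_support: "asym m u ==> norm x > real (Suc n) ==> u n x = 0"
proof (induction rule: asym.induct)
 case (wave q g w)
 have "norm ((1 / real (Suc n)) *\<^sub>R x) > 1" using wave.prems by (simp add: field_simps)
 thus ?case using wave(3) by (simp add: wave_def)
qed simp

lemma wave_continuous: "cts g ==> cts (wave g w n)"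
 unfolding wave_def[abs_def]
 by (intro continuous_intros e_continuous1) (rule cont_space.lin[OF _ linear_scaling])

lemma asym_continuous: "asym m u ==> cts (u n)"
proof (induction rule: asym.induct)
 case (wave q g w)
 show ?case by (intro continuous_intros wave_continuous cont_space.smooth_P[OF wave(2)])
qed (intro continuous_intros)

lemma asym_bounded: "asym m u ==> \<exists>B. \<forall>n x. norm (u n x) <= B"
proof (induction rule: asym.induct)
 case (wave q g w)
 obtain B where B: "B >= 0" "!!x. norm (g x) <= B"
  by (rule compact_support_bounded[OF cont_space.smooth_P[OF wave(2)] wave(3)]) (assumption | rule that)+
 obtain Q where Q: "!!n. norm (q n) <= Q" using wave(1) by (auto simp: bounded_iff)
 have "norm (q n * wave g w n x) <= Q * (B * 1)" for n x
  unfolding wave_def norm_mult using Q B norm_e_i order_trans[OF norm_ge_zero Q] by (intro mult_mono) auto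
 thus ?case by blast
next
 case (add u v)
 then obtain A B where "!!n x. norm (u n x) <= A" "!!n x. norm (v n x) <= B" by blast
 hence "norm (u n x + v n x) <= A + B" for n x by (intro order_trans[OF norm_triangle_ineq] add_mono)
 thus ?case by blast
qed

lemma wave_C1:
 assumes "cont_space.smooth (Suc m) g" shows "C_class 1 (wave g w n)"
proof -
 have "C_class 1 (\<lambda>x. g ((1 / real (Suc n)) *\<^sub>R x))"
  unfolding C_class_smooth by (rule cont_space.smooth_lin[OF linear_scaling cont_space.smooth_le[OF assms]]) simp
 thus ?thesis unfolding wave_def[abs_def] by (intro C_class_mult e_C1)
qed

lemma C_class_add: "C_class m f ==> C_class m g ==> C_class m (\<lambda>x. f x + g x)"
 unfolding C_class_smooth by (rule cont_space.smooth_add)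

lemma C_class_cmult: "C_class m f ==> C_class m (\<lambda>x. q * f x)" for q :: complex
 unfolding C_class_smooth by (rule cont_space.smooth_cmult)

lemma asym_C1: "asym (Suc m) u ==> C_class 1 (u n)"
 by (induction rule: asym.induct) (intro C_class_cmult C_class_add wave_C1; assumption)+

text \<open>The amplitude is a dilation, so its derivatives and reflection quotients carry the
  factor \<open>1 / (n + 1)\<close>. In the product rule the kernel is evaluated at the reflected
  point, which equivariance rewrites as a wave of reflected frequency.\<close>

lemma wave_dunkl:
 assumes g: "cont_space.smooth (Suc m) g" and supp: "!!x. norm x > 1 ==> g x = 0"
 obtains r where "asym m r"
  "!!n x. T w (wave g z n) x = - \<i> * cor (w \<bullet> z) * wave g z n x + cor (1 / real (Suc n)) * r n x"
proof -
 let ?A = "\<lambda>b. k b / 2 * (b \<bullet> w)"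
 let ?B = "\<lambda>us x. \<Sum>b\<in>R. cor (?A b) * rquot b us x * e (-\<i>) z (\<sigma> b x)"
 let ?C = "\<lambda>g n x. \<Sum>b\<in>R. cor (?A b) * wave (rquot b g) (\<sigma> b z) n x"
 define r where "r n x = wave (\<lambda>x. fderiv g x w) z n x + (?C g n x)" for n x
 have d: "g differentiable (at x)" for x using g by simp
 have "asym m r" unfolding r_def[abs_def]
 proof (intro asym.add asym_sum asym_cmult asym_wave)
  show "cont_space.smooth m (\<lambda>x. fderiv g x w)" by (rule cont_space.smooth_frechet[OF g])
  show "fderiv g x w = 0" if "norm x > 1" for x
   using frechet_derivative_outside_support[of 1 g] supp that by blast
  show "cont_space.smooth m (rquot b g)" if "b \<in> R" for b
   by (rule dunkl_op_smooth_in(1)[OF cont_space.function_space_axioms g that])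
  show "rquot b g x = 0" if "b \<in> R" "norm x > 1" for b x
   using supported_dunkl(1)[of 1 g] supp that by blast
 qed auto
 moreover have "T w (wave g z n) x = - \<i> * cor (w \<bullet> z) * wave g z n x + cor (1 / real (Suc n)) * r n x" for n x
 proof -
  define s where "s = 1 / real (Suc n)"
  have s0: "s \<noteq> 0" by (simp add: s_def)
  define us where "us x = g (s *\<^sub>R x)" for x
  have ds: "(us has_derivative (\<lambda>v. fderiv g (s *\<^sub>R x) (s *\<^sub>R v))) (at x)" for x
   unfolding us_def[abs_def]
   by (rule has_derivative_compose[OF linear_imp_has_derivative[OF linear_scaling]]) (use d in \<open>simp add: frechet_derivative_works\<close>)
  have fd: "fderiv us x v = cor s * fderiv g (s *\<^sub>R x) v" for x v
   unfolding fderiv_eq[OF ds] by (simp add: linear_scale[OF linear_frechet_derivative[OF d]] scaleR_complex)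
  have dd: "us differentiable (at x)" unfolding differentiable_def by (rule exI, rule ds)
  have rq: "rquot b us x = cor s * rquot b g (s *\<^sub>R x)" if a: "b \<in> R" for b
   using a s0 by (simp add: reflection_quotient_root fd us_def linear_scale[OF reflection_linear])
  have "T w (\<lambda>x. us x * e (-\<i>) z x) x = us x * T w (e (-\<i>) z) x + fderiv us x w * e (-\<i>) z x +
    (?B us x)"
   by (rule dunkl_op_mult[OF dd e_differentiable])
  also have "(?B us x) =
    cor s * (?C g n x)"
   unfolding sum_distrib_left
  proof (rule sum.cong[OF refl])
   fix b assume a: "b \<in> R"
   have "e (-\<i>) z (\<sigma> b x) = e (-\<i>) (\<sigma> b z) x"
    using e_equivariant[OF group_reflection[OF a], of "-\<i>" "\<sigma> b z" x] by (simp add: reflection_reflection[OF a])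
   thus "cor (?A b) * rquot b us x * e (-\<i>) z (\<sigma> b x) =
    cor s * (cor (?A b) * wave (rquot b g) (\<sigma> b z) n x)"
    unfolding rq[OF a] wave_def s_def[symmetric] by (simp only: mult_ac)
  qed
  finally show ?thesis
   unfolding dunkl_op_e fd r_def wave_def[abs_def] s_def[symmetric] us_def[symmetric]
   by (simp add: algebra_simps)
 qed
 ultimately show ?thesis by (rule that)
qed

lemma inverse_Suc_bounded: "bounded (range (\<lambda>n. cor (1 / real (Suc n))))"
proof -
 have "norm (cor (1 / real (Suc n))) <= 1" for n unfolding norm_of_real by simp
 thus ?thesis unfolding bounded_iff by blast
qed

lemma asym_dunkl: "asym (Suc m) u ==> asym m (\<lambda>n. T w (u n))"
proof (induction rule: asym.induct)
 case (wave q g z)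
 obtain r where r: "asym m r"
  "!!n x. T w (wave g z n) x = - \<i> * cor (w \<bullet> z) * wave g z n x + cor (1 / real (Suc n)) * r n x"
  by (rule wave_dunkl[OF wave(2,3)]) (assumption | rule that)+
 have "(\<lambda>n. T w (\<lambda>x. q n * wave g z n x)) = (\<lambda>n x. q n * (- \<i> * cor (w \<bullet> z) * wave g z n x + cor (1 / real (Suc n)) * r n x))"
  using dunkl_op_cmult[OF C1_D(1)[OF wave_C1[OF wave(2)]]] by (simp add: fun_eq_iff r(2))
 moreover have "asym m (\<lambda>n x. q n * (- \<i> * cor (w \<bullet> z) * wave g z n x + cor (1 / real (Suc n)) * r n x))"
  by (intro asym_cmult asym.add r(1) asym_wave wave cont_space.smooth_mono[OF wave(2)] inverse_Suc_bounded) auto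
 ultimately show ?case by simp
next
 case (add u v)
 have "(\<lambda>n. T w (\<lambda>x. u n x + v n x)) = (\<lambda>n x. T w (u n) x + T w (v n) x)"
  using dunkl_op_add[OF C1_D(1)[OF asym_C1[OF add(1)]] C1_D(1)[OF asym_C1[OF add(2)]]] by (simp add: fun_eq_iff)
 thus ?case using asym.add[OF add.IH] by simp
qed

lemma asym_idl: "asym (Suc (Suc m)) u ==> asym m (\<lambda>n. idl (u n))"
proof -
 let ?A = "\<lambda>n x. u n x + (-1) * (\<Sum>j\<in>UNIV. T (axis j 1) (T (axis j 1) (u n)) x)"
 assume u: "asym (Suc (Suc m)) u"
 have "(\<lambda>n. idl (u n)) = ?A" by (simp add: idl_def fun_eq_iff)
 moreover have "asym m ?A"
  by (intro asym.add asym_cmult asym_sum asym_mono[OF asym_mono[OF u]] asym_dunkl u) auto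
 ultimately show ?thesis by simp
qed

lemma asym_integrable:
 assumes F: "cts F" and u: "asym m u" shows "integrable W (\<lambda>x. F x * u n x)"
 by (rule integrable_W_compact_support[where r="real (Suc n)"])
  (use asym_support[OF u] in \<open>auto intro!: continuous_intros F asym_continuous[OF u]\<close>)

lemma asym_by_parts:
 assumes F: "cont_space.smooth (Suc j) F" and u: "asym (Suc m) u"
 shows "(LINT x|W. T v F x * u n x) = - (LINT x|W. F x * T v (u n) x)"
proof (rule by_parts_compact[OF _ asym_C1[OF u]])
 show "C_class 1 F" unfolding C_class_smooth by (rule cont_space.smooth_le[OF F]) simp
 show "u n x = 0" if "norm x > real (Suc n)" for x by (rule asym_support[OF u that])
qed

lemma idl_by_parts:
 assumes F: "cont_space.smooth (Suc (Suc 0)) F" and u: "asym (Suc (Suc m)) u"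
 shows "(LINT x|W. idl F x * u n x) = (LINT x|W. F x * idl (u n) x)"
proof -
 have Fc: "cts F" by (rule cont_space.smooth_P[OF F])
 have TF: "cont_space.smooth (Suc 0) (T v F)" for v by (rule dunkl_op_smooth_in(2)[OF cont_space.function_space_axioms F])
 have TTF: "cts (T v (T v F))" for v
  by (rule cont_space.smooth_P[OF dunkl_op_smooth_in(2)[OF cont_space.function_space_axioms TF]])
 have each: "(LINT x|W. T v (T v F) x * u n x) = (LINT x|W. F x * T v (T v (u n)) x)" for v
 proof -
  have "(LINT x|W. T v (T v F) x * u n x) = - (LINT x|W. T v F x * T v (u n) x)" by (rule asym_by_parts[OF TF u])
  also have "(LINT x|W. T v F x * T v (u n) x) = - (LINT x|W. F x * T v (T v (u n)) x)"
   by (rule asym_by_parts[OF F asym_dunkl[OF u]])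
  finally show ?thesis by simp
 qed
 have "(LINT x|W. idl F x * u n x) = (LINT x|W. F x * u n x - (\<Sum>j\<in>UNIV. T (axis j 1) (T (axis j 1) F) x * u n x))"
  by (simp add: idl_def left_diff_distrib sum_distrib_right)
 also have "\<dots> = (LINT x|W. F x * u n x) - (\<Sum>j\<in>UNIV. LINT x|W. T (axis j 1) (T (axis j 1) F) x * u n x)"
  using asym_integrable[OF Fc u] asym_integrable[OF TTF u] by simp
 also have "\<dots> = (LINT x|W. F x * u n x) - (\<Sum>j\<in>UNIV. LINT x|W. F x * T (axis j 1) (T (axis j 1) (u n)) x)"
  by (simp only: each)
 also have "\<dots> = (LINT x|W. F x * u n x - (\<Sum>j\<in>UNIV. F x * T (axis j 1) (T (axis j 1) (u n)) x))"
  using asym_integrable[OF Fc u] asym_integrable[OF Fc asym_dunkl[OF asym_dunkl[OF u]]] by simp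
 also have "\<dots> = (LINT x|W. F x * idl (u n) x)"
  by (simp add: idl_def right_diff_distrib sum_distrib_left)
 finally show ?thesis .
qed

lemma idl_pow_by_parts:
 "cont_space.smooth (2 * s) F ==> asym (2 * s) u ==> (LINT x|W. (idl ^^ s) F x * u n x) = (LINT x|W. F x * (idl ^^ s) (u n) x)"
proof (induction s arbitrary: u)
 case (Suc s)
 have H: "cont_space.smooth (Suc (Suc 0)) ((idl ^^ s) F)"
  by (rule smooth_idl_pow[OF cont_space.function_space_axioms]) (use Suc.prems in simp)
 have u: "asym (Suc (Suc (2 * s))) u" using Suc.prems by simp
 have F: "cont_space.smooth (2 * s) F" by (rule cont_space.smooth_le[OF Suc.prems(1)]) simp
 have "(LINT x|W. (idl ^^ Suc s) F x * u n x) = (LINT x|W. (idl ^^ s) F x * idl (u n) x)"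
  using idl_by_parts[OF H u] by simp
 also have "\<dots> = (LINT x|W. F x * (idl ^^ s) (idl (u n)) x)" by (rule Suc.IH[OF F asym_idl[OF u]])
 also have "(idl ^^ s) (idl (u n)) = (idl ^^ Suc s) (u n)" by (simp add: funpow_swap1)
 finally show ?case .
qed simp

text \<open>The error of order \<open>1 / n\<close> is required to lie in the class again, so that
  further operators can be applied to it.\<close>

definition near :: "(real^'n => complex) => real^'n => nat => complex => (nat => real^'n => complex) => bool" where
 "near g v m a w \<longleftrightarrow> (\<exists>r. asym m r \<and> (\<forall>n x. w n x = a * wave g v n x + cor (1 / real (Suc n)) * r n x))"

lemma nearI: "asym m r ==> (!!n x. w n x = a * wave g v n x + cor (1 / real (Suc n)) * r n x) ==> near g v m a w"
 unfolding near_def by blast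

lemma near_add:
 assumes "near g z m a v" "near g z m b w" shows "near g z m (a + b) (\<lambda>n x. v n x + w n x)"
proof -
 obtain r r' where "asym m r" "!!n x. v n x = a * wave g z n x + cor (1 / real (Suc n)) * r n x"
  "asym m r'" "!!n x. w n x = b * wave g z n x + cor (1 / real (Suc n)) * r' n x"
  using assms unfolding near_def by blast
 thus ?thesis by (intro nearI[of m "\<lambda>n x. r n x + r' n x"] asym.add) (auto simp: algebra_simps)
qed

lemma near_cmult: assumes "near g v m a w" shows "near g v m (q * a) (\<lambda>n x. q * w n x)"
proof -
 obtain r where "asym m r" "!!n x. w n x = a * wave g v n x + cor (1 / real (Suc n)) * r n x"
  using assms unfolding near_def by blast
 thus ?thesis by (intro nearI[of m "\<lambda>n x. q * r n x"] asym_cmult) (auto simp: algebra_simps)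
qed

lemma near_sum: "finite I ==> (!!i. i \<in> I ==> near g v m (a i) (w i)) ==> near g v m (\<Sum>i\<in>I. a i) (\<lambda>n x. \<Sum>i\<in>I. w i n x)"
proof (induction rule: finite_induct)
 case empty
 show ?case by (rule nearI[OF asym_zero]) simp
qed (auto intro: near_add)

lemma near_mono: "near g v (Suc m) a w ==> near g v m a w"
 unfolding near_def using asym_mono by blast

context
 fixes \<psi> :: "real^'n => complex" and \<zeta> :: "real^'n" and M :: nat
 assumes \<psi>: "cont_space.smooth M \<psi>" and supp: "!!x. norm x > 1 ==> \<psi> x = 0"
begin

lemma near_dunkl:
 assumes w: "near \<psi> \<zeta> (Suc m) a w" and m: "Suc m <= M"
 shows "near \<psi> \<zeta> m (- \<i> * cor (v \<bullet> \<zeta>) * a) (\<lambda>n. T v (w n))"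
proof -
 obtain r where r: "asym (Suc m) r" "!!n x. w n x = a * wave \<psi> \<zeta> n x + cor (1 / real (Suc n)) * r n x"
  using w unfolding near_def by blast
 have \<psi>m: "cont_space.smooth (Suc m) \<psi>" by (rule cont_space.smooth_le[OF \<psi> m])
 obtain r' where r': "asym m r'"
  "!!n x. T v (wave \<psi> \<zeta> n) x = - \<i> * cor (v \<bullet> \<zeta>) * wave \<psi> \<zeta> n x + cor (1 / real (Suc n)) * r' n x"
  by (rule wave_dunkl[OF \<psi>m supp]) (assumption | rule that)+
 have d1: "wave \<psi> \<zeta> n differentiable (at x)" and d2: "r n differentiable (at x)" for n x
  by (rule C1_D(1)[OF wave_C1[OF \<psi>m]], rule C1_D(1)[OF asym_C1[OF r(1)]])
 have wn: "w n = (\<lambda>x. a * wave \<psi> \<zeta> n x + cor (1 / real (Suc n)) * r n x)" for n using r(2) by blast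
 have "T v (w n) x = a * T v (wave \<psi> \<zeta> n) x + cor (1 / real (Suc n)) * T v (r n) x" for n x
  unfolding wn using d1 d2
  by (subst dunkl_op_add) (auto simp: dunkl_op_cmult intro!: differentiable_mult simp del: of_real_divide)
 hence "T v (w n) x = - \<i> * cor (v \<bullet> \<zeta>) * a * wave \<psi> \<zeta> n x + cor (1 / real (Suc n)) * (a * r' n x + T v (r n) x)" for n x
  unfolding r'(2) by (simp add: algebra_simps)
 moreover have "asym m (\<lambda>n x. a * r' n x + T v (r n) x)"
  by (intro asym.add asym_cmult r' asym_dunkl r) auto
 ultimately show ?thesis by (intro nearI)
qed

text \<open>Each squared Dunkl operator contributes the square of
  \<open>- \<i> * cor (\<zeta> $ j)\<close>, hence the symbol
  \<open>1 + (norm \<zeta>)\<^sup>2\<close>.\<close>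

lemma near_idl:
 assumes w: "near \<psi> \<zeta> (Suc (Suc m)) a w" and m: "Suc (Suc m) <= M"
 shows "near \<psi> \<zeta> m (cor (1 + (norm \<zeta>)\<^sup>2) * a) (\<lambda>n. idl (w n))"
proof -
 let ?A = "\<lambda>j. axis j 1 \<bullet> \<zeta>"
 have "near \<psi> \<zeta> m (a + (-1) * (\<Sum>j\<in>(UNIV :: 'n set). - \<i> * cor (?A j) * (- \<i> * cor (?A j) * a)))
  (\<lambda>n x. w n x + (-1) * (\<Sum>j\<in>UNIV. T (axis j 1) (T (axis j 1) (w n)) x))"
  by (intro near_add near_cmult near_sum near_mono[OF near_mono[OF w]] near_dunkl w) (use m in auto)
 moreover have "a + (-1) * (\<Sum>j\<in>(UNIV :: 'n set). - \<i> * cor (?A j) * (- \<i> * cor (?A j) * a)) = cor (1 + (norm \<zeta>)\<^sup>2) * a"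
 proof -
  have ax: "axis j 1 \<bullet> \<zeta> = \<zeta> $ j" for j by (simp add: inner_axis')
  have "- \<i> * cor (\<zeta> $ j) * (- \<i> * cor (\<zeta> $ j) * a) = - (cor ((\<zeta> $ j)\<^sup>2) * a)" for j
   by (simp add: power2_eq_square mult_ac)
  moreover have "(norm \<zeta>)\<^sup>2 = (\<Sum>j\<in>UNIV. (\<zeta> $ j)\<^sup>2)" unfolding power2_norm_eq_inner inner_vec_def by (simp add: power2_eq_square)
  ultimately show ?thesis unfolding ax by (simp add: sum_negf sum_distrib_right distrib_right)
 qed
 ultimately show ?thesis by (simp add: idl_def[abs_def])
qed

lemma near_idl_pow:
 "2 * s + m <= M ==> near \<psi> \<zeta> m (cor ((1 + (norm \<zeta>)\<^sup>2) ^ s)) (\<lambda>n. (idl ^^ s) (wave \<psi> \<zeta> n))"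
proof (induction s arbitrary: m)
 case 0
 show ?case by (rule nearI[OF asym_zero]) simp
next
 case (Suc s)
 have "near \<psi> \<zeta> (Suc (Suc m)) (cor ((1 + (norm \<zeta>)\<^sup>2) ^ s)) (\<lambda>n. (idl ^^ s) (wave \<psi> \<zeta> n))"
  by (rule Suc.IH) (use Suc.prems in simp)
 from near_idl[OF this] Suc.prems show ?case by simp
qed

end

text \<open>Only \<open>F\<close> and \<open>(idl ^^ s) F\<close> are known to be integrable, so
  cutting off \<open>F\<close> itself would leave uncontrolled derivatives. All operators are first
  moved onto a compactly supported wave; dominated convergence then applies on both sides of the
  resulting identity.\<close>

theorem integral_idl_pow:
 assumes F: "cont_space.smooth (2 * s) F" and iF: "integrable W F" and iG: "integrable W ((idl ^^ s) F)"
 shows "(LINT x|W. (idl ^^ s) F x * e (-\<i>) v x) = cor ((1 + (norm v)\<^sup>2) ^ s) * (LINT x|W. F x * e (-\<i>) v x)"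
proof -
 let ?A = "\<lambda>n. 1 / real (Suc n)"
 let ?B = "\<lambda>g n. wave g v n"
 let ?C = "\<lambda>a x. a * e (-\<i>) v x"
 \<comment> \<open>Smooth enough for \<open>2 * s\<close> derivatives, bounded by 1 and equal to 1
   at the origin.\<close>
 define g :: "real^'n => complex" where "g = bump (Suc (2 * s))"
 have g: "cont_space.smooth (2 * s) g" unfolding g_def by (rule bump_smooth)
 have supp: "g x = 0" if "norm x > 1" for x unfolding g_def using that by (intro bump_support) auto
 define a where "a = cor ((1 + (norm v)\<^sup>2) ^ s)"
 have "near g v 0 a (\<lambda>n. (idl ^^ s) (?B g n))" unfolding a_def by (rule near_idl_pow[OF g supp]) auto
 then obtain r where r: "asym 0 r" "!!n x. (idl ^^ s) (?B g n) x = a * wave g v n x + cor (?A n) * r n x"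
  unfolding near_def by blast
 obtain B where B: "!!n x. norm (r n x) <= B" using asym_bounded[OF r(1)] by blast
 have B0: "B >= 0" using norm_ge_zero order_trans B by blast
 have w1: "norm (wave g v n x) <= 1" for n x
 proof -
  have "norm (wave g v n x) <= 1 * 1" unfolding wave_def norm_mult g_def by (intro mult_mono bump_le norm_e_i) auto
  thus ?thesis by simp
 qed
 have wl: "(\<lambda>n. wave g v n x) \<longlonglongrightarrow> e (-\<i>) v x" for x
 proof -
  have "(\<lambda>n. (?A n) *\<^sub>R x) \<longlonglongrightarrow> 0 *\<^sub>R x"
   by (intro tendsto_scaleR tendsto_const LIMSEQ_inverse_real_of_nat[unfolded inverse_eq_divide])
  hence "(\<lambda>n. g ((?A n) *\<^sub>R x)) \<longlonglongrightarrow> g (0 *\<^sub>R x)"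
   by (rule continuous_on_tendsto_compose[OF cont_space.smooth_P[OF g]]) auto
  hence "(\<lambda>n. wave g v n x) \<longlonglongrightarrow> g (0 *\<^sub>R x) * e (-\<i>) v x"
   unfolding wave_def by (intro tendsto_mult tendsto_const)
  thus ?thesis by (simp add: g_def bump_def)
 qed
 have wc: "cts (?B g n)" for n by (rule wave_continuous[OF cont_space.smooth_P[OF g]])
 have rl: "(\<lambda>n. cor (?A n) * r n x) \<longlonglongrightarrow> 0" for x
 proof (rule Lim_null_comparison)
  show "\<forall>\<^sub>F n in sequentially. norm (cor (?A n) * r n x) <= (?A n) * B"
   using B by (intro always_eventually allI) (simp add: norm_mult norm_divide divide_right_mono del: of_nat_Suc)
  show "(\<lambda>n. (?A n) * B) \<longlonglongrightarrow> 0"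
   by (intro tendsto_mult_left_zero LIMSEQ_inverse_real_of_nat[unfolded inverse_eq_divide])
 qed
 have L: "(\<lambda>n. LINT x|W. (idl ^^ s) F x * wave g v n x) \<longlonglongrightarrow> (LINT x|W. (idl ^^ s) F x * e (-\<i>) v x)"
 proof (rule integral_dominated_convergence[where w="\<lambda>x. norm ((idl ^^ s) F x)"])
  show "AE x in W. norm ((idl ^^ s) F x * wave g v n x) <= norm ((idl ^^ s) F x)" for n
   using w1 by (intro AE_I2) (simp add: norm_mult mult_left_le)
  show "AE x in W. (\<lambda>n. (idl ^^ s) F x * wave g v n x) \<longlonglongrightarrow> (idl ^^ s) F x * e (-\<i>) v x"
   by (intro AE_I2 tendsto_mult tendsto_const wl)
  show "(\<lambda>x. (idl ^^ s) F x * e (-\<i>) v x) \<in> borel_measurable W"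
   by (intro borel_measurable_times[OF borel_measurable_integrable[OF iG]] continuous_measurable_W e_continuous1)
  show "(\<lambda>x. (idl ^^ s) F x * wave g v n x) \<in> borel_measurable W" for n
   by (intro borel_measurable_times[OF borel_measurable_integrable[OF iG]] continuous_measurable_W wc)
 qed (use iG in auto)
 have Rl: "(\<lambda>n. LINT x|W. F x * (idl ^^ s) (?B g n) x) \<longlonglongrightarrow> (LINT x|W. F x * (?C a x))"
 proof (rule integral_dominated_convergence[where w="\<lambda>x. norm (F x) * (norm a + B)"])
  show "AE x in W. norm (F x * (idl ^^ s) (?B g n) x) <= norm (F x) * (norm a + B)" for n
  proof (intro AE_I2)
   fix x
   have "norm (a * wave g v n x) <= norm a" using w1 by (simp add: norm_mult mult_left_le)
   moreover have "norm (cor (?A n) * r n x) <= 1 * B"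
    unfolding norm_mult norm_of_real using B B0 by (intro mult_mono) auto
   ultimately have "norm ((idl ^^ s) (?B g n) x) <= norm a + B"
    unfolding r(2) using norm_triangle_ineq[of "a * wave g v n x" "cor (?A n) * r n x"] by linarith
   thus "norm (F x * (idl ^^ s) (?B g n) x) <= norm (F x) * (norm a + B)"
    by (simp add: norm_mult mult_left_mono)
  qed
  show "AE x in W. (\<lambda>n. F x * (idl ^^ s) (?B g n) x) \<longlonglongrightarrow> F x * (?C a x)"
  proof (intro AE_I2)
   fix x
   have "(\<lambda>n. a * wave g v n x + cor (?A n) * r n x) \<longlonglongrightarrow> a * e (-\<i>) v x + 0"
    by (intro tendsto_add tendsto_mult tendsto_const wl rl)
   thus "(\<lambda>n. F x * (idl ^^ s) (?B g n) x) \<longlonglongrightarrow> F x * (?C a x)"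
    unfolding r(2) by (intro tendsto_mult tendsto_const) simp
  qed
  show "(\<lambda>x. F x * (?C a x)) \<in> borel_measurable W"
   by (intro borel_measurable_times[OF borel_measurable_integrable[OF iF]] continuous_measurable_W continuous_intros e_continuous1)
  show "(\<lambda>x. F x * (idl ^^ s) (?B g n) x) \<in> borel_measurable W" for n
   unfolding r(2)
   by (intro borel_measurable_times[OF borel_measurable_integrable[OF iF]] continuous_measurable_W continuous_intros wc asym_continuous[OF r(1)])
 qed (use iF in auto)
 have "(LINT x|W. (idl ^^ s) F x * wave g v n x) = (LINT x|W. F x * (idl ^^ s) (?B g n) x)" for n
  by (rule idl_pow_by_parts[OF F asym_wave[OF g supp]])
 hence "(LINT x|W. (idl ^^ s) F x * e (-\<i>) v x) = (LINT x|W. F x * (?C a x))"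
  using LIMSEQ_unique[OF L] Rl by simp
 also have "\<dots> = a * (LINT x|W. F x * e (-\<i>) v x)"
  unfolding mult.left_commute[of _ a] by (rule Bochner_Integration.integral_mult_right_zero)
 finally show ?thesis by (simp only: a_def)
qed

end

section \<open>Rapidly decreasing functions\<close>

definition bounded_continuous :: "(real^'n => complex) => bool" where
 "bounded_continuous f \<longleftrightarrow> cts f \<and> (\<exists>B. \<forall>x. norm (f x) <= B)"

interpretation bounded_space: function_space "bounded_continuous :: (real^'n => complex) => bool"
proof
 fix f g :: "real^'n => complex" assume "bounded_continuous f" "bounded_continuous g"
 then obtain A B where f: "cts f" "!!x. norm (f x) <= A" and g: "cts g" "!!x. norm (g x) <= B"
  unfolding bounded_continuous_def by blast
 have "norm (f x + g x) <= A + B" for x by (intro order_trans[OF norm_triangle_ineq] add_mono f g)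
 thus "bounded_continuous (\<lambda>x. f x + g x)" unfolding bounded_continuous_def using f g by (auto intro!: continuous_intros)
 have "norm (f x * g x) <= A * B" for x unfolding norm_mult using f g by (intro mult_mono') auto
 thus "bounded_continuous (\<lambda>x. f x * g x)" unfolding bounded_continuous_def using f g by (auto intro!: continuous_intros)
next
 let ?A = "\<lambda>x t \<alpha>. x - (t * (x \<bullet> \<alpha>)) *\<^sub>R \<alpha>"
 fix f :: "real^'n => complex" and p :: "real => real" and \<alpha>
 assume f: "bounded_continuous f" and p: "continuous_on (cbox 0 1) p"
 obtain A where A: "!!x. norm (f x) <= A" using f unfolding bounded_continuous_def by blast
 have fc: "cts f" using f by (simp add: bounded_continuous_def)
 have "bounded (p ` cbox 0 1)" by (rule compact_imp_bounded[OF compact_continuous_image[OF p compact_cbox]])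
 then obtain B where B: "!!t. t \<in> cbox 0 1 ==> norm (p t) <= B" unfolding bounded_iff by blast
 have "norm (avg p \<alpha> f x) <= B * A" for x
 proof -
  have "continuous_on {0..1} (\<lambda>t. cor (p t) * f (?A x t \<alpha>))"
   using p by (intro continuous_intros continuous_on_compose2[OF fc]) auto
  moreover have "norm (cor (p t) * f (?A x t \<alpha>)) <= B * A" if "t \<in> {0..1}" for t
   unfolding norm_mult using B[of t] A that by (intro mult_mono') auto
  ultimately have "norm (integral {0..1} (\<lambda>t. cor (p t) * f (?A x t \<alpha>))) <= B * A * (1 - 0)"
   by (intro integral_bound) auto
  thus ?thesis by (simp add: avg_def)
 qed
 thus "bounded_continuous (avg p \<alpha> f)"
  unfolding bounded_continuous_def using cont_space.average[OF fc p] by blast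
next
 fix f :: "real^'n => complex" and L :: "real^'n => real^'n" assume "bounded_continuous f" "linear L"
 thus "bounded_continuous (\<lambda>x. f (L x))"
  unfolding bounded_continuous_def using cont_space.lin by blast
qed (auto simp: bounded_continuous_def)

section \<open>Polynomial weights, their logarithmic derivatives and rapid decrease\<close>

definition bracket :: "real^'n => complex" where "bracket x = cor (1 + (norm x)\<^sup>2)"
text \<open>Half the logarithmic derivative of \<open>bracket\<close> in direction \<open>v\<close>.
  All its derivatives are bounded, which makes commutators with powers of \<open>bracket\<close>
  harmless.\<close>

definition slope :: "real^'n => real^'n => complex" where "slope v x = cor ((x \<bullet> v) / (1 + (norm x)\<^sup>2))"

lemma bracket_real_pos: "1 + (norm (x :: real^'n))\<^sup>2 > 0" by (simp add: add_pos_nonneg)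

lemma bracket_der:
 fixes x :: "real^'n"
 shows "(bracket has_derivative (\<lambda>v. 2 * slope v x * bracket x)) (at x)"
proof -
 let ?A = "\<lambda>x. 1 + (norm x)\<^sup>2"
 have "((\<lambda>x :: real^'n. 1 + (norm x)\<^sup>2) has_derivative (\<lambda>v. 2 * (x \<bullet> v))) (at x)"
  unfolding power2_norm_eq_inner by (auto intro!: derivative_eq_intros simp: inner_commute)
 from has_derivative_of_real[OF this] show ?thesis
  unfolding bracket_def[abs_def]
 proof (rule has_derivative_eq_rhs)
  have "2 * (x \<bullet> v) = 2 * ((x \<bullet> v) / (?A x)) * (?A x)" for v
   using bracket_real_pos[of x] by simp
  hence "cor (2 * (x \<bullet> v)) = cor (2 * ((x \<bullet> v) / (?A x)) * (?A x))" for v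
   by (simp only:)
  thus "(\<lambda>v. cor (2 * (x \<bullet> v))) = (\<lambda>v. 2 * slope v x * cor (?A x))"
   by (simp only: slope_def of_real_mult of_real_numeral)
 qed
qed

lemma bracket_power_der: "((\<lambda>x. bracket x ^ M) has_derivative (\<lambda>v. of_nat (2 * M) * slope v x * bracket x ^ M)) (at x)"
proof (induction M)
 case (Suc M)
 show ?case unfolding power_Suc
  by (rule has_derivative_eq_rhs[OF has_derivative_mult[OF bracket_der Suc]]) (simp add: fun_eq_iff algebra_simps)
qed simp

lemma inverse_bracket_der: "((\<lambda>x. inverse (bracket x)) has_derivative (\<lambda>v. - 2 * slope v x * inverse (bracket x))) (at x)"
proof -
 have "bracket x \<noteq> 0" using bracket_real_pos[of x] unfolding bracket_def by (simp only: of_real_eq_0_iff)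
 from Deriv.has_derivative_inverse[OF this bracket_der] show ?thesis
  by (rule has_derivative_eq_rhs) (use \<open>bracket x \<noteq> 0\<close> in \<open>simp add: fun_eq_iff\<close>)
qed

lemma slope_eq: "slope v x = cor (x \<bullet> v) * inverse (bracket x)"
 by (simp add: slope_def bracket_def divide_inverse)

lemma slope_der: "(slope v has_derivative (\<lambda>w. cor (w \<bullet> v) * inverse (bracket x) - 2 * slope v x * slope w x)) (at x)"
proof -
 have "((\<lambda>x. cor (x \<bullet> v)) has_derivative (\<lambda>w. cor (w \<bullet> v))) (at x)"
  by (intro has_derivative_of_real bounded_linear_imp_has_derivative bounded_linear_inner_left)
 from has_derivative_mult[OF this inverse_bracket_der] show ?thesis
  unfolding slope_eq[of v, abs_def] by (rule has_derivative_eq_rhs) (simp add: fun_eq_iff slope_eq algebra_simps)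
qed

text \<open>Both families are treated in one induction because the derivatives of each are
  combinations of products of members of the two.\<close>

lemma slope_smooth: "bounded_space.smooth m (\<lambda>x :: real^'n. inverse (bracket x)) \<and> (\<forall>v :: real^'n. bounded_space.smooth m (slope v))"
proof (induction m)
 have ic: "cts (\<lambda>x :: real^'n. inverse (bracket x))"
  by (intro has_derivative_continuous_on[of UNIV _ "\<lambda>x v. - 2 * slope v x * inverse (bracket x)"]) (blast intro: has_derivative_at_withinI inverse_bracket_der)
 have sc: "cts (slope v)" for v :: "real^'n"
  by (intro has_derivative_continuous_on[of UNIV _ "\<lambda>x w. cor (w \<bullet> v) * inverse (bracket x) - 2 * slope v x * slope w x"]) (blast intro: has_derivative_at_withinI slope_der)
 have "norm (inverse (bracket x)) <= 1" for x :: "real^'n"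
  unfolding bracket_def norm_inverse norm_of_real by (simp add: inverse_le_1_iff)
 hence 1: "bounded_continuous (\<lambda>x :: real^'n. inverse (bracket x))" unfolding bounded_continuous_def using ic by blast
 have "norm (slope v x) <= norm v" for v x :: "real^'n"
 proof -
  have "norm x <= 1 + (norm x)\<^sup>2" using sum_squares_bound[of 1 "norm x"] norm_ge_zero[of x] unfolding power_one mult_1_right by linarith
  hence "norm x * norm v <= (1 + (norm x)\<^sup>2) * norm v" by (intro mult_right_mono) auto
  hence "\<bar>x \<bullet> v\<bar> <= (1 + (norm x)\<^sup>2) * norm v" using Cauchy_Schwarz_ineq2[of x v] by linarith
  thus ?thesis unfolding slope_def norm_of_real using bracket_real_pos[of x] by (simp add: abs_divide divide_le_eq mult.commute)
 qed
 hence 2: "bounded_continuous (slope v)" for v :: "real^'n" unfolding bounded_continuous_def using sc by blast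
 case 0 show ?case using 1 2 by simp
 case (Suc m)
 hence S: "bounded_space.smooth m (\<lambda>x :: real^'n. inverse (bracket x))" "!!v :: real^'n. bounded_space.smooth m (slope v)" by blast+
 have "partial_deriv i (\<lambda>x :: real^'n. inverse (bracket x)) = (\<lambda>x. (- 2) * (slope (axis i 1) x * inverse (bracket x)))" for i
  unfolding partial_deriv_def[abs_def] fderiv_eq[OF inverse_bracket_der] by (simp add: mult.assoc)
 moreover have "partial_deriv i (slope v) = (\<lambda>x. cor (axis i 1 \<bullet> v) * inverse (bracket x) + (- 2) * (slope v x * slope (axis i 1) x))" for i and v :: "real^'n"
  unfolding partial_deriv_def[abs_def] fderiv_eq[OF slope_der] by (simp add: mult.assoc)
 moreover have "(\<lambda>x :: real^'n. inverse (bracket x)) differentiable (at x)" "slope v differentiable (at x)" for v x :: "real^'n"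
  unfolding differentiable_def by (rule exI, rule inverse_bracket_der, rule exI, rule slope_der)
 moreover have "bounded_space.smooth m (\<lambda>x :: real^'n. (- 2) * (slope (axis i 1) x * inverse (bracket x)))"
  "bounded_space.smooth m (\<lambda>x. cor (axis i 1 \<bullet> v) * inverse (bracket x) + (- 2) * (slope v x * slope (axis i 1) x))" for i and v :: "real^'n"
  by (intro bounded_space.smooth_add bounded_space.smooth_cmult bounded_space.smooth_mult S)+
 ultimately show ?case using 1 2 by simp
qed

text \<open>The Schwartz condition with the weight inside the derivatives. As \<open>bracket\<close>
  is smooth and invariant under \<open>G\<close>, this form is stable under Dunkl operators by the
  ordinary product rule.\<close>

definition rapid :: "(real^'n => complex) => bool" where
 "rapid f \<longleftrightarrow> (\<forall>m M. bounded_space.smooth m (\<lambda>x. bracket x ^ M * f x))"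

lemma schwartz_partial_deriv: assumes "schwartz f" shows "schwartz (partial_deriv i f)"
 unfolding schwartz_def
proof (intro conjI allI)
 show "C_class m (partial_deriv i f)" for m
  using assms C_class.simps(2)[of m f] unfolding schwartz_def by blast
 show "bounded (range (\<lambda>x. (1 + norm x) ^ n *\<^sub>R foldr partial_deriv is (partial_deriv i f) x))" for "is" n
 proof -
  have "bounded (range (\<lambda>x. (1 + norm x) ^ n *\<^sub>R foldr partial_deriv (is @ [i]) f x))"
   using assms unfolding schwartz_def by blast
  thus ?thesis by simp
 qed
qed

lemma schwartz_rapid: assumes "schwartz f" shows "rapid f"
proof -
 let ?A = "\<lambda>M f. \<lambda>x. bracket x ^ M * f x"
 let ?B = "\<lambda>M i f. \<lambda>x. bracket x ^ M * partial_deriv i f x + of_nat (2 * M) * (slope (axis i 1) x * (bracket x ^ M * f x))"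
 have "bounded_space.smooth m (?A M f)" if "schwartz f" for m M f
  using that
 proof (induction m arbitrary: f)
  have bc: "bounded_continuous (?A M f)" if f: "schwartz f" for f
  proof -
   have "C_class 0 f" using f unfolding schwartz_def by blast
   hence fc: "cts f" by simp
   have "bounded (range (\<lambda>x. (1 + norm x) ^ (2 * M) *\<^sub>R foldr partial_deriv [] f x))"
    using f unfolding schwartz_def by blast
   then obtain B where B: "!!x. norm ((1 + norm x) ^ (2 * M) *\<^sub>R f x) <= B" unfolding bounded_iff by auto
   have "norm (bracket x ^ M * f x) <= B" for x
   proof -
    have "1 + (norm x)\<^sup>2 <= (1 + norm x)\<^sup>2" by (simp add: power2_sum)
    hence "(1 + (norm x)\<^sup>2) ^ M <= ((1 + norm x)\<^sup>2) ^ M" by (rule power_mono) (simp add: add_nonneg_nonneg)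
    hence "norm (bracket x ^ M) <= (1 + norm x) ^ (2 * M)" unfolding bracket_def norm_power norm_of_real by (simp add: power_mult)
    hence "norm (bracket x ^ M) * norm (f x) <= (1 + norm x) ^ (2 * M) * norm (f x)" by (rule mult_right_mono) simp
    thus ?thesis using B[of x] by (simp add: norm_mult)
   qed
   moreover have "cts (?A M f)"
    unfolding bracket_def by (intro continuous_intros fc)
   ultimately show ?thesis unfolding bounded_continuous_def by blast
  qed
  case 0 thus ?case using bc by simp
  case (Suc m)
  have C1: "C_class (Suc 0) f" using Suc.prems unfolding schwartz_def by blast
  hence d: "f differentiable (at x)" for x by simp
  have der: "((?A M f) has_derivative (\<lambda>v. bracket x ^ M * fderiv f x v + of_nat (2 * M) * slope v x * bracket x ^ M * f x)) (at x)" for x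
   by (rule has_derivative_mult[OF bracket_power_der]) (use d in \<open>simp add: frechet_derivative_works\<close>)
  have "partial_deriv i (?A M f) = (?B M i f)" for i
   unfolding partial_deriv_def[abs_def] fderiv_eq[OF der] by (simp only: mult.assoc)
  moreover have "bounded_space.smooth m (?B M i f)" for i
   using slope_smooth[of m]
   by (intro bounded_space.smooth_add bounded_space.smooth_cmult bounded_space.smooth_mult Suc.IH Suc.prems schwartz_partial_deriv) auto
  moreover have "(?A M f) differentiable (at x)" for x
   unfolding differentiable_def by (rule exI, rule der)
  ultimately show ?case using bc[OF Suc.prems] by simp
 qed
 thus ?thesis using assms unfolding rapid_def by blast
qed

lemma rapid_add: "rapid f ==> rapid g ==> rapid (\<lambda>x. f x + g x)"
 unfolding rapid_def by (simp add: distrib_left bounded_space.smooth_add)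

lemma rapid_cmult: assumes "rapid f" shows "rapid (\<lambda>x. q * f x)"
 unfolding rapid_def mult.left_commute[of _ q]
 using assms unfolding rapid_def by (intro allI bounded_space.smooth_cmult) blast

lemma rapid_sum: "finite I ==> (!!i. i \<in> I ==> rapid (f i)) ==> rapid (\<lambda>x. \<Sum>i\<in>I. f i x)"
proof (induction rule: finite_induct)
 case empty
 show ?case unfolding rapid_def by (simp add: bounded_space.smooth_const)
qed (auto intro: rapid_add)

context dunkl begin

lemma rapid_dunkl: assumes f: "rapid f" shows "rapid (T q f)"
 unfolding rapid_def
proof (intro allI)
 let ?A = "\<lambda>M f. \<lambda>x. bracket x ^ M * f x"
 let ?B = "\<lambda>x M f. slope q x * (bracket x ^ M * f x)"
 fix m M
 have s: "bounded_space.smooth j (\<lambda>x. bracket x ^ L * f x)" for j L using f unfolding rapid_def by blast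
 have d: "f differentiable (at x)" for x using s[of "Suc 0" 0] by simp
 have bd: "(\<lambda>x. bracket x ^ M) differentiable (at x)" for x :: "real^'n"
  unfolding differentiable_def by (rule exI, rule bracket_power_der)
 have inv: "bracket (\<sigma> a x) ^ M = bracket x ^ M" if "a \<in> R" for a x using that by (simp add: bracket_def)
 have "T q (?A M f) x = bracket x ^ M * T q f x + of_nat (2 * M) * slope q x * bracket x ^ M * f x" for x
  using dunkl_op_invariant_mult[OF bd inv d] unfolding fderiv_eq[OF bracket_power_der] .
 hence "bracket x ^ M * T q f x = T q (?A M f) x + (- of_nat (2 * M)) * (?B x M f)" for x
  by (simp add: algebra_simps)
 moreover have "bounded_space.smooth m (\<lambda>x. T q (?A M f) x + (- of_nat (2 * M)) * (?B x M f))"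
 proof (rule bounded_space.smooth_add)
  show "bounded_space.smooth m (T q (?A M f))"
   by (rule dunkl_op_smooth_in(2)[OF bounded_space.function_space_axioms s])
  show "bounded_space.smooth m (\<lambda>x. (- of_nat (2 * M)) * (?B x M f))"
   using slope_smooth[of m] by (intro bounded_space.smooth_cmult bounded_space.smooth_mult s) blast
 qed
 ultimately show "bounded_space.smooth m (\<lambda>x. bracket x ^ M * T q f x)" by simp
qed

lemma rapid_idl_pow: "rapid f ==> rapid ((idl ^^ s) f)"
proof (induction s)
 case (Suc s)
 have "rapid (\<lambda>x. (idl ^^ s) f x + (-1) * (\<Sum>j\<in>UNIV. T (axis j 1) (T (axis j 1) ((idl ^^ s) f)) x))"
  by (intro rapid_add rapid_cmult rapid_sum rapid_dunkl Suc) auto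
 thus ?case by (simp add: idl_def[abs_def])
qed simp

lemma rapid_integrable: assumes "rapid f" shows "integrable W f"
proof -
 define M where "M = nat \<lceil>N\<rceil>"
 have M: "N <= real M" using N_pos by (simp add: M_def)
 have "bounded_space.smooth 0 (\<lambda>x. bracket x ^ j * f x)" for j using assms unfolding rapid_def by blast
 hence bc: "bounded_continuous (\<lambda>x. bracket x ^ j * f x)" for j by simp
 have fc: "cts f" using bc[of 0] by (simp add: bounded_continuous_def)
 obtain B where B: "!!x. norm (bracket x ^ M * f x) <= B" using bc[of M] unfolding bounded_continuous_def by blast
 have "norm (f x) <= B * (1 + (norm x)\<^sup>2) powr - real M" for x
 proof -
  have "(1 + (norm x)\<^sup>2) ^ M * norm (f x) <= B" using B[of x] by (simp add: norm_mult norm_power bracket_def del: of_real_add)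
  thus ?thesis using bracket_real_pos[of x] by (simp add: powr_minus powr_realpow field_simps)
 qed
 hence bnd: "norm (f x) <= norm (B * (1 + (norm x)\<^sup>2) powr - real M)" for x
  unfolding real_norm_def by (rule order_trans[OF _ abs_ge_self])
 have "integrable W (\<lambda>x. B * (1 + (norm x)\<^sup>2) powr - real M)" by (intro integrable_mult_right integrable_decay M)
 thus ?thesis
  by (rule Bochner_Integration.integrable_bound) (use bnd in \<open>auto intro: continuous_measurable_W[OF fc]\<close>)
qed

section \<open>The Dunkl transform\<close>

definition ft :: "(real^'n => complex) => real^'n => complex" where
 "ft f q = (LINT x|W. f x * e (-\<i>) q x)"

lemma dunkl_transform_eq: "dunkl_transform R k f q = inverse (cor c) * ft f q"
 unfolding dunkl_transform_def ft_def c_def dunkl_kernel_eq e_def by (simp add: mult.commute)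

lemma dunkl_kernel_e: "dunkl_kernel R k (\<i> *s cvec q) (cvec x) = e \<i> q x"
 by (simp add: dunkl_kernel_eq e_def)

lemma ft_minus: "ft f (- q) = (LINT x|W. f x * e \<i> q x)"
 unfolding ft_def by (simp add: e_minus)

lemma integrable_times_e:
 assumes "integrable W f" shows "integrable W (\<lambda>x. f x * e (-\<i>) q x)" "integrable W (\<lambda>x. f x * e \<i> q x)"
proof -
 show "integrable W (\<lambda>x. f x * e (-\<i>) q x)"
  by (rule Bochner_Integration.integrable_bound[OF assms borel_measurable_times[OF borel_measurable_integrable[OF assms] continuous_measurable_W[OF e_continuous1]]])
   (simp add: norm_mult mult_left_le norm_e_i)
 show "integrable W (\<lambda>x. f x * e \<i> q x)"
  by (rule Bochner_Integration.integrable_bound[OF assms borel_measurable_times[OF borel_measurable_integrable[OF assms] continuous_measurable_W[OF e_continuous1]]])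
   (simp add: norm_mult mult_left_le norm_e_i)
qed

lemma norm_ft: assumes "integrable W f" shows "norm (ft f q) <= (LINT x|W. norm (f x))"
proof -
 have "norm (ft f q) <= (LINT x|W. norm (f x * e (-\<i>) q x))" unfolding ft_def by (rule integral_norm_bound)
 also have "\<dots> <= (LINT x|W. norm (f x))"
  using norm_e_i assms integrable_times_e(1)[OF assms] by (intro integral_mono integrable_norm) (auto simp: norm_mult mult_left_le)
 finally show ?thesis .
qed

lemma ft_measurable: assumes [measurable]: "f \<in> borel_measurable W" shows "ft f \<in> borelm"
proof -
 interpret sigma_finite_measure W by (rule sigma_finite_W)
 show ?thesis unfolding ft_def[abs_def] by measurable
qed

lemma ft_idl_pow:
 assumes "cont_space.smooth (2 * s) F" "integrable W F" "integrable W ((idl ^^ s) F)"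
 shows "ft F q = cor ((1 + (norm q)\<^sup>2) powr - real s) * ft ((idl ^^ s) F) q"
proof -
 have "(1 + (norm q)\<^sup>2) powr - real s * (1 + (norm q)\<^sup>2) ^ s = 1"
  using bracket_real_pos[of q] by (simp add: powr_minus powr_realpow)
 thus ?thesis unfolding ft_def integral_idl_pow[OF assms] mult.assoc[symmetric] of_real_mult[symmetric] by simp
qed

text \<open>The transform of \<open>(idl ^^ s) F\<close> is bounded, so the factor
  \<open>(1 + (norm q)\<^sup>2) powr - real s\<close> supplies the decay.\<close>

lemma ft_integrable:
 assumes "cont_space.smooth (2 * s) F" "integrable W F" "integrable W ((idl ^^ s) F)" "real s >= N"
 shows "integrable W (ft F)"
proof (rule Bochner_Integration.integrable_bound)
 let ?I = "LINT x|W. norm ((idl ^^ s) F x)"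
 show "integrable W (\<lambda>q. (1 + (norm q)\<^sup>2) powr - real s * ?I)"
  by (intro integrable_mult_left integrable_decay assms)
 show "ft F \<in> borel_measurable W" using assms(2) by (intro measurable_W ft_measurable) auto
 show "AE q in W. norm (ft F q) <= norm ((1 + (norm q)\<^sup>2) powr - real s * ?I)"
 proof (rule AE_I2)
  fix q
  have "norm (ft F q) <= (1 + (norm q)\<^sup>2) powr - real s * ?I"
   unfolding ft_idl_pow[OF assms(1-3)] norm_mult norm_of_real abs_of_nonneg[OF powr_ge_zero]
   by (intro mult_left_mono norm_ft assms) auto
  thus "norm (ft F q) <= norm ((1 + (norm q)\<^sup>2) powr - real s * ?I)" by simp
 qed
qed

lemma schwartz_integrable: "schwartz g ==> integrable W g"
 by (intro rapid_integrable schwartz_rapid)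

lemma schwartz_ft_integrable: assumes g: "schwartz g" shows "integrable W (ft g)"
proof -
 define s where "s = nat \<lceil>N\<rceil>"
 have s: "N <= real s" using N_pos by (simp add: s_def)
 have "C_class (2 * s) g" using g unfolding schwartz_def by blast
 hence "cont_space.smooth (2 * s) g" by (simp only: C_class_smooth)
 thus ?thesis
  using schwartz_integrable[OF g] rapid_integrable[OF rapid_idl_pow[OF schwartz_rapid[OF g]]] s by (rule ft_integrable)
qed

end

section \<open>The Schur test\<close>

text \<open>Young's inequality as a tangent to the power at \<open>u = l\<close>, a form that
  includes \<open>p = 1\<close>. It comes from the tangent of \<open>exp\<close> at
  \<open>M\<close>, the mean of \<open>p * ln u\<close> and \<open>p * ln l\<close> with weights
  \<open>1 / p\<close> and \<open>1 - 1 / p\<close>.\<close>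

lemma young_tangent:
 fixes u l p :: real
 assumes u: "u >= 0" and l: "l > 0" and p: "p >= 1"
 shows "u <= l powr (1 - p) / p * u powr p + (1 - 1 / p) * l"
proof (cases "u = 0")
 case True
 thus ?thesis using assms by simp
next
 case False
 hence u: "u > 0" using u by simp
 define M where "M = ln u + (p - 1) * ln l"
 define a where "a = u powr p"
 define b where "b = l powr p"
 have exp_ge: "exp M * (1 + x - M) <= exp x" for x
  using mult_left_mono[OF exp_ge_add_one_self[of "x - M"], of "exp M"] by (simp add: exp_add[symmetric] algebra_simps)
 have ab: "a = exp (p * ln u)" "b = exp (p * ln l)" using u l by (simp_all add: a_def b_def powr_def)
 have "1 / p * (exp M * (1 + p * ln u - M)) + (1 - 1 / p) * (exp M * (1 + p * ln l - M)) <= 1 / p * a + (1 - 1 / p) * b"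
  unfolding ab using p by (intro add_mono mult_left_mono exp_ge) auto
 moreover have "1 / p * (exp M * (1 + p * ln u - M)) + (1 - 1 / p) * (exp M * (1 + p * ln l - M)) = exp M"
 proof -
  have "1 / p * (1 + p * ln u - M) + (1 - 1 / p) * (1 + p * ln l - M) = 1"
   unfolding M_def using p by (simp add: field_simps)
  moreover have "1 / p * (exp M * X) + (1 - 1 / p) * (exp M * Y) = exp M * (1 / p * X + (1 - 1 / p) * Y)" for X Y
   by (simp add: algebra_simps)
  ultimately show ?thesis by (simp only: mult_1_right)
 qed
 moreover have "exp M = u * l powr (p - 1)" using u l by (simp add: M_def exp_add powr_def mult.commute)
 ultimately have "u * l powr (p - 1) <= 1 / p * a + (1 - 1 / p) * b" by simp
 hence "(u * l powr (p - 1)) * l powr (1 - p) <= (1 / p * a + (1 - 1 / p) * b) * l powr (1 - p)"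
  by (rule mult_right_mono) simp
 moreover have "l powr (p - 1) * l powr (1 - p) = 1" "b * l powr (1 - p) = l"
  using l by (simp_all add: b_def powr_add[symmetric])
 ultimately show ?thesis
  by (simp add: mult.assoc distrib_right a_def mult.commute[of "u powr p"])
qed

text \<open>Hoelder's inequality for the measure with density \<open>w\<close>: the tangent
  inequality is integrated with the slope chosen so that
  \<open>l powr (1 - p) * q = l * A\<close>.\<close>

lemma schur_pointwise:
 fixes f w :: "'a => real"
 assumes [measurable]: "f \<in> borel_measurable M" "w \<in> borel_measurable M"
  and nn: "!!x. 0 <= f x" "!!x. 0 <= w x" and p: "p >= 1" and A: "A > 0" "(nnint M (\<lambda>x. w x)) <= ennreal A"
  and q: "q > 0" "(nnint M (\<lambda>x. f x powr p * w x)) <= ennreal q"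
 shows "(nnint M (\<lambda>x. f x * w x)) <= ennreal (A * (q / A) powr (1 / p))"
proof -
 define l where "l = (q / A) powr (1 / p)"
 have l: "l > 0" using q A by (simp add: l_def)
 have lp: "l powr p = q / A" using q A p by (simp add: l_def powr_powr)
 define d where "d = l powr (1 - p) / p"
 define d' where "d' = (1 - 1 / p) * l"
 have d: "d >= 0" "d' >= 0" using p l by (auto simp: d_def d'_def)
 have "(nnint M (\<lambda>x. f x * w x)) <= (\<integral>\<^sup>+x. ennreal d * ennreal (f x powr p * w x) + ennreal d' * ennreal (w x) \<partial>M)"
 proof (rule nn_integral_mono)
  fix x
  have "f x * w x <= (d * f x powr p + d') * w x"
   using young_tangent[OF nn(1) l p, of x] nn(2) unfolding d_def d'_def by (intro mult_right_mono) auto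
  also have "\<dots> = d * (f x powr p * w x) + d' * w x" by (simp add: algebra_simps)
  finally have "ennreal (f x * w x) <= ennreal (d * (f x powr p * w x) + d' * w x)" by (rule ennreal_leI)
  thus "ennreal (f x * w x) <= ennreal d * ennreal (f x powr p * w x) + ennreal d' * ennreal (w x)"
   using d nn by (simp only: ennreal_mult ennreal_plus mult_nonneg_nonneg powr_ge_zero)
 qed
 also have "\<dots> = ennreal d * (nnint M (\<lambda>x. f x powr p * w x)) + ennreal d' * (nnint M (\<lambda>x. w x))"
  by (simp add: nn_integral_add nn_integral_cmult)
 also have "\<dots> <= ennreal d * ennreal q + ennreal d' * ennreal A"
  by (intro add_mono mult_left_mono A q) auto
 also have "\<dots> = ennreal (d * q + d' * A)"
  using d q(1) A(1) by (simp only: ennreal_mult ennreal_plus mult_nonneg_nonneg less_imp_le)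
 also have "d * q + d' * A = A * l"
 proof -
  have "l powr (1 - p) * q = l * A"
   using l lp q A by (simp add: powr_diff field_simps)
  thus ?thesis using p by (simp add: d_def d'_def field_simps)
 qed
 finally show ?thesis by (simp only: l_def)
qed

text \<open>The row bound controls the \<open>p\<close>-th power of the integral by
  \<open>A powr (p - 1) * Q x\<close>, and the column bound with Tonelli integrates
  \<open>Q\<close>. Finiteness of \<open>Q\<close> almost everywhere also yields absolute
  convergence of the integral.\<close>

lemma schur_test:
 fixes K :: "'a => 'a => complex"
 assumes sf: "sigma_finite_measure M" and K[measurable]: "(\<lambda>(x, y). K x y) \<in> borel_measurable (M \<Otimes>\<^sub>M M)"
  and A: "A > 0" "!!x. x \<in> space M ==> (nnint M (\<lambda>y. norm (K x y))) <= ennreal A"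
   "!!y. y \<in> space M ==> (nnint M (\<lambda>x. norm (K x y))) <= ennreal A"
  and p: "p >= 1" and g: "in_Lp M p g"
 shows "AE x in M. integrable M (\<lambda>y. g y * K x y)"
  and "in_Lp M p (\<lambda>x. LINT y|M. g y * K x y)"
  and "Lp_norm M p (\<lambda>x. LINT y|M. g y * K x y) <= A * Lp_norm M p g"
proof -
 let ?A = "\<lambda>M x. LINT y|M. g y * K x y"
 let ?B = "\<lambda>M. \<lambda>x. norm (?A M x) powr p"
 let ?C = "\<lambda>y. \<lambda>x. norm (g y) powr p * norm (K x y)"
 let ?D = "\<lambda>Q. \<integral>\<^sup>+x. Q x \<partial>M"
 let ?E = "A powr (p - 1)"
 let ?F = "\<lambda>M. \<lambda>x. LINT y|M. g y * K x y"
 let ?I = "\<lambda>M. LINT x|M. norm (?A M x) powr p"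
 interpret sigma_finite_measure M by (rule sf)
 interpret P: pair_sigma_finite M M ..
 have gm[measurable]: "g \<in> borel_measurable M" and gi: "integrable M (\<lambda>x. norm (g x) powr p)"
  using g by (auto simp: in_Lp_def)
 define I where "I = (LINT x|M. norm (g x) powr p)"
 have I0: "I >= 0" unfolding I_def by (rule Bochner_Integration.integral_nonneg) simp
 have gI: "(nnint M (\<lambda>x. norm (g x) powr p)) = ennreal I"
  unfolding I_def by (rule nn_integral_eq_integral[OF gi]) simp
 have Kx[measurable]: "(\<lambda>y. K x y) \<in> borel_measurable M" if "x \<in> space M" for x
  using measurable_compose[OF measurable_Pair1'[OF that] K] by simp
 define Q where "Q x = (nnint M (\<lambda>y. norm (g y) powr p * norm (K x y)))" for x
 have Qm[measurable]: "Q \<in> borel_measurable M" unfolding Q_def[abs_def] by measurable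
 have QI: "(?D Q) <= ennreal (A * I)"
 proof -
  have "(?D Q) = (\<integral>\<^sup>+y. nnint M (?C y) \<partial>M)"
   unfolding Q_def using P.Fubini[of "\<lambda>(x, y). ennreal (norm (g y) powr p * norm (K x y))"] by simp
  also have "\<dots> <= (\<integral>\<^sup>+y. ennreal A * ennreal (norm (g y) powr p) \<partial>M)"
  proof (rule nn_integral_mono)
   fix y assume y: "y \<in> space M"
   have m: "(\<lambda>x. ennreal (norm (K x y))) \<in> borel_measurable M"
    using measurable_compose[OF measurable_Pair2'[OF y] K] by simp
   have "(nnint M (?C y)) = ennreal (norm (g y) powr p) * (nnint M (\<lambda>x. norm (K x y)))"
    by (simp add: ennreal_mult' nn_integral_cmult[OF m])
   also have "\<dots> <= ennreal (norm (g y) powr p) * ennreal A" by (rule mult_left_mono[OF A(3)[OF y]]) simp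
   finally show "(nnint M (?C y)) <= ennreal A * ennreal (norm (g y) powr p)"
    by (simp only: mult.commute)
  qed
  also have "\<dots> = ennreal A * ennreal I" unfolding gI[symmetric] by (rule nn_integral_cmult) measurable
  also have "\<dots> = ennreal (A * I)" using A I0 by (simp add: ennreal_mult)
  finally show ?thesis .
 qed
 hence Qfin: "AE x in M. Q x \<noteq> \<infinity>" by (intro nn_integral_noteq_infinite) (auto simp: top_unique)
 define X where "X x = (nnint M (\<lambda>y. norm (g y * K x y)))" for x
 have X: "X x <= ennreal (A * (q / A) powr (1 / p))" if "x \<in> space M" "q > 0" "Q x <= ennreal q" for x q
  unfolding X_def norm_mult using that
  by (intro schur_pointwise p A) (auto simp: Q_def)
 have Xp: "ennreal (norm (?A M x) powr p) <= ennreal ?E * Q x" if x: "x \<in> space M" for x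
 proof (cases "Q x")
  case top
  thus ?thesis using A by (simp add: ennreal_mult_top)
 next
  case (real q)
  \<comment> \<open>The slack covers \<open>q = 0\<close>, since \<open>schur_pointwise\<close> asks
    for a positive bound; dividing \<open>d\<close> by \<open>A powr (p - 1)\<close> makes the final
    excess exactly \<open>d\<close>.\<close>
  have "norm (?A M x) powr p <= A powr (p - 1) * q + d" if d: "d > 0" for d
  proof -
   define q' where "q' = q + d / A powr (p - 1)"
   have Ap: "A powr (p - 1) > 0" using A by simp
   have q': "q' > 0" "q <= q'" using real d Ap by (auto simp: q'_def add_nonneg_pos)
   have "ennreal (norm (?A M x)) <= X x" unfolding X_def by (rule norm_integral_le_nn_integral)
   also have "\<dots> <= ennreal (A * (q' / A) powr (1 / p))" using X[OF x q'(1)] real q'(2) by (simp add: ennreal_leI)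
   finally have "norm (?A M x) <= A * (q' / A) powr (1 / p)" using A by simp
   hence "norm (?A M x) powr p <= (A * (q' / A) powr (1 / p)) powr p"
    using p by (intro powr_mono2) auto
   also have "\<dots> = A powr p * (q' / A)" using A q' p by (simp add: powr_mult powr_powr)
   also have "\<dots> = A powr (p - 1) * q'" using A by (simp add: powr_diff)
   also have "\<dots> = A powr (p - 1) * q + d" using Ap by (simp add: q'_def distrib_left)
   finally show ?thesis .
  qed
  hence "norm (?A M x) powr p <= A powr (p - 1) * q" by (rule field_le_epsilon)
  thus ?thesis using real by (simp add: ennreal_mult'[symmetric] ennreal_leI)
 qed
 show "AE x in M. integrable M (\<lambda>y. g y * K x y)"
  using Qfin
 proof (rule AE_mp, intro AE_I2 impI)
  fix x assume x: "x \<in> space M" and "Q x \<noteq> \<infinity>"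
  then obtain q where q: "q >= 0" "Q x = ennreal q" by (cases "Q x") auto
  have "X x <= ennreal (A * ((q + 1) / A) powr (1 / p))" using q by (intro X x) (auto simp: ennreal_leI)
  also have "\<dots> < \<infinity>" by simp
  finally have "X x < \<infinity>" .
  thus "integrable M (\<lambda>y. g y * K x y)" unfolding X_def using x
   by (intro integrableI_bounded) (auto simp: Kx)
 qed
 have cm: "(?F M) \<in> borel_measurable M" by measurable
 have total: "(nnint M (?B M)) <= ennreal (A powr p * I)"
 proof -
  have "(nnint M (?B M)) <= (\<integral>\<^sup>+x. ennreal ?E * Q x \<partial>M)"
   by (intro nn_integral_mono Xp)
  also have "\<dots> = ennreal ?E * (?D Q)" by (rule nn_integral_cmult) measurable
  also have "\<dots> <= ennreal ?E * ennreal (A * I)" by (rule mult_left_mono[OF QI]) simp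
  also have "\<dots> = ennreal (A powr p * I)"
  proof -
   have "A powr (p - 1) * A = A powr p" using A powr_add[of A "p - 1" 1] by simp
   thus ?thesis using A I0 by (simp add: ennreal_mult'[symmetric] mult.assoc[symmetric])
  qed
  finally show ?thesis .
 qed
 have ci: "integrable M (?B M)"
 proof (rule integrableI_bounded)
  show "(?B M) \<in> borel_measurable M" using cm by measurable
  show "(nnint M (\<lambda>x. norm (norm (?A M x) powr p))) < \<infinity>"
   using total by (simp add: le_less_trans)
 qed
 show "in_Lp M p (?F M)" unfolding in_Lp_def using cm ci by blast
 have "ennreal (?I M) <= ennreal (A powr p * I)"
  using total nn_integral_eq_integral[OF ci] by simp
 hence "(?I M) <= A powr p * I"
  using I0 by simp
 hence "(?I M) powr (1 / p) <= (A powr p * I) powr (1 / p)"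
  using p by (intro powr_mono2 Bochner_Integration.integral_nonneg) auto
 also have "\<dots> = A * I powr (1 / p)" using A I0 p by (simp add: powr_mult powr_powr)
 finally show "Lp_norm M p (?F M) <= A * Lp_norm M p g"
  by (simp add: Lp_norm_def I_def)
qed

section \<open>Translations\<close>

context dunkl begin

lemma translation_integrand_eq:
 "translation_integrand R k y F x q = inverse (cor c) * (e \<i> q y * (e \<i> q x * ft F q))"
 unfolding translation_integrand_def dunkl_kernel_e dunkl_transform_eq by (simp add: mult_ac)

lemma dunkl_translation_eq:
 "dunkl_translation R k y F x = (inverse (cor c))\<^sup>2 * (LINT q|W. e \<i> q y * (e \<i> q x * ft F q))"
 unfolding dunkl_translation_def translation_integrand_eq c_def[symmetric] by (simp add: power2_eq_square)

lemma dunkl_translation_symmetric: "dunkl_translation R k y F x = dunkl_translation R k x F y"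
 unfolding dunkl_translation_eq by (simp only: mult.left_commute)

lemma norm_ee_le: "norm (e \<i> q y * (e \<i> q x * u)) <= norm u"
proof -
 have "norm (e \<i> q y * (e \<i> q x * u)) <= 1 * (1 * norm u)"
  unfolding norm_mult by (intro mult_mono norm_e_i) auto
 thus ?thesis by simp
qed

lemma ee_integrable:
 assumes "integrable W u" shows "integrable W (\<lambda>q. e \<i> q y * (e \<i> q x * u q))"
proof (rule Bochner_Integration.integrable_bound[OF assms])
 have [measurable]: "u \<in> borel_measurable W" using assms by simp
 show "(\<lambda>q. e \<i> q y * (e \<i> q x * u q)) \<in> borel_measurable W" by measurable
qed (use norm_ee_le in auto)

lemma product_integrable:
 fixes f g :: "real^'n => complex"
 assumes f: "integrable W f" and g: "integrable W g"
 shows "integrable (W \<Otimes>\<^sub>M W) (\<lambda>(x, y). norm (f x) * norm (g y))"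
proof -
 interpret W: sigma_finite_measure W by (rule sigma_finite_W)
 interpret P: pair_sigma_finite W W ..
 have [measurable]: "f \<in> borel_measurable W" "g \<in> borel_measurable W" using f g by auto
 show ?thesis
 proof (rule P.Fubini_integrable)
  show "(\<lambda>(x, y). norm (f x) * norm (g y)) \<in> borel_measurable (W \<Otimes>\<^sub>M W)" by measurable
  show "integrable W (\<lambda>x. LINT y|W. norm (case (x, y) of (x, y) => norm (f x) * norm (g y)))"
   using f by simp
  show "AE x in W. integrable W (\<lambda>y. case (x, y) of (x, y) => norm (f x) * norm (g y))"
   using g by simp
 qed
qed

text \<open>Fubini, legitimate because the kernels at \<open>\<i>\<close> have modulus at most 1;
  the inner integral over \<open>x\<close> is the transform of \<open>f\<close> at
  \<open>- q\<close>.\<close>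

lemma translation_pairing:
 assumes f: "integrable W f" and u: "integrable W u"
 shows "(LINT x|W. (LINT q|W. e \<i> q y * (e \<i> q x * u q)) * f x) = (LINT q|W. e \<i> q y * (u q * ft f (- q)))"
proof -
 let ?A = "\<lambda>q x. e \<i> q x * u q"
 interpret W: sigma_finite_measure W by (rule sigma_finite_W)
 interpret P: pair_sigma_finite W W ..
 have [measurable]: "f \<in> borel_measurable W" "u \<in> borel_measurable W" using f u by auto
 have int: "integrable (W \<Otimes>\<^sub>M W) (\<lambda>(q, x). e \<i> q y * (?A q x) * f x)"
 proof (rule Bochner_Integration.integrable_bound[OF product_integrable[OF u f]])
  show "(\<lambda>(q, x). e \<i> q y * (?A q x) * f x) \<in> borel_measurable (W \<Otimes>\<^sub>M W)" by measurable
  show "AE p in W \<Otimes>\<^sub>M W. norm (case p of (q, x) => e \<i> q y * (?A q x) * f x) <= norm (case p of (x, y) => norm (u x) * norm (f y))"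
   unfolding split_beta norm_mult[of _ "f _"] using norm_ee_le by (intro AE_I2) (simp add: mult_right_mono)
 qed
 have "(LINT x|W. (LINT q|W. e \<i> q y * (?A q x)) * f x) = (LINT x|W. LINT q|W. e \<i> q y * (?A q x) * f x)"
  by simp
 also have "\<dots> = (LINT q|W. LINT x|W. e \<i> q y * (?A q x) * f x)"
  by (rule P.Fubini_integral[OF int])
 also have "\<dots> = (LINT q|W. e \<i> q y * (u q * ft f (- q)))"
 proof (rule Bochner_Integration.integral_cong[OF refl])
  fix q
  have "(LINT x|W. e \<i> q y * (?A q x) * f x) = (LINT x|W. (e \<i> q y * u q) * (f x * e \<i> q x))"
   by (simp only: mult_ac)
  thus "(LINT x|W. e \<i> q y * (?A q x) * f x) = e \<i> q y * (u q * ft f (- q))"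
   unfolding ft_minus by (simp add: mult.assoc)
 qed
 finally show ?thesis .
qed

text \<open>Both pairings reduce to one integral of the two transforms; replacing \<open>p\<close>
  by \<open>- p\<close> in it exchanges their roles and turns \<open>y\<close> into
  \<open>- y\<close>. Integrability of both transforms takes the place of an inversion
  formula.\<close>

lemma represents_translation_of_transform:
 assumes F: "integrable W F" and ftF: "integrable W (ft F)"
 shows "represents_translation R k y F (dunkl_translation R k y F)"
 unfolding represents_translation_def
proof (intro allI impI)
 let ?A = "\<lambda>g. LINT p|W. e \<i> p y * (ft F p * ft g (- p))"
 fix g :: "real^'n => complex" assume g: "schwartz g"
 define q where "q = (inverse (cor c))\<^sup>2"
 have gi: "integrable W g" "integrable W (ft g)" using schwartz_integrable schwartz_ft_integrable g by auto
 have m: "ft F \<in> borelm" "ft g \<in> borelm" using F gi by (auto intro: ft_measurable)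
 have "(LINT x|W. dunkl_translation R k y F x * g x) = q * (LINT x|W. (LINT p|W. e \<i> p y * (e \<i> p x * ft F p)) * g x)"
  unfolding dunkl_translation_eq q_def[symmetric] by (simp add: mult.assoc)
 also have "\<dots> = q * (?A g)"
  unfolding translation_pairing[OF gi(1) ftF] ..
 also have "(?A g) = (LINT p|W. e \<i> (- p) y * (ft F (- p) * ft g (- (- p))))"
 proof (rule integral_W_minus[symmetric])
  have [measurable]: "(\<lambda>p. ft g (- p)) \<in> borelm" by (rule measurable_compose[OF _ m(2)]) auto
  show "(\<lambda>p. e \<i> p y * (ft F p * ft g (- p))) \<in> borelm" using m(1) by measurable
 qed
 also have "\<dots> = (LINT p|W. e \<i> p (- y) * (ft g p * ft F (- p)))"
  by (simp add: e_minus e_minus_right mult.commute[of "ft F _"])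
 also have "\<dots> = (LINT x|W. (LINT p|W. e \<i> p (- y) * (e \<i> p x * ft g p)) * F x)"
  by (rule translation_pairing[OF F gi(2), symmetric])
 also have "q * \<dots> = (LINT x|W. F x * dunkl_translation R k (- y) g x)"
  unfolding dunkl_translation_eq q_def[symmetric] by (simp add: mult_ac)
 finally show "(LINT x|W. dunkl_translation R k y F x * g x) = (LINT x|W. F x * dunkl_translation R k (- y) g x)" .
qed

lemma bes_measurable: "(\<lambda>(x, z). bes s y (- z) x) \<in> borel_measurable (W \<Otimes>\<^sub>M W)"
proof -
 interpret sigma_finite_measure W by (rule sigma_finite_W)
 show ?thesis unfolding bes_def by measurable
qed

context
 fixes s :: nat and F :: "real^'n => complex"
 assumes s: "real s >= N" and F: "cont_space.smooth (2 * s) F" "integrable W F" "integrable W ((idl ^^ s) F)"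
begin

text \<open>Inserting the transform of \<open>(idl ^^ s) F\<close> and exchanging integrals leaves a
  Bessel translate. \<open>bes\<close> carries \<open>-\<i>\<close> on its first vector and
  \<open>\<i>\<close> on its second, hence the reversed signs of \<open>y\<close> and
  \<open>z\<close>.\<close>

lemma translation_bes:
 "dunkl_translation R k y F x = (inverse (cor c))\<^sup>2 * (LINT z|W. (idl ^^ s) F z * bes (real s) (- y) (- z) x)"
proof -
 let ?A = "\<lambda>q w. e \<i> q x * w q"
 let ?B = "\<lambda>G z q. G z * e (-\<i>) q z"
 interpret W: sigma_finite_measure W by (rule sigma_finite_W)
 interpret P: pair_sigma_finite W W ..
 define G where "G = (idl ^^ s) F"
 define w where "w q = cor ((1 + (norm q)\<^sup>2) powr - real s)" for q :: "real^'n"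
 have wi: "integrable W w" using integrable_decay[OF s] unfolding w_def complex_of_real_integrable_eq .
 have Gi: "integrable W G" using F by (simp add: G_def)
 have [measurable]: "G \<in> borel_measurable W" "w \<in> borel_measurable W" using Gi wi by auto
 have int: "integrable (W \<Otimes>\<^sub>M W) (\<lambda>(q, z). e \<i> q y * (?A q w) * (?B G z q))"
 proof (rule Bochner_Integration.integrable_bound[OF product_integrable[OF wi Gi]])
  show "(\<lambda>(q, z). e \<i> q y * (?A q w) * (?B G z q)) \<in> borel_measurable (W \<Otimes>\<^sub>M W)" by measurable
  have "norm (e \<i> q y * (?A q w) * (?B G z q)) <= norm (w q) * norm (G z)" for q z
   unfolding norm_mult[of _ "G z * _"] using norm_ee_le by (intro mult_mono) (auto simp: norm_mult mult_left_le norm_e_i)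
  thus "AE p in W \<Otimes>\<^sub>M W. norm (case p of (q, z) => e \<i> q y * (?A q w) * (?B G z q)) <= norm (case p of (x, y) => norm (w x) * norm (G y))"
   unfolding split_beta by (intro AE_I2) simp
 qed
 have "(LINT q|W. e \<i> q y * (e \<i> q x * ft F q)) = (LINT q|W. LINT z|W. e \<i> q y * (?A q w) * (?B G z q))"
  unfolding ft_idl_pow[OF F] by (simp add: ft_def w_def G_def mult.assoc)
 also have "\<dots> = (LINT z|W. LINT q|W. e \<i> q y * (?A q w) * (?B G z q))"
  by (rule P.Fubini_integral[OF int, symmetric])
 also have "\<dots> = (LINT z|W. G z * bes (real s) (- y) (- z) x)"
 proof (rule Bochner_Integration.integral_cong[OF refl])
  fix z
  have "(\<lambda>q. e \<i> q y * (?A q w) * (?B G z q)) = (\<lambda>q. G z * (e \<i> x q * (e (-\<i>) (- y) q * (e \<i> (- z) q * w q))))"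
   by (simp add: fun_eq_iff e_minus e_symmetric[of _ x] e_symmetric[of _ y] e_symmetric[of _ z] mult_ac)
  thus "(LINT q|W. e \<i> q y * (?A q w) * (?B G z q)) = G z * bes (real s) (- y) (- z) x"
   unfolding bes_def w_def by (simp only: Bochner_Integration.integral_mult_right_zero)
 qed
 finally show ?thesis unfolding dunkl_translation_eq G_def by simp
qed

text \<open>In \<open>bes\<close> the growing parameter is the integration variable
  \<open>z\<close>, not \<open>y\<close>: the weight therefore falls on \<open>(idl ^^ s) F\<close>,
  and the bound is uniform in \<open>y\<close>.\<close>

lemma translation_mass:
 assumes C: "!!y z. (nnint W (\<lambda>x. norm (bes (real s) y z x))) <= ennreal (C * (1 + norm z) powr (N / 2))" "C > 0"
  and \<epsilon>: "\<epsilon> > 0" and B: "integrable W (\<lambda>z. norm ((idl ^^ s) F z) * (1 + norm z) powr (N / 2 + \<epsilon>))"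
 shows "(nnint W (\<lambda>x. norm (dunkl_translation R k y F x))) <= ennreal (C / c\<^sup>2 * (LINT z|W. norm ((idl ^^ s) F z) * (1 + norm z) powr (N / 2 + \<epsilon>)))"
proof -
 let ?A = "\<lambda>G z x. G z * bes (real s) (- y) (- z) x"
 let ?B = "1 / c\<^sup>2"
 let ?C = "\<lambda>G x. \<lambda>z. norm (?A G z x)"
 let ?D = "\<lambda>x. dunkl_translation R k y F x"
 let ?E = "N / 2 + \<epsilon>"
 interpret W: sigma_finite_measure W by (rule sigma_finite_W)
 interpret P: pair_sigma_finite W W ..
 define G where "G = (idl ^^ s) F"
 have [measurable]: "G \<in> borel_measurable W" using F by (simp add: G_def)
 note bes_measurable[of "real s" "- y", measurable]
 define v where "v z = norm (G z) * (1 + norm z) powr ?E" for z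
 have v: "integrable W v" using B by (simp add: v_def[abs_def] G_def)
 have c2: "c\<^sup>2 > 0" using c_pos by simp
 have Gb: "(\<lambda>(x, z). ennreal (norm (?A G z x))) \<in> borel_measurable (W \<Otimes>\<^sub>M W)" by measurable
 have "(nnint W (\<lambda>x. norm (?D x))) <= (\<integral>\<^sup>+x. ennreal ?B * (nnint W (?C G x)) \<partial>W)"
 proof (rule nn_integral_mono)
  fix x
  have "norm (?D x) = 1 / c\<^sup>2 * norm (LINT z|W. G z * bes (real s) (- y) (- z) x)"
   unfolding translation_bes G_def using c_pos by (simp add: norm_mult norm_inverse norm_power power_inverse divide_inverse)
  hence "ennreal (norm (?D x)) = ennreal ?B * ennreal (norm (LINT z|W. G z * bes (real s) (- y) (- z) x))"
   using c2 by (simp only: ennreal_mult norm_ge_zero zero_le_divide_1_iff less_imp_le)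
  also have "\<dots> <= ennreal ?B * (nnint W (?C G x))"
   by (intro mult_left_mono norm_integral_le_nn_integral) simp
  finally show "ennreal (norm (?D x)) <= ennreal ?B * (nnint W (?C G x))" .
 qed
 also have "\<dots> = ennreal ?B * (\<integral>\<^sup>+x. nnint W (?C G x) \<partial>W)"
  by (rule nn_integral_cmult) (use Gb in measurable)
 also have "(\<integral>\<^sup>+x. nnint W (?C G x) \<partial>W) = (\<integral>\<^sup>+z. nnint W (\<lambda>x. norm (?A G z x)) \<partial>W)"
  using P.Fubini[OF Gb] by simp
 also have "\<dots> <= (\<integral>\<^sup>+z. ennreal C * ennreal (v z) \<partial>W)"
 proof (rule nn_integral_mono)
  fix z
  have m: "(\<lambda>x. ennreal (norm (bes (real s) (- y) (- z) x))) \<in> borel_measurable W"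
   using measurable_compose[OF measurable_Pair2'[of z W W] bes_measurable[of "real s" "- y"]] by simp
  have "(nnint W (\<lambda>x. norm (?A G z x))) = ennreal (norm (G z)) * (nnint W (\<lambda>x. norm (bes (real s) (- y) (- z) x)))"
   by (simp add: norm_mult ennreal_mult nn_integral_cmult[OF m])
  also have "\<dots> <= ennreal (norm (G z)) * ennreal (C * (1 + norm (- z)) powr (N / 2))" by (intro mult_left_mono C) simp
  also have "\<dots> = ennreal (norm (G z) * (C * (1 + norm z) powr (N / 2)))" using C(2) by (simp add: ennreal_mult)
  also have "\<dots> <= ennreal (C * v z)"
  proof (rule ennreal_leI)
   have "(1 + norm z) powr (N / 2) <= (1 + norm z) powr ?E" using \<epsilon> by (intro powr_mono) auto
   hence "(norm (G z) * C) * (1 + norm z) powr (N / 2) <= (norm (G z) * C) * (1 + norm z) powr ?E"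
    using C(2) by (intro mult_left_mono) auto
   thus "norm (G z) * (C * (1 + norm z) powr (N / 2)) <= C * v z" by (simp add: v_def mult_ac)
  qed
  also have "\<dots> = ennreal C * ennreal (v z)" using C(2) by (intro ennreal_mult) (auto simp: v_def)
  finally show "(nnint W (\<lambda>x. norm (?A G z x))) <= ennreal C * ennreal (v z)" .
 qed
 also have "\<dots> = ennreal C * ennreal (LINT z|W. v z)"
 proof -
  have "(nnint W (\<lambda>z. v z)) = ennreal (LINT z|W. v z)"
   by (rule nn_integral_eq_integral[OF v]) (simp add: v_def)
  thus ?thesis using v by (subst nn_integral_cmult) auto
 qed
 also have "ennreal ?B * (ennreal C * ennreal (LINT z|W. v z)) = ennreal (C / c\<^sup>2 * (LINT z|W. v z))"
 proof -
  have "0 <= (LINT z|W. v z)" by (rule Bochner_Integration.integral_nonneg) (simp add: v_def)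
  thus ?thesis using C(2) c2 by (simp add: ennreal_mult[symmetric])
 qed
 finally show ?thesis by (simp add: v_def G_def mult_left_mono)
qed

lemma translation_measurable: "(\<lambda>(x, y). dunkl_translation R k x F (- y)) \<in> borel_measurable (W \<Otimes>\<^sub>M W)"
proof -
 interpret sigma_finite_measure W by (rule sigma_finite_W)
 have [measurable]: "ft F \<in> borelm" using F by (intro ft_measurable) auto
 show ?thesis unfolding dunkl_translation_eq by measurable
qed

end

end

text \<open>The transform of \<open>F\<close> is absolutely integrable, so the pointwise translation
  exists everywhere and is shown to be the distributional one. Recording these convergence facts
  ensures that the norm bounds concern genuine functions and not default values of divergent
  integrals.\<close>

theorem corollary4p17:
  fixes R :: "(real^'n) set" and k :: "real^'n \<Rightarrow> real" and s :: nat and \<epsilon> :: real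
  assumes "normalized_reduced_root_system R"
    and "multiplicity_function R k"
    and "real s > homogeneous_dim R k" and "s > 0"
    and "\<epsilon> > 0"
  shows "\<exists>C>0. \<forall>F :: real^'n \<Rightarrow> complex.
    C_class (2 * s) F \<longrightarrow>
    in_Lp (dunkl_measure R k) 1 F \<longrightarrow>
    in_Lp (dunkl_measure R k) 1 (weighted_smoothness R k s \<epsilon> F) \<longrightarrow>
    (let B\<^sub>1 = Lp_norm (dunkl_measure R k) 1 (weighted_smoothness R k s \<epsilon> F) in
      (\<forall>y. (\<forall>x. integrable (dunkl_measure R k) (translation_integrand R k y F x)) \<and>
           represents_translation R k y F (dunkl_translation R k y F) \<and>
           in_Lp (dunkl_measure R k) 1 (dunkl_translation R k y F) \<and>
           Lp_norm (dunkl_measure R k) 1 (dunkl_translation R k y F) \<le> C * B\<^sub>1) \<and>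
      (\<forall>p\<ge>1. \<forall>g :: real^'n \<Rightarrow> complex. in_Lp (dunkl_measure R k) p g \<longrightarrow>
           (AE x in dunkl_measure R k.
              integrable (dunkl_measure R k) (\<lambda>y. g y * translation_kernel R k F x y)) \<and>
           in_Lp (dunkl_measure R k) p (dunkl_convolution R k g F) \<and>
           Lp_norm (dunkl_measure R k) p (dunkl_convolution R k g F)
             \<le> C * B\<^sub>1 * Lp_norm (dunkl_measure R k) p g))"
proof -
 interpret dunkl R k using assms(1,2) by unfold_locales
 have s: "real s >= N" using assms(3) by simp
 obtain C where C: "C > 0" "!!y z. (nnint W (\<lambda>x. norm (bes (real s) y z x))) <= ennreal (C * (1 + norm z) powr (N / 2))"
  using bes_mass[OF s] by metis
 \<comment> \<open>One factor \<open>1 / c\<close> comes from the transform, the other from the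
   integral defining the translation.\<close>
 define D where "D = C / c\<^sup>2"
 have D: "D > 0" using C c_pos by (simp add: D_def)
 show ?thesis
 proof (rule exI[of _ D], intro conjI D allI impI)
  fix F :: "real^'n => complex"
  assume F0: "C_class (2 * s) F" and F1: "in_Lp W 1 F" and F2: "in_Lp W 1 (weighted_smoothness R k s \<epsilon> F)"
  define G where "G = (idl ^^ s) F"
  define B where "B = Lp_norm W 1 (weighted_smoothness R k s \<epsilon> F)"
  have F: "cont_space.smooth (2 * s) F" using F0 by (simp only: C_class_smooth)
  have Fi: "integrable W F" using F1 unfolding in_Lp_def by (auto intro: integrable_norm_cancel)
  have nw: "norm (weighted_smoothness R k s \<epsilon> F z) = norm (G z) * (1 + norm z) powr (N / 2 + \<epsilon>)" for z
   by (simp add: weighted_smoothness_def id_minus_laplacian_pow_eq G_def norm_mult)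
  have Bi: "integrable W (\<lambda>z. norm (G z) * (1 + norm z) powr (N / 2 + \<epsilon>))"
   using F2 unfolding in_Lp_def nw[symmetric] by simp
  have B: "B = (LINT z|W. norm (G z) * (1 + norm z) powr (N / 2 + \<epsilon>))"
  proof -
   have "0 <= (LINT z|W. norm (weighted_smoothness R k s \<epsilon> F z))" by (rule Bochner_Integration.integral_nonneg) simp
   thus ?thesis unfolding B_def Lp_norm_def nw[symmetric] by simp
  qed
  have B0: "B >= 0" unfolding B by (rule Bochner_Integration.integral_nonneg) simp
  have "cts G"
   unfolding G_def by (rule cont_space.smooth_P[of 0, OF smooth_idl_pow[OF cont_space.function_space_axioms]]) (use F in simp)
  hence Gm: "G \<in> borel_measurable W" by (rule continuous_measurable_W)
  have Gi: "integrable W G"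
  proof (rule Bochner_Integration.integrable_bound[OF Bi Gm], intro AE_I2)
   fix z :: "real^'n"
   have "1 <= (1 + norm z) powr (N / 2 + \<epsilon>)" using N_pos assms(5) by (intro ge_one_powr_ge_zero) auto
   thus "norm (G z) <= norm (norm (G z) * (1 + norm z) powr (N / 2 + \<epsilon>))"
    using mult_left_mono[of 1 "(1 + norm z) powr (N / 2 + \<epsilon>)" "norm (G z)"] by simp
  qed
  note hyps = s F Fi Gi[unfolded G_def]
  have ftF: "integrable W (ft F)" by (rule ft_integrable[OF F Fi Gi[unfolded G_def] s])
  have mass: "(nnint W (\<lambda>x. norm (dunkl_translation R k y F x))) <= ennreal (D * B)" for y
   unfolding B D_def G_def by (rule translation_mass[OF hyps C(2,1) assms(5) Bi[unfolded G_def]])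
  have int: "integrable W (translation_integrand R k y F x)" for x y
   unfolding translation_integrand_eq[abs_def] by (intro integrable_mult_right ee_integrable ftF)
  have tm: "dunkl_translation R k y F \<in> borel_measurable W" for y
  proof -
   \<comment> \<open>Joint measurability is available for the kernel with a negated argument;
     composing with negation undoes the sign.\<close>
   have "(\<lambda>x. dunkl_translation R k y F (- (- x))) \<in> borel_measurable W"
   proof (rule measurable_compose[where g="\<lambda>x. dunkl_translation R k y F (- x)" and N=W])
    show "(\<lambda>x. dunkl_translation R k y F (- x)) \<in> borel_measurable W"
     using measurable_compose[OF measurable_Pair1'[of y W W] translation_measurable[OF hyps]] by simp
    show "uminus \<in> measurable W W" by (simp add: measurable_cong_sets[OF sets_W sets_W])
   qed
   thus ?thesis by simp
  qed
  have ti: "integrable W (dunkl_translation R k y F)" for y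
   using mass[of y] by (intro integrableI_bounded tm) (simp add: le_less_trans)
  have part1: "Lp_norm W 1 (dunkl_translation R k y F) <= D * B" for y
  proof -
   have "ennreal (LINT x|W. norm (dunkl_translation R k y F x)) <= ennreal (D * B)"
    using mass[of y] nn_integral_eq_integral[OF integrable_norm[OF ti[of y]]] by simp
   hence "(LINT x|W. norm (dunkl_translation R k y F x)) <= D * B" using D B0 by simp
   moreover have "0 <= (LINT x|W. norm (dunkl_translation R k y F x))" by (rule Bochner_Integration.integral_nonneg) simp
   ultimately show ?thesis by (simp add: Lp_norm_def)
  qed
  have K1: "(nnint W (\<lambda>y. norm (translation_kernel R k F x y))) <= ennreal (D * B)" for x
  proof -
   have "(\<lambda>y. ennreal (norm (dunkl_translation R k x F y))) \<in> borelm"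
    using tm[of x] measurable_cong_sets[OF sets_W refl] by auto
   from nn_integral_W_minus[OF this] show ?thesis using mass[of x] by (simp add: translation_kernel_def)
  qed
  \<comment> \<open>Symmetry exchanges the translation parameter with the argument, so column
    integrals are again norms of translates.\<close>
  have K2: "(nnint W (\<lambda>x. norm (translation_kernel R k F x y))) <= ennreal (D * B)" for y
   unfolding translation_kernel_def dunkl_translation_symmetric[of _ F "- y"] by (rule mass)
  have Km: "(\<lambda>(x, y). translation_kernel R k F x y) \<in> borel_measurable (W \<Otimes>\<^sub>M W)"
   unfolding translation_kernel_def by (rule translation_measurable[OF hyps])
  have conv: "dunkl_convolution R k g F = (\<lambda>x. LINT y|W. g y * translation_kernel R k F x y)" for g
   by (simp add: dunkl_convolution_def fun_eq_iff)
  have part2: "(AE x in W. integrable W (\<lambda>y. g y * translation_kernel R k F x y)) \<and>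
   in_Lp W p (dunkl_convolution R k g F) \<and> Lp_norm W p (dunkl_convolution R k g F) <= D * B * Lp_norm W p g"
   if p: "p >= 1" and g: "in_Lp W p g" for p g
  proof -
   \<comment> \<open>The Schur test asks for a positive bound while \<open>B\<close> may be 0; a
     slack is added here and removed at the end.\<close>
   have A: "D * B + \<delta> > 0" "ennreal (D * B) <= ennreal (D * B + \<delta>)" if "\<delta> > 0" for \<delta>
    using that D B0 by (auto intro: ennreal_leI add_nonneg_pos)
   note S = schur_test[OF sigma_finite_W Km A(1) order_trans[OF K1 A(2)] order_trans[OF K2 A(2)] p g, folded conv]
   have bound: "Lp_norm W p (dunkl_convolution R k g F) <= D * B * Lp_norm W p g"
   proof (rule field_le_epsilon)
    fix \<delta> :: real assume \<delta>: "\<delta> > 0"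
    define L where "L = Lp_norm W p g"
    have L: "L >= 0" by (simp add: L_def Lp_norm_def)
    \<comment> \<open>Scaled so that its product with \<open>L\<close> is at most
      \<open>\<delta>\<close>, also for \<open>L = 0\<close>.\<close>
    have "\<delta> / (L + 1) > 0" using \<delta> L by simp
    from S(3)[OF this this this] have "Lp_norm W p (dunkl_convolution R k g F) <= (D * B + \<delta> / (L + 1)) * L"
     by (simp only: L_def)
    also have "\<dots> <= D * B * L + \<delta>"
    proof -
     have "\<delta> / (L + 1) * L <= \<delta>" using L \<delta> by (simp add: field_simps)
     thus ?thesis by (simp add: distrib_right)
    qed
    finally show "Lp_norm W p (dunkl_convolution R k g F) <= D * B * Lp_norm W p g + \<delta>" by (simp only: L_def)
   qed
   show ?thesis using S(1,2)[of 1] bound by simp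
  qed
  show "let B\<^sub>1 = Lp_norm W 1 (weighted_smoothness R k s \<epsilon> F) in
   (\<forall>y. (\<forall>x. integrable W (translation_integrand R k y F x)) \<and> represents_translation R k y F (dunkl_translation R k y F) \<and>
     in_Lp W 1 (dunkl_translation R k y F) \<and> Lp_norm W 1 (dunkl_translation R k y F) <= D * B\<^sub>1) \<and>
   (\<forall>p\<ge>1. \<forall>g. in_Lp W p g \<longrightarrow> (AE x in W. integrable W (\<lambda>y. g y * translation_kernel R k F x y)) \<and>
     in_Lp W p (dunkl_convolution R k g F) \<and> Lp_norm W p (dunkl_convolution R k g F) <= D * B\<^sub>1 * Lp_norm W p g)"
   unfolding Let_def B_def[symmetric]
   using int represents_translation_of_transform[OF Fi ftF] part1 part2 tm ti by (auto simp: in_Lp_def)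
 qed
qed

end
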